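(* Let $N\ge1$, $p\in(1,\infty)$ and let $\Omega\subseteq\mathbb{R}^N$ be a bounded open set with Lipschitz boundary. Let $q:[0,\frac12]\to\mathbb{R}$ be $C^1$ with $\lim_{s\to0^+}q(s)=p$, $\mu:=q'(0)\in(-\infty,0)$, and $q(s)\in(1,p)$ for $s\in(0,\frac12]$. Let $p_s^*=\frac{Np}{N-sp}$ and let $a:[0,\frac12]\times\Omega\to\mathbb{R}$ satisfy: (a$_0$) for a.e. $x\in\Omega$, $a(\cdot,x)\in C^1([0,\frac12])$ and $\lim_{s\to0^+}a(s,x)=1$; (a$_1$) for some $\delta\in(0,1)$, for all $s\in(0,\frac12]$, $a(s,\cdot)\in L^{\nu}(\Omega)$, where $\nu=\nu(s)>\max\left\{\frac{p_s^*}{p_s^*-q(s)},\,1+\frac{(N-sp)p}{s(p^2-N\mu-\delta p^2)}\right\}$; (a$_2$) $a'(s,\cdot):=\frac{\partial a(s,\cdot)}{\partial s}\in L^\infty(\Omega)$ for all $s\in[0,\frac12]$ and $\sup_{s\in[0,1/2]}\|a'(s,\cdot)\|_{L^\infty(\Omega)}<+\infty$; (a$_3$) there exist constants $c_1,c_2$ (independent of $s$) such that $c_1\le\|a(s,\cdot)\|_{L^{\nu}(\Omega)}^{\frac1{p-q(s)}}\le c_2$ for all $s\in(0,\frac12]$. Let $(u_s)$, $u_s\in W_0^{s,p}(\Omega)$, be a sequence of nontrivial positive least energy solutions of $$(-\Delta_p)^su=a(s,x)|u|^{q(s)-2}u\ \text{ in }\Omega,\qquad u=0\ \text{ in }\mathbb{R}^N\setminus\Omega.$$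 Then there exists a unique, nontrivial least energy solution $u_1\in X_{L_{\Delta_p}}(\Omega)\cap L^\infty(\Omega)$ of $$L_{\Delta_p}u=a'(0,x)|u|^{p-2}u+\mu|u|^{p-2}u\ln|u|\ \text{ in }\Omega,\qquad u=0\ \text{ in }\mathbb{R}^N\setminus\Omega,$$ such that, up to a subsequence, $u_s\to u_1$ in $L^p(\Omega)$ as $s\to0^+$.
   Context: Convention: $sp<N$ whenever $p_s^*$ is used. Write $h(t):=|t|^{p-2}t$; $|t|^{p}\ln|t|$ and $h(t)\ln|t|$ are $0$ at $t=0$; functions on $\Omega$ are extended by $0$ to $\mathbb{R}^N$. Fractional problem. $C_{N,s,p}:=\frac{sp\,2^{2s-1}\Gamma(\frac{N+sp}2)}{\pi^{N/2}\Gamma(1-s)}$, $[u]_{s,p,\mathbb{R}^N}^p:=\frac{C_{N,s,p}}2\iint_{\mathbb{R}^N\times\mathbb{R}^N}\frac{|u(x)-u(y)|^p}{|x-y|^{N+sp}}dxdy$, $W_0^{s,p}(\Omega):=\{u\in L^p(\mathbb{R}^N):[u]_{s,p,\mathbb{R}^N}<\infty,\ u=0\text{ a.e. in }\mathbb{R}^N\setminus\Omega\}$. A weak solution is $u\in W_0^{s,p}(\Omega)$ with $\frac{C_{N,s,p}}2\iint_{\mathbb{R}^N\times\mathbb{R}^N}\frac{h(u(x)-u(y))(v(x)-v(y))}{|x-y|^{N+sp}}dxdy=\int_\Omega a(s,x)|u|^{q(s)-2}uv\,dx$ for all $v\in W_0^{s,p}(\Omega)$. With $J_{s,p}(u):=\frac1p[u]_{s,p,\mathbb{R}^N}^p-\frac1{q(s)}\int_\Omega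 a(s,x)|u|^{q(s)}dx$ and $\mathcal{N}_{s,p}:=\{u\in W_0^{s,p}(\Omega)\setminus\{0\}:[u]_{s,p,\mathbb{R}^N}^p=\int_\Omega a(s,x)|u|^{q(s)}dx\}$, a weak solution $u$ is of least energy if $J_{s,p}(u)=\inf_{\mathcal{N}_{s,p}}J_{s,p}$. Limit problem. $C_{N,p}:=\frac{p\,\Gamma(N/2)}{2\pi^{N/2}}$, $[u]_{X_{L_{\Delta_p}}(\Omega)}^p:=C_{N,p}\iint_{|x-y|\le 1}\frac{|u(x)-u(y)|^p}{|x-y|^N}dxdy$, $X_{L_{\Delta_p}}(\Omega):=\{u\in L^p(\Omega): [u]_{X_{L_{\Delta_p}}(\Omega)}<\infty,\ u=0\text{ in }\mathbb{R}^N\setminus\Omega\}$. With $\Upsilon(z_1,z_2,t_1,t_2):=h(z_1-z_2)(t_1-t_2)-h(z_1)t_1-h(z_2)t_2$, $$\mathcal{E}_{L_{\Delta_p}}(u,v):=\frac{C_{N,p}}{2}\iint_{|x-y|\le1}\frac{h(u(x)-u(y))(v(x)-v(y))}{|x-y|^N}dxdy+\frac{C_{N,p}}{2}\iint_{|x-y|\ge1}\frac{\Upsilon(u(x),u(y),v(x),v(y))}{|x-y|^N}dxdy+\rho_N\int_{\mathbb{R}^N}h(u)v\,dx,$$ $\rho_N:=2\ln2-\gamma_E+\frac p2\psi_0(\frac N2)$, $\gamma_E=-\Gamma'(1)$, $\psi_0=\Gamma'/\Gamma$. A weak solution is $u\in X_{L_{\Delta_p}}(\Omega)$ with $\mathcal{E}_{L_{\Delta_p}}(u,v)=\int_\Omega(a'(0,x)+\mu\ln|u|)h(u)v\,dx$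 for all $v\in X_{L_{\Delta_p}}(\Omega)$. With $J_{L_{\Delta_p}}(u):=\frac1p\mathcal{E}_{L_{\Delta_p}}(u,u)-\frac1p\int_\Omega a'(0,x)|u|^pdx-\frac\mu{p^2}\int_\Omega|u|^p(\ln|u|^p-1)dx$ and $\mathcal{N}_{L_{\Delta_p}}:=\{u\in X_{L_{\Delta_p}}(\Omega)\setminus\{0\}:\mathcal{E}_{L_{\Delta_p}}(u,u)=\int_\Omega(a'(0,x)+\mu\ln|u|)|u|^pdx\}$, a weak solution $u$ is of least energy if $J_{L_{\Delta_p}}(u)=\inf_{\mathcal{N}_{L_{\Delta_p}}}J_{L_{\Delta_p}}$. *)

theory Defs
  imports "HOL-Probability.Essential_Supremum"
begin

text \<open>
  The space \<open>\<real>\<^sup>N\<close> is \<^typ>\<open>real ^ 'n\<close> with \<open>N = CARD('n)\<close>.  Functions on \<open>\<Omega>\<close> extended by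
  zero are functions on the whole space that vanish almost everywhere off \<open>\<Omega>\<close>; elements of
  function spaces are representatives, to be compared almost everywhere.
\<close>

section \<open>General notions\<close>

definition C1_on :: "real set \<Rightarrow> (real \<Rightarrow> real) \<Rightarrow> bool" where
  "C1_on S f \<longleftrightarrow>
     (\<forall>t\<in>S. f differentiable (at t within S)) \<and>
     continuous_on S (\<lambda>t. vector_derivative f (at t within S))"

text \<open>
  Near each boundary point, after a rotation taking \<open>e\<close> to the last coordinate vector, the set is
  the region above the graph of a Lipschitz function \<open>g\<close> of the coordinates orthogonal to \<open>e\<close>.
\<close>

definition lipschitz_boundary :: "'a::euclidean_space set \<Rightarrow> bool" where
  "lipschitz_boundary \<Omega> \<longleftrightarrow>
     (\<forall>z\<in>frontier \<Omega>. \<exists>r>0. \<exists>e g L. norm e = 1 \<and> L-lipschitz_on {y. y \<bullet> e = 0} g \<and>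
        \<Omega> \<inter> ball z r = {x \<in> ball z r. g (x - (x \<bullet> e) *\<^sub>R e) < x \<bullet> e})"

definition Lp :: "'a measure \<Rightarrow> real \<Rightarrow> ('a \<Rightarrow> real) set" where
  "Lp M p = {f \<in> borel_measurable M. integrable M (\<lambda>x. \<bar>f x\<bar> powr p)}"

definition Lp_norm :: "'a measure \<Rightarrow> real \<Rightarrow> ('a \<Rightarrow> real) \<Rightarrow> real" where
  "Lp_norm M p f = (LINT x|M. \<bar>f x\<bar> powr p) powr (1 / p)"

definition Linf_norm :: "'a measure \<Rightarrow> ('a \<Rightarrow> real) \<Rightarrow> ereal" where
  "Linf_norm M f = esssup M (\<lambda>x. ereal \<bar>f x\<bar>)"

definition Linf :: "'a measure \<Rightarrow> ('a \<Rightarrow> real) set" where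
  "Linf M = {f \<in> borel_measurable M. Linf_norm M f < \<infinity>}"

definition nontrivial :: "(real ^ 'n \<Rightarrow> real) \<Rightarrow> bool" where
  "nontrivial u \<longleftrightarrow> \<not> (AE x in lebesgue. u x = 0)"

definition h :: "real \<Rightarrow> real \<Rightarrow> real" where
  "h p t = \<bar>t\<bar> powr (p - 2) * t"

section \<open>The fractional problem\<close>

definition frac_const :: "'n::finite itself \<Rightarrow> real \<Rightarrow> real \<Rightarrow> real" where
  "frac_const _ s p =
     s * p * 2 powr (2 * s - 1) * Gamma ((real CARD('n) + s * p) / 2) /
     (pi powr (real CARD('n) / 2) * Gamma (1 - s))"

text \<open>The \<open>p\<close>-th power of the seminorm; it is \<open>\<infinity>\<close> when the double integral diverges.\<close>

definition frac_seminorm_pow :: "real \<Rightarrow> real \<Rightarrow> (real ^ 'n \<Rightarrow> real) \<Rightarrow> ennreal" where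
  "frac_seminorm_pow s p u =
     ennreal (frac_const TYPE('n) s p / 2) *
     (\<integral>\<^sup>+ (x, y). ennreal (\<bar>u x - u y\<bar> powr p / norm (x - y) powr (real CARD('n) + s * p))
        \<partial>(lebesgue \<Otimes>\<^sub>M lebesgue))"

definition W0 :: "real \<Rightarrow> real \<Rightarrow> (real ^ 'n) set \<Rightarrow> (real ^ 'n \<Rightarrow> real) set" where
  "W0 s p \<Omega> = {u \<in> Lp lebesgue p.
     frac_seminorm_pow s p u < \<infinity> \<and> (AE x in lebesgue. x \<notin> \<Omega> \<longrightarrow> u x = 0)}"

definition frac_form :: "real \<Rightarrow> real \<Rightarrow> (real ^ 'n \<Rightarrow> real) \<Rightarrow> (real ^ 'n \<Rightarrow> real) \<Rightarrow> real" where
  "frac_form s p u v =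
     frac_const TYPE('n) s p / 2 *
     (\<integral> (x, y). h p (u x - u y) * (v x - v y) / norm (x - y) powr (real CARD('n) + s * p)
        \<partial>(lebesgue \<Otimes>\<^sub>M lebesgue))"

text \<open>
  In the following definitions \<open>r\<close> and \<open>b\<close> stand for the exponent \<open>q(s)\<close> and the
  weight \<open>a(s, \<cdot>)\<close> at the order \<open>s\<close> under consideration.
\<close>

definition frac_weak_solution ::
  "real \<Rightarrow> real \<Rightarrow> real \<Rightarrow> (real ^ 'n \<Rightarrow> real) \<Rightarrow> (real ^ 'n) set \<Rightarrow> (real ^ 'n \<Rightarrow> real) \<Rightarrow> bool" where
  "frac_weak_solution s p r b \<Omega> u \<longleftrightarrow>
     u \<in> W0 s p \<Omega> \<and>
     (\<forall>v\<in>W0 s p \<Omega>. frac_form s p u v = (LINT x|lebesgue_on \<Omega>. b x * h r (u x) * v x))"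

definition frac_energy ::
  "real \<Rightarrow> real \<Rightarrow> real \<Rightarrow> (real ^ 'n \<Rightarrow> real) \<Rightarrow> (real ^ 'n) set \<Rightarrow> (real ^ 'n \<Rightarrow> real) \<Rightarrow> real" where
  "frac_energy s p r b \<Omega> u =
     1 / p * enn2real (frac_seminorm_pow s p u) -
     1 / r * (LINT x|lebesgue_on \<Omega>. b x * \<bar>u x\<bar> powr r)"

definition frac_Nehari ::
  "real \<Rightarrow> real \<Rightarrow> real \<Rightarrow> (real ^ 'n \<Rightarrow> real) \<Rightarrow> (real ^ 'n) set \<Rightarrow> (real ^ 'n \<Rightarrow> real) set" where
  "frac_Nehari s p r b \<Omega> = {u \<in> W0 s p \<Omega>. nontrivial u \<and>
     enn2real (frac_seminorm_pow s p u) = (LINT x|lebesgue_on \<Omega>. b x * \<bar>u x\<bar> powr r)}"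

text \<open>The infimum is taken in \<^typ>\<open>ereal\<close>, where it exists without any boundedness condition.\<close>

definition frac_least_energy_solution ::
  "real \<Rightarrow> real \<Rightarrow> real \<Rightarrow> (real ^ 'n \<Rightarrow> real) \<Rightarrow> (real ^ 'n) set \<Rightarrow> (real ^ 'n \<Rightarrow> real) \<Rightarrow> bool" where
  "frac_least_energy_solution s p r b \<Omega> u \<longleftrightarrow>
     frac_weak_solution s p r b \<Omega> u \<and>
     ereal (frac_energy s p r b \<Omega> u) =
       (INF w\<in>frac_Nehari s p r b \<Omega>. ereal (frac_energy s p r b \<Omega> w))"

section \<open>The limit problem\<close>

definition log_const :: "'n::finite itself \<Rightarrow> real \<Rightarrow> real" where
  "log_const _ p = p * Gamma (real CARD('n) / 2) / (2 * pi powr (real CARD('n) / 2))"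

definition rho :: "'n::finite itself \<Rightarrow> real \<Rightarrow> real" where
  "rho _ p = 2 * ln 2 - euler_mascheroni + p / 2 * Digamma (real CARD('n) / 2)"

definition log_seminorm_pow :: "real \<Rightarrow> (real ^ 'n \<Rightarrow> real) \<Rightarrow> ennreal" where
  "log_seminorm_pow p u =
     ennreal (log_const TYPE('n) p) *
     (\<integral>\<^sup>+ (x, y). ennreal (indicator {z. norm z \<le> 1} (x - y) *
          (\<bar>u x - u y\<bar> powr p / norm (x - y) ^ CARD('n)))
        \<partial>(lebesgue \<Otimes>\<^sub>M lebesgue))"

definition X_log :: "real \<Rightarrow> (real ^ 'n) set \<Rightarrow> (real ^ 'n \<Rightarrow> real) set" where
  "X_log p \<Omega> = {u \<in> Lp lebesgue p.
     log_seminorm_pow p u < \<infinity> \<and> (AE x in lebesgue. x \<notin> \<Omega> \<longrightarrow> u x = 0)}"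

definition Upsilon :: "real \<Rightarrow> real \<Rightarrow> real \<Rightarrow> real \<Rightarrow> real \<Rightarrow> real" where
  "Upsilon p z1 z2 t1 t2 = h p (z1 - z2) * (t1 - t2) - h p z1 * t1 - h p z2 * t2"

definition log_form :: "real \<Rightarrow> (real ^ 'n \<Rightarrow> real) \<Rightarrow> (real ^ 'n \<Rightarrow> real) \<Rightarrow> real" where
  "log_form p u v =
     log_const TYPE('n) p / 2 *
       (\<integral> (x, y). indicator {z. norm z \<le> 1} (x - y) *
            (h p (u x - u y) * (v x - v y) / norm (x - y) ^ CARD('n))
          \<partial>(lebesgue \<Otimes>\<^sub>M lebesgue)) +
     log_const TYPE('n) p / 2 *
       (\<integral> (x, y). indicator {z. 1 \<le> norm z} (x - y) *
            (Upsilon p (u x) (u y) (v x) (v y) / norm (x - y) ^ CARD('n))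
          \<partial>(lebesgue \<Otimes>\<^sub>M lebesgue)) +
     rho TYPE('n) p * (LINT x|lebesgue. h p (u x) * v x)"

text \<open>Here \<open>b\<close> stands for the weight \<open>a'(0, \<cdot>)\<close>.\<close>

definition log_weak_solution ::
  "real \<Rightarrow> real \<Rightarrow> (real ^ 'n \<Rightarrow> real) \<Rightarrow> (real ^ 'n) set \<Rightarrow> (real ^ 'n \<Rightarrow> real) \<Rightarrow> bool" where
  "log_weak_solution p \<mu> b \<Omega> u \<longleftrightarrow>
     u \<in> X_log p \<Omega> \<and>
     (\<forall>v\<in>X_log p \<Omega>. log_form p u v =
        (LINT x|lebesgue_on \<Omega>. (b x + \<mu> * ln \<bar>u x\<bar>) * h p (u x) * v x))"

definition log_energy ::
  "real \<Rightarrow> real \<Rightarrow> (real ^ 'n \<Rightarrow> real) \<Rightarrow> (real ^ 'n) set \<Rightarrow> (real ^ 'n \<Rightarrow> real) \<Rightarrow> real" where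
  "log_energy p \<mu> b \<Omega> u =
     1 / p * log_form p u u -
     1 / p * (LINT x|lebesgue_on \<Omega>. b x * \<bar>u x\<bar> powr p) -
     \<mu> / p\<^sup>2 * (LINT x|lebesgue_on \<Omega>. \<bar>u x\<bar> powr p * (ln (\<bar>u x\<bar> powr p) - 1))"

definition log_Nehari ::
  "real \<Rightarrow> real \<Rightarrow> (real ^ 'n \<Rightarrow> real) \<Rightarrow> (real ^ 'n) set \<Rightarrow> (real ^ 'n \<Rightarrow> real) set" where
  "log_Nehari p \<mu> b \<Omega> = {u \<in> X_log p \<Omega>. nontrivial u \<and>
     log_form p u u = (LINT x|lebesgue_on \<Omega>. (b x + \<mu> * ln \<bar>u x\<bar>) * \<bar>u x\<bar> powr p)}"

definition log_least_energy_solution ::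
  "real \<Rightarrow> real \<Rightarrow> (real ^ 'n \<Rightarrow> real) \<Rightarrow> (real ^ 'n) set \<Rightarrow> (real ^ 'n \<Rightarrow> real) \<Rightarrow> bool" where
  "log_least_energy_solution p \<mu> b \<Omega> u \<longleftrightarrow>
     log_weak_solution p \<mu> b \<Omega> u \<and>
     ereal (log_energy p \<mu> b \<Omega> u) =
       (INF w\<in>log_Nehari p \<mu> b \<Omega>. ereal (log_energy p \<mu> b \<Omega> w))"

section \<open>Data of the theorem\<close>

definition crit_exp :: "'n::finite itself \<Rightarrow> real \<Rightarrow> real \<Rightarrow> real" where
  "crit_exp _ s p = real CARD('n) * p / (real CARD('n) - s * p)"

text \<open>The derivative in the first variable, one-sided at the endpoints of \<open>[0, 1/2]\<close>.\<close>

definition d_order :: "(real \<Rightarrow> 'a \<Rightarrow> real) \<Rightarrow> real \<Rightarrow> 'a \<Rightarrow> real" where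
  "d_order a s x = vector_derivative (\<lambda>t. a t x) (at s within {0..1/2})"

definition subseq_limit_Lp ::
  "'a measure \<Rightarrow> real \<Rightarrow> (nat \<Rightarrow> 'a \<Rightarrow> real) \<Rightarrow> ('a \<Rightarrow> real) \<Rightarrow> bool" where
  "subseq_limit_Lp M p u w \<longleftrightarrow>
     (\<exists>r. strict_mono r \<and> (\<lambda>k. Lp_norm M p (\<lambda>x. u (r k) x - w x)) \<longlonglongrightarrow> 0)"

end

theory Submission
  imports Defs "HOL-Real_Asymp.Real_Asymp" "HOL-Complex_Analysis.Great_Picard"
begin

text \<open>
  Dividing the energy of order \<open>s\<close> by \<open>s\<close> gives a functional that converges, as \<open>s\<close> tends to \<open>0\<close>, to the
  energy of the limit problem: a \<open>p\<close>-Dirichlet form with kernel of order \<open>N\<close>, a bounded potential, and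
  an entropy term with the positive coefficient \<open>- \<mu> / p\<^sup>2\<close>.  Since \<open>q(s) < p\<close> and \<open>\<mu> < 0\<close>, both problems are
  sublinear: by scaling along rays, a least energy solution of order \<open>s\<close> is a global minimiser, and so
  is a least energy solution of the limit problem.  The entropy bounds the fractional minimisers in \<open>L\<^sup>p\<close>, and
  the infinite mass of the limit kernel at the origin makes them compact there; comparing with Lipschitz functions,
  which are dense in energy because the boundary is Lipschitz, shows that any limit minimises the limit energy.
  For non-negative minimisers \<open>u\<close> and \<open>w\<close>, passing to \<open>((u\<^sup>p + w\<^sup>p) / 2)\<^bsup>1/p\<^esup>\<close> does not increase the average of the
  Dirichlet forms, whereas the entropy is a strictly convex function of \<open>u\<^sup>p\<close>; hence \<open>u = w\<close>.
\<close>

section \<open>Inequalities for powers\<close>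

text \<open>The seminorm of order \<open>s\<close> does not vanish with \<open>s\<close>: for
  Lipschitz functions its \<open>p\<close>-th power tends to the integral of
  \<open>|u| powr p\<close>, so the energy divided by \<open>s\<close> contains terms of size
  \<open>1 / s\<close>. Splitting the kernel isolates them. Pairs at distance above 1 with exactly
  one point in \<Omega> contribute only a potential, whose leading constant
  \<open>frac_kappa\<close> equals 1 at \<open>s = 0\<close>. Subtracting this 1 leaves a difference
  quotient with limit \<open>rho\<close>; the subtracted term joins \<open>|u| powr q / q\<close> in
  \<open>entr\<close>, a difference quotient in the exponent, whose limit is the entropy. What
  remains is \<open>dform\<close>, with near pairs and pairs inside \<Omega>, and bounded
  potentials. The lower bound in the limit is Fatou's lemma. The upper bound is the obstacle: a
  function of finite logarithmic energy need not have finite fractional energy, so it cannot be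
  tested directly. Near the boundary the approximation works because a cutoff of width
  \<open>r\<close> costs only about \<open>r * ln (1 / r)\<close>. The limit equation is odd, so
  least energy solutions are unique only up to sign; positivity of the fractional solutions selects
  the sign.\<close>

lemma powr_add_le:
  fixes a b p :: real
  assumes "0 \<le> a" "0 \<le> b" "0 < p"
  shows "(a + b) powr p \<le> 2 powr p * (a powr p + b powr p)"
proof -
  have "(a + b) powr p \<le> (2 * max a b) powr p"
    using assms by (intro powr_mono2) auto
  also have "\<dots> = 2 powr p * max a b powr p"
    using assms by (simp add: powr_mult)
  also have "\<dots> \<le> 2 powr p * (a powr p + b powr p)"
    by (intro mult_left_mono) (auto simp: max_def)
  finally show ?thesis .
qed

lemma abs_diff_powr_le:
  fixes a b p :: real
  assumes "0 < p"
  shows "\<bar>a - b\<bar> powr p \<le> 2 powr p * (\<bar>a\<bar> powr p + \<bar>b\<bar> powr p)"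
proof -
  have "\<bar>a - b\<bar> powr p \<le> (\<bar>a\<bar> + \<bar>b\<bar>) powr p"
    using assms by (intro powr_mono2) auto
  also have "\<dots> \<le> 2 powr p * (\<bar>a\<bar> powr p + \<bar>b\<bar> powr p)"
    using assms by (intro powr_add_le) auto
  finally show ?thesis .
qed

lemma h_mult_self: "h p t * t = \<bar>t\<bar> powr p"
proof (cases "t = 0")
  case False
  then have "\<bar>t\<bar> powr p = \<bar>t\<bar> powr (p - 2) * \<bar>t\<bar> powr 2"
    by (subst powr_add[symmetric]) simp
  with False show ?thesis by (simp add: h_def power2_eq_square)
qed (simp add: h_def)

lemma abs_h: "\<bar>h p t\<bar> = \<bar>t\<bar> powr (p - 1)"
proof (cases "t = 0")
  case False
  then have "\<bar>t\<bar> powr (p - 1) = \<bar>t\<bar> powr (p - 2) * \<bar>t\<bar> powr 1"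
    by (subst powr_add[symmetric]) simp
  with False show ?thesis by (simp add: h_def abs_mult)
qed (simp add: h_def)

lemma h_zero [simp]: "h p 0 = 0"
  by (simp add: h_def)

text \<open>Young's inequality with a crude constant: replacing both factors by their maximum avoids
  conjugate exponents.\<close>

lemma abs_h_mult_le:
  assumes "1 < p"
  shows "\<bar>h p a * b\<bar> \<le> \<bar>a\<bar> powr p + \<bar>b\<bar> powr p"
proof -
  let ?m = "max \<bar>a\<bar> \<bar>b\<bar>"
  have "\<bar>h p a * b\<bar> = \<bar>a\<bar> powr (p - 1) * \<bar>b\<bar>" by (simp add: abs_mult abs_h)
  also have "\<dots> \<le> ?m powr (p - 1) * ?m"
    using assms by (intro mult_mono powr_mono2) auto
  also have "\<dots> = ?m powr p"
    using powr_mult_base[of ?m "p - 1"] by (simp add: mult.commute)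
  also have "\<dots> \<le> \<bar>a\<bar> powr p + \<bar>b\<bar> powr p" by (auto simp: max_def)
  finally show ?thesis .
qed

lemma h_measurable [measurable]: "h p \<in> borel_measurable borel"
  unfolding h_def[abs_def] by measurable

text \<open>Away from 0 this is the chain rule. At 0 the difference quotient has size
  \<open>|t| powr (p - 1)\<close>, which tends to 0 because \<open>p > 1\<close>.\<close>

lemma DERIV_abs_powr:
  assumes "1 < p"
  shows "((\<lambda>t. \<bar>t\<bar> powr p) has_real_derivative p * h p t) (at t)"
proof (cases "t = 0")
  case True
  have "((\<lambda>t. \<bar>t\<bar> powr p / t) \<longlongrightarrow> 0) (at (0::real))"
  proof (rule Lim_null_comparison)
    show "\<forall>\<^sub>F t in at (0::real). norm (\<bar>t\<bar> powr p / t) \<le> \<bar>t\<bar> powr (p - 1)"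
      using eventually_neq_at_within[of 0]
    proof eventually_elim
      case (elim t)
      then show ?case
        using powr_mult_base[of "\<bar>t\<bar>" "p - 1"] by (simp add: field_simps)
    qed
    show "((\<lambda>t. \<bar>t\<bar> powr (p - 1)) \<longlongrightarrow> 0) (at 0)"
      using assms by (intro tendsto_eq_intros) (auto intro!: tendsto_rabs_zero)
  qed
  then show ?thesis
    using True by (simp add: DERIV_def)
next
  case False
  then consider "t > 0" | "t < 0" by linarith
  then show ?thesis
  proof cases
    case 1
    have "((\<lambda>t. t powr p) has_real_derivative p * t powr (p - 1)) (at t)"
      using 1 by (auto intro!: derivative_eq_intros simp: powr_diff)
    then have "((\<lambda>t. \<bar>t\<bar> powr p) has_real_derivative p * t powr (p - 1)) (at t)"
      by (rule DERIV_cong_ev[THEN iffD1, rotated 3])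
         (use 1 in \<open>auto intro!: eventually_mono[OF eventually_gt_at_top]
            eventually_mono[OF order_tendstoD(1)[OF tendsto_ident_at, of 0 t UNIV]]
            simp: eventually_nhds_conv_at\<close>)
    then show ?thesis
      using 1 powr_mult_base[of t "p - 2"] by (simp add: h_def mult.commute)
  next
    case 2
    have "((\<lambda>t. (- t) powr p) has_real_derivative - (p * (- t) powr (p - 1))) (at t)"
      using 2 by (auto intro!: derivative_eq_intros simp: powr_diff)
    then have "((\<lambda>t. \<bar>t\<bar> powr p) has_real_derivative - (p * (- t) powr (p - 1))) (at t)"
      by (rule DERIV_cong_ev[THEN iffD1, rotated 3])
         (use 2 in \<open>auto intro!: eventually_mono[OF order_tendstoD(2)[OF tendsto_ident_at, of t 0 UNIV]]
            simp: eventually_nhds_conv_at\<close>)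
    moreover have "- (p * (- t) powr (p - 1)) = p * h p t"
      using 2 powr_mult_base[of "- t" "p - 2", symmetric] by (simp add: h_def)
    ultimately show ?thesis by simp
  qed
qed

lemma h_mono:
  assumes "1 < p" "x \<le> y"
  shows "h p x \<le> h p y"
proof -
  have *: "h p t = sgn t * \<bar>t\<bar> powr (p - 1)" for t
    using abs_h[of p t] by (auto simp: h_def sgn_if abs_mult)
  have pos: "0 \<le> h p t" if "0 \<le> t" for t using that by (simp add: h_def)
  have neg: "h p t \<le> 0" if "t \<le> 0" for t
    using that by (auto simp: h_def intro!: mult_nonneg_nonpos)
  consider "0 \<le> x" | "x < 0" "0 \<le> y" | "y < 0" by linarith
  then show ?thesis
  proof cases
    case 1
    then show ?thesis
      using assms by (auto simp: * sgn_if intro!: powr_mono2)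
  next
    case 2
    then show ?thesis using pos[of y] neg[of x] by linarith
  next
    case 3
    then show ?thesis
      using assms by (auto simp: * sgn_if intro!: powr_mono2)
  qed
qed

lemma convex_on_abs_powr:
  assumes "1 < p"
  shows "convex_on UNIV (\<lambda>t::real. \<bar>t\<bar> powr p)"
proof (rule convex_on_realI)
  show "((\<lambda>t. \<bar>t\<bar> powr p) has_real_derivative p * h p x) (at x)" for x
    by (rule DERIV_abs_powr[OF assms])
  show "p * h p x \<le> p * h p y" if "x \<le> y" for x y
    using assms that by (intro mult_left_mono h_mono) auto
qed auto

text \<open>Convexity applied to the combination of \<open>a / (1 - \<theta>)\<close> and
  \<open>b / \<theta>\<close>. As \<theta> tends to 0 the coefficient of \<open>a powr p\<close>
  tends to 1, at the price of a large coefficient in front of a term that is small for other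
  reasons.\<close>

lemma powr_add_le_weighted:
  fixes a b p \<theta> :: real
  assumes "1 < p" "0 \<le> a" "0 \<le> b" "0 < \<theta>" "\<theta> < 1"
  shows "(a + b) powr p \<le> (1 - \<theta>) powr (1 - p) * a powr p + \<theta> powr (1 - p) * b powr p"
proof -
  have "\<bar>(1 - \<theta>) *\<^sub>R (a / (1 - \<theta>)) + \<theta> *\<^sub>R (b / \<theta>)\<bar> powr p
     \<le> (1 - \<theta>) * \<bar>a / (1 - \<theta>)\<bar> powr p + \<theta> * \<bar>b / \<theta>\<bar> powr p"
    using convex_onD[OF convex_on_abs_powr[OF assms(1)], of \<theta> "a / (1 - \<theta>)" "b / \<theta>"] assms by simp
  then show ?thesis
    using assms by (simp add: powr_divide powr_diff abs_div_pos)
qed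

text \<open>Minkowski's inequality for two-term l^p norms. Each vector is scaled to norm 1, so that
  the sum is \<open>\<alpha> + \<beta>\<close> times a convex combination, and convexity of the p-th
  power is applied in each coordinate; a vanishing vector is treated apart.\<close>

lemma abs_sum_sub_powr_le:
  fixes a b c d p :: real
  assumes p: "1 < p" and nn: "0 \<le> a" "0 \<le> b" "0 \<le> c" "0 \<le> d"
  shows "(a + c) powr p + (b + d) powr p \<le>
    ((a powr p + b powr p) powr (1/p) + (c powr p + d powr p) powr (1/p)) powr p"
proof -
  define \<alpha> \<beta> where "\<alpha> = (a powr p + b powr p) powr (1/p)" and "\<beta> = (c powr p + d powr p) powr (1/p)"
  have \<alpha>p: "\<alpha> powr p = a powr p + b powr p" and \<beta>p: "\<beta> powr p = c powr p + d powr p"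
    using p by (simp_all add: \<alpha>_def \<beta>_def powr_powr)
  have nn': "0 \<le> \<alpha>" "0 \<le> \<beta>" by (simp_all add: \<alpha>_def \<beta>_def)
  show ?thesis
  proof (cases "\<alpha> = 0 \<or> \<beta> = 0")
    case True
    then consider "a powr p + b powr p = 0" | "c powr p + d powr p = 0"
      using \<alpha>p \<beta>p by auto
    then show ?thesis
    proof cases
      case 1
      then have "a powr p = 0" "b powr p = 0"
        using powr_ge_zero[of a p] powr_ge_zero[of b p] by linarith+
      then have "a = 0" "b = 0" by auto
      then show ?thesis using p \<beta>p by (simp add: \<beta>_def powr_powr)
    next
      case 2
      then have "c powr p = 0" "d powr p = 0"
        using powr_ge_zero[of c p] powr_ge_zero[of d p] by linarith+
      then have "c = 0" "d = 0" by auto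
      then show ?thesis using p \<alpha>p by (simp add: \<alpha>_def powr_powr)
    qed
  next
    case False
    with nn' have pos: "0 < \<alpha>" "0 < \<beta>" by auto
    define \<eta> where "\<eta> = \<beta> / (\<alpha> + \<beta>)"
    have \<eta>: "0 < \<eta>" "\<eta> < 1" "1 - \<eta> = \<alpha> / (\<alpha> + \<beta>)"
      using pos by (auto simp: \<eta>_def field_simps)
    have *: "((x + y) / (\<alpha> + \<beta>)) powr p \<le> (1 - \<eta>) * (x powr p / \<alpha> powr p) + \<eta> * (y powr p / \<beta> powr p)"
      if "0 \<le> x" "0 \<le> y" for x y
    proof -
      have "(1 - \<eta>) * (x / \<alpha>) + \<eta> * (y / \<beta>) = (x + y) / (\<alpha> + \<beta>)"
        using pos \<eta>(3) by (simp add: \<eta>_def add_divide_distrib)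
      moreover have "\<bar>(1 - \<eta>) *\<^sub>R (x / \<alpha>) + \<eta> *\<^sub>R (y / \<beta>)\<bar> powr p
         \<le> (1 - \<eta>) * \<bar>x / \<alpha>\<bar> powr p + \<eta> * \<bar>y / \<beta>\<bar> powr p"
        using convex_onD[OF convex_on_abs_powr[OF p], of \<eta> "x / \<alpha>" "y / \<beta>"] \<eta> by simp
      ultimately show ?thesis
        using pos that by (simp add: powr_divide)
    qed
    have "((a + c) / (\<alpha> + \<beta>)) powr p + ((b + d) / (\<alpha> + \<beta>)) powr p
      \<le> (1 - \<eta>) * ((a powr p + b powr p) / \<alpha> powr p) + \<eta> * ((c powr p + d powr p) / \<beta> powr p)"
      using *[OF nn(1,3)] *[OF nn(2,4)] by (simp add: add_divide_distrib distrib_left)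
    also have "\<dots> = 1" using pos by (simp flip: \<alpha>p \<beta>p)
    finally have "((a + c) powr p + (b + d) powr p) / (\<alpha> + \<beta>) powr p \<le> 1"
      using pos nn powr_divide[of "a + c" "\<alpha> + \<beta>" p] powr_divide[of "b + d" "\<alpha> + \<beta>" p]
      by (simp only: add_divide_distrib)
    then have "(a + c) powr p + (b + d) powr p \<le> (\<alpha> + \<beta>) powr p"
      using pos by (simp add: divide_le_eq)
    then show ?thesis by (simp add: \<alpha>_def \<beta>_def)
  qed
qed

text \<open>The reverse triangle inequality of the two-term l^p norm, raised to the power
  \<open>p\<close>. It is the pointwise core of the hidden convexity of the Dirichlet form.\<close>

lemma lp_norm_diff_le:
  fixes a b c d p :: real
  assumes p: "1 < p" and nn: "0 \<le> a" "0 \<le> b" "0 \<le> c" "0 \<le> d"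
  shows "\<bar>(a powr p + b powr p) powr (1/p) - (c powr p + d powr p) powr (1/p)\<bar> powr p
    \<le> \<bar>a - c\<bar> powr p + \<bar>b - d\<bar> powr p"
proof -
  define n where "n x y = (x powr p + y powr p) powr (1/p)" for x y :: real
  have np: "n x y powr p = x powr p + y powr p" for x y
    using p by (simp add: n_def powr_powr)
  have n0: "0 \<le> n x y" for x y by (simp add: n_def)
  have tri: "n (x + x') (y + y') \<le> n x y + n x' y'"
    if "0 \<le> x" "0 \<le> y" "0 \<le> x'" "0 \<le> y'" for x y x' y'
  proof -
    have "n (x + x') (y + y') powr p \<le> (n x y + n x' y') powr p"
      using abs_sum_sub_powr_le[OF p that(1,2,3,4)] by (simp add: np) (simp add: n_def)
    then show ?thesis
      using p n0 powr_less_mono2[of p "n x y + n x' y'" "n (x + x') (y + y')"]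
      by (meson add_nonneg_nonneg less_le_not_le linorder_not_le order_less_trans zero_less_one)
  qed
  have mono: "n x y \<le> n x' y'" if "0 \<le> x" "x \<le> x'" "0 \<le> y" "y \<le> y'" for x y x' y'
    unfolding n_def using that p by (intro powr_mono2 add_mono) auto
  have 1: "n a b \<le> n c d + n \<bar>a - c\<bar> \<bar>b - d\<bar>"
    by (rule order_trans[OF mono tri]) (use nn in auto)
  have 2: "n c d \<le> n a b + n \<bar>a - c\<bar> \<bar>b - d\<bar>"
    by (rule order_trans[OF mono tri]) (use nn in auto)
  have "\<bar>n a b - n c d\<bar> powr p \<le> n \<bar>a - c\<bar> \<bar>b - d\<bar> powr p"
    using 1 2 p by (intro powr_mono2) auto
  then show ?thesis by (simp add: np) (simp add: n_def)
qed

text \<open>The midpoint of a path on which the p-th powers, not the functions, move linearly.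
  Potentials are averaged exactly by it, the entropy is strictly convex along it, and
  \<open>pmean_diff_le\<close> gives the midpoint inequality for the Dirichlet form.\<close>

definition pmean :: "real \<Rightarrow> real \<Rightarrow> real \<Rightarrow> real" where
  "pmean p a b = ((a powr p + b powr p) / 2) powr (1 / p)"

lemma pmean_powr: "0 < p \<Longrightarrow> pmean p a b powr p = (a powr p + b powr p) / 2"
  by (simp add: pmean_def powr_powr)

lemma pmean_nonneg [simp]: "0 \<le> pmean p a b"
  by (simp add: pmean_def)

lemma pmean_zero [simp]: "pmean p 0 0 = 0"
  by (simp add: pmean_def)

lemma pmean_diff_le:
  assumes p: "1 < p" and nn: "0 \<le> a" "0 \<le> b" "0 \<le> c" "0 \<le> d"
  shows "\<bar>pmean p a b - pmean p c d\<bar> powr p \<le> (\<bar>a - c\<bar> powr p + \<bar>b - d\<bar> powr p) / 2"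
proof -
  have "pmean p a b - pmean p c d = ((a powr p + b powr p) powr (1/p) - (c powr p + d powr p) powr (1/p)) / 2 powr (1/p)"
    by (simp add: pmean_def powr_divide diff_divide_distrib)
  then have "\<bar>pmean p a b - pmean p c d\<bar> powr p =
      \<bar>(a powr p + b powr p) powr (1/p) - (c powr p + d powr p) powr (1/p)\<bar> powr p / 2"
    using p by (simp add: powr_divide powr_powr abs_divide)
  then show ?thesis using lp_norm_diff_le[OF assms] by simp
qed

section \<open>The logarithmic nonlinearity\<close>

text \<open>The entropy density \<open>y * (ln y - 1)\<close> at \<open>y = |t| powr p\<close>. It
  enters the limit because the derivative of \<open>|t| powr r / r\<close> with respect to the
  exponent \<open>r\<close> is \<open>psi r t\<close> divided by the square of
  \<open>r\<close>.\<close>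

definition psi :: "real \<Rightarrow> real \<Rightarrow> real" where
  "psi p t = \<bar>t\<bar> powr p * (p * ln \<bar>t\<bar> - 1)"

lemma psi_zero [simp]: "psi p 0 = 0"
  by (simp add: psi_def)

lemma psi_abs [simp]: "psi p \<bar>t\<bar> = psi p t"
  by (simp add: psi_def)

lemma psi_measurable [measurable]: "psi p \<in> borel_measurable borel"
  unfolding psi_def[abs_def] by measurable

lemma ln_powr': "ln (\<bar>t\<bar> powr p) = p * ln \<bar>t\<bar>" for t :: real
  by (cases "t = 0") (simp_all add: ln_powr)

lemma psi_eq: "psi p t = \<bar>t\<bar> powr p * (ln (\<bar>t\<bar> powr p) - 1)"
  by (simp add: psi_def ln_powr')

text \<open>The gap between the function and its tangent is \<open>w\<close> times
  \<open>m / w - 1 - ln (m / w)\<close>, which is non-negative and vanishes only for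
  \<open>m = w\<close>. At \<open>w = 0\<close> the convention for the logarithm of 0 is harmless,
  since it is multiplied by 0.\<close>

lemma entropy_tangent:
  fixes w m :: real
  assumes "0 \<le> w" "0 < m"
  shows "m * (ln m - 1) + ln m * (w - m) \<le> w * (ln w - 1)"
    and "m * (ln m - 1) + ln m * (w - m) = w * (ln w - 1) \<Longrightarrow> w = m"
proof -
  have *: "w * (ln w - 1) - (m * (ln m - 1) + ln m * (w - m)) = m - w - w * ln (m / w)" if "0 < w"
    using that assms by (simp add: ln_div algebra_simps)
  have **: "m - w - w * ln (m / w) = w * (m / w - 1 - ln (m / w))" if "0 < w"
    using that by (simp add: field_simps)
  have 1: "ln (m / w) \<le> m / w - 1" if "0 < w"
    using that assms by (intro ln_le_minus_one) simp
  show "m * (ln m - 1) + ln m * (w - m) \<le> w * (ln w - 1)"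
  proof (cases "w = 0")
    case False
    with assms have w: "0 < w" by simp
    have "0 \<le> w * (m / w - 1 - ln (m / w))"
      using w 1[OF w] by (intro mult_nonneg_nonneg) auto
    then show ?thesis using *[OF w] **[OF w] by linarith
  qed (use assms in \<open>simp add: algebra_simps\<close>)
  assume eq: "m * (ln m - 1) + ln m * (w - m) = w * (ln w - 1)"
  show "w = m"
  proof (cases "w = 0")
    case False
    with assms have w: "0 < w" by simp
    have "w * (m / w - 1 - ln (m / w)) = 0"
      using eq *[OF w] **[OF w] by linarith
    then have "ln (m / w) = m / w - 1" using w by simp
    then have "m / w = 1" using w assms by (intro ln_eq_minus_one) auto
    then show ?thesis using w by simp
  qed (use eq assms in \<open>simp add: algebra_simps\<close>)
qed

text \<open>The tangent to the entropy at 1 is horizontal, at height -1.\<close>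

lemma psi_ge: "- 1 \<le> psi p t"
proof -
  have "1 * (ln 1 - 1) + ln 1 * (\<bar>t\<bar> powr p - 1) \<le> \<bar>t\<bar> powr p * (ln (\<bar>t\<bar> powr p) - 1)"
    by (intro entropy_tangent) auto
  then show ?thesis by (simp add: psi_eq)
qed

text \<open>Both values are compared with the tangent at the mean \<open>m\<close>. The linear terms
  cancel, and equality in the average forces equality in each tangent inequality. There is no
  tangent at \<open>m = 0\<close>, so this case is separate.\<close>

lemma psi_pmean_le:
  assumes "0 < p" "0 \<le> a" "0 \<le> b"
  shows "psi p (pmean p a b) \<le> (psi p a + psi p b) / 2"
    and "psi p (pmean p a b) = (psi p a + psi p b) / 2 \<Longrightarrow> a = b"
proof -
  define m where "m = (a powr p + b powr p) / 2"
  have m: "psi p (pmean p a b) = m * (ln m - 1)" "\<bar>pmean p a b\<bar> powr p = m"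
    using assms by (simp_all add: psi_eq pmean_powr m_def)
  have ab: "psi p a = a powr p * (ln (a powr p) - 1)" "psi p b = b powr p * (ln (b powr p) - 1)"
    using assms by (simp_all add: psi_eq)
  have "psi p (pmean p a b) \<le> (psi p a + psi p b) / 2 \<and>
    (psi p (pmean p a b) = (psi p a + psi p b) / 2 \<longrightarrow> a = b)"
  proof (cases "m = 0")
    case True
    then have "a powr p + b powr p = 0" by (simp add: m_def)
    then have "a powr p = 0 \<and> b powr p = 0"
      using powr_ge_zero[of a p] powr_ge_zero[of b p] by linarith
    then have "a = 0" "b = 0" by simp_all
    then show ?thesis by simp
  next
    case False
    then have m0: "0 < m"
      by (simp add: m_def order_less_le)
    note A = entropy_tangent[OF powr_ge_zero[of a p] m0]
    note B = entropy_tangent[OF powr_ge_zero[of b p] m0]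
    have sum: "ln m * (a powr p - m) + ln m * (b powr p - m) = 0"
      unfolding distrib_left[symmetric] by (simp add: m_def)
    have avg: "x \<le> (y + z) / 2" "x = (y + z) / 2 \<Longrightarrow> x + d = y" "x = (y + z) / 2 \<Longrightarrow> x + e = z"
      if "x + d \<le> y" "x + e \<le> z" "d + e = 0" for x y z d e :: real
      using that by - argo+
    note avg = avg[OF A(1) B(1) sum, folded m(1) ab]
    have "psi p (pmean p a b) \<le> (psi p a + psi p b) / 2" by (rule avg(1))
    moreover have "a = b" if "psi p (pmean p a b) = (psi p a + psi p b) / 2"
    proof -
      have "a powr p = m" "b powr p = m"
        using avg(2,3)[OF that] A(2)[folded m(1) ab] B(2)[folded m(1) ab] by blast+
      then have "a powr p = b powr p" by simp
      then have "(a powr p) powr (1 / p) = (b powr p) powr (1 / p)" by simp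
      then show ?thesis using assms by (simp add: powr_powr)
    qed
    ultimately show ?thesis by blast
  qed
  then show "psi p (pmean p a b) \<le> (psi p a + psi p b) / 2"
    "psi p (pmean p a b) = (psi p a + psi p b) / 2 \<Longrightarrow> a = b" by auto
qed

text \<open>The tangent at \<open>k powr p\<close> has slope \<open>p * ln k\<close>. This slope is
  unbounded in \<open>k\<close>, so truncation at a high level gains more entropy than any bounded
  potential can cost.\<close>

lemma psi_diff_ge:
  assumes "0 < p" "0 < k"
  shows "p * ln k * (\<bar>t\<bar> powr p - k powr p) \<le> psi p t - psi p k"
  using entropy_tangent(1)[of "\<bar>t\<bar> powr p" "k powr p"] assms
  by (simp add: psi_eq ln_powr)

text \<open>\<open>psi\<close> is not monotone in \<open>|t|\<close>, but it is increasing where it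
  is positive and never below -1, so the region of non-monotonicity costs only the constant 1. This
  dominates truncated and cut-off functions.\<close>

lemma abs_psi_mono:
  assumes "0 < p" "\<bar>s\<bar> \<le> \<bar>t\<bar>"
  shows "\<bar>psi p s\<bar> \<le> 1 + \<bar>psi p t\<bar>"
proof -
  have "psi p s \<le> 1 + \<bar>psi p t\<bar>"
  proof (cases "p * ln \<bar>s\<bar> \<le> 1")
    case True
    then have "psi p s \<le> 0"
      unfolding psi_def by (intro mult_nonneg_nonpos) auto
    then show ?thesis by linarith
  next
    case False
    then have s: "0 < \<bar>s\<bar>" using assms by (cases "s = 0") auto
    have "ln \<bar>s\<bar> \<le> ln \<bar>t\<bar>" using s assms by simp
    then have "psi p s \<le> psi p t"
      unfolding psi_def using False assms
      by (intro mult_mono powr_mono2) (auto simp: mult_left_mono)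
    then show ?thesis by linarith
  qed
  with psi_ge[of p s] show ?thesis by linarith
qed

lemma powr_ln_bound:
  fixes x e :: real
  assumes "0 < e" "0 \<le> x" "x \<le> 1"
  shows "x powr e * \<bar>ln x\<bar> \<le> 1 / e"
proof (cases "x = 0")
  case False
  with assms have x: "0 < x" by simp
  have "ln (1 / x) \<le> (1 / x) powr e / e"
    using x assms by (intro ln_powr_bound) auto
  then have "\<bar>ln x\<bar> \<le> 1 / (e * x powr e)"
    using x assms by (simp add: ln_div powr_divide mult.commute)
  then show ?thesis using x assms by (simp add: pos_le_divide_eq mult_ac)
qed (use assms in auto)

text \<open>At 0, \<open>|t| powr (p - 1)\<close> is split into two equal powers: one absorbs the
  logarithm, the other makes the difference quotient vanish.\<close>

lemma DERIV_psi:
  assumes "1 < p"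
  shows "(psi p has_real_derivative p\<^sup>2 * h p t * ln \<bar>t\<bar>) (at t)"
proof (cases "t = 0")
  case True
  have "((\<lambda>t. psi p t / t) \<longlongrightarrow> 0) (at (0::real))"
  proof (rule Lim_null_comparison)
    let ?e = "(p - 1) / 2"
    show "\<forall>\<^sub>F t in at (0::real). norm (psi p t / t) \<le> (p * (1 / ?e) + 1) * \<bar>t\<bar> powr ?e"
      using eventually_at_ball[of 1 "0::real" UNIV, simplified] eventually_neq_at_within[of 0]
    proof eventually_elim
      case (elim t)
      then have t: "t \<noteq> 0" "\<bar>t\<bar> \<le> 1" by auto
      have e: "0 < ?e" using assms by simp
      have 1: "\<bar>t\<bar> powr ?e * \<bar>ln \<bar>t\<bar>\<bar> \<le> 1 / ?e"
        by (rule powr_ln_bound[OF e]) (use t in auto)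
      have 2: "\<bar>t\<bar> powr ?e \<le> 1" using t e by (simp add: powr_le1)
      have "\<bar>t\<bar> powr p = \<bar>t\<bar> * (\<bar>t\<bar> powr ?e * \<bar>t\<bar> powr ?e)"
        using t powr_mult_base[of "\<bar>t\<bar>" "p - 1"] by (simp flip: powr_add)
      then have "norm (psi p t / t) = \<bar>t\<bar> powr ?e * \<bar>t\<bar> powr ?e * \<bar>p * ln \<bar>t\<bar> - 1\<bar>"
        using t by (simp add: psi_def abs_mult)
      also have "\<dots> = \<bar>t\<bar> powr ?e * (\<bar>t\<bar> powr ?e * \<bar>p * ln \<bar>t\<bar> - 1\<bar>)" by simp
      also have "\<dots> \<le> \<bar>t\<bar> powr ?e * (p * (1 / ?e) + 1)"
      proof (intro mult_left_mono)
        have "\<bar>t\<bar> powr ?e * \<bar>p * ln \<bar>t\<bar> - 1\<bar> \<le> \<bar>t\<bar> powr ?e * (p * \<bar>ln \<bar>t\<bar>\<bar> + 1)"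
          using assms by (intro mult_left_mono) (auto intro!: order_trans[OF abs_triangle_ineq4] simp: abs_mult)
        also have "\<dots> = p * (\<bar>t\<bar> powr ?e * \<bar>ln \<bar>t\<bar>\<bar>) + \<bar>t\<bar> powr ?e" by (simp add: algebra_simps)
        also have "\<dots> \<le> p * (1 / ?e) + 1"
          using assms by (intro add_mono mult_left_mono 1 2) auto
        finally show "\<bar>t\<bar> powr ?e * \<bar>p * ln \<bar>t\<bar> - 1\<bar> \<le> p * (1 / ?e) + 1" .
      qed auto
      finally show ?case by (simp add: mult.commute)
    qed
    show "((\<lambda>t. (p * (1 / ?e) + 1) * \<bar>t\<bar> powr ?e) \<longlongrightarrow> 0) (at 0)"
      using assms by (intro tendsto_eq_intros) (auto intro!: tendsto_rabs_zero)
  qed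
  then show ?thesis using True by (simp add: DERIV_def)
next
  case False
  have ln: "((\<lambda>t. ln \<bar>t\<bar>) has_real_derivative 1 / t) (at t)"
  proof -
    have "((\<lambda>t. ln (t\<^sup>2) / 2) has_real_derivative 1 / t) (at t)"
    proof -
      have "0 < t\<^sup>2" using False by simp
      then show ?thesis
        using False by (auto intro!: derivative_eq_intros simp: power2_eq_square)
    qed
    moreover have "ln (t\<^sup>2) / 2 = ln \<bar>t\<bar>" for t :: real
      using ln_realpow[of "\<bar>t\<bar>" 2] by (cases "t = 0") simp_all
    ultimately show ?thesis by simp
  qed
  have "(psi p has_real_derivative (p * h p t) * (p * ln \<bar>t\<bar> - 1) + p * (1 / t) * \<bar>t\<bar> powr p) (at t)"
    unfolding psi_def[abs_def]
    by (rule DERIV_cong[OF DERIV_mult[OF DERIV_abs_powr[OF assms] DERIV_diff[OF DERIV_cmult[OF ln] DERIV_const]]]) simp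
  moreover have "\<bar>t\<bar> powr p = h p t * t" by (simp add: h_mult_self)
  ultimately show ?thesis
    using False by (simp add: algebra_simps power2_eq_square)
qed

text \<open>A bound for the first variation of the entropy along a segment. For small \<tau> the
  logarithm is absorbed by the power; for large \<tau> all factors are monotone, and
  \<open>|\<alpha>| + |\<beta>|\<close> is at most the larger of \<open>|2 * \<alpha>|\<close> and
  \<open>|2 * \<beta>|\<close>, whence the factors 2.\<close>

lemma abs_h_ln_mult_le:
  assumes p: "1 < p" and \<tau>: "\<bar>\<tau>\<bar> \<le> \<bar>\<alpha>\<bar> + \<bar>\<beta>\<bar>"
  shows "\<bar>h p \<tau> * ln \<bar>\<tau>\<bar> * \<beta>\<bar> \<le> \<bar>\<beta>\<bar> / (p - 1) + \<bar>2 * \<alpha>\<bar> powr p * \<bar>ln \<bar>2 * \<alpha>\<bar>\<bar> + \<bar>2 * \<beta>\<bar> powr p * \<bar>ln \<bar>2 * \<beta>\<bar>\<bar>"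
proof -
  have eq: "\<bar>h p \<tau> * ln \<bar>\<tau>\<bar> * \<beta>\<bar> = \<bar>\<tau>\<bar> powr (p - 1) * \<bar>ln \<bar>\<tau>\<bar>\<bar> * \<bar>\<beta>\<bar>"
    by (simp add: abs_mult abs_h)
  let ?\<theta> = "\<lambda>t::real. \<bar>t\<bar> powr p * \<bar>ln \<bar>t\<bar>\<bar>"
  have \<theta>: "0 \<le> ?\<theta> t" for t by simp
  show ?thesis
  proof (cases "\<bar>\<tau>\<bar> \<le> 1")
    case True
    have "\<bar>\<tau>\<bar> powr (p - 1) * \<bar>ln \<bar>\<tau>\<bar>\<bar> \<le> 1 / (p - 1)"
      using p True by (intro powr_ln_bound) auto
    then have "\<bar>\<tau>\<bar> powr (p - 1) * \<bar>ln \<bar>\<tau>\<bar>\<bar> * \<bar>\<beta>\<bar> \<le> 1 / (p - 1) * \<bar>\<beta>\<bar>"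
      by (rule mult_right_mono) simp
    then show ?thesis using \<theta>[of "2 * \<alpha>"] \<theta>[of "2 * \<beta>"] unfolding eq by (simp only: times_divide_eq_left mult_1)
  next
    case False
    define M where "M = max \<bar>2 * \<alpha>\<bar> \<bar>2 * \<beta>\<bar>"
    have M: "\<bar>\<tau>\<bar> \<le> M" "\<bar>\<beta>\<bar> \<le> M" "1 \<le> M"
      using \<tau> False by (auto simp: M_def)
    have "\<bar>\<tau>\<bar> powr (p - 1) * \<bar>ln \<bar>\<tau>\<bar>\<bar> * \<bar>\<beta>\<bar> \<le> M powr (p - 1) * \<bar>ln M\<bar> * M"
      using M False p by (intro mult_mono powr_mono2) auto
    also have "\<dots> = ?\<theta> M"
      using M powr_mult_base[of M "p - 1"] by (simp add: mult_ac)
    also have "\<dots> \<le> ?\<theta> (2 * \<alpha>) + ?\<theta> (2 * \<beta>)"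
      by (auto simp: M_def max_def)
    finally have "\<bar>\<tau>\<bar> powr (p - 1) * \<bar>ln \<bar>\<tau>\<bar>\<bar> * \<bar>\<beta>\<bar> \<le> ?\<theta> (2 * \<alpha>) + ?\<theta> (2 * \<beta>)" .
    moreover have "0 \<le> \<bar>\<beta>\<bar> / (p - 1)" using p by simp
    ultimately show ?thesis unfolding eq by (simp only: add_increasing add.assoc)
  qed
qed

section \<open>Polar coordinates\<close>

text \<open>Both measures of a half-line \<open>{..a}\<close> are the volume of a ball of radius
  \<open>a\<close>, and half-lines generate the Borel sets. This yields polar coordinates for radial
  integrands without surface measure.\<close>

lemma distr_norm_lborel:
  "distr lborel borel (norm :: 'a::euclidean_space \<Rightarrow> real) =
   density lborel (\<lambda>r. ennreal (DIM('a) * unit_ball_vol DIM('a) * r ^ (DIM('a) - 1)) * indicator {0..} r)"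
proof (rule measure_eqI_generator_eq[where E = "range atMost" and \<Omega> = UNIV and A = "\<lambda>i. {..real i}"])
  show "Int_stable (range atMost :: real set set)"
    by (auto simp: Int_stable_def)
  show "sets (distr lborel borel (norm :: 'a \<Rightarrow> real)) = sigma_sets UNIV (range atMost)"
    by (simp add: borel_eq_atMost)
  show "sets (density lborel (\<lambda>r. ennreal (DIM('a) * unit_ball_vol DIM('a) * r ^ (DIM('a) - 1)) * indicator {0..} r))
    = sigma_sets UNIV (range atMost)"
    by (simp add: borel_eq_atMost)
  have lhs: "emeasure (distr lborel borel (norm :: 'a \<Rightarrow> real)) {..a} = ennreal (unit_ball_vol DIM('a) * a ^ DIM('a))"
    if "0 \<le> a" for a
  proof -
    have "emeasure (distr lborel borel (norm :: 'a \<Rightarrow> real)) {..a} = emeasure lborel (cball (0::'a) a)"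
      by (subst emeasure_distr) (auto intro!: arg_cong[where f = "emeasure lborel"])
    with emeasure_cball[OF that] show ?thesis by simp
  qed
  show "emeasure (distr lborel borel (norm :: 'a \<Rightarrow> real)) X =
    emeasure (density lborel (\<lambda>r. ennreal (DIM('a) * unit_ball_vol DIM('a) * r ^ (DIM('a) - 1)) * indicator {0..} r)) X"
    if "X \<in> range atMost" for X
  proof -
    from that obtain a where X: "X = {..a}" by auto
    show ?thesis
    proof (cases "0 \<le> a")
      case True
      have "emeasure (density lborel (\<lambda>r. ennreal (DIM('a) * unit_ball_vol DIM('a) * r ^ (DIM('a) - 1)) * indicator {0..} r)) X
        = (\<integral>\<^sup>+r. ennreal (DIM('a) * unit_ball_vol DIM('a) * r ^ (DIM('a) - 1)) * indicator {0..a} r \<partial>lborel)"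
        unfolding X by (subst emeasure_density) (auto intro!: nn_integral_cong simp: indicator_def)
      also have "\<dots> = ennreal (unit_ball_vol DIM('a) * a ^ DIM('a) - unit_ball_vol DIM('a) * 0 ^ DIM('a))"
        using True by (intro nn_integral_FTC_Icc) (auto intro!: derivative_eq_intros)
      also have "\<dots> = emeasure (distr lborel borel (norm :: 'a \<Rightarrow> real)) X"
        unfolding X lhs[OF True] by (simp add: power_0_left)
      finally show ?thesis by simp
    next
      case False
      have "emeasure (distr lborel borel (norm :: 'a \<Rightarrow> real)) X = emeasure lborel ({} :: 'a set)"
        unfolding X using False
        by (subst emeasure_distr)
          (auto intro!: arg_cong[where f = "emeasure lborel"] simp del: emeasure_empty dest: order_trans[OF norm_ge_zero])
      moreover have "emeasure (density lborel (\<lambda>r. ennreal (DIM('a) * unit_ball_vol DIM('a) * r ^ (DIM('a) - 1)) * indicator {0..} r)) X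
        = (\<integral>\<^sup>+r. 0 \<partial>(lborel :: real measure))"
        unfolding X
      proof (subst emeasure_density)
        have "indicator {0..} r * indicator {..a} r = (0::ennreal)" for r
          using False by (auto split: split_indicator)
        then show "(\<integral>\<^sup>+r. ennreal (DIM('a) * unit_ball_vol DIM('a) * r ^ (DIM('a) - 1)) * indicator {0..} r * indicator {..a} r \<partial>lborel)
          = (\<integral>\<^sup>+r. 0 \<partial>(lborel :: real measure))"
          by (intro nn_integral_cong) (simp add: mult.assoc del: mult_eq_0_iff)
      qed auto
      ultimately show ?thesis by simp
    qed
  qed
  show "(\<Union>i. {..real i}) = UNIV" by (auto intro: real_arch_simple)
  show "emeasure (distr lborel borel (norm :: 'a \<Rightarrow> real)) {..real i} \<noteq> \<infinity>" for i
    by (simp add: lhs)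
qed auto

lemma nn_integral_norm:
  fixes f :: "real \<Rightarrow> ennreal"
  assumes [measurable]: "f \<in> borel_measurable borel"
  shows "(\<integral>\<^sup>+z. f (norm (z::'a::euclidean_space)) \<partial>lborel) =
    (\<integral>\<^sup>+r. ennreal (DIM('a) * unit_ball_vol DIM('a) * r ^ (DIM('a) - 1)) * indicator {0..} r * f r \<partial>lborel)"
proof -
  have "(\<integral>\<^sup>+z. f (norm (z::'a)) \<partial>lborel) = (\<integral>\<^sup>+r. f r \<partial>distr lborel borel (norm :: 'a \<Rightarrow> real))"
    by (subst nn_integral_distr) auto
  then show ?thesis
    unfolding distr_norm_lborel by (subst (asm) nn_integral_density) auto
qed

section \<open>Difference quotients with a singular kernel\<close>

text \<open>At the origin the value is 0, because division by zero is 0; the diagonal therefore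
  never contributes.\<close>

definition nkern :: "real \<Rightarrow> 'a::euclidean_space \<Rightarrow> real" where
  "nkern \<beta> z = indicator {..1} (norm z) / norm z powr \<beta>"

text \<open>Near pairs are kept everywhere, far pairs only inside \<Omega>: for a function vanishing
  off \<Omega>, the other far pairs reduce to a potential. Distance exactly 1 is counted in both
  parts, on a null set of pairs.\<close>

definition ker :: "'a::euclidean_space set \<Rightarrow> real \<Rightarrow> 'a \<times> 'a \<Rightarrow> real" where
  "ker \<Omega> \<beta> z = nkern \<beta> (fst z - snd z) + indicator \<Omega> (fst z) * indicator \<Omega> (snd z) *
     (indicator {1..} (norm (fst z - snd z)) / norm (fst z - snd z) powr \<beta>)"

text \<open>The values lie in \<open>ennreal\<close>, so that finiteness can express membership in
  an energy space. With the empty set as domain only the near part is left.\<close>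

definition dform :: "'a::euclidean_space set \<Rightarrow> real \<Rightarrow> real \<Rightarrow> ('a \<Rightarrow> real) \<Rightarrow> ennreal" where
  "dform \<Omega> \<beta> p u =
     (\<integral>\<^sup>+z. ennreal (ker \<Omega> \<beta> z * \<bar>u (fst z) - u (snd z)\<bar> powr p) \<partial>(lborel \<Otimes>\<^sub>M lborel))"

lemma nkern_nonneg [simp]: "0 \<le> nkern \<beta> z"
  by (simp add: nkern_def)

lemma nkern_measurable [measurable]: "nkern \<beta> \<in> borel_measurable borel"
  unfolding nkern_def[abs_def] by measurable

lemma ker_nonneg [simp]: "0 \<le> ker \<Omega> \<beta> z"
  by (simp add: ker_def)

lemma ker_measurable [measurable]:
  assumes [measurable]: "\<Omega> \<in> sets borel"
  shows "ker \<Omega> \<beta> \<in> borel_measurable (lborel \<Otimes>\<^sub>M lborel)"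
  unfolding ker_def[abs_def] by measurable

lemma ker_empty: "ker {} \<beta> z = nkern \<beta> (fst z - snd z)"
  by (simp add: ker_def)

lemma nkern_minus: "nkern \<beta> (- z) = nkern \<beta> z"
  by (simp add: nkern_def)

lemma nn_integral_lborel_translate:
  fixes f :: "'a::euclidean_space \<Rightarrow> ennreal"
  assumes [measurable]: "f \<in> borel_measurable borel"
  shows "(\<integral>\<^sup>+x. f (c + x) \<partial>lborel) = (\<integral>\<^sup>+x. f x \<partial>lborel)"
proof -
  have "(\<integral>\<^sup>+x. f x \<partial>lborel) = (\<integral>\<^sup>+x. f x \<partial>distr lborel borel ((+) c))"
    by (simp add: lborel_distr_plus)
  then show ?thesis by (subst (asm) nn_integral_distr) auto
qed

lemma integral_lborel_translate:
  fixes f :: "'a::euclidean_space \<Rightarrow> real"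
  assumes [measurable]: "f \<in> borel_measurable borel"
  shows "(\<integral>x. f (c + x) \<partial>lborel) = (\<integral>x. f x \<partial>lborel)"
    and "integrable lborel (\<lambda>x. f (c + x)) \<longleftrightarrow> integrable lborel f"
proof -
  have "(\<integral>x. f x \<partial>lborel) = (\<integral>x. f x \<partial>distr lborel borel ((+) c))"
    by (simp add: lborel_distr_plus)
  then show "(\<integral>x. f (c + x) \<partial>lborel) = (\<integral>x. f x \<partial>lborel)" by (subst (asm) integral_distr) auto
  have "integrable lborel f \<longleftrightarrow> integrable (distr lborel borel ((+) c)) f"
    by (simp add: lborel_distr_plus)
  then show "integrable lborel (\<lambda>x. f (c + x)) \<longleftrightarrow> integrable lborel f"
    by (subst (asm) integrable_distr_eq) auto
qed

lemma dform_near: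
  fixes u :: "'a::euclidean_space \<Rightarrow> real"
  assumes [measurable]: "u \<in> borel_measurable borel"
  shows "dform {} \<beta> p u =
    (\<integral>\<^sup>+x. \<integral>\<^sup>+z. ennreal (nkern \<beta> z * \<bar>u x - u (x + z)\<bar> powr p) \<partial>lborel \<partial>lborel)"
proof -
  have "dform {} \<beta> p u =
    (\<integral>\<^sup>+x. \<integral>\<^sup>+y. ennreal (nkern \<beta> (x - y) * \<bar>u x - u y\<bar> powr p) \<partial>lborel \<partial>lborel)"
    unfolding dform_def ker_empty by (subst lborel.nn_integral_fst[symmetric]) auto
  also have "\<dots> = (\<integral>\<^sup>+x. \<integral>\<^sup>+z. ennreal (nkern \<beta> z * \<bar>u x - u (x + z)\<bar> powr p) \<partial>lborel \<partial>lborel)"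
  proof (rule nn_integral_cong)
    fix x
    show "(\<integral>\<^sup>+y. ennreal (nkern \<beta> (x - y) * \<bar>u x - u y\<bar> powr p) \<partial>lborel) =
      (\<integral>\<^sup>+z. ennreal (nkern \<beta> z * \<bar>u x - u (x + z)\<bar> powr p) \<partial>lborel)"
      by (subst nn_integral_lborel_translate[of _ x, symmetric]) (auto simp: nkern_minus)
  qed
  finally show ?thesis .
qed

text \<open>A Lipschitz probability density below \<open>1 / W\<close> times the logarithmic kernel.
  As that kernel is not integrable at the origin, \<open>W\<close> can be as large as desired, even
  for densities supported in a small ball; this is what replaces a gain of derivatives.\<close>

definition mollifier :: "real \<Rightarrow> real \<Rightarrow> ('a::euclidean_space \<Rightarrow> real) \<Rightarrow> bool" where
  "mollifier \<rho> W k \<longleftrightarrow> (\<forall>z. 0 \<le> k z) \<and> (\<forall>z. z \<noteq> 0 \<longrightarrow> W * k z \<le> nkern (real DIM('a)) z) \<and>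
     (\<forall>z. \<rho> < norm z \<longrightarrow> k z = 0) \<and> (\<exists>L. L-lipschitz_on UNIV k) \<and> (\<exists>B. \<forall>z. k z \<le> B) \<and>
     integrable lborel k \<and> (LINT z|lborel. k z) = 1"

lemma lipschitz_on_max_const:
  fixes f :: "'a::metric_space \<Rightarrow> real"
  assumes "L-lipschitz_on S f"
  shows "L-lipschitz_on S (\<lambda>x. max c (f x))"
proof (rule lipschitz_onI)
  fix x y assume "x \<in> S" "y \<in> S"
  then have "dist (f x) (f y) \<le> L * dist x y" using assms by (rule lipschitz_onD[rotated])
  moreover have "dist (max c (f x)) (max c (f y)) \<le> dist (f x) (f y)" by (auto simp: dist_real_def max_def)
  ultimately show "dist (max c (f x)) (max c (f y)) \<le> L * dist x y" by linarith
qed (use assms in \<open>rule lipschitz_on_nonneg\<close>)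

text \<open>The truncated kernel \<open>max 0 (max |z| \<epsilon> powr - N - \<rho> powr - N)\<close>, whose mass grows like \<open>ln (\<rho> / \<epsilon>)\<close>.\<close>

lemma mollifier_exists:
  assumes \<rho>: "0 < \<rho>" "\<rho> \<le> 1" and M: "0 < M"
  obtains W k where "M \<le> W" "mollifier \<rho> W (k :: 'a::euclidean_space \<Rightarrow> real)"
proof -
  define N where "N = real DIM('a)"
  define v where "v = unit_ball_vol (real DIM('a))"
  have N: "1 \<le> N" "0 < N" by (auto simp: N_def DIM_ge_Suc0 Suc_leI)
  have v: "0 < v" by (simp add: v_def)
  \<comment> \<open>Chosen so that \<open>N * v * ln (\<rho> / \<epsilon>) = M + v\<close>.
    Subtracting the constant \<open>\<rho> powr - N\<close> removes at most \<open>v\<close> of the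
    mass on the shell between \<epsilon> and \<rho>, which leaves at least \<open>M\<close>.\<close>
  define \<epsilon> where "\<epsilon> = \<rho> * exp (- ((M + v) / (N * v)))"
  have \<epsilon>: "0 < \<epsilon>" "\<epsilon> < \<rho>"
    using \<rho> M N v by (auto simp: \<epsilon>_def mult_less_cancel_left1)
  define g where "g r = max 0 (max r \<epsilon> powr (- N) - \<rho> powr (- N))" for r :: real
  define m where "m z = g (norm z)" for z :: 'a
  have [measurable]: "g \<in> borel_measurable borel" unfolding g_def[abs_def] by measurable
  have [measurable]: "m \<in> borel_measurable borel" unfolding m_def[abs_def] by measurable
  have g0: "0 \<le> g r" for r by (simp add: g_def)
  have gB: "g r \<le> \<epsilon> powr (- N)" for r
    using \<epsilon> N powr_mono2'[of "- N" \<epsilon> "max r \<epsilon>"] powr_ge_zero[of \<rho> "- N"]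
    by (auto simp: g_def intro: order_trans[of _ "max r \<epsilon> powr - N"])
  have gsupp: "g r = 0" if "\<rho> < r" for r
    using that \<rho> \<epsilon> N powr_mono2'[of "- N" \<rho> r] by (auto simp: g_def max_def)
  have m_le: "m z \<le> nkern N z" if "z \<noteq> 0" for z
  proof (cases "norm z \<le> \<rho>")
    case True
    have "max (norm z) \<epsilon> powr (- N) \<le> norm z powr (- N)"
      using that N by (intro powr_mono2') auto
    then have "m z \<le> norm z powr (- N)"
      by (auto simp: m_def g_def intro: order_trans[rotated] add_increasing2)
    then show ?thesis using True \<rho> by (simp add: nkern_def powr_minus field_simps)
  next
    case False
    then show ?thesis using gsupp[of "norm z"] by (simp add: m_def)
  qed
  have lip: "(N * \<epsilon> powr (- N - 1))-lipschitz_on UNIV m"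
  proof -
    have "(N * \<epsilon> powr (- N - 1))-lipschitz_on {\<epsilon>..} (\<lambda>r. r powr (- N))"
    proof (rule lipschitz_onI)
      fix x y assume xy: "x \<in> {\<epsilon>..}" "y \<in> {\<epsilon>..}"
      have "norm (x powr (- N) - y powr (- N)) \<le> N * \<epsilon> powr (- N - 1) * norm (x - y)"
      proof (rule field_differentiable_bound[where S = "{\<epsilon>..}" and f' = "\<lambda>r. - N * r powr (- N - 1)"])
        show "((\<lambda>r. r powr (- N)) has_field_derivative - N * r powr (- N - 1)) (at r within {\<epsilon>..})"
          if "r \<in> {\<epsilon>..}" for r
          using that \<epsilon> by (auto intro!: derivative_eq_intros simp: powr_diff)
        show "norm (- N * r powr (- N - 1)) \<le> N * \<epsilon> powr (- N - 1)" if "r \<in> {\<epsilon>..}" for r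
          using that \<epsilon> N by (auto simp: abs_mult intro!: powr_mono2')
      qed (use xy in auto)
      then show "dist (x powr (- N)) (y powr (- N)) \<le> N * \<epsilon> powr (- N - 1) * dist x y"
        by (simp add: dist_norm)
    qed (use N in auto)
    then have f2: "(N * \<epsilon> powr (- N - 1))-lipschitz_on ((\<lambda>z::'a. max \<epsilon> (norm z)) ` UNIV) (\<lambda>r. r powr (- N))"
      by (rule lipschitz_on_subset) auto
    have f1: "1-lipschitz_on UNIV (\<lambda>z::'a. max \<epsilon> (norm z))"
      by (intro lipschitz_on_max_const lipschitz_onI) (auto simp: dist_real_def dist_norm norm_triangle_ineq3)
    note lipschitz_on_compose2[OF f1 f2]
    then have "(N * \<epsilon> powr (- N - 1) + 0)-lipschitz_on UNIV (\<lambda>z::'a. (max \<epsilon> (norm z)) powr (- N) - \<rho> powr (- N))"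
      by (intro lipschitz_on_diff) (auto intro: lipschitz_on_constant)
    then show ?thesis
      unfolding m_def[abs_def] g_def[abs_def] by (intro lipschitz_on_max_const) (simp add: max.commute)
  qed
  have fin: "(\<integral>\<^sup>+z. ennreal (m z) \<partial>lborel) < \<infinity>"
  proof -
    have "(\<integral>\<^sup>+z. ennreal (m z) \<partial>lborel) \<le> (\<integral>\<^sup>+z. ennreal (\<epsilon> powr (- N)) * indicator (cball (0::'a) 1) z \<partial>lborel)"
    proof (rule nn_integral_mono)
      fix z :: 'a
      show "ennreal (m z) \<le> ennreal (\<epsilon> powr (- N)) * indicator (cball 0 1) z"
        using gB[of "norm z"] gsupp[of "norm z"] \<rho> by (auto simp: m_def indicator_def intro: ennreal_leI)
    qed
    also have "\<dots> < \<infinity>"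
      by (subst nn_integral_cmult_indicator) (auto simp: emeasure_cball ennreal_mult_less_top)
    finally show ?thesis .
  qed
  have int: "integrable lborel m"
    using fin by (intro integrableI_nonneg) (auto simp: m_def g0)
  define W where "W = (LINT z|lborel. m z)"
  have W: "ennreal W = (\<integral>\<^sup>+z. ennreal (m z) \<partial>lborel)"
    unfolding W_def using int by (subst nn_integral_eq_integral) (auto simp: m_def g0)
  have "ennreal M \<le> ennreal W"
  proof -
    have "M \<le> (N * v * ln \<rho> - v / \<rho> powr N * \<rho> powr N) - (N * v * ln \<epsilon> - v / \<rho> powr N * \<epsilon> powr N)"
    proof -
      have "ln \<epsilon> = ln \<rho> - (M + v) / (N * v)"
        using \<rho> by (simp add: \<epsilon>_def ln_mult)
      then have "N * v * ln \<rho> - N * v * ln \<epsilon> = M + v"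
        using N v by (simp add: right_diff_distrib)
      moreover have "0 \<le> v / \<rho> powr N * \<epsilon> powr N" using v by simp
      moreover have "v / \<rho> powr N * \<rho> powr N = v" using \<rho> by simp
      ultimately show ?thesis by linarith
    qed
    then have "ennreal M \<le> ennreal ((N * v * ln \<rho> - v / \<rho> powr N * \<rho> powr N) - (N * v * ln \<epsilon> - v / \<rho> powr N * \<epsilon> powr N))"
      by (rule ennreal_leI)
    also have "\<dots> = (\<integral>\<^sup>+r. ennreal (N * v * (1 / r) - v / \<rho> powr N * (N * r powr (N - 1))) * indicator {\<epsilon>..\<rho>} r \<partial>lborel)"
    proof (rule nn_integral_FTC_Icc[where F = "\<lambda>r. N * v * ln r - v / \<rho> powr N * r powr N", symmetric])
      fix r assume "r \<in> {\<epsilon>..\<rho>}"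
      then have "\<epsilon> \<le> r" "r \<le> \<rho>" by auto
      then have r: "0 < r" using \<epsilon> by simp
      show "((\<lambda>r. N * v * ln r - v / \<rho> powr N * r powr N) has_real_derivative N * v * (1 / r) - v / \<rho> powr N * (N * r powr (N - 1))) (at r)"
        using r \<rho> by (auto intro!: derivative_eq_intros simp: powr_diff mult_ac)
      have "r powr N \<le> \<rho> powr N" using r \<open>r \<le> \<rho>\<close> N by (intro powr_mono2) auto
      then have "N * v * (r powr N / \<rho> powr N) \<le> N * v * 1"
        using N v \<rho> by (intro mult_left_mono) auto
      then have "0 \<le> (N * v - N * v * (r powr N / \<rho> powr N)) / r" using r by simp
      also have "\<dots> = N * v * (1 / r) - v / \<rho> powr N * (N * r powr (N - 1))"
        using r \<rho> by (simp add: powr_diff diff_divide_distrib mult_ac)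
      finally show "0 \<le> N * v * (1 / r) - v / \<rho> powr N * (N * r powr (N - 1))" .
    qed (use \<epsilon> in auto)
    also have "\<dots> \<le> (\<integral>\<^sup>+r. ennreal (N * v * r ^ (DIM('a) - 1)) * indicator {0..} r * ennreal (g r) \<partial>lborel)"
    proof (rule nn_integral_mono)
      fix r :: real
      show "ennreal (N * v * (1 / r) - v / \<rho> powr N * (N * r powr (N - 1))) * indicator {\<epsilon>..\<rho>} r
        \<le> ennreal (N * v * r ^ (DIM('a) - 1)) * indicator {0..} r * ennreal (g r)"
      proof (cases "r \<in> {\<epsilon>..\<rho>}")
        case True
        then have r: "0 < r" "\<epsilon> \<le> r" using \<epsilon> by auto
        have pw: "r ^ (DIM('a) - 1) = r powr (N - 1)"
          using r DIM_ge_Suc0[where 'a = 'a] by (simp add: N_def powr_realpow[symmetric] of_nat_diff)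
        have "N * v * (1 / r) - v / \<rho> powr N * (N * r powr (N - 1)) = N * v * r powr (N - 1) * (r powr (- N) - \<rho> powr (- N))"
          using r \<rho> by (simp add: powr_diff powr_minus field_simps)
        also have "\<dots> \<le> N * v * r powr (N - 1) * g r"
          using N v r by (intro mult_left_mono) (auto simp: g_def max_absorb1)
        finally show ?thesis
          unfolding pw using True r g0[of r] N v by (simp add: ennreal_mult[symmetric] ennreal_leI)
      qed auto
    qed
    also have "\<dots> = ennreal W"
      unfolding W m_def N_def v_def by (subst nn_integral_norm) (auto simp: N_def[symmetric])
    finally show ?thesis .
  qed
  then have MW: "M \<le> W" using M
    by (metis ennreal_le_iff2 less_le_not_le order.trans ennreal_leI linorder_not_le)
  have W0: "0 < W" using MW M by simp
  have "mollifier \<rho> W (\<lambda>z. m z / W)"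
    unfolding mollifier_def N_def[symmetric]
  proof (intro conjI allI impI)
    show "\<exists>L. L-lipschitz_on UNIV (\<lambda>z. m z / W)"
      using lipschitz_on_cmult_real[OF lip, of "1 / W"] by auto
    show "\<exists>B. \<forall>z. m z / W \<le> B"
      using gB W0 by (auto intro!: exI[of _ "\<epsilon> powr (- N) / W"] divide_right_mono simp: m_def)
    show "(LINT z|lborel. m z / W) = 1" using W0 by (simp add: W_def)
    show "integrable lborel (\<lambda>z. m z / W)" using int by simp
  qed (use W0 m_le g0 gsupp int in \<open>auto simp: m_def\<close>)
  with MW show thesis by (rule that)
qed

text \<open>The argument \<open>x + z\<close> makes \<open>conv k u x - u x\<close> an average of
  the increments that appear in \<open>dform_near\<close>.\<close>

definition conv :: "('a::euclidean_space \<Rightarrow> real) \<Rightarrow> ('a \<Rightarrow> real) \<Rightarrow> 'a \<Rightarrow> real" where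
  "conv k u x = (LINT z|lborel. k z * u (x + z))"

lemma conv_measurable [measurable]:
  assumes [measurable]: "k \<in> borel_measurable borel" "u \<in> borel_measurable borel"
  shows "conv k u \<in> borel_measurable borel"
  unfolding conv_def[abs_def] by measurable

lemma abs_powr_tangent:
  assumes "1 < p"
  shows "\<bar>a\<bar> powr p + p * h p a * (t - a) \<le> \<bar>t\<bar> powr p"
  using convex_on_imp_above_tangent[OF convex_on_abs_powr[OF assms], of a t "p * h p a"]
    DERIV_abs_powr[OF assms, of a]
  by (simp add: algebra_simps)

text \<open>The tangent line at the mean is integrated against \<open>k\<close>. The right-hand side
  is allowed to be infinite, in which case there is nothing to prove.\<close>

lemma weighted_jensen:
  fixes k f :: "'a \<Rightarrow> real"
  assumes p: "1 < p" and k: "integrable M k" "\<And>z. 0 \<le> k z" "(LINT z|M. k z) = 1"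
    and kf: "integrable M (\<lambda>z. k z * f z)" and [measurable]: "f \<in> borel_measurable M"
  shows "ennreal (\<bar>LINT z|M. k z * f z\<bar> powr p) \<le> (\<integral>\<^sup>+z. ennreal (k z * \<bar>f z\<bar> powr p) \<partial>M)"
proof (cases "(\<integral>\<^sup>+z. ennreal (k z * \<bar>f z\<bar> powr p) \<partial>M) < \<infinity>")
  case True
  have [measurable]: "k \<in> borel_measurable M" using k(1) by auto
  have int: "integrable M (\<lambda>z. k z * \<bar>f z\<bar> powr p)"
    using True k(2) by (intro integrableI_nonneg) auto
  define a where "a = (LINT z|M. k z * f z)"
  have "\<bar>a\<bar> powr p = (LINT z|M. k z * \<bar>a\<bar> powr p + p * h p a * (k z * f z - k z * a))"
    using k kf by (simp add: a_def)
  also have "\<dots> \<le> (LINT z|M. k z * \<bar>f z\<bar> powr p)"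
  proof (rule integral_mono)
    show "integrable M (\<lambda>z. k z * \<bar>a\<bar> powr p + p * h p a * (k z * f z - k z * a))"
      using k kf by auto
    fix z
    have "k z * (\<bar>a\<bar> powr p + p * h p a * (f z - a)) \<le> k z * \<bar>f z\<bar> powr p"
      using k(2) by (intro mult_left_mono abs_powr_tangent p) auto
    then show "k z * \<bar>a\<bar> powr p + p * h p a * (k z * f z - k z * a) \<le> k z * \<bar>f z\<bar> powr p"
      by (simp add: algebra_simps)
  qed (rule int)
  finally have "\<bar>a\<bar> powr p \<le> (LINT z|M. k z * \<bar>f z\<bar> powr p)" .
  then show ?thesis
    using int k(2) by (subst nn_integral_eq_integral) (auto simp: a_def intro: ennreal_leI)
qed (auto simp: not_less top_unique)

section \<open>Averages against a mollifier\<close>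

context
  fixes \<rho> W p :: real and k u :: "'a::euclidean_space \<Rightarrow> real"
  assumes moll: "mollifier \<rho> W k" and W: "0 < W" and p: "1 < p"
    and u[measurable]: "u \<in> borel_measurable borel" and u_int: "integrable lborel u"
begin

lemma moll_facts:
  shows "\<And>z. 0 \<le> k z" "\<And>z. z \<noteq> 0 \<Longrightarrow> k z \<le> nkern (real DIM('a)) z / W"
    "\<And>z. \<rho> < norm z \<Longrightarrow> k z = 0" "integrable lborel k" "(LINT z|lborel. k z) = 1"
  using moll W by (auto simp: mollifier_def field_simps)

lemma moll_measurable [measurable]: "k \<in> borel_measurable borel"
  using moll_facts(4) by auto

lemma conv_integrable: "integrable lborel (\<lambda>z. k z * u (x + z))"
proof -
  obtain B where B: "\<And>z. k z \<le> B" using moll by (auto simp: mollifier_def)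
  have ux: "integrable lborel (\<lambda>z. u (x + z))" using u_int by (simp add: integral_lborel_translate)
  show ?thesis
  proof (rule Bochner_Integration.integrable_bound)
    show "integrable lborel (\<lambda>z. B * u (x + z))" using ux by auto
    show "AE z in lborel. norm (k z * u (x + z)) \<le> norm (B * u (x + z))"
    proof (rule AE_I2)
      fix z
      have "\<bar>k z\<bar> \<le> \<bar>B\<bar>" using B[of z] moll_facts(1)[of z] by linarith
      then show "norm (k z * u (x + z)) \<le> norm (B * u (x + z))"
        by (simp add: abs_mult mult_right_mono)
    qed
  qed auto
qed

lemma conv_alt: "conv k u x = (LINT w|lborel. k (w - x) * u w)"
  unfolding conv_def by (subst integral_lborel_translate[of _ x, symmetric]) auto

text \<open>The kernel carries the Lipschitz constant, so the constant of the average depends on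
  \<open>u\<close> only through its L1 norm. For a bounded family this is equicontinuity.\<close>

lemma conv_lipschitz:
  assumes L: "L-lipschitz_on UNIV k"
  shows "(L * (LINT w|lborel. \<bar>u w\<bar>))-lipschitz_on UNIV (conv k u)"
proof -
  have int: "integrable lborel (\<lambda>w. k (w - x) * u w)" for x
    using conv_integrable[of x] integral_lborel_translate(2)[of "\<lambda>w. k (w - x) * u w" x] by simp
  show ?thesis
  proof (rule lipschitz_onI)
    fix x y
    have "\<bar>conv k u x - conv k u y\<bar> = \<bar>LINT w|lborel. k (w - x) * u w - k (w - y) * u w\<bar>"
      using int by (simp add: conv_alt)
    also have "\<dots> \<le> (LINT w|lborel. \<bar>k (w - x) * u w - k (w - y) * u w\<bar>)"
      by (rule integral_abs_bound)
    also have "\<dots> \<le> (LINT w|lborel. L * dist x y * \<bar>u w\<bar>)"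
    proof (rule integral_mono)
      fix w
      have "\<bar>k (w - x) - k (w - y)\<bar> \<le> L * dist x y"
        using lipschitz_onD[OF L, of "w - x" "w - y"] by (simp add: dist_real_def dist_norm norm_minus_commute)
      then have "\<bar>k (w - x) - k (w - y)\<bar> * \<bar>u w\<bar> \<le> L * dist x y * \<bar>u w\<bar>"
        by (rule mult_right_mono) simp
      then show "\<bar>k (w - x) * u w - k (w - y) * u w\<bar> \<le> L * dist x y * \<bar>u w\<bar>"
        by (simp add: left_diff_distrib flip: abs_mult)
    qed (use int u_int in auto)
    finally show "dist (conv k u x) (conv k u y) \<le> L * (LINT w|lborel. \<bar>u w\<bar>) * dist x y"
      by (simp add: dist_real_def mult_ac)
  qed (use lipschitz_on_nonneg[OF L] in auto)
qed

lemma abs_conv_le: "(\<And>x. \<bar>u x\<bar> \<le> B) \<Longrightarrow> \<bar>conv k u x\<bar> \<le> B"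
proof -
  assume B: "\<And>x. \<bar>u x\<bar> \<le> B"
  have "\<bar>conv k u x\<bar> \<le> (LINT z|lborel. \<bar>k z * u (x + z)\<bar>)"
    unfolding conv_def by (rule integral_abs_bound)
  also have "\<dots> \<le> (LINT z|lborel. k z * B)"
  proof (rule integral_mono)
    show "integrable lborel (\<lambda>z. \<bar>k z * u (x + z)\<bar>)" by (intro integrable_abs conv_integrable)
    show "\<bar>k z * u (x + z)\<bar> \<le> k z * B" for z
      using moll_facts(1)[of z] B[of "x + z"] by (simp add: abs_mult mult_left_mono)
  qed (use moll_facts(4) in auto)
  finally show ?thesis using moll_facts by simp
qed

lemma abs_conv_le_L1: "(\<And>z. k z \<le> B) \<Longrightarrow> \<bar>conv k u x\<bar> \<le> B * (LINT z|lborel. \<bar>u z\<bar>)"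
proof -
  assume B: "\<And>z. k z \<le> B"
  have ux: "integrable lborel (\<lambda>z. \<bar>u (x + z)\<bar>)" using u_int integral_lborel_translate(2)[of u x] by simp
  have "\<bar>conv k u x\<bar> \<le> (LINT z|lborel. \<bar>k z * u (x + z)\<bar>)"
    unfolding conv_def by (rule integral_abs_bound)
  also have "\<dots> \<le> (LINT z|lborel. B * \<bar>u (x + z)\<bar>)"
  proof (rule integral_mono)
    show "integrable lborel (\<lambda>z. \<bar>k z * u (x + z)\<bar>)" by (intro integrable_abs conv_integrable)
    show "\<bar>k z * u (x + z)\<bar> \<le> B * \<bar>u (x + z)\<bar>" for z
      using moll_facts(1)[of z] B[of z] by (simp add: abs_mult mult_right_mono)
  qed (use ux in auto)
  also have "\<dots> = B * (LINT z|lborel. \<bar>u z\<bar>)"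
    using integral_lborel_translate(1)[of "\<lambda>z. \<bar>u z\<bar>" x] by simp
  finally show ?thesis .
qed

lemma conv_eq_0: "(\<And>z. norm z \<le> \<rho> \<Longrightarrow> u (x + z) = 0) \<Longrightarrow> conv k u x = 0"
proof -
  assume *: "\<And>z. norm z \<le> \<rho> \<Longrightarrow> u (x + z) = 0"
  have eq: "k z * u (x + z) = 0" for z
    using *[of z] moll_facts(3)[of z] by (cases "norm z \<le> \<rho>") auto
  show ?thesis unfolding conv_def eq by simp
qed

text \<open>By Jensen the left-hand side is at most the \<open>k\<close>-average of the increments,
  and \<open>k\<close> is below the kernel divided by \<open>W\<close>. At \<open>z = 0\<close>,
  where the comparison of kernels fails, the increment vanishes.\<close>

lemma conv_minus_le:
  "(\<integral>\<^sup>+x. ennreal (\<bar>conv k u x - u x\<bar> powr p) \<partial>lborel) \<le> ennreal (1 / W) * dform {} (real DIM('a)) p u"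
proof -
  let ?N = "real DIM('a)"
  have "(\<integral>\<^sup>+x. ennreal (\<bar>conv k u x - u x\<bar> powr p) \<partial>lborel)
    \<le> (\<integral>\<^sup>+x. \<integral>\<^sup>+z. ennreal (1 / W) * ennreal (nkern ?N z * \<bar>u x - u (x + z)\<bar> powr p) \<partial>lborel \<partial>lborel)"
  proof (rule nn_integral_mono)
    fix x
    have "integrable lborel (\<lambda>z. k z * (u (x + z) - u x))"
      using conv_integrable[of x] moll_facts(4) by (simp add: right_diff_distrib)
    then have "ennreal (\<bar>LINT z|lborel. k z * (u (x + z) - u x)\<bar> powr p)
      \<le> (\<integral>\<^sup>+z. ennreal (k z * \<bar>u (x + z) - u x\<bar> powr p) \<partial>lborel)"
      using moll_facts by (intro weighted_jensen p) auto
    also have "(LINT z|lborel. k z * (u (x + z) - u x)) = conv k u x - u x"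
      using conv_integrable[of x] moll_facts(4,5) by (simp add: right_diff_distrib conv_def)
    also have "(\<integral>\<^sup>+z. ennreal (k z * \<bar>u (x + z) - u x\<bar> powr p) \<partial>lborel)
      \<le> (\<integral>\<^sup>+z. ennreal (1 / W) * ennreal (nkern ?N z * \<bar>u x - u (x + z)\<bar> powr p) \<partial>lborel)"
    proof (rule nn_integral_mono)
      fix z
      have "k z * \<bar>u (x + z) - u x\<bar> powr p \<le> nkern ?N z / W * \<bar>u x - u (x + z)\<bar> powr p"
      proof (cases "z = 0")
        case False
        then show ?thesis
          unfolding abs_minus_commute[of "u (x + z)"] by (intro mult_right_mono moll_facts(2)) auto
      qed simp
      then show "ennreal (k z * \<bar>u (x + z) - u x\<bar> powr p)
        \<le> ennreal (1 / W) * ennreal (nkern ?N z * \<bar>u x - u (x + z)\<bar> powr p)"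
        using W by (simp add: ennreal_mult[symmetric] ennreal_leI)
    qed
    finally show "ennreal (\<bar>conv k u x - u x\<bar> powr p)
      \<le> (\<integral>\<^sup>+z. ennreal (1 / W) * ennreal (nkern ?N z * \<bar>u x - u (x + z)\<bar> powr p) \<partial>lborel)" .
  qed
  also have "\<dots> = ennreal (1 / W) * dform {} ?N p u"
    unfolding dform_near[OF u] by (subst nn_integral_cmult, measurable)+
  finally show ?thesis .
qed

text \<open>The average is a convex combination of translates of \<open>u\<close>, and the near form
  is convex and invariant under translation.\<close>

lemma dform_conv_le: "dform {} (real DIM('a)) p (conv k u) \<le> dform {} (real DIM('a)) p u"
proof -
  let ?N = "real DIM('a)"
  define G where "G x = (\<integral>\<^sup>+w. ennreal (nkern ?N w * \<bar>u x - u (x + w)\<bar> powr p) \<partial>lborel)" for x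
  have [measurable]: "G \<in> borel_measurable borel" unfolding G_def[abs_def] by measurable
  have "dform {} ?N p (conv k u) =
    (\<integral>\<^sup>+x. \<integral>\<^sup>+w. ennreal (nkern ?N w * \<bar>conv k u x - conv k u (x + w)\<bar> powr p) \<partial>lborel \<partial>lborel)"
    by (rule dform_near) measurable
  also have "\<dots> \<le> (\<integral>\<^sup>+x. \<integral>\<^sup>+w. \<integral>\<^sup>+z. ennreal (k z) *
      ennreal (nkern ?N w * \<bar>u (x + z) - u (x + z + w)\<bar> powr p) \<partial>lborel \<partial>lborel \<partial>lborel)"
  proof (intro nn_integral_mono)
    fix x w
    have int: "integrable lborel (\<lambda>z. k z * (u (x + z) - u (x + w + z)))"
      using conv_integrable[of x] conv_integrable[of "x + w"] by (simp add: right_diff_distrib)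
    have "ennreal (nkern ?N w * \<bar>conv k u x - conv k u (x + w)\<bar> powr p) =
      ennreal (nkern ?N w) * ennreal (\<bar>LINT z|lborel. k z * (u (x + z) - u (x + w + z))\<bar> powr p)"
      using conv_integrable[of x] conv_integrable[of "x + w"]
      by (simp add: right_diff_distrib conv_def ennreal_mult)
    also have "\<dots> \<le> ennreal (nkern ?N w) * (\<integral>\<^sup>+z. ennreal (k z * \<bar>u (x + z) - u (x + w + z)\<bar> powr p) \<partial>lborel)"
      using moll_facts int by (intro mult_left_mono weighted_jensen p) auto
    also have "\<dots> = (\<integral>\<^sup>+z. ennreal (k z) * ennreal (nkern ?N w * \<bar>u (x + z) - u (x + z + w)\<bar> powr p) \<partial>lborel)"
      using moll_facts(1) by (subst nn_integral_cmult[symmetric])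
        (auto intro!: nn_integral_cong simp: ennreal_mult mult_ac add_ac)
    finally show "ennreal (nkern ?N w * \<bar>conv k u x - conv k u (x + w)\<bar> powr p) \<le>
      (\<integral>\<^sup>+z. ennreal (k z) * ennreal (nkern ?N w * \<bar>u (x + z) - u (x + z + w)\<bar> powr p) \<partial>lborel)" .
  qed
  also have "\<dots> = (\<integral>\<^sup>+x. \<integral>\<^sup>+z. \<integral>\<^sup>+w. ennreal (k z) *
      ennreal (nkern ?N w * \<bar>u (x + z) - u (x + z + w)\<bar> powr p) \<partial>lborel \<partial>lborel \<partial>lborel)"
    by (intro nn_integral_cong lborel_pair.Fubini') measurable
  also have "\<dots> = (\<integral>\<^sup>+x. \<integral>\<^sup>+z. ennreal (k z) * G (x + z) \<partial>lborel \<partial>lborel)"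
    unfolding G_def by (intro nn_integral_cong nn_integral_cmult) measurable
  also have "\<dots> = (\<integral>\<^sup>+z. \<integral>\<^sup>+x. ennreal (k z) * G (x + z) \<partial>lborel \<partial>lborel)"
    by (intro lborel_pair.Fubini') measurable
  also have "\<dots> = (\<integral>\<^sup>+z. ennreal (k z) * (\<integral>\<^sup>+x. G x \<partial>lborel) \<partial>lborel)"
  proof (intro nn_integral_cong)
    fix z
    show "(\<integral>\<^sup>+x. ennreal (k z) * G (x + z) \<partial>lborel) = ennreal (k z) * (\<integral>\<^sup>+x. G x \<partial>lborel)"
      using nn_integral_lborel_translate[of G z]
      by (subst nn_integral_cmult) (auto simp: add.commute)
  qed
  also have "\<dots> = (\<integral>\<^sup>+z. ennreal (k z) \<partial>lborel) * (\<integral>\<^sup>+x. G x \<partial>lborel)"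
    by (subst nn_integral_multc) auto
  also have "(\<integral>\<^sup>+z. ennreal (k z) \<partial>lborel) = 1"
    using moll_facts by (subst nn_integral_eq_integral) auto
  also have "1 * (\<integral>\<^sup>+x. G x \<partial>lborel) = dform {} ?N p u"
    unfolding G_def dform_near[OF u] by simp
  finally show ?thesis .
qed

end

declare moll_measurable [measurable del]

section \<open>Compactness\<close>

text \<open>The Riesz-Fischer theorem: Chebyshev's inequality and the Borel-Cantelli lemma make a
  fast subsequence converge almost everywhere, and Fatou's lemma returns to the norm.\<close>

lemma Lp_complete:
  fixes v :: "nat \<Rightarrow> 'a \<Rightarrow> real"
  assumes p: "0 < p" and v[measurable]: "\<And>n. v n \<in> borel_measurable M"
    and cauchy: "\<And>e. 0 < e \<Longrightarrow> \<exists>n0. \<forall>m\<ge>n0. \<forall>n\<ge>n0.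
      (\<integral>\<^sup>+x. ennreal (\<bar>v m x - v n x\<bar> powr p) \<partial>M) \<le> ennreal e"
  obtains r U where "strict_mono r" "U \<in> borel_measurable M" "AE x in M. (\<lambda>n. v (r n) x) \<longlonglongrightarrow> U x"
    "\<And>e. 0 < e \<Longrightarrow> \<exists>n0. \<forall>n\<ge>n0. (\<integral>\<^sup>+x. ennreal (\<bar>v n x - U x\<bar> powr p) \<partial>M) \<le> ennreal e"
proof -
  \<comment> \<open>With this accuracy, Chebyshev's inequality bounds by \<open>(1/2) ^ i\<close>
    the measure of the set where consecutive terms differ by at least
    \<open>(1/2) ^ i\<close>.\<close>
  define \<epsilon> where "\<epsilon> i = (1/2) ^ i * ((1/2) ^ i) powr p" for i :: nat
  have \<epsilon>: "0 < \<epsilon> i" for i by (simp add: \<epsilon>_def)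
  define P where "P i n0 \<longleftrightarrow> (\<forall>m\<ge>n0. \<forall>n\<ge>n0. (\<integral>\<^sup>+x. ennreal (\<bar>v m x - v n x\<bar> powr p) \<partial>M) \<le> ennreal (\<epsilon> i))" for i n0
  have "\<exists>r. \<forall>i. P i (r i) \<and> r i < r (Suc i)"
  proof (rule dependent_nat_choice)
    show "\<exists>n0. P 0 n0" using cauchy[OF \<epsilon>] unfolding P_def by blast
    fix n0 i
    obtain n1 where "P (Suc i) n1" using cauchy[OF \<epsilon>] unfolding P_def by blast
    then have "P (Suc i) (max n1 (Suc n0))" unfolding P_def by simp
    then show "\<exists>y. P (Suc i) y \<and> n0 < y" by (intro exI[of _ "max n1 (Suc n0)"]) auto
  qed
  then obtain r where r: "\<And>i. P i (r i)" "\<And>i. r i < r (Suc i)" by blast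
  have mono: "strict_mono r" using r(2) by (simp add: strict_mono_Suc_iff)
  define d where "d i x = v (r (Suc i)) x - v (r i) x" for i x
  have [measurable]: "d i \<in> borel_measurable M" for i unfolding d_def[abs_def] by measurable
  define A where "A i = {x\<in>space M. (1/2) ^ i \<le> \<bar>d i x\<bar>}" for i
  have [measurable]: "A i \<in> sets M" for i unfolding A_def by measurable
  have em: "emeasure M (A i) \<le> ennreal ((1/2) ^ i)" for i
  proof -
    have "ennreal (((1/2) ^ i) powr p) * emeasure M (A i) = (\<integral>\<^sup>+x. ennreal (((1/2) ^ i) powr p) * indicator (A i) x \<partial>M)"
      by (subst nn_integral_cmult_indicator) auto
    also have "\<dots> \<le> (\<integral>\<^sup>+x. ennreal (\<bar>d i x\<bar> powr p) \<partial>M)"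
      using p by (intro nn_integral_mono) (auto simp: A_def indicator_def intro!: ennreal_leI powr_mono2)
    also have "\<dots> \<le> ennreal (\<epsilon> i)"
      using r(1)[of i] r(2)[of i] unfolding P_def d_def by (simp add: less_imp_le)
    also have "\<dots> = ennreal (((1/2) ^ i) powr p) * ennreal ((1/2) ^ i)"
      by (simp add: \<epsilon>_def ennreal_mult mult.commute)
    finally show ?thesis
      by (subst (asm) ennreal_mult_le_mult_iff) auto
  qed
  have fin: "emeasure M (A i) < \<infinity>" for i
    using em[of i] by (rule order.strict_trans1) simp
  have "AE x in M. \<forall>\<^sub>F i in sequentially. x \<in> space M - A i"
  proof (rule borel_cantelli_AE1)
    show "summable (\<lambda>i. measure M (A i))"
    proof (rule summable_comparison_test')
      show "summable (\<lambda>i. (1/2::real) ^ i)" by (rule summable_geometric) simp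
      show "norm (measure M (A i)) \<le> (1/2) ^ i" if "0 \<le> i" for i
        using em[of i] fin[of i] by (simp add: emeasure_eq_ennreal_measure top.not_eq_extremum ennreal_le_iff)
    qed
  qed (use fin in auto)
  then have conv: "AE x in M. convergent (\<lambda>i. v (r i) x)"
  proof eventually_elim
    case (elim x)
    then have "\<forall>\<^sub>F i in sequentially. norm (d i x) \<le> (1/2) ^ i"
      by eventually_elim (auto simp: A_def)
    then have "summable (\<lambda>i. d i x)"
      by (rule summable_comparison_test_ev) (rule summable_geometric, simp)
    then have "convergent (\<lambda>n. (\<Sum>i<n. d i x) + v (r 0) x)"
      by (intro convergent_add convergent_const) (simp add: summable_iff_convergent)
    moreover have "(\<Sum>i<n. d i x) + v (r 0) x = v (r n) x" for n
      unfolding d_def by (subst sum_lessThan_telescope) simp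
    ultimately show ?case by simp
  qed
  define U where "U x = lim (\<lambda>i. v (r i) x)" for x
  have [measurable]: "U \<in> borel_measurable M" unfolding U_def[abs_def] by measurable
  have AE: "AE x in M. (\<lambda>n. v (r n) x) \<longlonglongrightarrow> U x"
    using conv by eventually_elim (simp add: U_def convergent_LIMSEQ_iff)
  have lim: "\<exists>n0. \<forall>n\<ge>n0. (\<integral>\<^sup>+x. ennreal (\<bar>v n x - U x\<bar> powr p) \<partial>M) \<le> ennreal e" if e: "0 < e" for e
  proof -
    obtain n0 where n0: "\<And>m n. n0 \<le> m \<Longrightarrow> n0 \<le> n \<Longrightarrow>
        (\<integral>\<^sup>+x. ennreal (\<bar>v m x - v n x\<bar> powr p) \<partial>M) \<le> ennreal e"
      using cauchy[OF e] by blast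
    show ?thesis
    proof (intro exI[of _ n0] allI impI)
      fix n assume n: "n0 \<le> n"
      have "(\<integral>\<^sup>+x. ennreal (\<bar>v n x - U x\<bar> powr p) \<partial>M)
        = (\<integral>\<^sup>+x. liminf (\<lambda>i. ennreal (\<bar>v n x - v (r i) x\<bar> powr p)) \<partial>M)"
      proof (rule nn_integral_cong_AE, use AE in eventually_elim)
        case (elim x)
        have "(\<lambda>i. ennreal (\<bar>v n x - v (r i) x\<bar> powr p)) \<longlonglongrightarrow> ennreal (\<bar>v n x - U x\<bar> powr p)"
          using elim p by (intro tendsto_intros tendsto_powr') auto
        then show ?case by (intro lim_imp_Liminf[symmetric]) auto
      qed
      also have "\<dots> \<le> liminf (\<lambda>i. \<integral>\<^sup>+x. ennreal (\<bar>v n x - v (r i) x\<bar> powr p) \<partial>M)"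
        by (intro nn_integral_liminf) measurable
      also have "\<dots> \<le> ennreal e"
      proof (rule Liminf_le)
        show "\<forall>\<^sub>F i in sequentially. (\<integral>\<^sup>+x. ennreal (\<bar>v n x - v (r i) x\<bar> powr p) \<partial>M) \<le> ennreal e"
          using eventually_ge_at_top[of n0]
          by eventually_elim (use n seq_suble[OF mono] in \<open>auto intro!: n0 intro: order_trans\<close>)
      qed simp
      finally show "(\<integral>\<^sup>+x. ennreal (\<bar>v n x - U x\<bar> powr p) \<partial>M) \<le> ennreal e" .
    qed
  qed
  show thesis by (rule that[OF mono _ AE lim]) auto
qed

lemma Lp_diff_le:
  assumes "0 < p" and [measurable]: "f \<in> borel_measurable M" "g \<in> borel_measurable M" "w \<in> borel_measurable M"
  shows "(\<integral>\<^sup>+x. ennreal (\<bar>f x - g x\<bar> powr p) \<partial>M) \<le>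
    ennreal (2 powr p) * ((\<integral>\<^sup>+x. ennreal (\<bar>f x - w x\<bar> powr p) \<partial>M) + (\<integral>\<^sup>+x. ennreal (\<bar>g x - w x\<bar> powr p) \<partial>M))"
proof -
  have "(\<integral>\<^sup>+x. ennreal (\<bar>f x - g x\<bar> powr p) \<partial>M) \<le>
    (\<integral>\<^sup>+x. ennreal (2 powr p) * (ennreal (\<bar>f x - w x\<bar> powr p) + ennreal (\<bar>g x - w x\<bar> powr p)) \<partial>M)"
  proof (rule nn_integral_mono)
    fix x
    have "\<bar>f x - g x\<bar> powr p \<le> 2 powr p * (\<bar>f x - w x\<bar> powr p + \<bar>g x - w x\<bar> powr p)"
      using abs_diff_powr_le[OF assms(1), of "f x - w x" "g x - w x"] by simp
    then show "ennreal (\<bar>f x - g x\<bar> powr p) \<le> ennreal (2 powr p) * (ennreal (\<bar>f x - w x\<bar> powr p) + ennreal (\<bar>g x - w x\<bar> powr p))"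
      by (simp add: ennreal_mult[symmetric] ennreal_plus[symmetric] ennreal_leI del: ennreal_plus)
  qed
  also have "\<dots> = ennreal (2 powr p) * ((\<integral>\<^sup>+x. ennreal (\<bar>f x - w x\<bar> powr p) \<partial>M) + (\<integral>\<^sup>+x. ennreal (\<bar>g x - w x\<bar> powr p) \<partial>M))"
    by (subst nn_integral_cmult) (auto simp: nn_integral_add)
  finally show ?thesis .
qed

lemma integrable_of_powr_bound:
  fixes u :: "'a::euclidean_space \<Rightarrow> real"
  assumes p: "1 < p" and \<Omega>[measurable]: "\<Omega> \<in> sets borel" and bdd: "bounded \<Omega>" and C: "0 \<le> C"
    and [measurable]: "u \<in> borel_measurable borel" and supp: "\<And>x. x \<notin> \<Omega> \<Longrightarrow> u x = 0"
    and le: "(\<integral>\<^sup>+x. ennreal (\<bar>u x\<bar> powr p) \<partial>lborel) \<le> ennreal C"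
  shows "integrable lborel u" "(LINT x|lborel. \<bar>u x\<bar>) \<le> measure lborel \<Omega> + C"
proof -
  have fin: "emeasure lborel \<Omega> < \<infinity>" using bdd by (rule emeasure_bounded_finite)
  have "(\<integral>\<^sup>+x. ennreal \<bar>u x\<bar> \<partial>lborel) \<le> (\<integral>\<^sup>+x. indicator \<Omega> x + ennreal (\<bar>u x\<bar> powr p) \<partial>lborel)"
  proof (rule nn_integral_mono)
    fix x
    show "ennreal \<bar>u x\<bar> \<le> indicator \<Omega> x + ennreal (\<bar>u x\<bar> powr p)"
    proof (cases "x \<in> \<Omega>")
      case True
      have "\<bar>u x\<bar> \<le> 1 + \<bar>u x\<bar> powr p"
      proof (cases "\<bar>u x\<bar> \<le> 1")
        case False
        then have "\<bar>u x\<bar> powr 1 \<le> \<bar>u x\<bar> powr p" using p by (intro powr_mono) auto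
        then show ?thesis using False by simp
      qed (simp add: add_increasing2)
      then have "ennreal \<bar>u x\<bar> \<le> ennreal (1 + \<bar>u x\<bar> powr p)" by (rule ennreal_leI)
      then show ?thesis using True by simp
    qed (simp add: supp)
  qed
  also have "\<dots> \<le> emeasure lborel \<Omega> + ennreal C"
    using le by (subst nn_integral_add) (auto intro: add_mono)
  also have "\<dots> = ennreal (measure lborel \<Omega> + C)"
    using fin C by (simp add: emeasure_eq_ennreal_measure top.not_eq_extremum ennreal_plus)
  finally have *: "(\<integral>\<^sup>+x. ennreal \<bar>u x\<bar> \<partial>lborel) \<le> ennreal (measure lborel \<Omega> + C)" .
  show int: "integrable lborel u"
    using order.strict_trans1[OF * ennreal_less_top] by (intro integrableI_bounded) auto
  show "(LINT x|lborel. \<bar>u x\<bar>) \<le> measure lborel \<Omega> + C"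
    using * C int by (subst (asm) nn_integral_eq_integral)
      (auto simp: ennreal_le_iff add_nonneg_nonneg simp del: ennreal_plus)
qed

text \<open>The logarithmic kernel has infinite mass at the origin, so \<open>u\<close> is within \<open>O(1/j)\<close> of its average
  \<open>conv (k j) u\<close>; for fixed \<open>j\<close> these averages are equi-Lipschitz.\<close>

theorem log_compactness:
  fixes u :: "nat \<Rightarrow> 'a::euclidean_space \<Rightarrow> real"
  assumes p: "1 < p" and \<Omega>[measurable]: "\<Omega> \<in> sets borel" and bdd: "bounded \<Omega>" and C: "0 \<le> C"
    and u[measurable]: "\<And>n. u n \<in> borel_measurable borel" and supp: "\<And>n x. x \<notin> \<Omega> \<Longrightarrow> u n x = 0"
    and Lp: "\<And>n. (\<integral>\<^sup>+x. ennreal (\<bar>u n x\<bar> powr p) \<partial>lborel) \<le> ennreal C"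
    and df: "\<And>n. dform {} (real DIM('a)) p (u n) \<le> ennreal C"
  obtains r U where "strict_mono r" "U \<in> borel_measurable borel" "\<And>x. x \<notin> \<Omega> \<Longrightarrow> U x = 0"
    "AE x in lborel. (\<lambda>n. u (r n) x) \<longlonglongrightarrow> U x"
    "(\<lambda>n. \<integral>\<^sup>+x. ennreal (\<bar>u (r n) x - U x\<bar> powr p) \<partial>lborel) \<longlonglongrightarrow> 0"
proof -
  have p0: "0 < p" using p by simp
  define I where "I = measure lborel \<Omega> + C + 1"
  have I: "0 < I" using C by (simp add: I_def add_nonneg_pos)
  have int: "integrable lborel (u n)" and L1: "(LINT x|lborel. \<bar>u n x\<bar>) \<le> I" for n
    using integrable_of_powr_bound[OF p \<Omega> bdd C u supp Lp, of n] by (simp_all add: I_def)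
  have fin: "emeasure lborel \<Omega> < \<infinity>" using bdd by (rule emeasure_bounded_finite)
  have "\<exists>k W. real (Suc j) \<le> W \<and> mollifier 1 W (k :: 'a \<Rightarrow> real)" for j
    using mollifier_exists[of 1 "real (Suc j)"] by (metis of_nat_0_less_iff zero_less_Suc zero_less_one order_refl)
  then obtain k W where W: "\<And>j. real (Suc j) \<le> W j" and k: "\<And>j. mollifier 1 (W j) (k j :: 'a \<Rightarrow> real)"
    by metis
  have W0: "0 < W j" for j using W[of j] by (simp add: order_less_le_trans[rotated])
  have "\<exists>B>0. \<forall>z. k j z \<le> B" for j
  proof -
    obtain B where "\<forall>z. k j z \<le> B" using k[of j] by (auto simp: mollifier_def)
    then show ?thesis by (intro exI[of _ "max 1 B"]) (auto simp: max_def intro: order_trans)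
  qed
  then obtain B where B: "\<And>j. 0 < B j" "\<And>j z. k j z \<le> B j" by metis
  have [measurable]: "k j \<in> borel_measurable borel" for j
    using moll_measurable[OF k W0 p u int] .
  have bd: "\<bar>conv (k j) (u n) x\<bar> \<le> B j * I" for j n x
    using abs_conv_le_L1[OF k W0 p u int B(2)] mult_left_mono[OF L1] B(1)
    by (meson less_imp_le order_trans)
  obtain D :: "'a set" where D: "countable D" "\<And>X. open X \<Longrightarrow> X \<noteq> {} \<Longrightarrow> \<exists>d\<in>D. d \<in> X"
    using countable_dense_exists[where 'a = 'a] by blast
  \<comment> \<open>Division by \<open>B j\<close> gives one bound \<open>I\<close> for all kernels
    and points at once, as the diagonal argument over the countable index set requires.\<close>
  define F where "F n z = conv (k (fst z)) (u n) (snd z) / B (fst z)" for n z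
  have cnt: "countable ((UNIV :: nat set) \<times> D)" using D(1) by auto
  have bnd: "norm (F n z) \<le> I" for n z
  proof -
    have "norm (F n z) = \<bar>conv (k (fst z)) (u n) (snd z)\<bar> / B (fst z)"
      unfolding F_def real_norm_def abs_divide using B(1)[of "fst z"] by (simp only: abs_of_pos)
    also have "\<dots> \<le> I"
      using bd[of "fst z" n "snd z"] unfolding pos_divide_le_eq[OF B(1)] mult.commute[of I] .
    finally show ?thesis .
  qed
  obtain r where r: "strict_mono r"
    and cr: "\<And>z. z \<in> UNIV \<times> D \<Longrightarrow> \<exists>l. (\<lambda>n. F (r n) z) \<longlonglongrightarrow> l"
    using function_convergent_subsequence[OF cnt, of F I] bnd by metis
  have convD: "convergent (\<lambda>n. conv (k j) (u (r n)) x)" if "x \<in> D" for j x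
  proof -
    have "convergent (\<lambda>n. conv (k j) (u (r n)) x / B j)"
      using cr[of "(j, x)"] that by (simp add: convergent_def F_def)
    then show ?thesis using B(1)[of j] by (simp add: convergent_mult_const_right_iff divide_inverse)
  qed
  have equi: "\<exists>L. \<forall>n. L-lipschitz_on UNIV (conv (k j) (u n))" for j
  proof -
    obtain L where L: "L-lipschitz_on UNIV (k j)" using k[of j] by (auto simp: mollifier_def)
    have "(L * I)-lipschitz_on UNIV (conv (k j) (u n))" for n
      using conv_lipschitz[OF k W0 p u int L, of n]
      by (rule lipschitz_on_mono) (auto intro!: mult_left_mono L1 lipschitz_on_nonneg[OF L])
    then show ?thesis by blast
  qed
  \<comment> \<open>Equicontinuity carries convergence from the dense set to every point.\<close>
  have cnv: "convergent (\<lambda>n. conv (k j) (u (r n)) x)" for j x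
  proof -
    obtain L where L: "\<And>n. L-lipschitz_on UNIV (conv (k j) (u n))" using equi by blast
    have L0: "0 \<le> L" using lipschitz_on_nonneg[OF L] .
    have "Cauchy (\<lambda>n. conv (k j) (u (r n)) x)"
    proof (rule metric_CauchyI)
      fix e :: real assume e: "0 < e"
      have "0 < e / (4 * (L + 1))" using e L0 by (intro divide_pos_pos mult_pos_pos) auto
      then have "ball x (e / (4 * (L + 1))) \<noteq> {}" by (simp only: ball_eq_empty not_le)
      then obtain d where d: "d \<in> D" "d \<in> ball x (e / (4 * (L + 1)))"
        using D(2)[OF open_ball] by blast
      have "L * dist x d \<le> (L + 1) * (e / (4 * (L + 1)))"
        using d L0 by (intro mult_mono) auto
      moreover have "(L + 1) * (e / (4 * (L + 1))) = e / 4" using L0 by (simp add: divide_simps)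
      ultimately have ld: "L * dist x d \<le> e / 4" by (rule ord_le_eq_trans)
      have near: "dist (conv (k j) (u n) x) (conv (k j) (u n) d) \<le> e / 4" for n
        using lipschitz_onD[OF L, of x d n] ld by simp
      have "Cauchy (\<lambda>n. conv (k j) (u (r n)) d)"
        using convD[OF d(1)] by (simp add: Cauchy_convergent_iff)
      moreover have "0 < e / 4" using e by simp
      ultimately obtain M where M: "\<And>m n. M \<le> m \<Longrightarrow> M \<le> n \<Longrightarrow>
          dist (conv (k j) (u (r m)) d) (conv (k j) (u (r n)) d) < e / 4"
        using metric_CauchyD by blast
      show "\<exists>M. \<forall>m\<ge>M. \<forall>n\<ge>M. dist (conv (k j) (u (r m)) x) (conv (k j) (u (r n)) x) < e"
      proof (intro exI[of _ M] allI impI)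
        fix m n assume "M \<le> m" "M \<le> n"
        from M[OF this] near[of "r m"] near[of "r n"] e
        show "dist (conv (k j) (u (r m)) x) (conv (k j) (u (r n)) x) < e"
          unfolding dist_real_def by linarith
      qed
    qed
    then show ?thesis by (simp add: Cauchy_convergent_iff)
  qed
  \<comment> \<open>Cutting off outside \<Omega> does not increase the distance to \<open>u\<close>,
    which vanishes there, and lets a constant on a set of finite measure serve as dominating
    function.\<close>
  define a where "a j n x = indicator \<Omega> x * conv (k j) (u (r n)) x" for j n x
  define G where "G j x = indicator \<Omega> x * lim (\<lambda>n. conv (k j) (u (r n)) x)" for j x
  have [measurable]: "a j n \<in> borel_measurable borel" for j n unfolding a_def[abs_def] by measurable
  have [measurable]: "G j \<in> borel_measurable borel" for j unfolding G_def[abs_def] by measurable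
  have aG: "(\<lambda>n. a j n x) \<longlonglongrightarrow> G j x" for j x
    unfolding a_def G_def using cnv[of j x] by (intro tendsto_mult_left) (simp add: convergent_LIMSEQ_iff)
  have a_bd: "\<bar>a j n x\<bar> \<le> B j * I" for j n x
    using bd[of j "r n" x] B(1)[of j] I by (auto simp: a_def indicator_def)
  have G_bd: "\<bar>G j x\<bar> \<le> B j * I" for j x
    using tendsto_rabs[OF aG] by (rule tendsto_upperbound) (simp_all add: a_bd)
  have e1: "(\<integral>\<^sup>+x. ennreal (\<bar>u (r n) x - a j n x\<bar> powr p) \<partial>lborel) \<le> ennreal (C / real (Suc j))" for j n
  proof -
    have "(\<integral>\<^sup>+x. ennreal (\<bar>u (r n) x - a j n x\<bar> powr p) \<partial>lborel) \<le>
      (\<integral>\<^sup>+x. ennreal (\<bar>conv (k j) (u (r n)) x - u (r n) x\<bar> powr p) \<partial>lborel)"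
    proof (rule nn_integral_mono)
      fix x
      show "ennreal (\<bar>u (r n) x - a j n x\<bar> powr p) \<le> ennreal (\<bar>conv (k j) (u (r n)) x - u (r n) x\<bar> powr p)"
        by (cases "x \<in> \<Omega>") (simp_all add: a_def supp abs_minus_commute)
    qed
    also have "\<dots> \<le> ennreal (1 / W j) * dform {} (real DIM('a)) p (u (r n))"
      by (rule conv_minus_le[OF k W0 p u int])
    also have "\<dots> \<le> ennreal (1 / W j) * ennreal C" by (intro mult_left_mono df) auto
    also have "\<dots> = ennreal (C / W j)" using W0[of j] C by (simp add: ennreal_mult[symmetric])
    also have "\<dots> \<le> ennreal (C / real (Suc j))"
      using W[of j] W0[of j] C by (intro ennreal_leI divide_left_mono) auto
    finally show ?thesis .
  qed
  have e2: "(\<lambda>n. \<integral>\<^sup>+x. ennreal (\<bar>G j x - a j n x\<bar> powr p) \<partial>lborel) \<longlonglongrightarrow> (\<integral>\<^sup>+x. 0 \<partial>(lborel :: 'a measure))" for j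
  proof (rule nn_integral_dominated_convergence)
    let ?w = "\<lambda>x. ennreal ((2 * (B j * I)) powr p) * indicator \<Omega> x"
    show "AE x in lborel. ennreal (\<bar>G j x - a j n x\<bar> powr p) \<le> ?w x" for n
    proof (rule AE_I2)
      fix x
      have "\<bar>G j x - a j n x\<bar> powr p \<le> (2 * (B j * I)) powr p"
        using a_bd[of j n x] G_bd[of j x] p by (intro powr_mono2) auto
      then show "ennreal (\<bar>G j x - a j n x\<bar> powr p) \<le> ?w x"
        by (cases "x \<in> \<Omega>") (auto simp: G_def a_def intro: ennreal_leI)
    qed
    show "(\<integral>\<^sup>+x. ?w x \<partial>lborel) < \<infinity>"
      using fin by (simp add: nn_integral_cmult_indicator ennreal_mult_less_top)
    show "AE x in lborel. (\<lambda>n. ennreal (\<bar>G j x - a j n x\<bar> powr p)) \<longlonglongrightarrow> 0"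
    proof (rule AE_I2)
      fix x
      have "(\<lambda>n. \<bar>G j x - a j n x\<bar> powr p) \<longlonglongrightarrow> \<bar>G j x - G j x\<bar> powr p"
        using p by (intro tendsto_powr' tendsto_intros aG) auto
      then have "(\<lambda>n. ennreal (\<bar>G j x - a j n x\<bar> powr p)) \<longlonglongrightarrow> ennreal (\<bar>G j x - G j x\<bar> powr p)"
        by (rule tendsto_ennrealI)
      then show "(\<lambda>n. ennreal (\<bar>G j x - a j n x\<bar> powr p)) \<longlonglongrightarrow> 0" by simp
    qed
  qed measurable
  have e3: "\<forall>\<^sub>F n in sequentially. (\<integral>\<^sup>+x. ennreal (\<bar>u (r n) x - G j x\<bar> powr p) \<partial>lborel)
      \<le> ennreal (2 powr p * ((C + 1) / real (Suc j)))" for j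
  proof -
    have "\<forall>\<^sub>F n in sequentially. (\<integral>\<^sup>+x. ennreal (\<bar>G j x - a j n x\<bar> powr p) \<partial>lborel) < ennreal (1 / real (Suc j))"
      using order_tendstoD(2)[OF e2[of j], of "ennreal (1 / real (Suc j))"] by simp
    then show ?thesis
    proof eventually_elim
      case (elim n)
      have "(\<integral>\<^sup>+x. ennreal (\<bar>u (r n) x - G j x\<bar> powr p) \<partial>lborel) \<le>
        ennreal (2 powr p) * ((\<integral>\<^sup>+x. ennreal (\<bar>u (r n) x - a j n x\<bar> powr p) \<partial>lborel) +
          (\<integral>\<^sup>+x. ennreal (\<bar>G j x - a j n x\<bar> powr p) \<partial>lborel))"
        by (rule Lp_diff_le[OF p0]) auto
      also have "\<dots> \<le> ennreal (2 powr p) * (ennreal (C / real (Suc j)) + ennreal (1 / real (Suc j)))"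
        using elim by (intro mult_left_mono add_mono e1) auto
      also have "\<dots> = ennreal (2 powr p * ((C + 1) / real (Suc j)))"
        using C by (simp add: ennreal_mult[symmetric] ennreal_plus[symmetric] add_divide_distrib del: ennreal_plus)
      finally show ?case .
    qed
  qed
  have cauchy: "\<exists>n0. \<forall>m\<ge>n0. \<forall>n\<ge>n0. (\<integral>\<^sup>+x. ennreal (\<bar>u (r m) x - u (r n) x\<bar> powr p) \<partial>lborel) \<le> ennreal e"
    if e: "0 < e" for e
  proof -
    \<comment> \<open>Each use of \<open>Lp_diff_le\<close> costs a factor \<open>2 powr p\<close>:
      one passes from \<open>u\<close> through its average to \<open>G j\<close>, the other from one
      member of the sequence through \<open>G j\<close> to another.\<close>
    define K where "K = 2 powr p * (2 * (2 powr p * (C + 1)))"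
    obtain j where "K / e < real j" using reals_Archimedean2 by blast
    then have "K < e * real j" using e by (simp add: pos_divide_less_eq mult.commute)
    also have "\<dots> \<le> e * real (Suc j)" using e by (intro mult_left_mono) auto
    finally have j: "K / real (Suc j) \<le> e" by (simp add: divide_le_eq)
    obtain n0 where n0: "\<And>n. n0 \<le> n \<Longrightarrow> (\<integral>\<^sup>+x. ennreal (\<bar>u (r n) x - G j x\<bar> powr p) \<partial>lborel)
      \<le> ennreal (2 powr p * ((C + 1) / real (Suc j)))"
      using e3[of j] unfolding eventually_sequentially by blast
    show ?thesis
    proof (intro exI[of _ n0] allI impI)
      fix m n assume mn: "n0 \<le> m" "n0 \<le> n"
      have "(\<integral>\<^sup>+x. ennreal (\<bar>u (r m) x - u (r n) x\<bar> powr p) \<partial>lborel) \<le>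
        ennreal (2 powr p) * ((\<integral>\<^sup>+x. ennreal (\<bar>u (r m) x - G j x\<bar> powr p) \<partial>lborel) +
          (\<integral>\<^sup>+x. ennreal (\<bar>u (r n) x - G j x\<bar> powr p) \<partial>lborel))"
        by (rule Lp_diff_le[OF p0]) auto
      also have "\<dots> \<le> ennreal (2 powr p) * (ennreal (2 powr p * ((C + 1) / real (Suc j))) + ennreal (2 powr p * ((C + 1) / real (Suc j))))"
        using mn by (intro mult_left_mono add_mono n0) auto
      also have "\<dots> = ennreal (K / real (Suc j))"
        using C by (simp add: K_def ennreal_mult[symmetric] ennreal_plus[symmetric] del: ennreal_plus)
      also have "\<dots> \<le> ennreal e" using j by (rule ennreal_leI)
      finally show "(\<integral>\<^sup>+x. ennreal (\<bar>u (r m) x - u (r n) x\<bar> powr p) \<partial>lborel) \<le> ennreal e" .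
    qed
  qed
  obtain r' U where r': "strict_mono r'" and U[measurable]: "U \<in> borel_measurable lborel"
    and AE: "AE x in lborel. (\<lambda>n. u (r (r' n)) x) \<longlonglongrightarrow> U x"
    and lim: "\<And>e. 0 < e \<Longrightarrow> \<exists>n0. \<forall>n\<ge>n0. (\<integral>\<^sup>+x. ennreal (\<bar>u (r n) x - U x\<bar> powr p) \<partial>lborel) \<le> ennreal e"
    using Lp_complete[of p "\<lambda>n. u (r n)" lborel, OF p0 _ cauchy] by auto
  \<comment> \<open>The limit vanishes off \<Omega> only almost everywhere; this representative
    vanishes there everywhere.\<close>
  define V where "V x = indicator \<Omega> x * U x" for x
  have VU: "AE x in lborel. V x = U x"
    using AE
  proof eventually_elim
    case (elim x)
    then show ?case
      by (cases "x \<in> \<Omega>") (auto simp: V_def supp LIMSEQ_const_iff)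
  qed
  have conv0: "(\<lambda>n. \<integral>\<^sup>+x. ennreal (\<bar>u (r n) x - V x\<bar> powr p) \<partial>lborel) \<longlonglongrightarrow> 0"
  proof (rule order_tendstoI)
    fix e :: ennreal assume "0 < e"
    then obtain e' where e': "0 < e'" "ennreal e' < e"
      by (metis ennreal_0 ennreal_less_zero_iff dense ennreal_cases less_imp_le not_le order_less_le_trans top_greatest ennreal_neq_top less_top)
    from lim[OF e'(1)] obtain n0 where
      n0: "\<And>n. n0 \<le> n \<Longrightarrow> (\<integral>\<^sup>+x. ennreal (\<bar>u (r n) x - U x\<bar> powr p) \<partial>lborel) \<le> ennreal e'" by blast
    have "(\<integral>\<^sup>+x. ennreal (\<bar>u (r n) x - V x\<bar> powr p) \<partial>lborel) = (\<integral>\<^sup>+x. ennreal (\<bar>u (r n) x - U x\<bar> powr p) \<partial>lborel)" for n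
      by (rule nn_integral_cong_AE, use VU in eventually_elim) simp
    with n0 e'(2) show "\<forall>\<^sub>F n in sequentially. (\<integral>\<^sup>+x. ennreal (\<bar>u (r n) x - V x\<bar> powr p) \<partial>lborel) < e"
      unfolding eventually_sequentially by (intro exI[of _ n0]) (auto intro: order.strict_trans1)
  qed simp
  show thesis
  proof (rule that)
    show "strict_mono (r \<circ> r')" using r r' by (rule strict_mono_o)
    show "V \<in> borel_measurable borel" using U unfolding V_def[abs_def] by measurable
    show "V x = 0" if "x \<notin> \<Omega>" for x using that by (simp add: V_def)
    show "AE x in lborel. (\<lambda>n. u ((r \<circ> r') n) x) \<longlonglongrightarrow> V x"
      using AE VU by eventually_elim simp
    show "(\<lambda>n. \<integral>\<^sup>+x. ennreal (\<bar>u ((r \<circ> r') n) x - V x\<bar> powr p) \<partial>lborel) \<longlonglongrightarrow> 0"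
      using LIMSEQ_subseq_LIMSEQ[OF conv0 r'] by (simp add: o_def)
  qed
qed

section \<open>Radial integrals and the logarithmic Sobolev inequality\<close>

lemma real_pow_DIM: "0 < r \<Longrightarrow> r ^ (DIM('a::euclidean_space) - 1) = r powr (real DIM('a) - 1)"
  using DIM_ge_Suc0[where 'a = 'a] by (simp add: powr_realpow[symmetric] of_nat_diff)

lemma nn_integral_radial_powr_from_0:
  fixes \<alpha> R :: real
  assumes \<alpha>: "0 < \<alpha>" and R: "0 \<le> R"
  shows "(\<integral>\<^sup>+z. ennreal (norm (z::'a::euclidean_space) powr (\<alpha> - DIM('a))) * indicator {..R} (norm z) \<partial>lborel)
    = ennreal (DIM('a) * unit_ball_vol DIM('a) * (R powr \<alpha> / \<alpha>))"
proof -
  let ?c = "real DIM('a) * unit_ball_vol DIM('a)"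
  have "(\<integral>\<^sup>+z. ennreal (norm (z::'a) powr (\<alpha> - DIM('a))) * indicator {..R} (norm z) \<partial>lborel)
    = (\<integral>\<^sup>+r. ennreal (?c * r ^ (DIM('a) - 1)) * indicator {0..} r * (ennreal (r powr (\<alpha> - DIM('a))) * indicator {..R} r) \<partial>lborel)"
    by (subst nn_integral_norm) auto
  also have "\<dots> = (\<integral>\<^sup>+r. ennreal ?c * ennreal (indicator {0..R} r * r powr (\<alpha> - 1)) \<partial>lborel)"
  proof (rule nn_integral_cong_AE, rule AE_mp[OF AE_lborel_singleton[of 0]], intro AE_I2 impI)
    fix r :: real assume "r \<noteq> 0"
    show "ennreal (?c * r ^ (DIM('a) - 1)) * indicator {0..} r * (ennreal (r powr (\<alpha> - DIM('a))) * indicator {..R} r)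
      = ennreal ?c * ennreal (indicator {0..R} r * r powr (\<alpha> - 1))"
    proof (cases "0 < r \<and> r \<le> R")
      case True
      then have "r ^ (DIM('a) - 1) * r powr (\<alpha> - DIM('a)) = r powr (\<alpha> - 1)"
        unfolding real_pow_DIM[OF conjunct1[OF True]] by (simp flip: powr_add)
      then show ?thesis using True
        by (simp add: ennreal_mult'[symmetric] ennreal_mult[symmetric] mult.assoc del: One_nat_def)
    qed (use \<open>r \<noteq> 0\<close> in \<open>auto simp: indicator_def\<close>)
  qed
  also have "\<dots> = ennreal ?c * (\<integral>\<^sup>+r. ennreal (indicator {0..R} r * r powr (\<alpha> - 1)) \<partial>lborel)"
    by (subst nn_integral_cmult) auto
  also have "(\<integral>\<^sup>+r. ennreal (indicator {0..R} r * r powr (\<alpha> - 1)) \<partial>lborel) = ennreal (R powr \<alpha> / \<alpha>)"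
    using has_integral_powr_from_0[of "\<alpha> - 1" R] \<alpha> R
    by (intro nn_integral_has_integral_lebesgue) auto
  finally show ?thesis using \<alpha> by (simp add: ennreal_mult[symmetric])
qed

lemma nn_integral_radial_log:
  fixes r :: real
  assumes r: "0 < r" "r \<le> 1"
  shows "(\<integral>\<^sup>+z. ennreal (norm (z::'a::euclidean_space) powr (- DIM('a))) * indicator {r..1} (norm z) \<partial>lborel)
    = ennreal (DIM('a) * unit_ball_vol DIM('a) * ln (1 / r))"
proof -
  let ?c = "real DIM('a) * unit_ball_vol DIM('a)"
  have "(\<integral>\<^sup>+z. ennreal (norm (z::'a) powr (- DIM('a))) * indicator {r..1} (norm z) \<partial>lborel)
    = (\<integral>\<^sup>+t. ennreal (?c * t ^ (DIM('a) - 1)) * indicator {0..} t * (ennreal (t powr (- DIM('a))) * indicator {r..1} t) \<partial>lborel)"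
    by (subst nn_integral_norm) auto
  also have "\<dots> = (\<integral>\<^sup>+t. ennreal (?c * (1 / t)) * indicator {r..1} t \<partial>lborel)"
  proof (rule nn_integral_cong)
    fix t :: real
    show "ennreal (?c * t ^ (DIM('a) - 1)) * indicator {0..} t * (ennreal (t powr (- DIM('a))) * indicator {r..1} t)
      = ennreal (?c * (1 / t)) * indicator {r..1} t"
    proof (cases "r \<le> t \<and> t \<le> 1")
      case True
      then have t: "0 < t" using r by simp
      have "t ^ (DIM('a) - 1) * t powr (- DIM('a)) = 1 / t"
        unfolding real_pow_DIM[OF t] powr_add[symmetric] using t by (simp add: powr_minus_divide)
      then show ?thesis using True t
        by (simp add: ennreal_mult'[symmetric] ennreal_mult[symmetric] mult.assoc del: One_nat_def)
    qed (auto simp: indicator_def)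
  qed
  also have "\<dots> = ennreal (?c * ln 1 - ?c * ln r)"
  proof (rule nn_integral_FTC_Icc[where F = "\<lambda>t. ?c * ln t"])
    show "((\<lambda>t. ?c * ln t) has_real_derivative ?c * (1 / t)) (at t)" if "t \<in> {r..1}" for t
      using that r by (auto intro!: derivative_eq_intros)
  qed (use r in auto)
  finally show ?thesis using r by (simp add: ln_div)
qed

lemma nn_integral_radial_far:
  fixes \<alpha> :: real
  assumes \<alpha>: "0 < \<alpha>"
  shows "(\<integral>\<^sup>+z. ennreal (norm (z::'a::euclidean_space) powr (- (DIM('a) + \<alpha>))) * indicator {1..} (norm z) \<partial>lborel)
    = ennreal (DIM('a) * unit_ball_vol DIM('a) / \<alpha>)"
proof -
  let ?c = "real DIM('a) * unit_ball_vol DIM('a)"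
  have "(\<integral>\<^sup>+z. ennreal (norm (z::'a) powr (- (DIM('a) + \<alpha>))) * indicator {1..} (norm z) \<partial>lborel)
    = (\<integral>\<^sup>+t. ennreal (?c * t ^ (DIM('a) - 1)) * indicator {0..} t * (ennreal (t powr (- (DIM('a) + \<alpha>))) * indicator {1..} t) \<partial>lborel)"
    by (subst nn_integral_norm) auto
  also have "\<dots> = (\<integral>\<^sup>+t. ennreal (?c * t powr (- \<alpha> - 1)) * indicator {1..} t \<partial>lborel)"
  proof (rule nn_integral_cong)
    fix t :: real
    show "ennreal (?c * t ^ (DIM('a) - 1)) * indicator {0..} t * (ennreal (t powr (- (DIM('a) + \<alpha>))) * indicator {1..} t)
      = ennreal (?c * t powr (- \<alpha> - 1)) * indicator {1..} t"
    proof (cases "1 \<le> t")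
      case True
      then have t: "0 < t" by simp
      have "t ^ (DIM('a) - 1) * t powr (- (DIM('a) + \<alpha>)) = t powr (- \<alpha> - 1)"
        unfolding real_pow_DIM[OF t] powr_add[symmetric] by (rule arg_cong[where f = "\<lambda>a. t powr a"]) simp
      then show ?thesis using True t
        by (simp add: ennreal_mult'[symmetric] ennreal_mult[symmetric] mult.assoc del: One_nat_def)
    qed (auto simp: indicator_def)
  qed
  also have "\<dots> = ennreal (0 - - ?c / \<alpha> * 1 powr (- \<alpha>))"
  proof (rule nn_integral_FTC_atLeast[where F = "\<lambda>t. - ?c / \<alpha> * t powr (- \<alpha>)"])
    show "((\<lambda>t. - ?c / \<alpha> * t powr (- \<alpha>)) has_real_derivative ?c * t powr (- \<alpha> - 1)) (at t)" if "1 \<le> t" for t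
      using that \<alpha> by (auto intro!: derivative_eq_intros simp: powr_diff)
    have "((\<lambda>t. - ?c / \<alpha> * t powr (- \<alpha>)) \<longlongrightarrow> - ?c / \<alpha> * 0) at_top"
      using \<alpha> by (intro tendsto_mult tendsto_const tendsto_neg_powr filterlim_ident) auto
    then show "((\<lambda>t. - ?c / \<alpha> * t powr (- \<alpha>)) \<longlongrightarrow> 0) at_top" by simp
  qed auto
  finally show ?thesis by simp
qed

text \<open>Let \<open>A\<close> be the set of increments \<open>z\<close> at which
  \<open>|u (x + z)|\<close> exceeds half of \<open>|u x|\<close>; its measure is at most
  \<open>E\<close> by Chebyshev. Off \<open>A\<close> the difference is at least
  \<open>|u x| / 2\<close>. Removing a set of measure \<open>E\<close> from the kernel on the shell
  from \<open>R\<close> to 1 loses at most \<open>R powr (- N) * E = v\<close>, and the mass of that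
  shell is \<open>v * N * ln (1 / R)\<close>, which is \<open>v * p * ln |u x|\<close> up to a
  constant multiple of \<open>v\<close>.\<close>

lemma log_Sobolev_pointwise:
  fixes u :: "'a::euclidean_space \<Rightarrow> real" and p I :: real
  defines "v \<equiv> unit_ball_vol DIM('a)"
  assumes p: "1 < p" and [measurable]: "u \<in> borel_measurable borel" and I0: "0 < I"
    and I: "(\<integral>\<^sup>+x. ennreal (\<bar>u x\<bar> powr p) \<partial>lborel) \<le> ennreal I" and ux: "u x \<noteq> 0"
  shows "ennreal ((\<bar>u x\<bar> / 2) powr p * v * (p * ln \<bar>u x\<bar> + ln (v / (2 powr p * I)))) \<le>
    (\<integral>\<^sup>+z. ennreal (nkern DIM('a) z * \<bar>u x - u (x + z)\<bar> powr p) \<partial>lborel) + ennreal ((\<bar>u x\<bar> / 2) powr p * v)"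
proof -
  define l where "l = \<bar>u x\<bar>"
  have l: "0 < l" using ux by (simp add: l_def)
  let ?N = "real DIM('a)"
  have v: "0 < v" by (simp add: v_def)
  define E where "E = (2 / l) powr p * I"
  have E: "0 < E" using l I0 by (simp add: E_def)
  \<comment> \<open>The radius of a ball of volume \<open>E\<close>. If it exceeds 1, the left-hand
    side of the claim is the \<open>ennreal\<close> of a non-positive number, hence 0.\<close>
  define R where "R = (E / v) powr (1 / ?N)"
  have R: "0 < R" using E v by (simp add: R_def)
  have RN: "R powr ?N = E / v" using E v by (simp add: R_def powr_powr)
  have lnR: "?N * ln (1 / R) = p * ln l + ln (v / (2 powr p * I))"
  proof -
    have "?N * ln (1 / R) = - ln (R powr ?N)" using R by (simp add: ln_div ln_powr)
    also have "\<dots> = ln v - ln E" unfolding RN using E v by (simp add: ln_div)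
    also have "ln E = p * (ln 2 - ln l) + ln I"
      using l I0 unfolding E_def by (simp add: ln_mult ln_powr ln_div)
    also have "ln v - (p * (ln 2 - ln l) + ln I) = p * ln l + ln (v / (2 powr p * I))"
      using v I0 by (simp add: ln_div ln_mult ln_powr algebra_simps)
    finally show ?thesis .
  qed
  show ?thesis
  proof (cases "R \<le> 1")
    case False
    then have "p * ln l + ln (v / (2 powr p * I)) \<le> 0"
      unfolding lnR[symmetric] by (simp add: ln_div mult_nonneg_nonpos)
    then have "(l / 2) powr p * v * (p * ln l + ln (v / (2 powr p * I))) \<le> 0"
      using v by (intro mult_nonneg_nonpos) auto
    then show ?thesis unfolding l_def by (simp add: ennreal_neg)
  next
    case True
    define A where "A = {z. l / 2 < \<bar>u (x + z)\<bar>}"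
    have [measurable]: "A \<in> sets borel" unfolding A_def by measurable
    have mA: "emeasure lborel A \<le> ennreal E"
    proof -
      have "ennreal ((l / 2) powr p) * emeasure lborel A = (\<integral>\<^sup>+z. ennreal ((l / 2) powr p) * indicator A z \<partial>lborel)"
        by (subst nn_integral_cmult_indicator) auto
      also have "\<dots> \<le> (\<integral>\<^sup>+z. ennreal (\<bar>u (x + z)\<bar> powr p) \<partial>lborel)"
        using p l by (intro nn_integral_mono) (auto simp: A_def indicator_def intro!: ennreal_leI powr_mono2)
      also have "\<dots> = (\<integral>\<^sup>+z. ennreal (\<bar>u z\<bar> powr p) \<partial>lborel)"
        by (rule nn_integral_lborel_translate[of "\<lambda>z. ennreal (\<bar>u z\<bar> powr p)"]) measurable
      also have "\<dots> \<le> ennreal I" by (rule I)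
      also have "\<dots> = ennreal ((l / 2) powr p) * ennreal E"
        using l I0 by (simp add: E_def ennreal_mult[symmetric] powr_divide)
      finally show ?thesis using l by (subst (asm) ennreal_mult_le_mult_iff) auto
    qed
    let ?f = "\<lambda>z. ennreal (norm (z::'a) powr (- ?N)) * indicator {R..1} (norm z)"
    have "ennreal (v * (p * ln l + ln (v / (2 powr p * I)))) = (\<integral>\<^sup>+z. ?f z \<partial>lborel)"
      unfolding lnR[symmetric] using nn_integral_radial_log[OF R True, where 'a = 'a]
      by (simp add: v_def mult_ac)
    also have "\<dots> \<le> (\<integral>\<^sup>+z. ennreal (nkern ?N z) * indicator (- A) z + ennreal (R powr (- ?N)) * indicator A z \<partial>lborel)"
    proof (rule nn_integral_mono)
      fix z :: 'a
      show "?f z \<le> ennreal (nkern ?N z) * indicator (- A) z + ennreal (R powr (- ?N)) * indicator A z"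
        using R by (cases "z \<in> A") (auto simp: indicator_def nkern_def powr_minus_divide
            intro!: ennreal_leI divide_left_mono powr_mono2 mult_pos_pos)
    qed
    also have "\<dots> = (\<integral>\<^sup>+z. ennreal (nkern ?N z) * indicator (- A) z \<partial>lborel) + ennreal (R powr (- ?N)) * emeasure lborel A"
      by (subst nn_integral_add) (auto simp: nn_integral_cmult_indicator)
    also have "\<dots> \<le> (\<integral>\<^sup>+z. ennreal (nkern ?N z) * indicator (- A) z \<partial>lborel) + ennreal v"
    proof (rule add_left_mono)
      have "ennreal (R powr (- ?N)) * emeasure lborel A \<le> ennreal (R powr (- ?N)) * ennreal E"
        by (rule mult_left_mono[OF mA]) simp
      also have "\<dots> = ennreal v" using E v by (simp add: powr_minus RN ennreal_mult[symmetric])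
      finally show "ennreal (R powr (- ?N)) * emeasure lborel A \<le> ennreal v" .
    qed
    finally have *: "ennreal (v * (p * ln l + ln (v / (2 powr p * I)))) \<le>
      (\<integral>\<^sup>+z. ennreal (nkern ?N z) * indicator (- A) z \<partial>lborel) + ennreal v" .
    have "ennreal ((l / 2) powr p * v * (p * ln l + ln (v / (2 powr p * I)))) =
      ennreal ((l / 2) powr p) * ennreal (v * (p * ln l + ln (v / (2 powr p * I))))"
      by (simp add: ennreal_mult'[symmetric] mult.assoc)
    also have "\<dots> \<le> ennreal ((l / 2) powr p) * ((\<integral>\<^sup>+z. ennreal (nkern ?N z) * indicator (- A) z \<partial>lborel) + ennreal v)"
      by (rule mult_left_mono[OF *]) simp
    also have "\<dots> = (\<integral>\<^sup>+z. ennreal ((l / 2) powr p) * (ennreal (nkern ?N z) * indicator (- A) z) \<partial>lborel) + ennreal ((l / 2) powr p * v)"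
      using v by (simp add: distrib_left nn_integral_cmult ennreal_mult)
    also have "\<dots> \<le> (\<integral>\<^sup>+z. ennreal (nkern ?N z * \<bar>u x - u (x + z)\<bar> powr p) \<partial>lborel) + ennreal ((l / 2) powr p * v)"
    proof (intro add_right_mono nn_integral_mono)
      fix z :: 'a
      show "ennreal ((l / 2) powr p) * (ennreal (nkern ?N z) * indicator (- A) z) \<le> ennreal (nkern ?N z * \<bar>u x - u (x + z)\<bar> powr p)"
      proof (cases "z \<in> A")
        case False
        then have "\<bar>u (x + z)\<bar> \<le> l / 2" unfolding A_def by simp
        then have "l / 2 \<le> \<bar>u x - u (x + z)\<bar>" unfolding l_def by linarith
        then have "(l / 2) powr p \<le> \<bar>u x - u (x + z)\<bar> powr p" using p l by (intro powr_mono2) auto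
        then show ?thesis using False
          by (simp add: ennreal_mult[symmetric] mult.commute[of "nkern ?N z"] ennreal_leI mult_right_mono)
      qed simp
    qed
    finally show ?thesis unfolding l_def .
  qed
qed

text \<open>The pointwise inequality is integrated over the points where \<open>|u|\<close> exceeds
  1; elsewhere \<open>|u| powr p * |ln |u||\<close> is at most \<open>1 / p\<close>, and \<Omega>
  has finite measure. Consequently the entropy is finite on the whole energy space.\<close>

lemma log_Sobolev:
  fixes u :: "'a::euclidean_space \<Rightarrow> real"
  assumes p: "1 < p" and \<Omega>[measurable]: "\<Omega> \<in> sets borel" and bdd: "bounded \<Omega>"
    and [measurable]: "u \<in> borel_measurable borel" and supp: "\<And>x. x \<notin> \<Omega> \<Longrightarrow> u x = 0"
    and I: "(\<integral>\<^sup>+x. ennreal (\<bar>u x\<bar> powr p) \<partial>lborel) < \<infinity>" and df: "dform {} DIM('a) p u < \<infinity>"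
  shows "(\<integral>\<^sup>+x. ennreal (\<bar>u x\<bar> powr p * \<bar>ln \<bar>u x\<bar>\<bar>) \<partial>lborel) < \<infinity>"
proof -
  let ?N = "real DIM('a)"
  define v where "v = unit_ball_vol ?N"
  have v: "0 < v" by (simp add: v_def)
  obtain I' where I': "(\<integral>\<^sup>+x. ennreal (\<bar>u x\<bar> powr p) \<partial>lborel) = ennreal I'" "0 \<le> I'"
    using I by (cases "\<integral>\<^sup>+x. ennreal (\<bar>u x\<bar> powr p) \<partial>lborel" rule: ennreal_cases) auto
  \<comment> \<open>Adding 1 keeps the bound positive when \<open>u\<close> vanishes almost
    everywhere.\<close>
  define J where "J = I' + 1"
  have J: "0 < J" "(\<integral>\<^sup>+x. ennreal (\<bar>u x\<bar> powr p) \<partial>lborel) \<le> ennreal J"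
    using I' by (auto simp: J_def intro: ennreal_leI)
  define K where "K = ln (v / (2 powr p * J))"
  define G where "G x = (\<integral>\<^sup>+z. ennreal (nkern ?N z * \<bar>u x - u (x + z)\<bar> powr p) \<partial>lborel)" for x
  have [measurable]: "G \<in> borel_measurable borel" unfolding G_def[abs_def] by measurable
  \<comment> \<open>The pointwise inequality is divided by \<open>v * p / 2 powr p\<close>:
    \<open>c1\<close> is the resulting factor of the kernel integral, and \<open>c2\<close> collects
    the multiples of \<open>|u| powr p\<close>.\<close>
  define c1 c2 where "c1 = 2 powr p / (v * p)" and "c2 = (1 + \<bar>K\<bar>) / p"
  have c: "0 < c1" "0 \<le> c2" using v p by (auto simp: c1_def c2_def)
  have ptw: "ennreal (\<bar>u x\<bar> powr p * \<bar>ln \<bar>u x\<bar>\<bar>) \<le> ennreal c1 * G x + ennreal c2 * ennreal (\<bar>u x\<bar> powr p) + ennreal (1 / p) * indicator \<Omega> x" for x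
  proof (cases "\<bar>u x\<bar> \<le> 1")
    case True
    show ?thesis
    proof (cases "x \<in> \<Omega>")
      case in\<Omega>: True
      have "\<bar>u x\<bar> powr p * \<bar>ln \<bar>u x\<bar>\<bar> \<le> 1 / p" using True p by (intro powr_ln_bound) auto
      then have "ennreal (\<bar>u x\<bar> powr p * \<bar>ln \<bar>u x\<bar>\<bar>) \<le> ennreal (1 / p) * indicator \<Omega> x"
        using in\<Omega> by (simp add: ennreal_leI)
      then show ?thesis by (rule order_trans) simp
    qed (simp add: supp)
  next
    case False
    then have ux: "u x \<noteq> 0" and l: "1 < \<bar>u x\<bar>" by auto
    define y where "y = \<bar>u x\<bar> powr p"
    have y: "0 \<le> y" by (simp add: y_def)
    have "ennreal (\<bar>u x\<bar> powr p * \<bar>ln \<bar>u x\<bar>\<bar>) \<le> ennreal c1 * G x + ennreal c2 * ennreal (\<bar>u x\<bar> powr p)"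
    proof (cases "G x" rule: ennreal_cases)
      case (real g)
      have "ennreal (y / 2 powr p * v * (p * ln \<bar>u x\<bar> + K)) \<le> ennreal g + ennreal (y / 2 powr p * v)"
        using log_Sobolev_pointwise[OF p _ J ux] real unfolding G_def v_def K_def y_def by (simp add: powr_divide)
      also have "\<dots> = ennreal (g + y / 2 powr p * v)" using real y v by (simp add: ennreal_plus)
      finally have "y / 2 powr p * v * (p * ln \<bar>u x\<bar> + K) \<le> g + y / 2 powr p * v"
        using real y v by (subst (asm) ennreal_le_iff) (auto intro: add_nonneg_nonneg)
      then have "c1 * (y / 2 powr p * v * (p * ln \<bar>u x\<bar> + K)) \<le> c1 * (g + y / 2 powr p * v)"
        using c by (intro mult_left_mono) auto
      moreover have "c1 * (y / 2 powr p * v * (p * ln \<bar>u x\<bar> + K)) = y * ln \<bar>u x\<bar> + y * (K / p)"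
        using v p by (simp add: c1_def field_simps)
      moreover have "c1 * (g + y / 2 powr p * v) = c1 * g + y * (1 / p)"
        using v p by (simp add: c1_def field_simps)
      moreover have "y * (1 / p) - y * (K / p) \<le> c2 * y"
      proof -
        have "y * ((1 - K) / p) \<le> y * c2"
          using y p unfolding c2_def by (intro mult_left_mono divide_right_mono) auto
        then show ?thesis by (simp add: diff_divide_distrib right_diff_distrib mult.commute)
      qed
      ultimately have "y * ln \<bar>u x\<bar> \<le> c1 * g + c2 * y" by linarith
      then show ?thesis
        using l real c y by (simp add: y_def[symmetric] ennreal_mult[symmetric] ennreal_plus[symmetric] ennreal_leI del: ennreal_plus)
    next
      case top
      then show ?thesis using c by (simp add: ennreal_mult_top)
    qed
    then show ?thesis by (rule order_trans) simp
  qed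
  have "(\<integral>\<^sup>+x. ennreal (\<bar>u x\<bar> powr p * \<bar>ln \<bar>u x\<bar>\<bar>) \<partial>lborel) \<le>
    (\<integral>\<^sup>+x. ennreal c1 * G x + ennreal c2 * ennreal (\<bar>u x\<bar> powr p) + ennreal (1 / p) * indicator \<Omega> x \<partial>lborel)"
    by (rule nn_integral_mono[OF ptw])
  also have "\<dots> = ennreal c1 * dform {} ?N p u + ennreal c2 * (\<integral>\<^sup>+x. ennreal (\<bar>u x\<bar> powr p) \<partial>lborel) + ennreal (1 / p) * emeasure lborel \<Omega>"
  proof -
    have "(\<integral>\<^sup>+x. G x \<partial>lborel) = dform {} ?N p u" unfolding G_def by (rule dform_near[symmetric]) measurable
    then show ?thesis
      by (simp add: nn_integral_add nn_integral_cmult nn_integral_cmult_indicator)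
  qed
  also have "\<dots> < \<infinity>"
    using I df emeasure_bounded_finite[OF bdd] by (simp add: ennreal_mult_less_top)
  finally show ?thesis .
qed

section \<open>Boundary layers of Lipschitz domains\<close>

text \<open>The layer lies in a slab around the graph. Translates of this slab along
  \<open>e\<close> by multiples of a length comparable to \<open>t\<close> are disjoint, and about
  \<open>1 / t\<close> of them fit into a fixed ball; as all have the same measure, it is of order
  \<open>t\<close>. This counting takes the place of Fubini's theorem in rotated
  coordinates.\<close>

lemma lipschitz_layer_local:
  fixes \<Omega> :: "'a::euclidean_space set"
  assumes op: "open \<Omega>" and e: "norm e = 1" and g: "L-lipschitz_on {y. y \<bullet> e = 0} g" and r: "0 < r"
    and loc: "\<Omega> \<inter> ball z r = {x \<in> ball z r. g (x - (x \<bullet> e) *\<^sub>R e) < x \<bullet> e}"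
  shows "\<exists>C\<ge>0. \<exists>t0>0. \<forall>t. 0 < t \<longrightarrow> t < t0 \<longrightarrow>
    emeasure lborel {y \<in> ball z (r / 2). \<exists>x\<in>frontier \<Omega>. dist y x < t} \<le> ennreal (C * t)"
proof -
  have L: "0 \<le> L" using g by (rule lipschitz_on_nonneg)
  have ee: "e \<bullet> e = 1" using e by (simp add: dot_square_norm)
  define P where "P x = x - (x \<bullet> e) *\<^sub>R e" for x
  \<comment> \<open>Signed height above the graph, measured along \<open>e\<close>.\<close>
  define \<phi> where "\<phi> x = x \<bullet> e - g (P x)" for x
  \<comment> \<open>A Lipschitz constant of \<phi>: 1 from the component along \<open>e\<close>, and
    \<open>2 * L\<close> because the estimate used for the projection \<open>P\<close> has constant
    2.\<close>
  define \<Lambda> where "\<Lambda> = 1 + 2 * L"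
  have \<Lambda>: "1 \<le> \<Lambda>" using L by (simp add: \<Lambda>_def)
  have Pe: "P x \<bullet> e = 0" for x by (simp add: P_def inner_diff_left ee)
  have lip: "\<bar>\<phi> x - \<phi> y\<bar> \<le> \<Lambda> * dist x y" for x y
  proof -
    have ie: "\<bar>(x - y) \<bullet> e\<bar> \<le> dist x y"
      using Cauchy_Schwarz_ineq2[of "x - y" e] e by (simp add: dist_norm)
    have "dist (P x) (P y) = norm ((x - y) - ((x - y) \<bullet> e) *\<^sub>R e)"
      by (simp add: P_def dist_norm inner_diff_left algebra_simps)
    also have "\<dots> \<le> norm (x - y) + norm (((x - y) \<bullet> e) *\<^sub>R e)" by (rule norm_triangle_ineq4)
    also have "\<dots> \<le> 2 * dist x y" using ie e by (simp add: dist_norm)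
    finally have "L * dist (P x) (P y) \<le> L * (2 * dist x y)" using L by (rule mult_left_mono)
    moreover have "dist (g (P x)) (g (P y)) \<le> L * dist (P x) (P y)"
      by (rule lipschitz_onD[OF g]) (simp_all add: Pe)
    ultimately have "\<bar>g (P x) - g (P y)\<bar> \<le> 2 * L * dist x y" by (simp add: dist_real_def)
    moreover have "\<phi> x - \<phi> y = (x - y) \<bullet> e - (g (P x) - g (P y))"
      by (simp add: \<phi>_def inner_diff_left)
    ultimately show ?thesis using ie unfolding \<Lambda>_def by (simp add: distrib_right)
  qed
  have shift: "\<phi> (x + \<tau> *\<^sub>R e) = \<phi> x + \<tau>" for x \<tau>
  proof -
    have "P (x + \<tau> *\<^sub>R e) = P x" by (simp add: P_def inner_add_left ee algebra_simps)
    then show ?thesis by (simp add: \<phi>_def inner_add_left ee)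
  qed
  have cont: "continuous_on UNIV \<phi>"
    by (rule lipschitz_on_continuous_on[of \<Lambda>], rule lipschitz_onI) (use lip \<Lambda> in \<open>auto simp: dist_real_def\<close>)
  then have [measurable]: "\<phi> \<in> borel_measurable borel" by (rule borel_measurable_continuous_onI)
  \<comment> \<open>As \<Omega> is open, a frontier point is outside it and has height at most 0. A
    negative height would persist on a neighbourhood, which would then miss \<Omega>.\<close>
  have \<phi>0: "\<phi> x = 0" if x: "x \<in> frontier \<Omega>" "x \<in> ball z r" for x
  proof (rule antisym)
    have "x \<notin> \<Omega>" using x(1) op by (simp add: frontier_def interior_open)
    then have "x \<notin> {x \<in> ball z r. g (x - (x \<bullet> e) *\<^sub>R e) < x \<bullet> e}" unfolding loc[symmetric] by simp
    then show "\<phi> x \<le> 0" using x(2) by (simp add: \<phi>_def P_def)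
    show "0 \<le> \<phi> x"
    proof (rule ccontr)
      assume "\<not> 0 \<le> \<phi> x"
      then have "x \<in> ball z r \<inter> \<phi> -` {..<0}" using x(2) by auto
      moreover have "open (ball z r \<inter> \<phi> -` {..<0})"
        using cont by (intro open_Int open_ball open_vimage) auto
      moreover have "x \<in> closure \<Omega>" using x(1) by (simp add: frontier_def)
      ultimately have "ball z r \<inter> \<phi> -` {..<0} \<inter> \<Omega> \<noteq> {}"
        using open_Int_closure_eq_empty by blast
      then obtain y where "y \<in> \<Omega>" "y \<in> ball z r" "\<phi> y < 0" by blast
      moreover from this(1,2) have "y \<in> {x \<in> ball z r. g (x - (x \<bullet> e) *\<^sub>R e) < x \<bullet> e}" unfolding loc[symmetric] by simp
      ultimately show False by (simp add: \<phi>_def P_def)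
    qed
  qed
  define V where "V = measure lborel (ball z (r / 2 + 1))"
  have V: "emeasure lborel (ball z (r / 2 + 1)) = ennreal V"
    unfolding V_def using emeasure_bounded_finite[OF bounded_ball[of z "r / 2 + 1"]]
    by (intro emeasure_eq_ennreal_measure) auto
  show ?thesis
  proof (intro exI conjI allI impI)
    show "0 \<le> V * (6 * \<Lambda>)" using \<Lambda> by (simp add: V_def)
    show "0 < min (r / 2) (1 / (3 * \<Lambda>))" using r \<Lambda> by simp
    fix t :: real assume t: "0 < t" "t < min (r / 2) (1 / (3 * \<Lambda>))"
    define S where "S = {y \<in> ball z (r / 2). \<bar>\<phi> y\<bar> \<le> \<Lambda> * t}"
    have [measurable]: "S \<in> sets borel" unfolding S_def by measurable
    \<comment> \<open>Points of the slab have heights within \<open>2 * \<Lambda> * t\<close> of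
      each other, so steps of \<open>3 * \<Lambda> * t\<close> make the translates disjoint.\<close>
    define d where "d = 3 * \<Lambda> * t"
    have d: "0 < d" "d \<le> 1" using t \<Lambda> by (auto simp: d_def field_simps)
    \<comment> \<open>The number of steps that fit into length 1. Because \<open>d\<close> is at
      most 1, rounding down keeps at least half of \<open>1 / d\<close>.\<close>
    define M where "M = nat \<lfloor>1 / d\<rfloor>"
    have M: "real M * d \<le> 1" "1 \<le> 2 * real M * d"
    proof -
      have "real M \<le> 1 / d" using d by (simp add: M_def)
      then show "real M * d \<le> 1" using d by (simp add: field_simps)
      have "1 / d - 1 < real M" using d unfolding M_def by linarith
      moreover have "1 \<le> real M" using d by (simp add: M_def le_nat_floor)
      ultimately have "1 / d \<le> 2 * real M" by linarith
      then show "1 \<le> 2 * real M * d" using d by (simp add: field_simps)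
    qed
    define T where "T j = {y. (- (real j * d)) *\<^sub>R e + y \<in> S}" for j :: nat
    have [measurable]: "T j \<in> sets borel" for j unfolding T_def by measurable
    have mT: "emeasure lborel (T j) = emeasure lborel S" for j
    proof -
      have "emeasure lborel (T j) = (\<integral>\<^sup>+y. indicator (T j) y \<partial>lborel)" by simp
      also have "\<dots> = (\<integral>\<^sup>+y. indicator S ((- (real j * d)) *\<^sub>R e + y) \<partial>lborel)"
        by (intro nn_integral_cong) (simp add: T_def indicator_def)
      also have "\<dots> = (\<integral>\<^sup>+y. indicator S y \<partial>lborel)"
        by (rule nn_integral_lborel_translate) measurable
      finally show ?thesis by simp
    qed
    have "disjoint_family_on T {..<M}"
      unfolding disjoint_family_on_def
    proof (intro ballI impI)
      fix i j :: nat assume ij: "i \<noteq> j"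
      show "T i \<inter> T j = {}"
      proof (rule ccontr)
        assume "T i \<inter> T j \<noteq> {}"
        then obtain y where "y \<in> T i" "y \<in> T j" by auto
        moreover have "\<phi> ((- (real k * d)) *\<^sub>R e + y) = \<phi> y - real k * d" for k
          using shift[of y "- (real k * d)"] by (simp add: add.commute)
        ultimately have "\<bar>\<phi> y - real i * d\<bar> \<le> \<Lambda> * t" "\<bar>\<phi> y - real j * d\<bar> \<le> \<Lambda> * t"
          by (auto simp: T_def S_def)
        then have "\<bar>(real i - real j) * d\<bar> \<le> 2 * (\<Lambda> * t)" unfolding left_diff_distrib by linarith
        also have "\<dots> < 1 * d" using t \<Lambda> by (simp add: d_def)
        finally have "\<bar>real i - real j\<bar> < 1" using d by (simp add: abs_mult)
        with ij show False by linarith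
      qed
    qed
    then have "(\<Sum>j<M. emeasure lborel (T j)) = emeasure lborel (\<Union>j<M. T j)"
      by (intro sum_emeasure) auto
    also have "\<dots> \<le> emeasure lborel (ball z (r / 2 + 1))"
    proof (rule emeasure_mono)
      show "(\<Union>j<M. T j) \<subseteq> ball z (r / 2 + 1)"
      proof safe
        fix j y assume j: "j < M" "y \<in> T j"
        then have "dist z ((- (real j * d)) *\<^sub>R e + y) < r / 2" by (auto simp: T_def S_def)
        moreover have "dist ((- (real j * d)) *\<^sub>R e + y) y = real j * d" using d e by (simp add: dist_norm)
        moreover have "real j * d \<le> real M * d" using j d by (intro mult_right_mono) auto
        ultimately show "y \<in> ball z (r / 2 + 1)"
          using M(1) dist_triangle[of z y "(- (real j * d)) *\<^sub>R e + y"] by simp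
      qed
    qed auto
    finally have *: "ennreal (real M) * emeasure lborel S \<le> ennreal V"
      by (simp add: mT V ennreal_of_nat_eq_real_of_nat)
    have Sfin: "emeasure lborel S < \<infinity>"
      by (intro emeasure_bounded_finite bounded_subset[OF bounded_ball[of z "r/2"]]) (auto simp: S_def)
    then have Sm: "emeasure lborel S = ennreal (measure lborel S)"
      by (intro emeasure_eq_ennreal_measure) auto
    have "real M * measure lborel S \<le> V"
      using * unfolding Sm by (simp add: ennreal_mult[symmetric] V_def ennreal_le_iff)
    have "measure lborel S \<le> 2 * real M * d * measure lborel S"
      using mult_right_mono[OF M(2), of "measure lborel S"] by simp
    also have "\<dots> = 2 * d * (real M * measure lborel S)" by simp
    also have "\<dots> \<le> 2 * d * V" using \<open>real M * measure lborel S \<le> V\<close> d by (intro mult_left_mono) auto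
    also have "\<dots> = V * (6 * \<Lambda>) * t" by (simp add: d_def)
    finally have mS: "emeasure lborel S \<le> ennreal (V * (6 * \<Lambda>) * t)" unfolding Sm by (rule ennreal_leI)
    have "{y \<in> ball z (r / 2). \<exists>x\<in>frontier \<Omega>. dist y x < t} \<subseteq> S"
    proof safe
      fix y x assume y: "y \<in> ball z (r / 2)" and x: "x \<in> frontier \<Omega>" "dist y x < t"
      have "x \<in> ball z r" using y x(2) t dist_triangle[of z x y] by simp
      then have "\<bar>\<phi> y\<bar> \<le> \<Lambda> * dist y x" using lip[of y x] \<phi>0[OF x(1)] by simp
      also have "\<dots> \<le> \<Lambda> * t" using x(2) \<Lambda> by (intro mult_left_mono) auto
      finally show "y \<in> S" using y by (simp add: S_def)
    qed
    then have "emeasure lborel {y \<in> ball z (r / 2). \<exists>x\<in>frontier \<Omega>. dist y x < t} \<le> emeasure lborel S"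
      by (rule emeasure_mono) simp
    with mS show "emeasure lborel {y \<in> ball z (r / 2). \<exists>x\<in>frontier \<Omega>. dist y x < t} \<le> ennreal (V * (6 * \<Lambda>) * t)"
      by (rule order_trans[rotated])
  qed
qed

text \<open>The frontier is compact, hence covered by finitely many charts. The cover uses half
  radii and \<open>t\<close> stays below them, so a point within \<open>t\<close> of the frontier
  still lies in the chart ball of its neighbour.\<close>

lemma lipschitz_layer:
  fixes \<Omega> :: "'a::euclidean_space set"
  assumes op: "open \<Omega>" and bdd: "bounded \<Omega>" and lip: "lipschitz_boundary \<Omega>"
  obtains C t0 where "0 \<le> C" "0 < t0"
    "\<And>t. 0 < t \<Longrightarrow> t < t0 \<Longrightarrow> emeasure lborel {y. \<exists>x\<in>frontier \<Omega>. dist y x < t} \<le> ennreal (C * t)"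
proof -
  define T where "T z r t = {y \<in> ball z r. \<exists>x\<in>frontier \<Omega>. dist y x < t}" for z r t
  have "\<exists>r>0. \<exists>C\<ge>0. \<exists>t0>0. \<forall>t. 0 < t \<longrightarrow> t < t0 \<longrightarrow> emeasure lborel (T z r t) \<le> ennreal (C * t)"
    if "z \<in> frontier \<Omega>" for z
  proof -
    from lip[unfolded lipschitz_boundary_def, rule_format, OF that]
    obtain r e g L where "0 < r" "norm e = 1" "L-lipschitz_on {y. y \<bullet> e = 0} g"
      "\<Omega> \<inter> ball z r = {x \<in> ball z r. g (x - (x \<bullet> e) *\<^sub>R e) < x \<bullet> e}"
      by (elim exE conjE)
    from lipschitz_layer_local[OF op this(2,3,1,4)] \<open>0 < r\<close> show ?thesis
      unfolding T_def by (intro exI[of _ "r / 2"]) auto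
  qed
  then obtain R C t0 where R: "\<And>z. z \<in> frontier \<Omega> \<Longrightarrow> 0 < R z" and C: "\<And>z. z \<in> frontier \<Omega> \<Longrightarrow> 0 \<le> C z"
    and t0: "\<And>z. z \<in> frontier \<Omega> \<Longrightarrow> 0 < t0 z"
    and le: "\<And>z t. z \<in> frontier \<Omega> \<Longrightarrow> 0 < t \<Longrightarrow> t < t0 z \<Longrightarrow> emeasure lborel (T z (R z) t) \<le> ennreal (C z * t)"
    by metis
  have "compact (frontier \<Omega>)" using bdd by (rule compact_frontier_bounded)
  then obtain Z where Z: "Z \<subseteq> frontier \<Omega>" "finite Z" "frontier \<Omega> \<subseteq> (\<Union>z\<in>Z. ball z (R z / 2))"
  proof (rule compactE_image)
    show "frontier \<Omega> \<subseteq> (\<Union>z\<in>frontier \<Omega>. ball z (R z / 2))"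
    proof
      fix x assume "x \<in> frontier \<Omega>"
      then show "x \<in> (\<Union>z\<in>frontier \<Omega>. ball z (R z / 2))" using R[of x] by (intro UN_I[of x]) auto
    qed
  qed auto
  define t1 where "t1 = Min (insert 1 ((\<lambda>z. min (t0 z) (R z / 2)) ` Z))"
  have t1: "0 < t1" using Z R t0 by (auto simp: t1_def)
  have t1_le: "t1 \<le> t0 z" "t1 \<le> R z / 2" if "z \<in> Z" for z
    using Z(2) that Min_le[of "insert 1 ((\<lambda>z. min (t0 z) (R z / 2)) ` Z)" "min (t0 z) (R z / 2)"]
    by (auto simp: t1_def)
  show thesis
  proof (rule that)
    show "0 \<le> (\<Sum>z\<in>Z. C z)" using Z C by (intro sum_nonneg) auto
    show "0 < t1" by (rule t1)
    fix t assume t: "0 < t" "t < t1"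
    have opT: "open {y. \<exists>x\<in>frontier \<Omega>. dist y x < t}"
    proof -
      have "{y. \<exists>x\<in>frontier \<Omega>. dist y x < t} = (\<Union>x\<in>frontier \<Omega>. ball x t)" by (auto simp: dist_commute)
      then show ?thesis by auto
    qed
    have mT: "T z r t \<in> sets lborel" for z r
    proof -
      have "T z r t = ball z r \<inter> {y. \<exists>x\<in>frontier \<Omega>. dist y x < t}" by (auto simp: T_def)
      then show ?thesis using opT by auto
    qed
    have "{y. \<exists>x\<in>frontier \<Omega>. dist y x < t} \<subseteq> (\<Union>z\<in>Z. T z (R z) t)"
    proof safe
      fix y x assume yx: "x \<in> frontier \<Omega>" "dist y x < t"
      then obtain z where z: "z \<in> Z" "dist z x < R z / 2" using Z(3) by auto
      then have "y \<in> ball z (R z)"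
        using yx(2) t t1_le(2)[OF z(1)] dist_triangle[of z y x] by (simp add: dist_commute)
      then show "y \<in> (\<Union>z\<in>Z. T z (R z) t)" using z yx by (auto simp: T_def)
    qed
    then have "emeasure lborel {y. \<exists>x\<in>frontier \<Omega>. dist y x < t} \<le> emeasure lborel (\<Union>z\<in>Z. T z (R z) t)"
      using Z(2) mT by (intro emeasure_mono) auto
    also have "\<dots> \<le> (\<Sum>z\<in>Z. emeasure lborel (T z (R z) t))"
      using Z(2) mT by (intro emeasure_subadditive_finite) auto
    also have "\<dots> \<le> (\<Sum>z\<in>Z. ennreal (C z * t))"
      using Z t t1_le by (intro sum_mono le) (auto intro: order_less_le_trans)
    also have "\<dots> = ennreal ((\<Sum>z\<in>Z. C z) * t)"
      using Z C t by (subst sum_ennreal) (auto simp: sum_distrib_right)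
    finally show "emeasure lborel {y. \<exists>x\<in>frontier \<Omega>. dist y x < t} \<le> ennreal ((\<Sum>z\<in>Z. C z) * t)" .
  qed
qed

section \<open>The energy functional on the logarithmic space\<close>

lemma borel_measurable_lebesgue_on [measurable (raw)]:
  "f \<in> borel_measurable borel \<Longrightarrow> f \<in> borel_measurable (lebesgue_on S)"
  by (intro measurable_restrict_space1 measurable_completion) auto

lemma integrable_lebesgue_on_of_lborel:
  fixes f :: "'a::euclidean_space \<Rightarrow> real"
  assumes "\<Omega> \<in> sets borel" "integrable lborel f"
  shows "integrable (lebesgue_on \<Omega>) f"
proof -
  have "integrable lebesgue f" using assms(2) by (simp add: integrable_completion)
  then show ?thesis
    using assms(1) integrable_mult_indicator[of \<Omega> lebesgue f] by (subst integrable_restrict_space) auto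
qed

lemma AE_lebesgue_on_of_lborel:
  assumes "\<Omega> \<in> sets borel" "AE x in lborel. P x"
  shows "AE x in lebesgue_on \<Omega>. P x"
  using AE_completion[OF assms(2)] assms(1) by (subst AE_restrict_space_iff) auto

lemma AE_lborel_of_lebesgue_on:
  assumes "\<Omega> \<in> sets borel" "AE x in lebesgue_on \<Omega>. P x" "\<And>x. x \<notin> \<Omega> \<Longrightarrow> P x"
  shows "AE x in lborel. P x"
proof -
  have "AE x in lebesgue. x \<in> \<Omega> \<longrightarrow> P x"
    using assms(1,2) by (subst (asm) AE_restrict_space_iff) auto
  then have "AE x in lebesgue. P x" by eventually_elim (use assms(3) in blast)
  then show ?thesis by (simp add: AE_completion_iff)
qed

lemma AE_lborel_pair:
  assumes "AE x in lborel. P (x::'a::euclidean_space)"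
  shows "AE z in (lborel \<Otimes>\<^sub>M lborel). P (fst z) \<and> P (snd z)"
proof -
  obtain N where N: "{x \<in> space lborel. \<not> P x} \<subseteq> N" "emeasure lborel N = 0" "N \<in> sets lborel"
    using assms by (rule AE_E)
  have "N \<times> UNIV \<in> null_sets (lborel \<Otimes>\<^sub>M lborel)" "UNIV \<times> N \<in> null_sets (lborel \<Otimes>\<^sub>M lborel)"
    using N by (auto simp: null_sets_def lborel.emeasure_pair_measure_Times)
  then have "N \<times> UNIV \<union> UNIV \<times> N \<in> null_sets (lborel \<Otimes>\<^sub>M (lborel :: 'a measure))" by auto
  then show ?thesis by (rule AE_I') (use N(1) in auto)
qed

text \<open>The kernel is split at the scale \<open>r\<close> of the cutoff. Increments longer than
  \<open>r\<close> change \<psi> by at most 1 and cost \<open>ln (1 / r)\<close>; shorter ones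
  change it by at most \<open>norm z / r\<close> and cost \<open>1 / p\<close>. One end of the
  increment must lie in \<open>T\<close>, whence \<open>2 * \<tau>\<close>. With \<tau> of order
  \<open>r\<close> the bound tends to 0.\<close>

lemma dform_cutoff_le:
  fixes \<psi> :: "'a::euclidean_space \<Rightarrow> real"
  assumes p: "1 < p" and r: "0 < r" "r \<le> 1" and [measurable]: "\<psi> \<in> borel_measurable borel" "T \<in> sets borel"
    and T: "emeasure lborel T \<le> ennreal \<tau>" "0 \<le> \<tau>" and le1: "\<And>x y. \<bar>\<psi> x - \<psi> y\<bar> \<le> 1"
    and le2: "\<And>x y. \<bar>\<psi> x - \<psi> y\<bar> \<le> dist x y / r" and eq: "\<And>x y. x \<notin> T \<Longrightarrow> y \<notin> T \<Longrightarrow> \<psi> x = \<psi> y"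
  shows "dform {} DIM('a) p \<psi> \<le> ennreal (2 * \<tau> * (DIM('a) * unit_ball_vol DIM('a) * (ln (1 / r) + 1 / p)))"
proof -
  let ?N = "real DIM('a)"
  let ?c = "?N * unit_ball_vol ?N"
  define \<kappa> where "\<kappa> z = ennreal (norm z powr (- ?N)) * indicator {r..1} (norm z) +
    ennreal (r powr (- p)) * (ennreal (norm z powr (p - ?N)) * indicator {..r} (norm z))" for z :: 'a
  have [measurable]: "\<kappa> \<in> borel_measurable borel" unfolding \<kappa>_def[abs_def] by measurable
  have int: "(\<integral>\<^sup>+z. \<kappa> z \<partial>lborel) = ennreal (?c * (ln (1 / r) + 1 / p))"
  proof -
    have "(\<integral>\<^sup>+z. \<kappa> z \<partial>lborel) = ennreal (?c * ln (1 / r)) + ennreal (r powr (- p)) * ennreal (?c * (r powr p / p))"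
      unfolding \<kappa>_def using p r nn_integral_radial_log[OF r, where 'a = 'a]
        nn_integral_radial_powr_from_0[of p r, where 'a = 'a]
      by (subst nn_integral_add) (auto simp: nn_integral_cmult)
    also have "\<dots> = ennreal (?c * (ln (1 / r) + 1 / p))"
      using p r by (simp add: ennreal_mult[symmetric] ennreal_plus[symmetric] powr_minus_divide distrib_left del: ennreal_plus)
    finally show ?thesis .
  qed
  have "dform {} ?N p \<psi> = (\<integral>\<^sup>+x. \<integral>\<^sup>+z. ennreal (nkern ?N z * \<bar>\<psi> x - \<psi> (x + z)\<bar> powr p) \<partial>lborel \<partial>lborel)"
    by (rule dform_near) measurable
  also have "\<dots> \<le> (\<integral>\<^sup>+x. \<integral>\<^sup>+z. (indicator T x + indicator T (z + x)) * \<kappa> z \<partial>lborel \<partial>lborel)"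
  proof (intro nn_integral_mono)
    fix x z :: 'a
    show "ennreal (nkern ?N z * \<bar>\<psi> x - \<psi> (x + z)\<bar> powr p) \<le> (indicator T x + indicator T (z + x)) * \<kappa> z"
    proof (cases "(x \<in> T \<or> z + x \<in> T) \<and> norm z \<le> 1 \<and> z \<noteq> 0")
      case False
      then have "nkern ?N z = 0 \<or> \<psi> x = \<psi> (x + z)"
        using eq[of x "x + z"] by (auto simp: nkern_def add.commute)
      then show ?thesis by auto
    next
      case True
      have "ennreal (nkern ?N z * \<bar>\<psi> x - \<psi> (x + z)\<bar> powr p) \<le> \<kappa> z"
      proof (cases "r \<le> norm z")
        case c: True
        have "\<bar>\<psi> x - \<psi> (x + z)\<bar> powr p \<le> 1" using le1[of x "x + z"] p by (intro powr_le1) auto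
        then have "nkern ?N z * \<bar>\<psi> x - \<psi> (x + z)\<bar> powr p \<le> nkern ?N z * 1" by (intro mult_left_mono) auto
        also have "\<dots> = norm z powr (- ?N)" using True by (simp add: nkern_def powr_minus_divide)
        finally have "ennreal (nkern ?N z * \<bar>\<psi> x - \<psi> (x + z)\<bar> powr p) \<le> ennreal (norm z powr (- ?N))" by (rule ennreal_leI)
        also have "\<dots> \<le> \<kappa> z" using c True by (simp add: \<kappa>_def)
        finally show ?thesis .
      next
        case c: False
        have "\<bar>\<psi> x - \<psi> (x + z)\<bar> powr p \<le> (norm z / r) powr p"
          using le2[of x "x + z"] p by (intro powr_mono2) (auto simp: dist_norm)
        then have "nkern ?N z * \<bar>\<psi> x - \<psi> (x + z)\<bar> powr p \<le> nkern ?N z * (norm z / r) powr p" by (intro mult_left_mono) auto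
        also have "\<dots> = r powr (- p) * norm z powr (p - ?N)"
          using True r by (simp add: nkern_def powr_minus_divide powr_divide powr_diff)
        finally have "ennreal (nkern ?N z * \<bar>\<psi> x - \<psi> (x + z)\<bar> powr p) \<le> ennreal (r powr (- p) * norm z powr (p - ?N))" by (rule ennreal_leI)
        also have "\<dots> \<le> \<kappa> z" using c True by (simp add: \<kappa>_def ennreal_mult)
        finally show ?thesis .
      qed
      also have "\<dots> = 1 * \<kappa> z" by simp
      also have "\<dots> \<le> (indicator T x + indicator T (z + x)) * \<kappa> z"
        using True by (intro mult_right_mono) (auto simp: indicator_def)
      finally show ?thesis .
    qed
  qed
  also have "\<dots> = (\<integral>\<^sup>+z. \<integral>\<^sup>+x. (indicator T x + indicator T (z + x)) * \<kappa> z \<partial>lborel \<partial>lborel)"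
    by (rule lborel_pair.Fubini'[symmetric]) measurable
  also have "\<dots> = (\<integral>\<^sup>+z. (2 * emeasure lborel T) * \<kappa> z \<partial>lborel)"
  proof (rule nn_integral_cong)
    fix z :: 'a
    have "(\<integral>\<^sup>+x. indicator T (z + x) \<partial>lborel) = (\<integral>\<^sup>+x. indicator T x \<partial>(lborel :: 'a measure))"
      by (rule nn_integral_lborel_translate) measurable
    then have "(\<integral>\<^sup>+x. indicator T x + indicator T (z + x) \<partial>lborel) = 2 * emeasure lborel T"
      by (subst nn_integral_add) (auto simp: mult_2)
    then show "(\<integral>\<^sup>+x. (indicator T x + indicator T (z + x)) * \<kappa> z \<partial>lborel) = (2 * emeasure lborel T) * \<kappa> z"
      by (subst nn_integral_multc) auto
  qed
  also have "\<dots> = (2 * emeasure lborel T) * ennreal (?c * (ln (1 / r) + 1 / p))"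
    by (subst nn_integral_cmult) (auto simp: int)
  also have "\<dots> \<le> (2 * ennreal \<tau>) * ennreal (?c * (ln (1 / r) + 1 / p))"
    using T by (intro mult_right_mono mult_left_mono) auto
  also have "\<dots> = ennreal (2 * \<tau> * (?c * (ln (1 / r) + 1 / p)))"
  proof -
    have "2 * ennreal \<tau> = ennreal (2 * \<tau>)" using T by (simp add: ennreal_mult)
    moreover have "0 \<le> ?c * (ln (1 / r) + 1 / p)" using r p by (intro mult_nonneg_nonneg add_nonneg_nonneg) auto
    ultimately show ?thesis using T by (simp add: ennreal_mult)
  qed
  finally show ?thesis .
qed

text \<open>Borel representatives, vanishing everywhere off \<Omega>, of the elements of
  \<open>X_log\<close>; with them double integrals live on the product of Borel measures. Only the
  near form is asked to be finite, because the far form is controlled by the L^p norm.\<close>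

definition logsp :: "'a::euclidean_space set \<Rightarrow> real \<Rightarrow> ('a \<Rightarrow> real) set" where
  "logsp \<Omega> p = {u \<in> borel_measurable borel. (\<forall>x. x \<notin> \<Omega> \<longrightarrow> u x = 0) \<and>
     (\<integral>\<^sup>+x. ennreal (\<bar>u x\<bar> powr p) \<partial>lborel) < \<infinity> \<and> dform {} DIM('a) p u < \<infinity>}"

text \<open>The limit energy with its coefficients abstracted: a positive Dirichlet coefficient
  \<open>c\<close>, a positive entropy coefficient \<open>m\<close> and a bounded potential
  \<open>V\<close>. The entropy dominates every bounded potential, whatever its sign.\<close>

locale log_functional =
  fixes \<Omega> :: "'a::euclidean_space set" and p c m VB :: real and V :: "'a \<Rightarrow> real"
  assumes p: "1 < p" and op: "open \<Omega>" and bdd: "bounded \<Omega>"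
    and c: "0 < c" and m: "0 < m" and V[measurable]: "V \<in> borel_measurable (lebesgue_on \<Omega>)"
    and VB: "AE x in lebesgue_on \<Omega>. \<bar>V x\<bar> \<le> VB"
begin

text \<open>The far part of \<open>ker\<close>. It is bounded by 1 and lives on pairs inside
  \<Omega>, so it causes no singularity.\<close>

definition farker :: "'a \<times> 'a \<Rightarrow> real" where
  "farker z = indicator \<Omega> (fst z) * indicator \<Omega> (snd z) *
     (indicator {1..} (norm (fst z - snd z)) / norm (fst z - snd z) powr DIM('a))"

definition dint :: "('a \<Rightarrow> real) \<Rightarrow> real" where
  "dint u = (LINT z|(lborel \<Otimes>\<^sub>M lborel). ker \<Omega> DIM('a) z * \<bar>u (fst z) - u (snd z)\<bar> powr p)"

definition low :: "('a \<Rightarrow> real) \<Rightarrow> real" where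
  "low u = (LINT x|lebesgue_on \<Omega>. V x * \<bar>u x\<bar> powr p + m * psi p (u x))"

definition func :: "('a \<Rightarrow> real) \<Rightarrow> real" where
  "func u = c * dint u + low u"

lemma p0: "0 < p" using p by simp

lemma \<Omega>_borel [measurable]: "\<Omega> \<in> sets borel" using op by simp

lemma fin: "emeasure lborel \<Omega> < \<infinity>"
  by (rule emeasure_bounded_finite[OF bdd])

lemma finite_measure_\<Omega>: "finite_measure (lebesgue_on \<Omega>)"
  by (rule finite_measureI) (use fin in \<open>simp add: emeasure_restrict_space space_restrict_space\<close>)

lemma farker_measurable [measurable]: "farker \<in> borel_measurable (lborel \<Otimes>\<^sub>M lborel)"
  unfolding farker_def[abs_def] by measurable

lemma farker_nonneg [simp]: "0 \<le> farker z" by (simp add: farker_def)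

lemma farker_le: "farker z \<le> indicator \<Omega> (fst z) * indicator \<Omega> (snd z)"
  unfolding farker_def by (auto simp: indicator_def divide_le_eq ge_one_powr_ge_zero)

lemma ker_eq: "ker \<Omega> DIM('a) z = ker {} DIM('a) z + farker z"
  by (simp add: ker_def farker_def)

lemma logspD:
  assumes "u \<in> logsp \<Omega> p"
  shows "u \<in> borel_measurable borel" "\<And>x. x \<notin> \<Omega> \<Longrightarrow> u x = 0"
    "(\<integral>\<^sup>+x. ennreal (\<bar>u x\<bar> powr p) \<partial>lborel) < \<infinity>" "dform {} DIM('a) p u < \<infinity>"
  using assms by (auto simp: logsp_def)

lemma logsp_powr_integrable: "u \<in> logsp \<Omega> p \<Longrightarrow> integrable lborel (\<lambda>x. \<bar>u x\<bar> powr p)"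
  using logspD[of u] by (intro integrableI_nonneg) auto

lemma logsp_powr_ln_integrable: "u \<in> logsp \<Omega> p \<Longrightarrow> integrable lborel (\<lambda>x. \<bar>u x\<bar> powr p * \<bar>ln \<bar>u x\<bar>\<bar>)"
  using logspD[of u] log_Sobolev[OF p \<Omega>_borel bdd, of u] by (intro integrableI_nonneg) auto

lemma logsp_psi_integrable: "u \<in> logsp \<Omega> p \<Longrightarrow> integrable lborel (\<lambda>x. psi p (u x))"
proof -
  assume u: "u \<in> logsp \<Omega> p"
  note [measurable] = logspD(1)[OF u]
  show ?thesis
  proof (rule Bochner_Integration.integrable_bound)
    show "integrable lborel (\<lambda>x. p * (\<bar>u x\<bar> powr p * \<bar>ln \<bar>u x\<bar>\<bar>) + \<bar>u x\<bar> powr p)"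
      using u by (intro Bochner_Integration.integrable_add integrable_mult_right logsp_powr_integrable logsp_powr_ln_integrable)
    show "AE x in lborel. norm (psi p (u x)) \<le> norm (p * (\<bar>u x\<bar> powr p * \<bar>ln \<bar>u x\<bar>\<bar>) + \<bar>u x\<bar> powr p)"
    proof (rule AE_I2)
      fix x
      have "\<bar>p * ln \<bar>u x\<bar> - 1\<bar> \<le> p * \<bar>ln \<bar>u x\<bar>\<bar> + 1"
        using p abs_triangle_ineq4[of "p * ln \<bar>u x\<bar>" 1] by (simp add: abs_mult)
      then have "\<bar>u x\<bar> powr p * \<bar>p * ln \<bar>u x\<bar> - 1\<bar> \<le> \<bar>u x\<bar> powr p * (p * \<bar>ln \<bar>u x\<bar>\<bar> + 1)"
        by (rule mult_left_mono) simp
      also have "\<dots> = norm (p * (\<bar>u x\<bar> powr p * \<bar>ln \<bar>u x\<bar>\<bar>) + \<bar>u x\<bar> powr p)"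
        using p by (simp add: algebra_simps)
      finally show "norm (psi p (u x)) \<le> norm (p * (\<bar>u x\<bar> powr p * \<bar>ln \<bar>u x\<bar>\<bar>) + \<bar>u x\<bar> powr p)"
        by (simp add: psi_def abs_mult)
    qed
  qed measurable
qed

lemma V_mult_integrable:
  assumes "integrable (lebesgue_on \<Omega>) f"
  shows "integrable (lebesgue_on \<Omega>) (\<lambda>x. V x * f x)"
proof (rule Bochner_Integration.integrable_bound)
  show "integrable (lebesgue_on \<Omega>) (\<lambda>x. VB * f x)" using assms by simp
  have [measurable]: "f \<in> borel_measurable (lebesgue_on \<Omega>)" using assms by simp
  show "(\<lambda>x. V x * f x) \<in> borel_measurable (lebesgue_on \<Omega>)" by measurable
  show "AE x in lebesgue_on \<Omega>. norm (V x * f x) \<le> norm (VB * f x)"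
    using VB by eventually_elim (auto simp: abs_mult intro!: mult_right_mono)
qed

lemma low_integrable:
  assumes "u \<in> logsp \<Omega> p"
  shows "integrable (lebesgue_on \<Omega>) (\<lambda>x. V x * \<bar>u x\<bar> powr p)"
    and "integrable (lebesgue_on \<Omega>) (\<lambda>x. psi p (u x))"
    and "integrable (lebesgue_on \<Omega>) (\<lambda>x. \<bar>u x\<bar> powr p)"
    and "integrable (lebesgue_on \<Omega>) (\<lambda>x. V x * \<bar>u x\<bar> powr p + m * psi p (u x))"
proof -
  show *: "integrable (lebesgue_on \<Omega>) (\<lambda>x. V x * \<bar>u x\<bar> powr p)"
    by (intro V_mult_integrable integrable_lebesgue_on_of_lborel logsp_powr_integrable assms \<Omega>_borel)
  show **: "integrable (lebesgue_on \<Omega>) (\<lambda>x. psi p (u x))"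
    by (intro integrable_lebesgue_on_of_lborel logsp_psi_integrable assms \<Omega>_borel)
  show "integrable (lebesgue_on \<Omega>) (\<lambda>x. \<bar>u x\<bar> powr p)"
    by (intro integrable_lebesgue_on_of_lborel logsp_powr_integrable assms \<Omega>_borel)
  show "integrable (lebesgue_on \<Omega>) (\<lambda>x. V x * \<bar>u x\<bar> powr p + m * psi p (u x))"
    using * ** by simp
qed

text \<open>Dominating functions of this shape serve for the far integrals; their integrability
  reflects the finite measure of \<Omega>.\<close>

lemma indicator_square_integrable:
  fixes H :: "'a \<Rightarrow> real"
  assumes H: "integrable lborel H" "\<And>x. 0 \<le> H x"
  shows "integrable (lborel \<Otimes>\<^sub>M lborel) (\<lambda>z. indicator \<Omega> (fst z) * indicator \<Omega> (snd z) * (H (fst z) + H (snd z)))"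
proof (rule integrableI_nonneg)
  have [measurable]: "H \<in> borel_measurable borel" using H(1) by simp
  show "(\<lambda>z. indicator \<Omega> (fst z) * indicator \<Omega> (snd z) * (H (fst z) + H (snd z))) \<in> borel_measurable (lborel \<Otimes>\<^sub>M lborel)"
    by measurable
  have Hf: "(\<integral>\<^sup>+x. ennreal (H x) \<partial>lborel) < \<infinity>"
    using H by (subst nn_integral_eq_integral) auto
  have "(\<integral>\<^sup>+z. ennreal (indicator \<Omega> (fst z) * indicator \<Omega> (snd z) * (H (fst z) + H (snd z))) \<partial>(lborel \<Otimes>\<^sub>M lborel))
    \<le> (\<integral>\<^sup>+z. ennreal (H (fst z)) * indicator \<Omega> (snd z) + ennreal (H (snd z)) * indicator \<Omega> (fst z) \<partial>(lborel \<Otimes>\<^sub>M lborel))"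
    using H(2) by (intro nn_integral_mono) (auto simp: indicator_def)
  also have "\<dots> = (\<integral>\<^sup>+x. ennreal (H x) \<partial>lborel) * emeasure lborel \<Omega> + (\<integral>\<^sup>+x. ennreal (H x) \<partial>lborel) * emeasure lborel \<Omega>"
    by (subst lborel.nn_integral_fst[symmetric])
      (auto simp: nn_integral_add nn_integral_cmult nn_integral_multc)
  also have "\<dots> < \<infinity>" using Hf fin by (simp add: ennreal_mult_less_top)
  finally show "(\<integral>\<^sup>+z. ennreal (indicator \<Omega> (fst z) * indicator \<Omega> (snd z) * (H (fst z) + H (snd z))) \<partial>(lborel \<Otimes>\<^sub>M lborel)) < \<infinity>" .
qed (use H in auto)

lemma far_integrable:
  assumes u: "u \<in> logsp \<Omega> p"
  shows "integrable (lborel \<Otimes>\<^sub>M lborel) (\<lambda>z. farker z * \<bar>u (fst z) - u (snd z)\<bar> powr p)"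
proof (rule Bochner_Integration.integrable_bound)
  note [measurable] = logspD(1)[OF u]
  let ?H = "\<lambda>x. 2 powr p * \<bar>u x\<bar> powr p"
  show "integrable (lborel \<Otimes>\<^sub>M lborel) (\<lambda>z. indicator \<Omega> (fst z) * indicator \<Omega> (snd z) * (?H (fst z) + ?H (snd z)))"
    using logsp_powr_integrable[OF u] by (intro indicator_square_integrable) auto
  show "AE z in (lborel \<Otimes>\<^sub>M lborel). norm (farker z * \<bar>u (fst z) - u (snd z)\<bar> powr p)
    \<le> norm (indicator \<Omega> (fst z) * indicator \<Omega> (snd z) * (?H (fst z) + ?H (snd z)))"
  proof (rule AE_I2)
    fix z :: "'a \<times> 'a"
    have "farker z * \<bar>u (fst z) - u (snd z)\<bar> powr p \<le> indicator \<Omega> (fst z) * indicator \<Omega> (snd z) * (2 powr p * (\<bar>u (fst z)\<bar> powr p + \<bar>u (snd z)\<bar> powr p))"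
      by (intro mult_mono farker_le abs_diff_powr_le p0) auto
    then show "norm (farker z * \<bar>u (fst z) - u (snd z)\<bar> powr p)
      \<le> norm (indicator \<Omega> (fst z) * indicator \<Omega> (snd z) * (?H (fst z) + ?H (snd z)))"
      by (simp add: distrib_left)
  qed
  show "(\<lambda>z. farker z * \<bar>u (fst z) - u (snd z)\<bar> powr p) \<in> borel_measurable (lborel \<Otimes>\<^sub>M lborel)"
    by measurable
qed

lemma near_integrable:
  assumes u: "u \<in> logsp \<Omega> p"
  shows "integrable (lborel \<Otimes>\<^sub>M lborel) (\<lambda>z. ker {} DIM('a) z * \<bar>u (fst z) - u (snd z)\<bar> powr p)"
  using logspD(1,4)[OF u] by (intro integrableI_nonneg) (auto simp: dform_def)

lemma dint_integrable:
  assumes u: "u \<in> logsp \<Omega> p"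
  shows "integrable (lborel \<Otimes>\<^sub>M lborel) (\<lambda>z. ker \<Omega> DIM('a) z * \<bar>u (fst z) - u (snd z)\<bar> powr p)"
  using near_integrable[OF u] far_integrable[OF u] by (simp add: ker_eq distrib_right)

lemma dint_eq:
  assumes u: "u \<in> logsp \<Omega> p"
  shows "dint u = enn2real (dform {} DIM('a) p u) + (LINT z|(lborel \<Otimes>\<^sub>M lborel). farker z * \<bar>u (fst z) - u (snd z)\<bar> powr p)"
proof -
  have "enn2real (dform {} DIM('a) p u) = (LINT z|(lborel \<Otimes>\<^sub>M lborel). ker {} DIM('a) z * \<bar>u (fst z) - u (snd z)\<bar> powr p)"
    using near_integrable[OF u] unfolding dform_def by (subst nn_integral_eq_integral) auto
  then show ?thesis
    using near_integrable[OF u] far_integrable[OF u] unfolding dint_def ker_eq distrib_right by simp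
qed

lemma dint_mono:
  assumes u: "u \<in> logsp \<Omega> p" and v: "v \<in> logsp \<Omega> p" and le: "\<And>x y. \<bar>v x - v y\<bar> \<le> \<bar>u x - u y\<bar>"
  shows "dint v \<le> dint u"
  unfolding dint_def using dint_integrable[OF u] dint_integrable[OF v] le p0
  by (intro integral_mono) (auto intro!: mult_left_mono powr_mono2)

text \<open>Truncation and absolute value shrink both values and differences, so the energy space is
  stable under them.\<close>

lemma logspI_contraction:
  assumes u: "u \<in> logsp \<Omega> p" and [measurable]: "v \<in> borel_measurable borel" and v0: "\<And>x. \<bar>v x\<bar> \<le> \<bar>u x\<bar>"
    and le: "\<And>x y. \<bar>v x - v y\<bar> \<le> \<bar>u x - u y\<bar>"
  shows "v \<in> logsp \<Omega> p"
proof -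
  have "(\<integral>\<^sup>+x. ennreal (\<bar>v x\<bar> powr p) \<partial>lborel) \<le> (\<integral>\<^sup>+x. ennreal (\<bar>u x\<bar> powr p) \<partial>lborel)"
    using p v0 by (intro nn_integral_mono ennreal_leI powr_mono2) auto
  moreover have "dform {} DIM('a) p v \<le> dform {} DIM('a) p u"
    unfolding dform_def using p le by (intro nn_integral_mono ennreal_leI mult_left_mono powr_mono2) auto
  moreover have "v x = 0" if "x \<notin> \<Omega>" for x using v0[of x] logspD(2)[OF u that] by simp
  ultimately show ?thesis using logspD[OF u] by (auto simp: logsp_def intro: order.strict_trans1)
qed

text \<open>Only the near part of the double integral has to be controlled by hand; everything else passes
  to the limit by dominated convergence.\<close>

lemma func_limit_le:
  assumes u: "u \<in> logsp \<Omega> p" and \<phi>: "\<And>j. \<phi> j \<in> logsp \<Omega> p" and le: "\<And>j::nat. J \<le> func (\<phi> j)"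
    and AE: "AE x in lborel. (\<lambda>j. \<phi> j x) \<longlonglongrightarrow> u x"
    and H: "integrable lborel H" "\<And>x. 0 \<le> H x"
    and dom: "\<And>j x. x \<in> \<Omega> \<Longrightarrow> \<bar>\<phi> j x\<bar> powr p \<le> H x" "\<And>j x. x \<in> \<Omega> \<Longrightarrow> \<bar>psi p (\<phi> j x)\<bar> \<le> H x"
    and near: "\<And>e. 0 < e \<Longrightarrow> \<forall>\<^sub>F j in sequentially. dform {} DIM('a) p (\<phi> j) \<le> dform {} DIM('a) p u + ennreal e"
  shows "J \<le> func u"
proof -
  note [measurable] = logspD(1)[OF u] logspD(1)[OF \<phi>]
  have [measurable]: "H \<in> borel_measurable borel" using H(1) by simp
  let ?far = "\<lambda>u. LINT z|(lborel \<Otimes>\<^sub>M lborel). farker z * \<bar>u (fst z) - u (snd z)\<bar> powr p"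
  have far: "(\<lambda>j. ?far (\<phi> j)) \<longlonglongrightarrow> ?far u"
  proof (rule integral_dominated_convergence)
    let ?w = "\<lambda>z. 2 powr p * (indicator \<Omega> (fst z) * indicator \<Omega> (snd z) * (H (fst z) + H (snd z)))"
    show "integrable (lborel \<Otimes>\<^sub>M lborel) ?w"
      by (intro integrable_mult_right indicator_square_integrable H)
    show "AE z in (lborel \<Otimes>\<^sub>M lborel). norm (farker z * \<bar>\<phi> j (fst z) - \<phi> j (snd z)\<bar> powr p) \<le> ?w z" for j
    proof (rule AE_I2)
      fix z :: "'a \<times> 'a"
      show "norm (farker z * \<bar>\<phi> j (fst z) - \<phi> j (snd z)\<bar> powr p) \<le> ?w z"
      proof (cases "fst z \<in> \<Omega> \<and> snd z \<in> \<Omega>")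
        case True
        have "farker z * \<bar>\<phi> j (fst z) - \<phi> j (snd z)\<bar> powr p \<le> 1 * (2 powr p * (\<bar>\<phi> j (fst z)\<bar> powr p + \<bar>\<phi> j (snd z)\<bar> powr p))"
          using farker_le[of z] True by (intro mult_mono abs_diff_powr_le p0) auto
        also have "\<dots> \<le> 1 * (2 powr p * (H (fst z) + H (snd z)))"
          using True by (intro mult_left_mono add_mono dom) auto
        finally show ?thesis using True by simp
      qed (auto simp: farker_def)
    qed
    show "AE z in (lborel \<Otimes>\<^sub>M lborel). (\<lambda>j. farker z * \<bar>\<phi> j (fst z) - \<phi> j (snd z)\<bar> powr p) \<longlonglongrightarrow>
      farker z * \<bar>u (fst z) - u (snd z)\<bar> powr p"
      using AE_lborel_pair[OF AE] by eventually_elim (use p in \<open>auto intro!: tendsto_intros tendsto_powr'\<close>)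
  qed measurable
  have low: "(\<lambda>j. low (\<phi> j)) \<longlonglongrightarrow> low u"
    unfolding low_def
  proof (rule integral_dominated_convergence)
    show "integrable (lebesgue_on \<Omega>) (\<lambda>x. (\<bar>VB\<bar> + m) * H x)"
      using H by (intro integrable_mult_right integrable_lebesgue_on_of_lborel) auto
    show "AE x in lebesgue_on \<Omega>. norm (V x * \<bar>\<phi> j x\<bar> powr p + m * psi p (\<phi> j x)) \<le> (\<bar>VB\<bar> + m) * H x" for j
      using VB AE_space
    proof eventually_elim
      case (elim x)
      then have x: "x \<in> \<Omega>" by (simp add: space_restrict_space)
      have "\<bar>V x * \<bar>\<phi> j x\<bar> powr p\<bar> \<le> \<bar>VB\<bar> * H x"
        unfolding abs_mult using elim(1) dom(1)[OF x, of j] by (intro mult_mono) auto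
      moreover have "\<bar>m * psi p (\<phi> j x)\<bar> \<le> m * H x"
        unfolding abs_mult using m dom(2)[OF x, of j] by (intro mult_mono) auto
      ultimately show ?case unfolding real_norm_def distrib_right by linarith
    qed
    show "AE x in lebesgue_on \<Omega>. (\<lambda>j. V x * \<bar>\<phi> j x\<bar> powr p + m * psi p (\<phi> j x)) \<longlonglongrightarrow> V x * \<bar>u x\<bar> powr p + m * psi p (u x)"
      using AE_lebesgue_on_of_lborel[OF \<Omega>_borel AE]
    proof eventually_elim
      case (elim x)
      have "isCont (psi p) (u x)" by (rule DERIV_isCont[OF DERIV_psi[OF p]])
      then have "(\<lambda>j. psi p (\<phi> j x)) \<longlonglongrightarrow> psi p (u x)" by (rule isCont_tendsto_compose) (rule elim)
      then show ?case using p elim by (intro tendsto_intros tendsto_powr') auto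
    qed
  qed measurable
  define A where "A = enn2real (dform {} DIM('a) p u)"
  have A: "dform {} DIM('a) p u = ennreal A"
    using logspD(4)[OF u] by (simp add: A_def less_top)
  have "J \<le> func u + c * e" if e: "0 < e" for e
  proof -
    have "\<forall>\<^sub>F j in sequentially. J \<le> c * (A + e + ?far (\<phi> j)) + low (\<phi> j)"
      using near[OF e]
    proof eventually_elim
      case (elim j)
      have "dform {} DIM('a) p (\<phi> j) \<le> ennreal (A + e)"
        using elim e unfolding A by (simp add: A_def ennreal_plus)
      then have "enn2real (dform {} DIM('a) p (\<phi> j)) \<le> A + e"
        using e by (intro enn2real_leI) (auto simp: A_def)
      then have "c * dint (\<phi> j) \<le> c * (A + e + ?far (\<phi> j))"
        unfolding dint_eq[OF \<phi>] using c by (intro mult_left_mono) auto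
      then show ?case using le[of j] unfolding func_def by linarith
    qed
    moreover have "(\<lambda>j. c * (A + e + ?far (\<phi> j)) + low (\<phi> j)) \<longlonglongrightarrow> c * (A + e + ?far u) + low u"
      by (intro tendsto_intros far low)
    ultimately have "J \<le> c * (A + e + ?far u) + low u"
      by (intro tendsto_lowerbound[of _ _ sequentially]) auto
    then show ?thesis unfolding func_def dint_eq[OF u] A_def[symmetric] by (simp add: algebra_simps)
  qed
  then have "J \<le> func u + e" if "0 < e" for e
    using that c by (metis divide_pos_pos nonzero_mult_div_cancel_left times_divide_eq_right less_irrefl)
  then show ?thesis by (rule field_le_epsilon)
qed

section \<open>Density of Lipschitz functions in energy\<close>

lemma psi_bounded:
  assumes "\<bar>t\<bar> \<le> B"
  shows "\<bar>psi p t\<bar> \<le> 1 + \<bar>psi p B\<bar>"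
  using assms by (intro abs_psi_mono p0) auto

text \<open>Averaging at a radius below \<open>r\<close> keeps the support in \<Omega>, makes the
  function Lipschitz and does not increase the near form. The L^p error is at most the form divided
  by \<open>W j\<close>, hence tends to 0. Boundedness of \<open>u\<close> supplies the dominating
  functions for the other terms.\<close>

lemma minimum_over_Lipschitz_to_compact_support:
  assumes J: "\<And>\<phi> L. \<phi> \<in> logsp \<Omega> p \<Longrightarrow> L-lipschitz_on UNIV \<phi> \<Longrightarrow> J \<le> func \<phi>"
    and u: "u \<in> logsp \<Omega> p" and B: "\<And>x. \<bar>u x\<bar> \<le> B"
    and r: "0 < r" "\<And>x. u x \<noteq> 0 \<Longrightarrow> ball x r \<subseteq> \<Omega>"
  shows "J \<le> func u"
proof -
  note [measurable] = logspD(1)[OF u]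
  define \<rho> where "\<rho> = min 1 (r / 2)"
  have \<rho>: "0 < \<rho>" "\<rho> \<le> 1" "\<rho> < r" using r(1) by (auto simp: \<rho>_def min_def)
  have "\<exists>k W. real (Suc j) \<le> W \<and> mollifier \<rho> W (k :: 'a \<Rightarrow> real)" for j
    using mollifier_exists[OF \<rho>(1,2), of "real (Suc j)"] by (metis of_nat_0_less_iff zero_less_Suc)
  then obtain k W where W: "\<And>j. real (Suc j) \<le> W j" and k: "\<And>j. mollifier \<rho> (W j) (k j :: 'a \<Rightarrow> real)"
    by metis
  have W0: "0 < W j" for j using W[of j] by (simp add: order_less_le_trans[rotated])
  have int: "integrable lborel u"
  proof (rule integrable_of_powr_bound(1)[OF p \<Omega>_borel bdd])
    show "(\<integral>\<^sup>+x. ennreal (\<bar>u x\<bar> powr p) \<partial>lborel) \<le> ennreal (enn2real (\<integral>\<^sup>+x. ennreal (\<bar>u x\<bar> powr p) \<partial>lborel))"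
      using logspD(3)[OF u] by (simp add: less_top)
  qed (use logspD[OF u] in auto)
  have um: "u \<in> borel_measurable borel" by measurable
  note MF = W0 p um int
  have [measurable]: "k j \<in> borel_measurable borel" for j
    using moll_measurable[OF k MF] .
  define \<phi> where "\<phi> j = conv (k j) u" for j
  have [measurable]: "\<phi> j \<in> borel_measurable borel" for j unfolding \<phi>_def by measurable
  have \<phi>B: "\<bar>\<phi> j x\<bar> \<le> B" for j x unfolding \<phi>_def by (rule abs_conv_le[OF k MF B])
  have B0: "0 \<le> B" using B[of undefined] by linarith
  have \<phi>0: "\<phi> j x = 0" if "x \<notin> \<Omega>" for j x
    unfolding \<phi>_def
  proof (rule conv_eq_0[OF k MF])
    fix z :: 'a assume "norm z \<le> \<rho>"
    then have "x \<in> ball (x + z) r" using \<rho> by (simp add: dist_norm)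
    then show "u (x + z) = 0" using r(2)[of "x + z"] that by blast
  qed
  have d: "dform {} DIM('a) p (\<phi> j) \<le> dform {} DIM('a) p u" for j
    unfolding \<phi>_def by (rule dform_conv_le[OF k MF])
  define Hb where "Hb x = indicator \<Omega> x * (B powr p + 1 + \<bar>psi p B\<bar>)" for x
  have Hb: "integrable lborel Hb" "\<And>x. 0 \<le> Hb x"
    using fin unfolding Hb_def[abs_def] by (auto simp: less_top[symmetric])
  have powB: "\<bar>\<phi> j x\<bar> powr p \<le> B powr p" for j x
    using \<phi>B[of j x] p by (intro powr_mono2) auto
  have \<phi>_in: "\<phi> j \<in> logsp \<Omega> p" for j
  proof -
    have "(\<integral>\<^sup>+x. ennreal (\<bar>\<phi> j x\<bar> powr p) \<partial>lborel) \<le> (\<integral>\<^sup>+x. ennreal (Hb x) \<partial>lborel)"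
    proof (intro nn_integral_mono ennreal_leI)
      fix x
      show "\<bar>\<phi> j x\<bar> powr p \<le> Hb x"
        using powB[of j x] by (cases "x \<in> \<Omega>") (simp_all add: Hb_def \<phi>0)
    qed
    also have "\<dots> < \<infinity>" using Hb by (subst nn_integral_eq_integral) auto
    finally show ?thesis using d[of j] logspD(4)[OF u] \<phi>0 by (auto simp: logsp_def intro: order.strict_trans1)
  qed
  have L1: "(\<lambda>j. LINT x|lborel. norm (\<bar>\<phi> j x - u x\<bar> powr p)) \<longlonglongrightarrow> 0"
  proof (rule tendsto_sandwich[of "\<lambda>_. 0"])
    define A where "A = enn2real (dform {} DIM('a) p u)"
    have A: "dform {} DIM('a) p u = ennreal A" "0 \<le> A"
      using logspD(4)[OF u] by (simp_all add: A_def less_top)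
    show "\<forall>\<^sub>F j in sequentially. (LINT x|lborel. norm (\<bar>\<phi> j x - u x\<bar> powr p)) \<le> A / real (Suc j)"
    proof (intro always_eventually allI)
      fix j
      have "(\<integral>\<^sup>+x. ennreal (\<bar>\<phi> j x - u x\<bar> powr p) \<partial>lborel) \<le> ennreal (1 / W j) * ennreal A"
        unfolding \<phi>_def A(1)[symmetric] by (rule conv_minus_le[OF k MF])
      also have "\<dots> = ennreal (A / W j)" using W0[of j] A by (simp add: ennreal_mult[symmetric])
      also have "\<dots> \<le> ennreal (A / real (Suc j))"
        using W[of j] W0[of j] A by (intro ennreal_leI divide_left_mono) auto
      finally have "(\<integral>\<^sup>+x. ennreal (\<bar>\<phi> j x - u x\<bar> powr p) \<partial>lborel) \<le> ennreal (A / real (Suc j))" .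
      then have "enn2real (\<integral>\<^sup>+x. ennreal (\<bar>\<phi> j x - u x\<bar> powr p) \<partial>lborel) \<le> A / real (Suc j)"
        using A by (intro enn2real_leI) auto
      then show "(LINT x|lborel. norm (\<bar>\<phi> j x - u x\<bar> powr p)) \<le> A / real (Suc j)"
        by (subst integral_eq_nn_integral) auto
    qed
    show "(\<lambda>j. A / real (Suc j)) \<longlonglongrightarrow> 0"
      by (rule real_tendsto_divide_at_top[OF tendsto_const]) (rule filterlim_real_sequentially[THEN filterlim_compose[OF _ filterlim_Suc]])
  qed auto
  have int_d: "integrable lborel (\<lambda>x. \<bar>\<phi> j x - u x\<bar> powr p)" for j
  proof (rule Bochner_Integration.integrable_bound)
    show "integrable lborel (\<lambda>x. 2 powr p * (\<bar>\<phi> j x\<bar> powr p + \<bar>u x\<bar> powr p))"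
      by (intro integrable_mult_right Bochner_Integration.integrable_add logsp_powr_integrable \<phi>_in u)
    show "AE x in lborel. norm (\<bar>\<phi> j x - u x\<bar> powr p) \<le> norm (2 powr p * (\<bar>\<phi> j x\<bar> powr p + \<bar>u x\<bar> powr p))"
      using abs_diff_powr_le[OF p0] by (intro AE_I2) auto
  qed measurable
  obtain q where q: "strict_mono q" and AEq: "AE x in lborel. (\<lambda>j. \<bar>\<phi> (q j) x - u x\<bar> powr p) \<longlonglongrightarrow> 0"
    using tendsto_L1_AE_subseq[OF int_d L1] by blast
  show ?thesis
  proof (rule func_limit_le[where \<phi> = "\<lambda>j. \<phi> (q j)" and H = Hb])
    show "AE x in lborel. (\<lambda>j. \<phi> (q j) x) \<longlonglongrightarrow> u x"
      using AEq
    proof eventually_elim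
      case (elim x)
      have "(\<lambda>j. (\<bar>\<phi> (q j) x - u x\<bar> powr p) powr (1 / p)) \<longlonglongrightarrow> 0 powr (1 / p)"
        using p by (intro tendsto_powr' elim tendsto_const) auto
      then have "(\<lambda>j. \<bar>\<phi> (q j) x - u x\<bar>) \<longlonglongrightarrow> 0" using p by (simp add: powr_powr)
      then show ?case by (simp add: tendsto_rabs_zero_iff LIM_zero_iff)
    qed
    show "J \<le> func (\<phi> (q j))" for j
    proof -
      obtain L where "L-lipschitz_on UNIV (k (q j))" using k[of "q j"] by (auto simp: mollifier_def)
      from conv_lipschitz[OF k MF this] show ?thesis
        using J[OF \<phi>_in] unfolding \<phi>_def by blast
    qed
    show "\<bar>\<phi> (q j) x\<bar> powr p \<le> Hb x" if "x \<in> \<Omega>" for j x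
      using that powB[of "q j" x] by (simp add: Hb_def)
    show "\<bar>psi p (\<phi> (q j) x)\<bar> \<le> Hb x" if "x \<in> \<Omega>" for j x
      using that add_mono[OF powr_ge_zero[of B p] psi_bounded[OF \<phi>B[of "q j" x]]] by (simp add: Hb_def)
    show "\<forall>\<^sub>F j in sequentially. dform {} DIM('a) p (\<phi> (q j)) \<le> dform {} DIM('a) p u + ennreal e" for e
      by (intro always_eventually allI order_trans[OF d]) simp
  qed (use u \<phi>_in Hb in auto)
qed

text \<open>Truncation at height \<open>j\<close> is a contraction, so the near form never
  increases, and the truncated function equals \<open>u x\<close> at each point from some
  \<open>j\<close> on.\<close>

lemma minimum_over_bounded_to_all:
  assumes J: "\<And>v B. v \<in> logsp \<Omega> p \<Longrightarrow> (\<And>x. \<bar>v x\<bar> \<le> B) \<Longrightarrow> J \<le> func v"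
    and u: "u \<in> logsp \<Omega> p"
  shows "J \<le> func u"
proof -
  note [measurable] = logspD(1)[OF u]
  define v where "v j x = max (- real j) (min (real j) (u x))" for j :: nat and x
  have v_in: "v j \<in> logsp \<Omega> p" for j
    by (rule logspI_contraction[OF u]) (auto simp: v_def[abs_def])
  have vu: "\<bar>v j x\<bar> \<le> \<bar>u x\<bar>" for j x by (auto simp: v_def)
  define H where "H x = \<bar>u x\<bar> powr p + indicator \<Omega> x + \<bar>psi p (u x)\<bar>" for x
  show ?thesis
  proof (rule func_limit_le[where \<phi> = v and H = H])
    show "J \<le> func (v j)" for j
      by (rule J[OF v_in, of j "real j"]) (auto simp: v_def)
    show "AE x in lborel. (\<lambda>j. v j x) \<longlonglongrightarrow> u x"
    proof (rule AE_I2)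
      fix x
      obtain n :: nat where n: "\<bar>u x\<bar> \<le> real n" using real_arch_simple by blast
      have "\<forall>\<^sub>F j in sequentially. v j x = u x"
        using eventually_ge_at_top[of n] by eventually_elim (use n in \<open>auto simp: v_def\<close>)
      then show "(\<lambda>j. v j x) \<longlonglongrightarrow> u x" by (rule tendsto_eventually)
    qed
    show "integrable lborel H"
      unfolding H_def using fin logsp_powr_integrable[OF u] logsp_psi_integrable[OF u]
      by (auto simp: less_top[symmetric])
    show "\<bar>v j x\<bar> powr p \<le> H x" if "x \<in> \<Omega>" for j x
      using powr_mono2[of p "\<bar>v j x\<bar>" "\<bar>u x\<bar>"] p vu[of j x] that by (simp add: H_def)
    show "\<bar>psi p (v j x)\<bar> \<le> H x" if "x \<in> \<Omega>" for j x
      using add_mono[OF powr_ge_zero[of "\<bar>u x\<bar>" p] abs_psi_mono[OF p0 vu[of j x]]] that by (simp add: H_def)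
    show "\<forall>\<^sub>F j in sequentially. dform {} DIM('a) p (v j) \<le> dform {} DIM('a) p u + ennreal e" for e
    proof (intro always_eventually allI)
      fix j
      have "dform {} DIM('a) p (v j) \<le> dform {} DIM('a) p u"
        unfolding dform_def using p by (intro nn_integral_mono ennreal_leI mult_left_mono powr_mono2) (auto simp: v_def)
      then show "dform {} DIM('a) p (v j) \<le> dform {} DIM('a) p u + ennreal e" by (rule order_trans) simp
    qed
  qed (use u v_in in \<open>auto simp: H_def\<close>)
qed

text \<open>The product rule for differences: the increment of \<open>(1 - \<psi>) * u\<close> is at
  most the increment of \<open>u\<close> plus \<open>B\<close> times the increment of \<psi>. The
  weighted inequality then keeps the factor of \<open>dform u\<close> close to 1.\<close>

lemma dform_mult_le:
  fixes u \<psi> :: "'a \<Rightarrow> real"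
  assumes [measurable]: "u \<in> borel_measurable borel" "\<psi> \<in> borel_measurable borel"
    and B: "\<And>x. \<bar>u x\<bar> \<le> B" and \<psi>: "\<And>x. 0 \<le> \<psi> x" "\<And>x. \<psi> x \<le> 1" and \<theta>: "0 < \<theta>" "\<theta> < 1"
  shows "dform {} DIM('a) p (\<lambda>x. (1 - \<psi> x) * u x) \<le>
    ennreal ((1 - \<theta>) powr (1 - p)) * dform {} DIM('a) p u + ennreal (\<theta> powr (1 - p) * B powr p) * dform {} DIM('a) p \<psi>"
proof -
  let ?N = "real DIM('a)"
  let ?\<alpha> = "(1 - \<theta>) powr (1 - p)" and ?\<beta> = "\<theta> powr (1 - p) * B powr p"
  have B0: "0 \<le> B" using B[of undefined] by linarith
  have "dform {} ?N p (\<lambda>x. (1 - \<psi> x) * u x) \<le> (\<integral>\<^sup>+z. ennreal ?\<alpha> * ennreal (ker {} ?N z * \<bar>u (fst z) - u (snd z)\<bar> powr p) +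
      ennreal ?\<beta> * ennreal (ker {} ?N z * \<bar>\<psi> (fst z) - \<psi> (snd z)\<bar> powr p) \<partial>(lborel \<Otimes>\<^sub>M lborel))"
    unfolding dform_def
  proof (rule nn_integral_mono)
    fix z :: "'a \<times> 'a"
    obtain x y where z: "z = (x, y)" by (cases z)
    have "(1 - \<psi> x) * u x - (1 - \<psi> y) * u y = (1 - \<psi> x) * (u x - u y) - u y * (\<psi> x - \<psi> y)"
      by (simp add: algebra_simps)
    also have "\<bar>\<dots>\<bar> \<le> \<bar>1 - \<psi> x\<bar> * \<bar>u x - u y\<bar> + \<bar>u y\<bar> * \<bar>\<psi> x - \<psi> y\<bar>"
      by (rule order_trans[OF abs_triangle_ineq4]) (simp add: abs_mult)
    also have "\<dots> \<le> 1 * \<bar>u x - u y\<bar> + B * \<bar>\<psi> x - \<psi> y\<bar>"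
      using \<psi>[of x] B[of y] by (intro add_mono mult_right_mono) auto
    finally have "\<bar>(1 - \<psi> x) * u x - (1 - \<psi> y) * u y\<bar> powr p \<le> (\<bar>u x - u y\<bar> + B * \<bar>\<psi> x - \<psi> y\<bar>) powr p"
      using p by (intro powr_mono2) auto
    also have "\<dots> \<le> ?\<alpha> * \<bar>u x - u y\<bar> powr p + \<theta> powr (1 - p) * (B * \<bar>\<psi> x - \<psi> y\<bar>) powr p"
      using p B0 \<theta> by (intro powr_add_le_weighted) auto
    also have "\<dots> = ?\<alpha> * \<bar>u x - u y\<bar> powr p + ?\<beta> * \<bar>\<psi> x - \<psi> y\<bar> powr p"
      using B0 by (simp add: powr_mult)
    finally have "ker {} ?N z * \<bar>(1 - \<psi> x) * u x - (1 - \<psi> y) * u y\<bar> powr p \<le>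
      ker {} ?N z * (?\<alpha> * \<bar>u x - u y\<bar> powr p + ?\<beta> * \<bar>\<psi> x - \<psi> y\<bar> powr p)" by (rule mult_left_mono) simp
    also have "\<dots> = ?\<alpha> * (ker {} ?N z * \<bar>u x - u y\<bar> powr p) + ?\<beta> * (ker {} ?N z * \<bar>\<psi> x - \<psi> y\<bar> powr p)"
      by (simp add: algebra_simps)
    finally have "ennreal (ker {} ?N z * \<bar>(1 - \<psi> x) * u x - (1 - \<psi> y) * u y\<bar> powr p) \<le>
      ennreal (?\<alpha> * (ker {} ?N z * \<bar>u x - u y\<bar> powr p) + ?\<beta> * (ker {} ?N z * \<bar>\<psi> x - \<psi> y\<bar> powr p))" by (rule ennreal_leI)
    also have "\<dots> = ennreal ?\<alpha> * ennreal (ker {} ?N z * \<bar>u x - u y\<bar> powr p) + ennreal ?\<beta> * ennreal (ker {} ?N z * \<bar>\<psi> x - \<psi> y\<bar> powr p)"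
      by (subst ennreal_plus) (auto simp: ennreal_mult[symmetric])
    finally show "ennreal (ker {} ?N z * \<bar>(1 - \<psi> (fst z)) * u (fst z) - (1 - \<psi> (snd z)) * u (snd z)\<bar> powr p) \<le>
      ennreal ?\<alpha> * ennreal (ker {} ?N z * \<bar>u (fst z) - u (snd z)\<bar> powr p) +
      ennreal ?\<beta> * ennreal (ker {} ?N z * \<bar>\<psi> (fst z) - \<psi> (snd z)\<bar> powr p)"
      by (simp add: z)
  qed
  also have "\<dots> = ennreal ?\<alpha> * dform {} ?N p u + ennreal ?\<beta> * dform {} ?N p \<psi>"
    unfolding dform_def by (subst nn_integral_add) (auto simp: nn_integral_cmult)
  finally show ?thesis .
qed

text \<open>The boundary has zero capacity for the logarithmic form: cutoffs at distance
  \<open>r\<close> from it have energy of order \<open>r * ln (1 / r)\<close>, by the measure of the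
  boundary layer. Multiplying by them therefore changes the energy arbitrarily little.\<close>

lemma minimum_compact_support_to_bounded:
  assumes lip: "lipschitz_boundary \<Omega>"
    and J: "\<And>v B r. v \<in> logsp \<Omega> p \<Longrightarrow> (\<And>x. \<bar>v x\<bar> \<le> B) \<Longrightarrow> 0 < r \<Longrightarrow> (\<And>x. v x \<noteq> 0 \<Longrightarrow> ball x r \<subseteq> \<Omega>) \<Longrightarrow> J \<le> func v"
    and u: "u \<in> logsp \<Omega> p" and B: "\<And>x. \<bar>u x\<bar> \<le> B"
  shows "J \<le> func u"
proof (cases "frontier \<Omega> = {}")
  case True
  then have "\<Omega> = {} \<or> \<Omega> = UNIV" by (simp add: frontier_eq_empty)
  then have "\<Omega> = {}" using bdd not_bounded_UNIV by auto
  then have "u x = 0" for x using logspD(2)[OF u] by simp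
  then show ?thesis by (intro J[OF u B, of 1]) auto
next
  case ne: False
  note [measurable] = logspD(1)[OF u]
  let ?N = "real DIM('a)"
  define F where "F = frontier \<Omega>"
  have F: "F \<noteq> {}" "closed F" using ne by (auto simp: F_def)
  obtain C t0 where C: "0 \<le> C" and t0: "0 < t0"
    and layer: "\<And>t. 0 < t \<Longrightarrow> t < t0 \<Longrightarrow> emeasure lborel {y. \<exists>x\<in>F. dist y x < t} \<le> ennreal (C * t)"
    using lipschitz_layer[OF op bdd lip, folded F_def] by blast
  define t1 where "t1 = min 1 (t0 / 4)"
  have t1: "0 < t1" "t1 \<le> 1" "2 * t1 < t0" using t0 by (auto simp: t1_def min_def)
  define r where "r j = t1 / (real j + 1)" for j :: nat
  have r: "0 < r j" "r j \<le> 1" "2 * r j < t0" for j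
  proof -
    have "r j \<le> t1" using t1 by (simp add: r_def divide_le_eq mult_le_cancel_left1)
    then show "0 < r j" "r j \<le> 1" "2 * r j < t0" using t1 by (auto simp: r_def)
  qed
  \<comment> \<open>Equal to 1 within distance \<open>r j\<close> of the frontier and to 0 beyond
    distance \<open>2 * r j\<close>.\<close>
  define \<psi> where "\<psi> j x = max 0 (min 1 (2 - infdist x F / r j))" for j x
  have [measurable]: "\<psi> j \<in> borel_measurable borel" for j
    unfolding \<psi>_def[abs_def] by (intro borel_measurable_continuous_onI continuous_intros) (use r in \<open>auto simp: less_imp_neq[symmetric]\<close>)
  have \<psi>01: "0 \<le> \<psi> j x" "\<psi> j x \<le> 1" for j x by (auto simp: \<psi>_def)
  define T where "T j = {y. \<exists>x\<in>F. dist y x < 2 * r j}" for j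
  have T_meas: "T j \<in> sets borel" for j
  proof -
    have "T j = (\<Union>x\<in>F. ball x (2 * r j))" by (auto simp: T_def dist_commute)
    then have "open (T j)" by (auto intro!: open_UN)
    then show ?thesis by simp
  qed
  have \<psi>T: "\<psi> j x = 0" if "x \<notin> T j" for j x
  proof -
    obtain y where "y \<in> F" "infdist x F = dist x y" using infdist_attains_inf[OF F(2,1), of x] by auto
    then have "2 * r j \<le> infdist x F" using that by (force simp: T_def)
    then have "2 \<le> infdist x F / r j" using r(1)[of j] by (simp add: le_divide_eq)
    then show ?thesis by (simp add: \<psi>_def)
  qed
  have \<psi>lip: "\<bar>\<psi> j x - \<psi> j y\<bar> \<le> dist x y / r j" for j x y
  proof -
    have "\<bar>infdist x F - infdist y F\<bar> \<le> dist x y"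
      using infdist_triangle[of x F y] infdist_triangle[of y F x] by (simp add: dist_commute abs_le_iff)
    then have "\<bar>infdist x F / r j - infdist y F / r j\<bar> \<le> dist x y / r j"
      using r(1)[of j] by (simp add: diff_divide_distrib[symmetric] abs_divide divide_right_mono)
    then show ?thesis unfolding \<psi>_def by (auto simp: max_def min_def)
  qed
  \<comment> \<open>The bound of \<open>dform_cutoff_le\<close> for a layer of width
    \<open>2 * r j\<close> and measure at most \<open>C * (2 * r j)\<close>.\<close>
  define E where "E j = 2 * (C * (2 * r j)) * (?N * unit_ball_vol ?N * (ln (1 / r j) + 1 / p))" for j
  have d\<psi>: "dform {} ?N p (\<psi> j) \<le> ennreal (E j)" for j
    unfolding E_def
  proof (rule dform_cutoff_le[OF p r(1,2) _ T_meas])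
    show "emeasure lborel (T j) \<le> ennreal (C * (2 * r j))"
      unfolding T_def using r[of j] by (intro layer) auto
    show "\<bar>\<psi> j x - \<psi> j y\<bar> \<le> 1" for x y using \<psi>01[of j x] \<psi>01[of j y] by linarith
  qed (use \<psi>T \<psi>lip C r in \<open>auto simp: less_imp_le\<close>)
  have E0: "E \<longlonglongrightarrow> 0"
  proof -
    have "(\<lambda>j. 2 * (C * (2 * (t1 / (real j + 1)))) * (?N * unit_ball_vol ?N * (ln (1 / (t1 / (real j + 1))) + 1 / p))) \<longlonglongrightarrow> 0"
      using t1(1) p by real_asymp
    then show ?thesis unfolding E_def r_def .
  qed
  define v where "v j x = (1 - \<psi> j x) * u x" for j x
  have [measurable]: "v j \<in> borel_measurable borel" for j unfolding v_def[abs_def] by measurable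
  have vu: "\<bar>v j x\<bar> \<le> \<bar>u x\<bar>" for j x
    using \<psi>01[of j x] mult_left_le_one_le[of "\<bar>u x\<bar>" "1 - \<psi> j x"] by (simp add: v_def abs_mult)
  have dv: "dform {} ?N p (v j) \<le> ennreal ((1 - \<theta>) powr (1 - p)) * dform {} ?N p u + ennreal (\<theta> powr (1 - p) * B powr p) * ennreal (E j)"
    if "0 < \<theta>" "\<theta> < 1" for j \<theta>
  proof -
    have "dform {} ?N p (v j) \<le> ennreal ((1 - \<theta>) powr (1 - p)) * dform {} ?N p u + ennreal (\<theta> powr (1 - p) * B powr p) * dform {} ?N p (\<psi> j)"
      unfolding v_def by (rule dform_mult_le) (use that \<psi>01 B in auto)
    also have "\<dots> \<le> ennreal ((1 - \<theta>) powr (1 - p)) * dform {} ?N p u + ennreal (\<theta> powr (1 - p) * B powr p) * ennreal (E j)"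
      by (intro add_left_mono mult_left_mono d\<psi>) auto
    finally show ?thesis .
  qed
  define A where "A = enn2real (dform {} ?N p u)"
  have A: "dform {} ?N p u = ennreal A" "0 \<le> A"
    using logspD(4)[OF u] by (simp_all add: A_def less_top)
  have v_in: "v j \<in> logsp \<Omega> p" for j
  proof -
    have "(\<integral>\<^sup>+x. ennreal (\<bar>v j x\<bar> powr p) \<partial>lborel) \<le> (\<integral>\<^sup>+x. ennreal (\<bar>u x\<bar> powr p) \<partial>lborel)"
      using p vu by (intro nn_integral_mono ennreal_leI powr_mono2) auto
    moreover have "dform {} ?N p (v j) < \<infinity>"
      using dv[of "1/2" j] A by (auto intro!: order.strict_trans1[OF dv[of "1/2" j]] simp: ennreal_mult_less_top)
    moreover have "v j x = 0" if "x \<notin> \<Omega>" for x using vu[of j x] logspD(2)[OF u that] by simp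
    ultimately show ?thesis using logspD(3)[OF u] by (auto simp: logsp_def intro: order.strict_trans1)
  qed
  define H where "H x = \<bar>u x\<bar> powr p + indicator \<Omega> x + \<bar>psi p (u x)\<bar>" for x
  show ?thesis
  proof (rule func_limit_le[where \<phi> = v and H = H])
    show "J \<le> func (v j)" for j
    proof (rule J[OF v_in _ r(1)])
      show "\<bar>v j x\<bar> \<le> B" for x using vu[of j x] B[of x] by linarith
      fix x assume "v j x \<noteq> 0"
      then have "u x \<noteq> 0" and x1: "\<psi> j x \<noteq> 1" by (auto simp: v_def)
      then have x: "x \<in> \<Omega>" using logspD(2)[OF u] by blast
      have "r j < infdist x F"
      proof (rule ccontr)
        assume "\<not> r j < infdist x F"
        then have "infdist x F / r j \<le> 1" using r(1)[of j] by (simp add: divide_le_eq)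
        then show False using x1 by (simp add: \<psi>_def)
      qed
      then have "ball x (r j) \<inter> F = {}"
        using infdist_le[of _ F x] by (force simp: disjoint_iff)
      \<comment> \<open>A connected set that meets \<Omega> but not its frontier lies in
        \<Omega>.\<close>
      then show "ball x (r j) \<subseteq> \<Omega>"
        using connected_Int_frontier[of "ball x (r j)" \<Omega>] x r(1)[of j] unfolding F_def
        by (metis Diff_eq_empty_iff IntI centre_in_ball connected_ball empty_iff)
    qed
    show "AE x in lborel. (\<lambda>j. v j x) \<longlonglongrightarrow> u x"
    proof (rule AE_I2)
      fix x
      show "(\<lambda>j. v j x) \<longlonglongrightarrow> u x"
      proof (cases "x \<in> \<Omega>")
        case True
        then have "x \<notin> F" using op by (simp add: F_def frontier_def interior_open)
        then have d: "0 < infdist x F"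
          using F by (metis infdist_nonneg in_closed_iff_infdist_zero less_eq_real_def)
        have "r \<longlonglongrightarrow> 0" unfolding r_def by real_asymp
        then have "\<forall>\<^sub>F j in sequentially. r j < infdist x F / 2"
          using d by (intro order_tendstoD(2)[of r 0]) auto
        then have "\<forall>\<^sub>F j in sequentially. v j x = u x"
        proof eventually_elim
          case (elim j)
          then have "2 \<le> infdist x F / r j" using r(1)[of j] by (simp add: le_divide_eq)
          then show ?case by (simp add: v_def \<psi>_def)
        qed
        then show ?thesis by (rule tendsto_eventually)
      qed (simp add: v_def logspD(2)[OF u])
    qed
    show "integrable lborel H"
      unfolding H_def using fin logsp_powr_integrable[OF u] logsp_psi_integrable[OF u]
      by (auto simp: less_top[symmetric])
    show "\<bar>v j x\<bar> powr p \<le> H x" if "x \<in> \<Omega>" for j x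
      using powr_mono2[of p "\<bar>v j x\<bar>" "\<bar>u x\<bar>"] p vu[of j x] that by (simp add: H_def)
    show "\<bar>psi p (v j x)\<bar> \<le> H x" if "x \<in> \<Omega>" for j x
      using add_mono[OF powr_ge_zero[of "\<bar>u x\<bar>" p] abs_psi_mono[OF p0 vu[of j x]]] that by (simp add: H_def)
    show "\<forall>\<^sub>F j in sequentially. dform {} ?N p (v j) \<le> dform {} ?N p u + ennreal e" if e: "0 < e" for e
    proof -
      \<comment> \<open>The order of choices matters: \<theta> is fixed first, small enough for the
        factor of \<open>dform u\<close>, and only then \<open>j\<close>, since the factor of
        \<open>E j\<close> is large for small \<theta>.\<close>
      have "((\<lambda>\<theta>. (1 - \<theta>) powr (1 - p) * A) \<longlongrightarrow> (1 - 0) powr (1 - p) * A) (at_right 0)"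
        by (intro tendsto_intros) auto
      then have "\<forall>\<^sub>F \<theta> in at_right 0. (1 - \<theta>) powr (1 - p) * A < A + e / 2"
        using e by (intro order_tendstoD(2)) auto
      moreover have "\<forall>\<^sub>F \<theta> in at_right (0::real). 0 < \<theta> \<and> \<theta> < 1"
        by (intro eventually_conj eventually_at_right_less order_tendstoD(2)[OF tendsto_ident_at]) auto
      ultimately have "\<forall>\<^sub>F \<theta> in at_right 0. (1 - \<theta>) powr (1 - p) * A < A + e / 2 \<and> 0 < \<theta> \<and> \<theta> < 1"
        by eventually_elim auto
      then obtain \<theta> where \<theta>: "(1 - \<theta>) powr (1 - p) * A < A + e / 2" "0 < \<theta>" "\<theta> < 1"
        using eventually_happens'[OF trivial_limit_at_right_real] by blast
      have "(\<lambda>j. (\<theta> powr (1 - p) * B powr p) * E j) \<longlonglongrightarrow> (\<theta> powr (1 - p) * B powr p) * 0"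
        by (intro tendsto_intros E0)
      then have "\<forall>\<^sub>F j in sequentially. (\<theta> powr (1 - p) * B powr p) * E j < e / 2"
        using e by (intro order_tendstoD(2)) auto
      then show ?thesis
      proof eventually_elim
        case (elim j)
        have "dform {} ?N p (v j) \<le> ennreal ((1 - \<theta>) powr (1 - p) * A) + ennreal (\<theta> powr (1 - p) * B powr p * E j)"
          using dv[OF \<theta>(2,3), of j] A by (simp add: ennreal_mult ennreal_mult')
        also have "\<dots> \<le> ennreal (A + e / 2) + ennreal (e / 2)"
          using \<theta>(1) elim by (intro add_mono ennreal_leI) auto
        also have "\<dots> = dform {} ?N p u + ennreal e"
          using A e by (simp add: ennreal_plus[symmetric] del: ennreal_plus)
        finally show ?case .
      qed
    qed
  qed (use u v_in in \<open>auto simp: H_def\<close>)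
qed

text \<open>The reductions compose in reverse: a function is truncated, then cut off near the
  boundary, then averaged.\<close>

theorem minimum_over_Lipschitz:
  assumes "lipschitz_boundary \<Omega>"
    and "\<And>\<phi> L. \<phi> \<in> logsp \<Omega> p \<Longrightarrow> L-lipschitz_on UNIV \<phi> \<Longrightarrow> J \<le> func \<phi>"
    and "u \<in> logsp \<Omega> p"
  shows "J \<le> func u"
  by (rule minimum_over_bounded_to_all[OF minimum_compact_support_to_bounded[OF assms(1)
        minimum_over_Lipschitz_to_compact_support[OF assms(2)]] assms(3)])

end

section \<open>Minimisers\<close>

text \<open>By convexity the quotient lies between the derivatives at the two ends of the segment,
  and each of them is bounded by Young's inequality uniformly in \<open>t\<close>.\<close>

lemma powr_quotient_bound:
  fixes a b t p :: real
  assumes p: "1 < p" and t: "0 < t" "t \<le> 1"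
  shows "\<bar>(\<bar>a + t * b\<bar> powr p - \<bar>a\<bar> powr p) / t\<bar> \<le> p * ((2 powr p + 1) * (\<bar>a\<bar> powr p + \<bar>b\<bar> powr p))"
proof -
  define q where "q = (\<bar>a + t * b\<bar> powr p - \<bar>a\<bar> powr p) / t"
  have p0: "0 < p" using p by simp
  have "\<bar>a\<bar> powr p + p * h p a * (t * b) \<le> \<bar>a + t * b\<bar> powr p"
    using abs_powr_tangent[OF p, of a "a + t * b"] by simp
  then have lo: "p * (h p a * b) \<le> q" using t by (simp add: q_def le_divide_eq algebra_simps)
  have "\<bar>a + t * b\<bar> powr p + p * h p (a + t * b) * (- (t * b)) \<le> \<bar>a\<bar> powr p"
    using abs_powr_tangent[OF p, of "a + t * b" a] by simp
  then have hi: "q \<le> p * (h p (a + t * b) * b)" using t by (simp add: q_def divide_le_eq algebra_simps)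
  have tb: "\<bar>t * b\<bar> powr p \<le> \<bar>b\<bar> powr p"
    using t p by (intro powr_mono2) (auto simp: abs_mult mult_left_le_one_le)
  have "\<bar>a + t * b\<bar> powr p \<le> 2 powr p * (\<bar>a\<bar> powr p + \<bar>t * b\<bar> powr p)"
    using abs_diff_powr_le[OF p0, of a "- (t * b)"] by simp
  also have "\<dots> \<le> 2 powr p * (\<bar>a\<bar> powr p + \<bar>b\<bar> powr p)" using tb by (intro mult_left_mono add_left_mono) auto
  finally have at: "\<bar>a + t * b\<bar> powr p \<le> 2 powr p * (\<bar>a\<bar> powr p + \<bar>b\<bar> powr p)" .
  have "\<bar>h p (a + t * b) * b\<bar> \<le> (2 powr p + 1) * (\<bar>a\<bar> powr p + \<bar>b\<bar> powr p)"
    using abs_h_mult_le[OF p, of "a + t * b" b] at powr_ge_zero[of "\<bar>a\<bar>" p]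
    by (simp only: distrib_right[of "2 powr p"] mult_1)
  then have 1: "p * (h p (a + t * b) * b) \<le> p * ((2 powr p + 1) * (\<bar>a\<bar> powr p + \<bar>b\<bar> powr p))"
    using p0 by (intro mult_left_mono) auto
  have nn: "0 \<le> 2 powr p * (\<bar>a\<bar> powr p + \<bar>b\<bar> powr p)" by simp
  have "\<bar>h p a * b\<bar> \<le> (2 powr p + 1) * (\<bar>a\<bar> powr p + \<bar>b\<bar> powr p)"
    using add_mono[OF nn abs_h_mult_le[OF p, of a b]] by (simp only: distrib_right[of "2 powr p"] mult_1 add_0)
  then have "p * - (h p a * b) \<le> p * ((2 powr p + 1) * (\<bar>a\<bar> powr p + \<bar>b\<bar> powr p))"
    using p0 by (intro mult_left_mono) auto
  then show ?thesis using lo hi 1 unfolding q_def[symmetric] by (simp only: mult_minus_right)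
qed

text \<open>\<open>psi\<close> is not convex in \<open>t\<close>, so the mean value theorem replaces
  the comparison with end slopes, and the bound has to hold at every intermediate point.\<close>

lemma psi_quotient_bound:
  fixes a b t p :: real
  assumes p: "1 < p" and t: "0 < t" "t \<le> 1"
  shows "\<bar>(psi p (a + t * b) - psi p a) / t\<bar> \<le>
    p\<^sup>2 * (\<bar>b\<bar> / (p - 1) + \<bar>2 * a\<bar> powr p * \<bar>ln \<bar>2 * a\<bar>\<bar> + \<bar>2 * b\<bar> powr p * \<bar>ln \<bar>2 * b\<bar>\<bar>)"
proof -
  have "\<exists>z. 0 < z \<and> z < t \<and> psi p (a + t * b) - psi p (a + 0 * b) = (t - 0) * (p\<^sup>2 * h p (a + z * b) * ln \<bar>a + z * b\<bar> * b)"
    by (rule MVT2[OF t(1)]) (rule DERIV_chain2[OF DERIV_psi[OF p]], auto intro!: derivative_eq_intros)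
  then obtain z where z: "0 < z" "z < t"
    "psi p (a + t * b) - psi p a = t * (p\<^sup>2 * h p (a + z * b) * ln \<bar>a + z * b\<bar> * b)" by auto
  then have "(psi p (a + t * b) - psi p a) / t = p\<^sup>2 * (h p (a + z * b) * ln \<bar>a + z * b\<bar> * b)"
    using t by simp
  then have eq: "\<bar>(psi p (a + t * b) - psi p a) / t\<bar> = p\<^sup>2 * \<bar>h p (a + z * b) * ln \<bar>a + z * b\<bar> * b\<bar>"
    by (simp add: abs_mult)
  have "\<bar>z * b\<bar> \<le> \<bar>b\<bar>" using z t by (simp add: abs_mult mult_left_le_one_le)
  then have "\<bar>a + z * b\<bar> \<le> \<bar>a\<bar> + \<bar>b\<bar>" by linarith
  from abs_h_ln_mult_le[OF p this] show ?thesis unfolding eq by (intro mult_left_mono) auto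
qed

lemma DERIV_quotient_sequence:
  fixes f :: "real \<Rightarrow> real"
  assumes "(f has_real_derivative D) (at 0)"
  shows "(\<lambda>n. (f (1 / real (Suc n)) - f 0) / (1 / real (Suc n))) \<longlonglongrightarrow> D"
proof -
  have "((\<lambda>t. (f (0 + t) - f 0) / t) \<longlongrightarrow> D) (at 0)" using assms by (simp add: DERIV_def)
  moreover have l: "(\<lambda>n. 1 / real (Suc n)) \<longlonglongrightarrow> 0"
    using LIMSEQ_inverse_real_of_nat by (simp add: inverse_eq_divide)
  have "filterlim (\<lambda>n. 1 / real (Suc n)) (at 0) sequentially"
    unfolding filterlim_at by (intro conjI l always_eventually allI) auto
  ultimately show ?thesis by (auto dest: filterlim_compose)
qed

section \<open>Boundedness, Euler-Lagrange equation and uniqueness of minimisers\<close>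

context log_functional
begin

lemma logsp_scaled_add:
  assumes u: "u \<in> logsp \<Omega> p" and v: "v \<in> logsp \<Omega> p"
  shows "(\<lambda>x. u x + t * v x) \<in> logsp \<Omega> p"
proof -
  note [measurable] = logspD(1)[OF u] logspD(1)[OF v]
  have ineq: "\<bar>a + t * b\<bar> powr p \<le> 2 powr p * \<bar>a\<bar> powr p + 2 powr p * \<bar>t\<bar> powr p * \<bar>b\<bar> powr p" for a b
    using abs_diff_powr_le[OF p0, of a "- (t * b)"] by (simp add: abs_mult powr_mult distrib_left mult.assoc)
  have "(\<integral>\<^sup>+x. ennreal (\<bar>u x + t * v x\<bar> powr p) \<partial>lborel) \<le>
    (\<integral>\<^sup>+x. ennreal (2 powr p) * ennreal (\<bar>u x\<bar> powr p) + ennreal (2 powr p * \<bar>t\<bar> powr p) * ennreal (\<bar>v x\<bar> powr p) \<partial>lborel)"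
    using ineq by (intro nn_integral_mono) (simp add: ennreal_mult[symmetric] ennreal_plus[symmetric] ennreal_leI del: ennreal_plus)
  also have "\<dots> < \<infinity>"
    using logspD(3)[OF u] logspD(3)[OF v] by (simp add: nn_integral_add nn_integral_cmult ennreal_mult_less_top)
  finally have 1: "(\<integral>\<^sup>+x. ennreal (\<bar>u x + t * v x\<bar> powr p) \<partial>lborel) < \<infinity>" .
  let ?k = "ker {} (real DIM('a))"
  have "dform {} DIM('a) p (\<lambda>x. u x + t * v x) \<le>
    (\<integral>\<^sup>+z. ennreal (2 powr p) * ennreal (?k z * \<bar>u (fst z) - u (snd z)\<bar> powr p) +
      ennreal (2 powr p * \<bar>t\<bar> powr p) * ennreal (?k z * \<bar>v (fst z) - v (snd z)\<bar> powr p) \<partial>(lborel \<Otimes>\<^sub>M lborel))"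
    unfolding dform_def
  proof (rule nn_integral_mono)
    fix z :: "'a \<times> 'a"
    have "?k z * \<bar>(u (fst z) + t * v (fst z)) - (u (snd z) + t * v (snd z))\<bar> powr p \<le>
      ?k z * (2 powr p * \<bar>u (fst z) - u (snd z)\<bar> powr p + 2 powr p * \<bar>t\<bar> powr p * \<bar>v (fst z) - v (snd z)\<bar> powr p)"
      using ineq[of "u (fst z) - u (snd z)" "v (fst z) - v (snd z)"]
      by (intro mult_left_mono) (auto simp: algebra_simps)
    also have "\<dots> = 2 powr p * (?k z * \<bar>u (fst z) - u (snd z)\<bar> powr p) + 2 powr p * \<bar>t\<bar> powr p * (?k z * \<bar>v (fst z) - v (snd z)\<bar> powr p)"
      by (simp add: algebra_simps)
    finally show "ennreal (?k z * \<bar>(u (fst z) + t * v (fst z)) - (u (snd z) + t * v (snd z))\<bar> powr p) \<le>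
      ennreal (2 powr p) * ennreal (?k z * \<bar>u (fst z) - u (snd z)\<bar> powr p) +
      ennreal (2 powr p * \<bar>t\<bar> powr p) * ennreal (?k z * \<bar>v (fst z) - v (snd z)\<bar> powr p)"
      by (simp add: ennreal_mult[symmetric] ennreal_plus[symmetric] ennreal_leI del: ennreal_plus)
  qed
  also have "\<dots> = ennreal (2 powr p) * dform {} DIM('a) p u + ennreal (2 powr p * \<bar>t\<bar> powr p) * dform {} DIM('a) p v"
    unfolding dform_def by (subst nn_integral_add) (auto simp: nn_integral_cmult)
  also have "\<dots> < \<infinity>"
    using logspD(4)[OF u] logspD(4)[OF v] by (simp add: ennreal_mult_less_top)
  finally have 2: "dform {} DIM('a) p (\<lambda>x. u x + t * v x) < \<infinity>" .
  show ?thesis using 1 2 logspD(2)[OF u] logspD(2)[OF v] by (auto simp: logsp_def)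
qed

lemma logsp_zero: "(\<lambda>x. 0) \<in> logsp \<Omega> p"
  using p by (auto simp: logsp_def dform_def)

lemma logsp_cmult: "u \<in> logsp \<Omega> p \<Longrightarrow> (\<lambda>x. t * u x) \<in> logsp \<Omega> p"
  using logsp_scaled_add[OF logsp_zero, of u t] by simp

lemma logsp_abs: "u \<in> logsp \<Omega> p \<Longrightarrow> (\<lambda>x. \<bar>u x\<bar>) \<in> logsp \<Omega> p"
  by (rule logspI_contraction) (auto dest: logspD(1))

definition minimizer :: "('a \<Rightarrow> real) \<Rightarrow> bool" where
  "minimizer u \<longleftrightarrow> u \<in> logsp \<Omega> p \<and> (\<forall>v\<in>logsp \<Omega> p. func u \<le> func v)"

text \<open>Truncation at \<open>k\<close> does not increase the Dirichlet part, so it cannot lower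
  the remaining part. But for large \<open>k\<close> it lowers that part by at least the integral of
  \<open>|u| powr p - |v| powr p\<close>; hence this integral is 0 and nothing is cut off.\<close>

lemma minimizer_bounded:
  assumes "minimizer u"
  obtains k where "AE x in lborel. \<bar>u x\<bar> \<le> k"
proof -
  have u: "u \<in> logsp \<Omega> p" and min: "\<And>v. v \<in> logsp \<Omega> p \<Longrightarrow> func u \<le> func v"
    using assms by (auto simp: minimizer_def)
  note [measurable] = logspD(1)[OF u]
  \<comment> \<open>The level at which the entropy slope \<open>m * p * ln k\<close> reaches
    \<open>|VB| + 1\<close>: it absorbs the potential and leaves a surplus of 1.\<close>
  define k where "k = exp ((\<bar>VB\<bar> + 1) / (m * p))"
  have k: "0 < k" "m * (p * ln k) = \<bar>VB\<bar> + 1" using m p by (auto simp: k_def)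
  define v where "v x = max (- k) (min k (u x))" for x
  have v: "v \<in> logsp \<Omega> p"
    by (rule logspI_contraction[OF u]) (use k in \<open>auto simp: v_def[abs_def]\<close>)
  have "dint v \<le> dint u" by (rule dint_mono[OF u v]) (auto simp: v_def)
  then have lowle: "low u \<le> low v"
    using min[OF v] c unfolding func_def by (smt (verit) mult_left_mono)
  have vu: "\<bar>v x\<bar> powr p \<le> \<bar>u x\<bar> powr p" for x using p k by (intro powr_mono2) (auto simp: v_def)
  have ge: "AE x in lebesgue_on \<Omega>. \<bar>u x\<bar> powr p - \<bar>v x\<bar> powr p \<le>
    (V x * \<bar>u x\<bar> powr p + m * psi p (u x)) - (V x * \<bar>v x\<bar> powr p + m * psi p (v x))"
    using VB
  proof eventually_elim
    case (elim x)
    define d where "d = \<bar>u x\<bar> powr p - \<bar>v x\<bar> powr p"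
    have d: "0 \<le> d" using vu[of x] by (simp add: d_def)
    have "(\<bar>VB\<bar> + 1) * d \<le> m * (psi p (u x) - psi p (v x))"
    proof (cases "\<bar>u x\<bar> \<le> k")
      case True
      then have "v x = u x" by (auto simp: v_def)
      then show ?thesis by (simp add: d_def)
    next
      case False
      then have vk: "\<bar>v x\<bar> = k" using k by (auto simp: v_def)
      have "p * ln k * (\<bar>u x\<bar> powr p - k powr p) \<le> psi p (u x) - psi p k" by (rule psi_diff_ge[OF p0 k(1)])
      then have "m * (p * ln k * d) \<le> m * (psi p (u x) - psi p (v x))"
        using m vk psi_abs[of p "v x"] by (intro mult_left_mono) (auto simp: d_def)
      then show ?thesis using k(2) by (simp add: mult.assoc[symmetric])
    qed
    moreover have "- \<bar>VB\<bar> * d \<le> V x * d" using elim d by (intro mult_right_mono) auto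
    ultimately have "d \<le> V x * d + m * (psi p (u x) - psi p (v x))" by (simp add: distrib_right)
    then show ?case by (simp add: d_def algebra_simps)
  qed
  have int: "integrable (lebesgue_on \<Omega>) (\<lambda>x. \<bar>u x\<bar> powr p - \<bar>v x\<bar> powr p)"
    using low_integrable(3)[OF u] low_integrable(3)[OF v] by simp
  have "(LINT x|lebesgue_on \<Omega>. \<bar>u x\<bar> powr p - \<bar>v x\<bar> powr p) \<le>
    (LINT x|lebesgue_on \<Omega>. (V x * \<bar>u x\<bar> powr p + m * psi p (u x)) - (V x * \<bar>v x\<bar> powr p + m * psi p (v x)))"
    by (rule integral_mono_AE[OF int _ ge]) (intro Bochner_Integration.integrable_diff low_integrable(4) u v)
  also have "\<dots> = low u - low v"
    unfolding low_def by (intro Bochner_Integration.integral_diff low_integrable(4) u v)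
  finally have "(LINT x|lebesgue_on \<Omega>. \<bar>u x\<bar> powr p - \<bar>v x\<bar> powr p) = 0"
    using lowle vu by (intro antisym integral_nonneg_AE) auto
  then have "AE x in lebesgue_on \<Omega>. \<bar>u x\<bar> powr p - \<bar>v x\<bar> powr p = 0"
    using vu by (subst (asm) integral_nonneg_eq_0_iff_AE[OF int]) auto
  then have "AE x in lebesgue_on \<Omega>. \<bar>u x\<bar> \<le> k"
  proof eventually_elim
    case (elim x)
    show ?case
    proof (rule ccontr)
      assume "\<not> \<bar>u x\<bar> \<le> k"
      then have "\<bar>v x\<bar> < \<bar>u x\<bar>" using k by (auto simp: v_def)
      then have "\<bar>v x\<bar> powr p < \<bar>u x\<bar> powr p" using p by (intro powr_less_mono2) auto
      then show False using elim by simp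
    qed
  qed
  then have "AE x in lborel. \<bar>u x\<bar> \<le> k"
    by (rule AE_lborel_of_lebesgue_on[OF \<Omega>_borel]) (use k logspD(2)[OF u] in auto)
  then show thesis by (rule that)
qed

text \<open>\<open>p * ddint u v\<close> is the derivative of \<open>dint\<close> at
  \<open>u\<close> in direction \<open>v\<close>.\<close>

definition ddint :: "('a \<Rightarrow> real) \<Rightarrow> ('a \<Rightarrow> real) \<Rightarrow> real" where
  "ddint u v = (LINT z|(lborel \<Otimes>\<^sub>M lborel). ker \<Omega> DIM('a) z * (h p (u (fst z) - u (snd z)) * (v (fst z) - v (snd z))))"

lemma ddint_integrable:
  assumes u: "u \<in> logsp \<Omega> p" and v: "v \<in> logsp \<Omega> p"
  shows "integrable (lborel \<Otimes>\<^sub>M lborel) (\<lambda>z. ker \<Omega> DIM('a) z * (h p (u (fst z) - u (snd z)) * (v (fst z) - v (snd z))))"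
proof -
  note [measurable] = logspD(1)[OF u] logspD(1)[OF v]
  show ?thesis
  proof (rule Bochner_Integration.integrable_bound[OF Bochner_Integration.integrable_add[OF dint_integrable[OF u] dint_integrable[OF v]]])
    show "AE z in (lborel \<Otimes>\<^sub>M lborel). norm (ker \<Omega> DIM('a) z * (h p (u (fst z) - u (snd z)) * (v (fst z) - v (snd z)))) \<le>
      norm (ker \<Omega> DIM('a) z * \<bar>u (fst z) - u (snd z)\<bar> powr p + ker \<Omega> DIM('a) z * \<bar>v (fst z) - v (snd z)\<bar> powr p)"
    proof (rule AE_I2)
      fix z :: "'a \<times> 'a"
      show "norm (ker \<Omega> DIM('a) z * (h p (u (fst z) - u (snd z)) * (v (fst z) - v (snd z)))) \<le>
        norm (ker \<Omega> DIM('a) z * \<bar>u (fst z) - u (snd z)\<bar> powr p + ker \<Omega> DIM('a) z * \<bar>v (fst z) - v (snd z)\<bar> powr p)"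
        using mult_left_mono[OF abs_h_mult_le[OF p, of "u (fst z) - u (snd z)" "v (fst z) - v (snd z)"] ker_nonneg[of \<Omega> "DIM('a)" z]]
        by (simp add: abs_mult distrib_left)
    qed
  qed measurable
qed

lemma h_mult_integrable:
  assumes u: "u \<in> logsp \<Omega> p" and v: "v \<in> logsp \<Omega> p"
  shows "integrable lborel (\<lambda>x. h p (u x) * v x)"
proof -
  note [measurable] = logspD(1)[OF u] logspD(1)[OF v]
  show ?thesis
    by (rule Bochner_Integration.integrable_bound[OF Bochner_Integration.integrable_add[OF logsp_powr_integrable[OF u] logsp_powr_integrable[OF v]]])
      (use abs_h_mult_le[OF p] in \<open>auto intro!: AE_I2\<close>)
qed

text \<open>The bound of \<open>abs_h_ln_mult_le\<close> as a function on the domain;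
  \<open>log_Sobolev\<close> for the doubled functions makes it integrable.\<close>

definition ln_bound :: "('a \<Rightarrow> real) \<Rightarrow> ('a \<Rightarrow> real) \<Rightarrow> 'a \<Rightarrow> real" where
  "ln_bound u v x = \<bar>v x\<bar> / (p - 1) + \<bar>2 * u x\<bar> powr p * \<bar>ln \<bar>2 * u x\<bar>\<bar> + \<bar>2 * v x\<bar> powr p * \<bar>ln \<bar>2 * v x\<bar>\<bar>"

lemma ln_bound_integrable:
  assumes u: "u \<in> logsp \<Omega> p" and v: "v \<in> logsp \<Omega> p"
  shows "integrable lborel (ln_bound u v)"
proof -
  note [measurable] = logspD(1)[OF u] logspD(1)[OF v]
  have "integrable lborel v"
  proof (rule integrable_of_powr_bound(1)[OF p \<Omega>_borel bdd])
    show "(\<integral>\<^sup>+x. ennreal (\<bar>v x\<bar> powr p) \<partial>lborel) \<le> ennreal (enn2real (\<integral>\<^sup>+x. ennreal (\<bar>v x\<bar> powr p) \<partial>lborel))"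
      using logspD(3)[OF v] by (simp add: less_top)
  qed (use logspD[OF v] in auto)
  then have "integrable lborel (\<lambda>x. \<bar>v x\<bar> / (p - 1))" by simp
  then show ?thesis
    unfolding ln_bound_def[abs_def]
    using logsp_powr_ln_integrable[OF logsp_cmult[OF u, of 2]] logsp_powr_ln_integrable[OF logsp_cmult[OF v, of 2]]
    by (intro Bochner_Integration.integrable_add)
qed

lemma h_ln_integrable:
  assumes u: "u \<in> logsp \<Omega> p" and v: "v \<in> logsp \<Omega> p"
  shows "integrable lborel (\<lambda>x. h p (u x) * ln \<bar>u x\<bar> * v x)"
proof -
  note [measurable] = logspD(1)[OF u] logspD(1)[OF v]
  show ?thesis
  proof (rule Bochner_Integration.integrable_bound[OF ln_bound_integrable[OF u v]])
    show "AE x in lborel. norm (h p (u x) * ln \<bar>u x\<bar> * v x) \<le> norm (ln_bound u v x)"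
    proof (rule AE_I2)
      fix x
      have "\<bar>h p (u x) * ln \<bar>u x\<bar> * v x\<bar> \<le> ln_bound u v x"
        unfolding ln_bound_def by (rule abs_h_ln_mult_le[OF p]) simp
      then show "norm (h p (u x) * ln \<bar>u x\<bar> * v x) \<le> norm (ln_bound u v x)" by simp
    qed
  qed measurable
qed

text \<open>The difference quotients of the energy along \<open>t n = 1 / (n + 1)\<close> are
  non-negative by minimality. Both parts converge by dominated convergence, with the two quotient
  bounds as dominating functions.\<close>

lemma first_variation_nonneg:
  assumes "minimizer u" and v: "v \<in> logsp \<Omega> p"
  shows "0 \<le> c * (p * ddint u v) + (LINT x|lebesgue_on \<Omega>. V x * (p * (h p (u x) * v x)) + m * (p\<^sup>2 * (h p (u x) * ln \<bar>u x\<bar> * v x)))"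
proof -
  have u: "u \<in> logsp \<Omega> p" and min: "\<And>v. v \<in> logsp \<Omega> p \<Longrightarrow> func u \<le> func v"
    using assms by (auto simp: minimizer_def)
  note [measurable] = logspD(1)[OF u] logspD(1)[OF v]
  define t where "t n = 1 / real (Suc n)" for n
  have t: "0 < t n" "t n \<le> 1" for n by (auto simp: t_def)
  define w where "w n x = u x + t n * v x" for n x
  have w: "w n \<in> logsp \<Omega> p" for n unfolding w_def by (rule logsp_scaled_add[OF u v])
  note [measurable] = logspD(1)[OF w]
  let ?K = "ker \<Omega> (real DIM('a))"
  let ?P = "lborel \<Otimes>\<^sub>M (lborel :: 'a measure)"
  define Q where "Q n z = (\<bar>w n (fst z) - w n (snd z)\<bar> powr p - \<bar>u (fst z) - u (snd z)\<bar> powr p) / t n" for n and z :: "'a \<times> 'a"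
  have Qeq: "Q n z = (\<bar>(u (fst z) - u (snd z)) + t n * (v (fst z) - v (snd z))\<bar> powr p - \<bar>u (fst z) - u (snd z)\<bar> powr p) / t n" for n z
    by (simp add: Q_def w_def algebra_simps)
  have 1: "(\<lambda>n. (dint (w n) - dint u) / t n) \<longlonglongrightarrow> p * ddint u v"
  proof -
    have "(\<lambda>n. LINT z|?P. ?K z * Q n z) \<longlonglongrightarrow> (LINT z|?P. p * (?K z * (h p (u (fst z) - u (snd z)) * (v (fst z) - v (snd z)))))"
    proof (rule integral_dominated_convergence)
      let ?w = "\<lambda>z. p * ((2 powr p + 1) * (?K z * \<bar>u (fst z) - u (snd z)\<bar> powr p + ?K z * \<bar>v (fst z) - v (snd z)\<bar> powr p))"
      show "integrable ?P ?w"
        by (intro integrable_mult_right Bochner_Integration.integrable_add dint_integrable u v)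
      show "AE z in ?P. norm (?K z * Q n z) \<le> ?w z" for n
      proof (rule AE_I2)
        fix z :: "'a \<times> 'a"
        have "?K z * \<bar>Q n z\<bar> \<le> ?K z * (p * ((2 powr p + 1) * (\<bar>u (fst z) - u (snd z)\<bar> powr p + \<bar>v (fst z) - v (snd z)\<bar> powr p)))"
          unfolding Qeq by (intro mult_left_mono powr_quotient_bound p t) simp
        also have "\<dots> = ?w z" by (simp add: algebra_simps)
        finally show "norm (?K z * Q n z) \<le> ?w z" by (simp add: abs_mult)
      qed
      show "AE z in ?P. (\<lambda>n. ?K z * Q n z) \<longlonglongrightarrow> p * (?K z * (h p (u (fst z) - u (snd z)) * (v (fst z) - v (snd z))))"
      proof (rule AE_I2)
        fix z :: "'a \<times> 'a"
        let ?a = "u (fst z) - u (snd z)" and ?b = "v (fst z) - v (snd z)"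
        have "((\<lambda>s. \<bar>?a + s * ?b\<bar> powr p) has_real_derivative p * h p (?a + 0 * ?b) * ?b) (at 0)"
          by (rule DERIV_chain2[OF DERIV_abs_powr[OF p]]) (auto intro!: derivative_eq_intros)
        from DERIV_quotient_sequence[OF this]
        have "(\<lambda>n. Q n z) \<longlonglongrightarrow> p * h p ?a * ?b" by (simp add: Qeq t_def)
        then have "(\<lambda>n. ?K z * Q n z) \<longlonglongrightarrow> ?K z * (p * h p ?a * ?b)" by (intro tendsto_mult_left)
        then show "(\<lambda>n. ?K z * Q n z) \<longlonglongrightarrow> p * (?K z * (h p ?a * ?b))" by (simp add: mult_ac)
      qed
    qed (auto simp: Q_def)
    moreover have "(LINT z|?P. ?K z * Q n z) = (dint (w n) - dint u) / t n" for n
      unfolding dint_def using dint_integrable[OF w[of n]] dint_integrable[OF u]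
      by (subst Bochner_Integration.integral_diff[symmetric]) (auto simp: Q_def right_diff_distrib diff_divide_distrib)
    ultimately show ?thesis unfolding ddint_def by simp
  qed
  have 2: "(\<lambda>n. (low (w n) - low u) / t n) \<longlonglongrightarrow> (LINT x|lebesgue_on \<Omega>. V x * (p * (h p (u x) * v x)) + m * (p\<^sup>2 * (h p (u x) * ln \<bar>u x\<bar> * v x)))"
  proof -
    define R where "R n x = V x * ((\<bar>w n x\<bar> powr p - \<bar>u x\<bar> powr p) / t n) + m * ((psi p (w n x) - psi p (u x)) / t n)" for n x
    have "(\<lambda>n. LINT x|lebesgue_on \<Omega>. R n x) \<longlonglongrightarrow>
      (LINT x|lebesgue_on \<Omega>. V x * (p * (h p (u x) * v x)) + m * (p\<^sup>2 * (h p (u x) * ln \<bar>u x\<bar> * v x)))"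
    proof (rule integral_dominated_convergence)
      let ?w = "\<lambda>x. \<bar>VB\<bar> * (p * ((2 powr p + 1) * (\<bar>u x\<bar> powr p + \<bar>v x\<bar> powr p))) + m * (p\<^sup>2 * ln_bound u v x)"
      show "integrable (lebesgue_on \<Omega>) ?w"
        by (intro integrable_lebesgue_on_of_lborel \<Omega>_borel integrable_mult_right Bochner_Integration.integrable_add
            logsp_powr_integrable ln_bound_integrable u v)
      show "AE x in lebesgue_on \<Omega>. norm (R n x) \<le> ?w x" for n
        using VB
      proof eventually_elim
        case (elim x)
        have "\<bar>V x * ((\<bar>w n x\<bar> powr p - \<bar>u x\<bar> powr p) / t n)\<bar> \<le> \<bar>VB\<bar> * (p * ((2 powr p + 1) * (\<bar>u x\<bar> powr p + \<bar>v x\<bar> powr p)))"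
          unfolding w_def abs_mult[of "V x"] using elim by (intro mult_mono powr_quotient_bound p t) auto
        moreover have "\<bar>m * ((psi p (w n x) - psi p (u x)) / t n)\<bar> \<le> m * (p\<^sup>2 * ln_bound u v x)"
          unfolding w_def ln_bound_def abs_mult[of m] using m by (intro mult_mono psi_quotient_bound p t) auto
        ultimately show ?case unfolding R_def real_norm_def by linarith
      qed
      show "AE x in lebesgue_on \<Omega>. (\<lambda>n. R n x) \<longlonglongrightarrow> V x * (p * (h p (u x) * v x)) + m * (p\<^sup>2 * (h p (u x) * ln \<bar>u x\<bar> * v x))"
      proof (rule AE_I2)
        fix x
        have "((\<lambda>s. \<bar>u x + s * v x\<bar> powr p) has_real_derivative p * h p (u x + 0 * v x) * v x) (at 0)"
          by (rule DERIV_chain2[OF DERIV_abs_powr[OF p]]) (auto intro!: derivative_eq_intros)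
        from DERIV_quotient_sequence[OF this]
        have A: "(\<lambda>n. (\<bar>w n x\<bar> powr p - \<bar>u x\<bar> powr p) / t n) \<longlonglongrightarrow> p * (h p (u x) * v x)"
          by (simp add: w_def t_def mult.assoc)
        have "((\<lambda>s. psi p (u x + s * v x)) has_real_derivative p\<^sup>2 * h p (u x + 0 * v x) * ln \<bar>u x + 0 * v x\<bar> * v x) (at 0)"
          by (rule DERIV_chain2[OF DERIV_psi[OF p]]) (auto intro!: derivative_eq_intros)
        from DERIV_quotient_sequence[OF this]
        have B: "(\<lambda>n. (psi p (w n x) - psi p (u x)) / t n) \<longlonglongrightarrow> p\<^sup>2 * (h p (u x) * ln \<bar>u x\<bar> * v x)"
          by (simp add: w_def t_def mult.assoc)
        show "(\<lambda>n. R n x) \<longlonglongrightarrow> V x * (p * (h p (u x) * v x)) + m * (p\<^sup>2 * (h p (u x) * ln \<bar>u x\<bar> * v x))"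
          unfolding R_def by (intro tendsto_intros A B)
      qed
    qed (auto simp: R_def)
    moreover have "(LINT x|lebesgue_on \<Omega>. R n x) = (low (w n) - low u) / t n" for n
    proof -
      have "(LINT x|lebesgue_on \<Omega>. R n x) = (LINT x|lebesgue_on \<Omega>. ((V x * \<bar>w n x\<bar> powr p + m * psi p (w n x)) - (V x * \<bar>u x\<bar> powr p + m * psi p (u x))) / t n)"
        by (intro Bochner_Integration.integral_cong) (auto simp: R_def add_divide_distrib diff_divide_distrib right_diff_distrib)
      also have "\<dots> = (low (w n) - low u) / t n"
        unfolding low_def using low_integrable(4)[OF w[of n]] low_integrable(4)[OF u] by simp
      finally show ?thesis .
    qed
    ultimately show ?thesis by simp
  qed
  have "(\<lambda>n. c * ((dint (w n) - dint u) / t n) + (low (w n) - low u) / t n) \<longlonglongrightarrow>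
    c * (p * ddint u v) + (LINT x|lebesgue_on \<Omega>. V x * (p * (h p (u x) * v x)) + m * (p\<^sup>2 * (h p (u x) * ln \<bar>u x\<bar> * v x)))"
    by (intro tendsto_intros 1 2)
  moreover have "0 \<le> c * ((dint (w n) - dint u) / t n) + (low (w n) - low u) / t n" for n
  proof -
    have "0 \<le> (func (w n) - func u) / t n" using min[OF w[of n]] t(1)[of n] by simp
    also have "\<dots> = c * ((dint (w n) - dint u) / t n) + (low (w n) - low u) / t n"
      by (simp add: func_def diff_divide_distrib add_divide_distrib right_diff_distrib)
    finally show ?thesis .
  qed
  ultimately show ?thesis by (intro tendsto_lowerbound[of _ _ sequentially]) auto
qed

text \<open>The one-sided variation is taken in the directions \<open>v\<close> and
  \<open>- v\<close>; both terms are odd in \<open>v\<close>.\<close>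

theorem Euler_Lagrange:
  assumes min: "minimizer u" and v: "v \<in> logsp \<Omega> p"
  shows "c * ddint u v + (LINT x|lebesgue_on \<Omega>. (V x + m * p * ln \<bar>u x\<bar>) * h p (u x) * v x) = 0"
proof -
  define I where "I v = (LINT x|lebesgue_on \<Omega>. (V x + m * p * ln \<bar>u x\<bar>) * h p (u x) * v x)" for v
  have *: "0 \<le> c * ddint u v + I v" if v: "v \<in> logsp \<Omega> p" for v
  proof -
    have "(LINT x|lebesgue_on \<Omega>. V x * (p * (h p (u x) * v x)) + m * (p\<^sup>2 * (h p (u x) * ln \<bar>u x\<bar> * v x))) =
      (LINT x|lebesgue_on \<Omega>. p * ((V x + m * p * ln \<bar>u x\<bar>) * h p (u x) * v x))"
      by (intro Bochner_Integration.integral_cong) (auto simp: algebra_simps power2_eq_square)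
    also have "\<dots> = p * I v" unfolding I_def by (rule integral_mult_right_zero)
    finally have "0 \<le> c * (p * ddint u v) + p * I v"
      using first_variation_nonneg[OF min v] by (simp only:)
    then have "0 \<le> p * (c * ddint u v + I v)" by (simp add: algebra_simps)
    then show ?thesis using p by (simp add: zero_le_mult_iff)
  qed
  have "0 \<le> c * ddint u (\<lambda>x. - v x) + I (\<lambda>x. - v x)"
    using logsp_cmult[OF v, of "- 1"] by (intro *) simp
  moreover have "ddint u (\<lambda>x. - v x) = - ddint u v"
    unfolding ddint_def by (subst integral_minus[symmetric]) (auto intro!: Bochner_Integration.integral_cong simp: algebra_simps)
  moreover have "I (\<lambda>x. - v x) = - I v" by (simp add: I_def)
  ultimately have "c * ddint u v + I v = 0" using *[OF v] by simp
  then show ?thesis by (simp add: I_def)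
qed

text \<open>The potential is linear in the p-th power, so \<open>pmean\<close> averages it exactly,
  and the Dirichlet part does not exceed the average. Minimality then leaves no room for the entropy
  gap \<open>g\<close>, which is non-negative and vanishes only where the two functions
  agree.\<close>

lemma minimizer_unique_nonneg:
  assumes "minimizer u" "minimizer w" and nn: "\<And>x. 0 \<le> u x" "\<And>x. 0 \<le> w x"
  shows "AE x in lborel. w x = u x"
proof -
  have u: "u \<in> logsp \<Omega> p" and w: "w \<in> logsp \<Omega> p" and min: "\<And>v. v \<in> logsp \<Omega> p \<Longrightarrow> func u \<le> func v"
    and eq: "func w = func u" using assms by (auto simp: minimizer_def intro: antisym)
  note [measurable] = logspD(1)[OF u] logspD(1)[OF w]
  define f where "f x = pmean p (u x) (w x)" for x
  have [measurable]: "f \<in> borel_measurable borel" unfolding f_def[abs_def] pmean_def by measurable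
  have fp: "\<bar>f x\<bar> powr p = (\<bar>u x\<bar> powr p + \<bar>w x\<bar> powr p) / 2" for x
    using nn p0 by (simp add: f_def pmean_powr)
  have fd: "\<bar>f x - f y\<bar> powr p \<le> (\<bar>u x - u y\<bar> powr p + \<bar>w x - w y\<bar> powr p) / 2" for x y
    unfolding f_def by (rule pmean_diff_le[OF p]) (use nn in auto)
  have f: "f \<in> logsp \<Omega> p"
  proof -
    have "(\<integral>\<^sup>+x. ennreal (\<bar>f x\<bar> powr p) \<partial>lborel) \<le> (\<integral>\<^sup>+x. ennreal (\<bar>u x\<bar> powr p) + ennreal (\<bar>w x\<bar> powr p) \<partial>lborel)"
      unfolding fp by (intro nn_integral_mono) (auto simp: ennreal_plus[symmetric] simp del: ennreal_plus intro!: ennreal_leI)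
    also have "\<dots> < \<infinity>" using logspD(3)[OF u] logspD(3)[OF w] by (simp add: nn_integral_add)
    finally have 1: "(\<integral>\<^sup>+x. ennreal (\<bar>f x\<bar> powr p) \<partial>lborel) < \<infinity>" .
    have "dform {} DIM('a) p f \<le> (\<integral>\<^sup>+z. ennreal (ker {} DIM('a) z * \<bar>u (fst z) - u (snd z)\<bar> powr p) +
        ennreal (ker {} DIM('a) z * \<bar>w (fst z) - w (snd z)\<bar> powr p) \<partial>(lborel \<Otimes>\<^sub>M lborel))"
      unfolding dform_def
    proof (rule nn_integral_mono)
      fix z :: "'a \<times> 'a"
      have "\<bar>f (fst z) - f (snd z)\<bar> powr p \<le> \<bar>u (fst z) - u (snd z)\<bar> powr p + \<bar>w (fst z) - w (snd z)\<bar> powr p"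
        by (rule order_trans[OF fd]) simp
      then have "ker {} DIM('a) z * \<bar>f (fst z) - f (snd z)\<bar> powr p \<le>
        ker {} DIM('a) z * (\<bar>u (fst z) - u (snd z)\<bar> powr p + \<bar>w (fst z) - w (snd z)\<bar> powr p)" by (rule mult_left_mono) simp
      then show "ennreal (ker {} DIM('a) z * \<bar>f (fst z) - f (snd z)\<bar> powr p) \<le> ennreal (ker {} DIM('a) z * \<bar>u (fst z) - u (snd z)\<bar> powr p) +
        ennreal (ker {} DIM('a) z * \<bar>w (fst z) - w (snd z)\<bar> powr p)"
        by (simp add: ennreal_plus[symmetric] ennreal_leI distrib_left del: ennreal_plus)
    qed
    also have "\<dots> < \<infinity>" using logspD(4)[OF u] logspD(4)[OF w] by (simp add: nn_integral_add dform_def)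
    finally show ?thesis using 1 logspD(2)[OF u] logspD(2)[OF w] by (auto simp: logsp_def f_def)
  qed
  have "dint f \<le> (LINT z|(lborel \<Otimes>\<^sub>M lborel). (ker \<Omega> DIM('a) z * \<bar>u (fst z) - u (snd z)\<bar> powr p + ker \<Omega> DIM('a) z * \<bar>w (fst z) - w (snd z)\<bar> powr p) / 2)"
    unfolding dint_def
  proof (rule integral_mono[OF dint_integrable[OF f]])
    show "integrable (lborel \<Otimes>\<^sub>M lborel) (\<lambda>z. (ker \<Omega> DIM('a) z * \<bar>u (fst z) - u (snd z)\<bar> powr p + ker \<Omega> DIM('a) z * \<bar>w (fst z) - w (snd z)\<bar> powr p) / 2)"
      using dint_integrable[OF u] dint_integrable[OF w] by simp
    fix z :: "'a \<times> 'a"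
    show "ker \<Omega> DIM('a) z * \<bar>f (fst z) - f (snd z)\<bar> powr p \<le> (ker \<Omega> DIM('a) z * \<bar>u (fst z) - u (snd z)\<bar> powr p + ker \<Omega> DIM('a) z * \<bar>w (fst z) - w (snd z)\<bar> powr p) / 2"
      using mult_left_mono[OF fd[of "fst z" "snd z"] ker_nonneg[of \<Omega> "DIM('a)" z]] by (simp add: distrib_left)
  qed
  also have "\<dots> = (dint u + dint w) / 2"
    unfolding dint_def using dint_integrable[OF u] dint_integrable[OF w] by simp
  finally have "c * dint f \<le> c * ((dint u + dint w) / 2)" using c by (intro mult_left_mono) auto
  moreover have "func u \<le> func f" by (rule min[OF f])
  ultimately have lowf: "(low u + low w) / 2 \<le> low f"
    using eq unfolding func_def by (simp add: field_simps)
  define g where "g x = (psi p (u x) + psi p (w x)) / 2 - psi p (f x)" for x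
  have g0: "0 \<le> g x" for x
    using psi_pmean_le(1)[OF p0 nn] by (simp add: g_def f_def)
  have gint: "integrable (lebesgue_on \<Omega>) g"
    unfolding g_def using low_integrable(2)[OF u] low_integrable(2)[OF w] low_integrable(2)[OF f] by simp
  have "(LINT x|lebesgue_on \<Omega>. m * g x) = (LINT x|lebesgue_on \<Omega>. ((V x * \<bar>u x\<bar> powr p + m * psi p (u x)) + (V x * \<bar>w x\<bar> powr p + m * psi p (w x))) / 2 - (V x * \<bar>f x\<bar> powr p + m * psi p (f x)))"
    by (intro Bochner_Integration.integral_cong refl) (simp add: g_def fp, simp add: field_simps)
  also have "\<dots> = (low u + low w) / 2 - low f"
    unfolding low_def using low_integrable(4)[OF u] low_integrable(4)[OF w] low_integrable(4)[OF f] by simp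
  finally have "m * (LINT x|lebesgue_on \<Omega>. g x) \<le> 0" using lowf by simp
  then have "(LINT x|lebesgue_on \<Omega>. g x) \<le> 0" using m by (simp add: mult_le_0_iff)
  then have "(LINT x|lebesgue_on \<Omega>. g x) = 0" using g0 by (intro antisym integral_nonneg_AE) auto
  then have "AE x in lebesgue_on \<Omega>. g x = 0" using g0 by (subst (asm) integral_nonneg_eq_0_iff_AE[OF gint]) auto
  then have "AE x in lebesgue_on \<Omega>. w x = u x"
  proof eventually_elim
    case (elim x)
    then show ?case using psi_pmean_le(2)[OF p0 nn(1)[of x] nn(2)[of x]] by (simp add: g_def f_def)
  qed
  then show ?thesis
    by (rule AE_lborel_of_lebesgue_on[OF \<Omega>_borel]) (use logspD(2)[OF u] logspD(2)[OF w] in auto)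
qed

text \<open>Taking absolute values does not increase the Dirichlet part, and equality forces
  \<open>u x * u y\<close> to be non-negative for almost every pair. The kernel is positive on all
  pairs of distinct points of \<Omega>, so the sign is global even if \<Omega> is
  disconnected.\<close>

lemma minimizer_abs:
  assumes "minimizer u"
  shows "minimizer (\<lambda>x. \<bar>u x\<bar>)" and "(AE x in lborel. u x = \<bar>u x\<bar>) \<or> (AE x in lborel. u x = - \<bar>u x\<bar>)"
proof -
  have u: "u \<in> logsp \<Omega> p" and min: "\<And>v. v \<in> logsp \<Omega> p \<Longrightarrow> func u \<le> func v"
    using assms by (auto simp: minimizer_def)
  note [measurable] = logspD(1)[OF u]
  note ua = logsp_abs[OF u]
  have low: "low (\<lambda>x. \<bar>u x\<bar>) = low u" by (simp add: low_def)
  have "dint (\<lambda>x. \<bar>u x\<bar>) \<le> dint u" by (rule dint_mono[OF u ua]) auto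
  then have "c * dint (\<lambda>x. \<bar>u x\<bar>) \<le> c * dint u" using c by (intro mult_left_mono) auto
  then have "func (\<lambda>x. \<bar>u x\<bar>) \<le> func u" by (simp add: func_def low)
  then have eq: "func (\<lambda>x. \<bar>u x\<bar>) = func u" using min[OF ua] by (rule antisym)
  then show "minimizer (\<lambda>x. \<bar>u x\<bar>)" using ua min by (simp add: minimizer_def)
  have deq: "dint (\<lambda>x. \<bar>u x\<bar>) = dint u" using eq c by (simp add: func_def low)
  let ?K = "ker \<Omega> (real DIM('a))"
  let ?P = "lborel \<Otimes>\<^sub>M (lborel :: 'a measure)"
  define g where "g z = ?K z * \<bar>u (fst z) - u (snd z)\<bar> powr p - ?K z * \<bar>\<bar>u (fst z)\<bar> - \<bar>u (snd z)\<bar>\<bar> powr p" for z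
  have g0: "0 \<le> g z" for z
    using p by (auto simp: g_def right_diff_distrib[symmetric] intro!: mult_nonneg_nonneg powr_mono2)
  have gint: "integrable ?P g" unfolding g_def using dint_integrable[OF u] dint_integrable[OF ua] by simp
  have "(LINT z|?P. g z) = 0"
    using deq dint_integrable[OF u] dint_integrable[OF ua] unfolding g_def dint_def by simp
  then have "AE z in ?P. g z = 0" using g0 by (subst (asm) integral_nonneg_eq_0_iff_AE[OF gint]) auto
  then have "AE x in lborel. AE y in lborel. g (x, y) = 0" by (rule lborel_pair.AE_pair)
  then have AE2: "AE x in lborel. AE y in lborel. 0 \<le> u x * u y"
  proof eventually_elim
    case (elim x)
    then show ?case
    proof eventually_elim
      case (elim y)
      show ?case
      proof (cases "x \<in> \<Omega> \<and> y \<in> \<Omega> \<and> x \<noteq> y")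
        case True
        then have "0 < ?K (x, y)"
          by (cases "norm (x - y) \<le> 1") (auto simp: ker_def nkern_def indicator_def intro!: add_pos_nonneg)
        then have "\<bar>u x - u y\<bar> powr p = \<bar>\<bar>u x\<bar> - \<bar>u y\<bar>\<bar> powr p" using elim by (simp add: g_def)
        then have "\<bar>u x - u y\<bar> = \<bar>\<bar>u x\<bar> - \<bar>u y\<bar>\<bar>"
          using p by (metis abs_ge_zero powr_less_mono2 less_irrefl linorder_neqE_linordered_idom p0)
        note eq = this
        show ?thesis
        proof (rule ccontr)
          assume "\<not> 0 \<le> u x * u y"
          then have "(0 < u x \<and> u y < 0) \<or> (u x < 0 \<and> 0 < u y)"
            by (simp add: not_le mult_less_0_iff)
          with eq show False by linarith
        qed
      next
        case False
        then show ?thesis using logspD(2)[OF u] by (cases "x = y") auto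
      qed
    qed
  qed
  show "(AE x in lborel. u x = \<bar>u x\<bar>) \<or> (AE x in lborel. u x = - \<bar>u x\<bar>)"
  proof (cases "AE x in lborel. 0 \<le> u x")
    case True
    then have "AE x in lborel. u x = \<bar>u x\<bar>" by eventually_elim simp
    then show ?thesis ..
  next
    case False
    \<comment> \<open>A single point of negative value whose almost all partners have no opposite
      sign determines the sign of \<open>u\<close>.\<close>
    have "\<exists>x. u x < 0 \<and> (AE y in lborel. 0 \<le> u x * u y)"
    proof (rule ccontr)
      assume "\<nexists>x. u x < 0 \<and> (AE y in lborel. 0 \<le> u x * u y)"
      then have "AE x in lborel. 0 \<le> u x" using AE2 by (auto elim!: eventually_mono simp: not_less[symmetric])
      then show False using False by simp
    qed
    then obtain x where x: "u x < 0" "AE y in lborel. 0 \<le> u x * u y" by blast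
    from x(2) have "AE y in lborel. u y = - \<bar>u y\<bar>"
      by eventually_elim (use x(1) in \<open>auto simp: zero_le_mult_iff\<close>)
    then show ?thesis ..
  qed
qed

lemma minimizer_unique:
  assumes u: "minimizer u" "\<And>x. 0 \<le> u x" and w: "minimizer w"
  shows "(AE x in lborel. w x = u x) \<or> (AE x in lborel. w x = - u x)"
proof -
  have "AE x in lborel. \<bar>w x\<bar> = u x"
    by (rule minimizer_unique_nonneg[OF u(1) minimizer_abs(1)[OF w] u(2)]) simp
  note abs = this
  from minimizer_abs(2)[OF w] show ?thesis
  proof
    assume "AE x in lborel. w x = \<bar>w x\<bar>"
    with abs have "AE x in lborel. w x = u x" by eventually_elim simp
    then show ?thesis ..
  next
    assume "AE x in lborel. w x = - \<bar>w x\<bar>"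
    with abs have "AE x in lborel. w x = - u x" by eventually_elim simp
    then show ?thesis ..
  qed
qed

end

section \<open>Convergence of the approximating functionals\<close>

text \<open>The mean value theorem in the exponent, not in \<open>t\<close>. This is where the power
  difference becomes an entropy.\<close>

lemma powr_div_diff_eq_psi:
  fixes t p q :: real
  assumes "1 < q" "q < p"
  obtains \<xi> where "q < \<xi>" "\<xi> < p" "\<bar>t\<bar> powr p / p - \<bar>t\<bar> powr q / q = (p - q) * (psi \<xi> t / \<xi>\<^sup>2)"
proof (cases "t = 0")
  case True
  then show thesis using that[of "(p + q) / 2"] assms by simp
next
  case False
  have "\<exists>\<xi>. q < \<xi> \<and> \<xi> < p \<and> \<bar>t\<bar> powr p / p - \<bar>t\<bar> powr q / q = (p - q) * (psi \<xi> t / \<xi>\<^sup>2)"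
  proof (rule MVT2[OF assms(2)])
    fix r assume r: "q \<le> r" "r \<le> p"
    show "((\<lambda>r. \<bar>t\<bar> powr r / r) has_real_derivative psi r t / r\<^sup>2) (at r)"
      using r assms False
      by (auto intro!: derivative_eq_intros simp: psi_def power2_eq_square field_simps)
  qed
  then show thesis using that by blast
qed

text \<open>Joint continuity in exponent and argument. At \<open>t0 = 0\<close> the logarithm is
  unbounded; exponents at least 1 allow \<open>|t|\<close> to be split into two square roots, one of
  which absorbs it.\<close>

lemma psi_tendsto:
  fixes \<xi> t :: "nat \<Rightarrow> real"
  assumes p: "1 < p" and \<xi>: "\<xi> \<longlonglongrightarrow> p" "\<And>n. 1 \<le> \<xi> n" and t: "t \<longlonglongrightarrow> t0"
  shows "(\<lambda>n. psi (\<xi> n) (t n)) \<longlonglongrightarrow> psi p t0"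
proof (cases "t0 = 0")
  case False
  then show ?thesis unfolding psi_def by (intro tendsto_intros \<xi> t) auto
next
  case True
  obtain B where B: "\<And>n. \<bar>\<xi> n\<bar> \<le> B" using convergent_imp_Bseq[OF convergentI[OF \<xi>(1)]] by (auto simp: Bseq_def)
  have B0: "0 \<le> B" using B[of 0] by linarith
  have "(\<lambda>n. psi (\<xi> n) (t n)) \<longlonglongrightarrow> 0"
  proof (rule Lim_null_comparison)
    have "\<forall>\<^sub>F n in sequentially. \<bar>t n\<bar> < 1"
      using tendsto_rabs[OF t] True by (intro order_tendstoD(2)) auto
    then show "\<forall>\<^sub>F n in sequentially. norm (psi (\<xi> n) (t n)) \<le> (B * 2 + 1) * \<bar>t n\<bar> powr (1/2)"
    proof eventually_elim
      case (elim n)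
      define x where "x = \<bar>t n\<bar>"
      have x: "0 \<le> x" "x < 1" using elim by (auto simp: x_def)
      have "x powr (\<xi> n) \<le> x powr 1"
      proof (cases "x = 0")
        case False
        then show ?thesis using x \<xi>(2)[of n] powr_mono'[of 1 "\<xi> n" x] by simp
      qed (use \<xi>(2)[of n] in auto)
      also have "x powr 1 = x powr (1/2) * x powr (1/2)" by (simp flip: powr_add)
      finally have 1: "x powr (\<xi> n) \<le> x powr (1/2) * x powr (1/2)" .
      have 2: "x powr (1/2) * \<bar>ln x\<bar> \<le> 2" using powr_ln_bound[of "1/2" x] x by simp
      have 3: "x powr (1/2) \<le> 1" using x by (intro powr_le1) auto
      have "norm (psi (\<xi> n) (t n)) = x powr (\<xi> n) * \<bar>\<xi> n * ln x - 1\<bar>" by (simp add: psi_def abs_mult x_def)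
      also have "\<dots> \<le> x powr (\<xi> n) * (B * \<bar>ln x\<bar> + 1)"
        using B[of n] by (intro mult_left_mono order_trans[OF abs_triangle_ineq4]) (auto simp: abs_mult intro: mult_right_mono)
      also have "\<dots> \<le> x powr (1/2) * x powr (1/2) * (B * \<bar>ln x\<bar> + 1)"
        using 1 B0 by (intro mult_right_mono) auto
      also have "\<dots> = x powr (1/2) * (B * (x powr (1/2) * \<bar>ln x\<bar>) + x powr (1/2))" by (simp add: algebra_simps)
      also have "\<dots> \<le> x powr (1/2) * (B * 2 + 1)"
        using 2 3 B0 by (intro mult_left_mono add_mono) auto
      finally show ?case by (simp add: x_def mult.commute)
    qed
    have "(\<lambda>n. (B * 2 + 1) * \<bar>t n\<bar> powr (1/2)) \<longlonglongrightarrow> (B * 2 + 1) * \<bar>t0\<bar> powr (1/2)"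
      by (intro tendsto_mult_left tendsto_powr' tendsto_rabs t) auto
    then show "(\<lambda>n. (B * 2 + 1) * \<bar>t n\<bar> powr (1/2)) \<longlonglongrightarrow> 0" using True by simp
  qed
  then show ?thesis using True by simp
qed

text \<open>The energies of order \<open>s k\<close> divided by \<open>s k\<close>, in abstract
  form. The term \<open>- b / p\<close> in \<open>V\<close> arises because the weights
  \<open>bk\<close> multiply \<open>|t| powr q k / q k\<close>, whose limit is
  \<open>|t| powr p / p\<close>; the coefficient \<open>m * p\<^sup>2\<close> is minus the slope of
  \<open>q\<close> at 0.\<close>

locale log_approx = log_functional +
  fixes s q ck :: "nat \<Rightarrow> real" and Vk bk :: "nat \<Rightarrow> 'a \<Rightarrow> real" and V1 b :: "'a \<Rightarrow> real" and A :: real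
  assumes s: "\<And>k. 0 < s k" "s \<longlonglongrightarrow> 0" and q: "\<And>k. 1 < q k" "\<And>k. q k < p" "q \<longlonglongrightarrow> p"
    and qs: "(\<lambda>k. (p - q k) / s k) \<longlonglongrightarrow> m * p\<^sup>2"
    and ck: "\<And>k. 0 < ck k" "ck \<longlonglongrightarrow> c"
    and Vk[measurable]: "\<And>k. Vk k \<in> borel_measurable (lebesgue_on \<Omega>)" and Vk_bd: "\<And>k. AE x in lebesgue_on \<Omega>. \<bar>Vk k x\<bar> \<le> A"
    and Vk_lim: "AE x in lebesgue_on \<Omega>. (\<lambda>k. Vk k x) \<longlonglongrightarrow> V1 x"
    and bk[measurable]: "\<And>k. bk k \<in> borel_measurable (lebesgue_on \<Omega>)" and bk_bd: "\<And>k. AE x in lebesgue_on \<Omega>. \<bar>bk k x\<bar> \<le> A"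
    and bk_lim: "AE x in lebesgue_on \<Omega>. (\<lambda>k. bk k x) \<longlonglongrightarrow> b x"
    and V_eq: "AE x in lebesgue_on \<Omega>. V x = V1 x - b x / p"
    and A0: "0 \<le> A"
begin

text \<open>The part of the energy that is singular before cancellation. The two powers differ by
  order \<open>s k\<close>, and the quotient tends to \<open>m * psi p t\<close>.\<close>

definition entr :: "nat \<Rightarrow> real \<Rightarrow> real" where
  "entr k t = (\<bar>t\<bar> powr p / p - \<bar>t\<bar> powr q k / q k) / s k"

definition G :: "nat \<Rightarrow> 'a \<Rightarrow> real \<Rightarrow> real" where
  "G k x t = Vk k x * \<bar>t\<bar> powr p - bk k x * (\<bar>t\<bar> powr q k / q k) + entr k t"

text \<open>For the coefficients of the problem, \<open>s k * efun k\<close> is the fractional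
  energy; see \<open>frac_energy_efun\<close>.\<close>

definition efun :: "nat \<Rightarrow> ('a \<Rightarrow> real) \<Rightarrow> real" where
  "efun k u = ck k * enn2real (dform \<Omega> (DIM('a) + s k * p) p u) + (LINT x|lebesgue_on \<Omega>. G k x (u x))"

section \<open>Rescaled entropy and lower order terms: limits, coercivity, bounds\<close>

lemma entr_measurable [measurable]: "entr k \<in> borel_measurable borel"
  unfolding entr_def[abs_def] by measurable

lemma G_measurable:
  assumes [measurable]: "u \<in> borel_measurable borel"
  shows "(\<lambda>x. G k x (u x)) \<in> borel_measurable (lebesgue_on \<Omega>)"
proof -
  have [measurable]: "u \<in> borel_measurable (lebesgue_on \<Omega>)" by (rule borel_measurable_lebesgue_on) measurable
  show ?thesis unfolding G_def by measurable
qed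

lemma m0: "0 < m * p\<^sup>2" using m p by simp

lemma entr_eq:
  obtains \<xi> where "q k < \<xi>" "\<xi> < p" "entr k t = (p - q k) / s k * (psi \<xi> t / \<xi>\<^sup>2)"
  using powr_div_diff_eq_psi[OF q(1,2), of k t] unfolding entr_def by (metis times_divide_eq_left)

lemma quotient_bounded: "\<exists>Q. \<forall>k. (p - q k) / s k \<le> Q"
proof -
  have "Bseq (\<lambda>k. (p - q k) / s k)" using convergent_imp_Bseq[OF convergentI[OF qs]] .
  then obtain K where "\<forall>k. norm ((p - q k) / s k) \<le> K" unfolding Bseq_def by blast
  then have "(p - q k) / s k \<le> K" for k
    using abs_ge_self[of "(p - q k) / s k"] unfolding real_norm_def by (blast intro: order_trans)
  then show ?thesis by blast
qed

text \<open>In the mean value form, \<open>psi\<close> is at least -1, the square of the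
  intermediate exponent is at least 1, and the prefactor \<open>(p - q k) / s k\<close> is bounded
  because it converges.\<close>

lemma entr_ge: "\<exists>Q\<ge>0. \<forall>k t. - Q \<le> entr k t"
proof -
  obtain Q where Q: "\<And>k. (p - q k) / s k \<le> Q" using quotient_bounded by blast
  show ?thesis
  proof (intro exI[of _ "max 0 Q"] conjI allI)
    fix k t
    obtain \<xi> where \<xi>: "q k < \<xi>" "\<xi> < p" and eq: "entr k t = (p - q k) / s k * (psi \<xi> t / \<xi>\<^sup>2)" by (rule entr_eq)
    have \<xi>1: "1 < \<xi>" using \<xi> q(1)[of k] by simp
    have sq: "1 \<le> \<xi>\<^sup>2" using \<xi>1 by (simp add: one_le_power less_imp_le)
    have "- 1 \<le> - (1 / \<xi>\<^sup>2)" using sq by (simp add: divide_le_eq)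
    also have "\<dots> \<le> psi \<xi> t / \<xi>\<^sup>2" using psi_ge[of \<xi> t] divide_right_mono[of "- 1" "psi \<xi> t" "\<xi>\<^sup>2"] by simp
    finally have 1: "- 1 \<le> psi \<xi> t / \<xi>\<^sup>2" .
    have pos: "0 \<le> (p - q k) / s k" using q(2)[of k] s(1)[of k] by simp
    have "(p - q k) / s k * (- 1) \<le> entr k t" unfolding eq by (rule mult_left_mono[OF 1 pos])
    then show "- max 0 Q \<le> entr k t" using Q[of k] by simp
  qed simp
qed

lemma entr_tendsto:
  assumes r: "strict_mono r" and t: "t \<longlonglongrightarrow> t0"
  shows "(\<lambda>k. entr (r k) (t k)) \<longlonglongrightarrow> m * psi p t0"
proof -
  have "\<forall>k. \<exists>\<xi>. q (r k) < \<xi> \<and> \<xi> < p \<and> entr (r k) (t k) = (p - q (r k)) / s (r k) * (psi \<xi> (t k) / \<xi>\<^sup>2)"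
    using entr_eq by metis
  then obtain \<xi> where \<xi>: "\<And>k. q (r k) < \<xi> k" "\<And>k. \<xi> k < p"
    and eq: "\<And>k. entr (r k) (t k) = (p - q (r k)) / s (r k) * (psi (\<xi> k) (t k) / (\<xi> k)\<^sup>2)" by metis
  have "(\<lambda>k. q (r k)) \<longlonglongrightarrow> p" using LIMSEQ_subseq_LIMSEQ[OF q(3) r] by (simp add: o_def)
  then have lim: "\<xi> \<longlonglongrightarrow> p"
    by (rule tendsto_sandwich[rotated 2, OF _ tendsto_const]) (use \<xi> in \<open>auto simp: less_imp_le\<close>)
  have ge: "1 \<le> \<xi> k" for k using \<xi>(1)[of k] q(1)[of "r k"] by simp
  have "(\<lambda>k. (p - q (r k)) / s (r k)) \<longlonglongrightarrow> m * p\<^sup>2" using LIMSEQ_subseq_LIMSEQ[OF qs r] by (simp add: o_def)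
  then have "(\<lambda>k. entr (r k) (t k)) \<longlonglongrightarrow> m * p\<^sup>2 * (psi p t0 / p\<^sup>2)"
    unfolding eq by (intro tendsto_intros psi_tendsto[OF p lim ge t] lim) (use p in auto)
  then show ?thesis using p by simp
qed

text \<open>Because \<open>q k < p\<close>, the quotient of \<open>entr k t\<close> by
  \<open>|t| powr p\<close> increases with \<open>|t|\<close>. It is thus enough to make it exceed
  \<open>|M|\<close> at one point \<open>T\<close>, which convergence at that point provides for
  large \<open>k\<close>; below \<open>T\<close> the uniform lower bound suffices.\<close>

lemma entr_coercive: "\<exists>C. \<forall>\<^sub>F k in sequentially. \<forall>t. M * \<bar>t\<bar> powr p - C \<le> entr k t"
proof -
  obtain Q where Q: "0 \<le> Q" "\<And>k t. - Q \<le> entr k t" using entr_ge by blast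
  \<comment> \<open>Makes the limit quotient \<open>m * (p * ln T - 1)\<close> equal to
    \<open>|M| + 1\<close>.\<close>
  define T where "T = exp (((\<bar>M\<bar> + 1) / m + 1) / p)"
  have T: "0 < T" "p * ln T - 1 = (\<bar>M\<bar> + 1) / m" using p by (auto simp: T_def)
  have Tp: "0 < T powr p" using T by simp
  have "(\<lambda>k. entr (id k) T) \<longlonglongrightarrow> m * psi p T"
    by (rule entr_tendsto) (simp_all add: strict_mono_def)
  then have "(\<lambda>k. entr k T / T powr p) \<longlonglongrightarrow> m * psi p T / T powr p"
    using T by (intro tendsto_divide tendsto_const) auto
  moreover have "m * psi p T / T powr p = \<bar>M\<bar> + 1" using T m by (simp add: psi_def)
  ultimately have "\<forall>\<^sub>F k in sequentially. \<bar>M\<bar> < entr k T / T powr p"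
    by (intro order_tendstoD(1)) auto
  then have "\<forall>\<^sub>F k in sequentially. \<forall>t. M * \<bar>t\<bar> powr p - (\<bar>M\<bar> * T powr p + Q) \<le> entr k t"
  proof eventually_elim
    case (elim k)
    show ?case
    proof
      fix t :: real
      show "M * \<bar>t\<bar> powr p - (\<bar>M\<bar> * T powr p + Q) \<le> entr k t"
      proof (cases "\<bar>t\<bar> \<le> T")
        case True
        have "\<bar>t\<bar> powr p \<le> T powr p" using True p by (intro powr_mono2) auto
        then have "M * \<bar>t\<bar> powr p \<le> \<bar>M\<bar> * T powr p" by (intro mult_mono) auto
        then show ?thesis using Q(2)[of k t] by linarith
      next
        case False
        then have t: "0 < \<bar>t\<bar>" "T \<le> \<bar>t\<bar>" using T by auto
        have *: "entr k y / \<bar>y\<bar> powr p = (1 / p - \<bar>y\<bar> powr (q k - p) / q k) / s k" if "0 < \<bar>y\<bar>" for y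
          using that q(1)[of k] s(1)[of k] p by (simp add: entr_def powr_diff field_simps)
        have "\<bar>t\<bar> powr (q k - p) \<le> T powr (q k - p)" using t T q(2)[of k] by (intro powr_mono2') auto
        then have "entr k T / T powr p \<le> entr k t / \<bar>t\<bar> powr p"
          using *[of t] *[of T] t T q(1)[of k] s(1)[of k]
          by (auto intro!: divide_right_mono diff_left_mono)
        then have le: "\<bar>M\<bar> \<le> entr k t / \<bar>t\<bar> powr p" using elim by linarith
        have "0 < \<bar>t\<bar> powr p" using t by simp
        then have "\<bar>M\<bar> * \<bar>t\<bar> powr p \<le> entr k t" using le by (simp only: pos_le_divide_eq)
        moreover have "M * \<bar>t\<bar> powr p \<le> \<bar>M\<bar> * \<bar>t\<bar> powr p" by (intro mult_right_mono) auto
        moreover have "0 \<le> \<bar>M\<bar> * T powr p" by simp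
        ultimately show ?thesis using Q(1) by linarith
      qed
    qed
  qed
  then show ?thesis by blast
qed

lemma powr_q_le: "\<bar>t\<bar> powr q k / q k \<le> 1 + \<bar>t\<bar> powr p"
proof -
  have "\<bar>t\<bar> powr q k / q k \<le> \<bar>t\<bar> powr q k" using q(1)[of k] by (simp add: divide_le_eq mult_le_cancel_left1)
  also have "\<dots> \<le> 1 + \<bar>t\<bar> powr p"
  proof (cases "\<bar>t\<bar> \<le> 1")
    case True
    then have "\<bar>t\<bar> powr q k \<le> 1" using q(1)[of k] by (intro powr_le1) auto
    then show ?thesis using powr_ge_zero[of "\<bar>t\<bar>" p] by linarith
  next
    case False
    then have "\<bar>t\<bar> powr q k \<le> \<bar>t\<bar> powr p" using q(2)[of k] by (intro powr_mono) auto
    then show ?thesis by simp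
  qed
  finally show ?thesis .
qed

text \<open>Of the growth rate \<open>2 * A + 1\<close> of the entropy, one \<open>A\<close> pays
  for \<open>Vk\<close>, one for \<open>bk\<close>, and 1 is left over.\<close>

lemma G_coercive: "\<exists>C\<ge>0. \<forall>\<^sub>F k in sequentially. AE x in lebesgue_on \<Omega>. \<forall>t. \<bar>t\<bar> powr p - C \<le> G k x t"
proof -
  obtain C where C: "\<forall>\<^sub>F k in sequentially. \<forall>t. (2 * A + 1) * \<bar>t\<bar> powr p - C \<le> entr k t"
    using entr_coercive by blast
  have "\<forall>\<^sub>F k in sequentially. AE x in lebesgue_on \<Omega>. \<forall>t. \<bar>t\<bar> powr p - (\<bar>C\<bar> + A) \<le> G k x t"
    using C
  proof eventually_elim
    case (elim k)
    show ?case
      using Vk_bd[of k] bk_bd[of k]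
    proof eventually_elim
      case x: (elim x)
      show ?case
      proof
        fix t :: real
        have "- A * \<bar>t\<bar> powr p \<le> Vk k x * \<bar>t\<bar> powr p" using x(1) by (intro mult_right_mono) auto
        moreover have "bk k x * (\<bar>t\<bar> powr q k / q k) \<le> A * (1 + \<bar>t\<bar> powr p)"
          using x(2) A0 powr_q_le[of t k] q(1)[of k] by (intro mult_mono) auto
        moreover have "(2 * A + 1) * \<bar>t\<bar> powr p - C \<le> entr k t" using elim by blast
        ultimately show "\<bar>t\<bar> powr p - (\<bar>C\<bar> + A) \<le> G k x t"
          using abs_ge_self[of C] unfolding G_def by (simp add: algebra_simps)
      qed
    qed
  qed
  then show ?thesis using A0 by (intro exI[of _ "\<bar>C\<bar> + A"]) auto
qed

text \<open>The quantifier over sequences stands inside the almost everywhere statement: the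
  exceptional set comes from the coefficients alone, so the values \<open>u k x\<close> can be
  inserted afterwards.\<close>

lemma G_tendsto:
  assumes r: "strict_mono r"
  shows "AE x in lebesgue_on \<Omega>. \<forall>(t :: nat \<Rightarrow> real) t0. t \<longlonglongrightarrow> t0 \<longrightarrow> (\<lambda>k. G (r k) x (t k)) \<longlonglongrightarrow> V x * \<bar>t0\<bar> powr p + m * psi p t0"
  using Vk_lim bk_lim V_eq
proof eventually_elim
  case (elim x)
  show ?case
  proof (intro allI impI)
    fix t :: "nat \<Rightarrow> real" and t0 assume t: "t \<longlonglongrightarrow> t0"
    have V: "(\<lambda>k. Vk (r k) x) \<longlonglongrightarrow> V1 x" and b: "(\<lambda>k. bk (r k) x) \<longlonglongrightarrow> b x" and q': "(\<lambda>k. q (r k)) \<longlonglongrightarrow> p"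
      using LIMSEQ_subseq_LIMSEQ[OF elim(1) r] LIMSEQ_subseq_LIMSEQ[OF elim(2) r] LIMSEQ_subseq_LIMSEQ[OF q(3) r]
      by (simp_all add: o_def)
    have pw: "(\<lambda>k. \<bar>t k\<bar> powr p) \<longlonglongrightarrow> \<bar>t0\<bar> powr p"
      using p by (intro tendsto_powr' tendsto_rabs t tendsto_const) auto
    have "(\<lambda>k. \<bar>t k\<bar> powr q (r k)) \<longlonglongrightarrow> \<bar>t0\<bar> powr p"
      using p by (intro tendsto_powr' tendsto_rabs t q') auto
    then have "(\<lambda>k. G (r k) x (t k)) \<longlonglongrightarrow> V1 x * \<bar>t0\<bar> powr p - b x * (\<bar>t0\<bar> powr p / p) + m * psi p t0"
      unfolding G_def using p by (intro tendsto_intros V b q' pw entr_tendsto r t) auto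
    moreover have "V1 x * \<bar>t0\<bar> powr p - b x * (\<bar>t0\<bar> powr p / p) + m * psi p t0 = V x * \<bar>t0\<bar> powr p + m * psi p t0"
      unfolding elim(3) by (simp add: left_diff_distrib)
    ultimately show "(\<lambda>k. G (r k) x (t k)) \<longlonglongrightarrow> V x * \<bar>t0\<bar> powr p + m * psi p t0" by simp
  qed
qed

lemma G_bounded:
  "\<exists>K. \<forall>k. AE x in lebesgue_on \<Omega>. \<forall>t. \<bar>t\<bar> \<le> B \<longrightarrow> \<bar>G k x t\<bar> \<le> K"
proof -
  obtain Q where Q: "\<And>k. (p - q k) / s k \<le> Q" using quotient_bounded by blast
  define E where "E = Q * ((1 + \<bar>B\<bar>) powr p * (p * \<bar>ln (1 + \<bar>B\<bar>)\<bar> + 1) + (p + 1))"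
  have entrB: "\<bar>entr k t\<bar> \<le> E" if t: "\<bar>t\<bar> \<le> B" for k t
  proof -
    obtain \<xi> where \<xi>: "q k < \<xi>" "\<xi> < p" and eq: "entr k t = (p - q k) / s k * (psi \<xi> t / \<xi>\<^sup>2)" by (rule entr_eq)
    have \<xi>1: "1 < \<xi>" using \<xi> q(1)[of k] by simp
    have sq: "1 \<le> \<xi>\<^sup>2" using \<xi>1 by (simp add: one_le_power less_imp_le)
    have pos: "0 \<le> (p - q k) / s k" using q(2)[of k] s(1)[of k] by simp
    have psiB: "\<bar>psi \<xi> t\<bar> \<le> (1 + \<bar>B\<bar>) powr p * (p * \<bar>ln (1 + \<bar>B\<bar>)\<bar> + 1) + (p + 1)"
    proof (cases "\<bar>t\<bar> \<le> 1")
      case True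
      have a: "\<bar>t\<bar> powr \<xi> * \<bar>ln \<bar>t\<bar>\<bar> \<le> 1 / \<xi>" using \<xi>1 True by (intro powr_ln_bound) auto
      have b: "\<bar>t\<bar> powr \<xi> \<le> 1" using \<xi>1 True by (intro powr_le1) auto
      have "\<bar>psi \<xi> t\<bar> = \<bar>t\<bar> powr \<xi> * \<bar>\<xi> * ln \<bar>t\<bar> - 1\<bar>" by (simp add: psi_def abs_mult)
      also have "\<dots> \<le> \<bar>t\<bar> powr \<xi> * (\<xi> * \<bar>ln \<bar>t\<bar>\<bar> + 1)"
        using \<xi>1 by (intro mult_left_mono order_trans[OF abs_triangle_ineq4]) (auto simp: abs_mult)
      also have "\<dots> = \<xi> * (\<bar>t\<bar> powr \<xi> * \<bar>ln \<bar>t\<bar>\<bar>) + \<bar>t\<bar> powr \<xi>" by (simp add: algebra_simps)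
      also have "\<dots> \<le> \<xi> * (1 / \<xi>) + 1" using a b \<xi>1 by (intro add_mono mult_left_mono) auto
      also have "\<dots> \<le> p + 1" using \<xi>1 p by simp
      finally have "\<bar>psi \<xi> t\<bar> \<le> p + 1" .
      moreover have "0 \<le> (1 + \<bar>B\<bar>) powr p * (p * \<bar>ln (1 + \<bar>B\<bar>)\<bar> + 1)" using p by (intro mult_nonneg_nonneg) auto
      ultimately show ?thesis by linarith
    next
      case False
      have "\<bar>psi \<xi> t\<bar> = \<bar>t\<bar> powr \<xi> * \<bar>\<xi> * ln \<bar>t\<bar> - 1\<bar>" by (simp add: psi_def abs_mult)
      also have "\<dots> \<le> \<bar>t\<bar> powr \<xi> * (\<xi> * \<bar>ln \<bar>t\<bar>\<bar> + 1)"
        using \<xi>1 by (intro mult_left_mono order_trans[OF abs_triangle_ineq4]) (auto simp: abs_mult)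
      also have "\<dots> \<le> (1 + \<bar>B\<bar>) powr p * (p * \<bar>ln (1 + \<bar>B\<bar>)\<bar> + 1)"
      proof (intro mult_mono add_mono)
        have "\<bar>t\<bar> powr \<xi> \<le> \<bar>t\<bar> powr p" using False \<xi> by (intro powr_mono) auto
        also have "\<dots> \<le> (1 + \<bar>B\<bar>) powr p" using t p by (intro powr_mono2) auto
        finally show "\<bar>t\<bar> powr \<xi> \<le> (1 + \<bar>B\<bar>) powr p" .
        show "\<bar>ln \<bar>t\<bar>\<bar> \<le> \<bar>ln (1 + \<bar>B\<bar>)\<bar>" using False t by simp
      qed (use \<xi> \<xi>1 p in auto)
      finally show ?thesis using p by linarith
    qed
    have "\<bar>psi \<xi> t / \<xi>\<^sup>2\<bar> \<le> \<bar>psi \<xi> t\<bar>" using sq by (simp add: abs_divide divide_le_eq mult_le_cancel_left1)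
    also note psiB
    finally have "\<bar>entr k t\<bar> \<le> (p - q k) / s k * ((1 + \<bar>B\<bar>) powr p * (p * \<bar>ln (1 + \<bar>B\<bar>)\<bar> + 1) + (p + 1))"
      unfolding eq abs_mult abs_of_nonneg[OF pos] using pos by (rule mult_left_mono)
    also have "\<dots> \<le> E" unfolding E_def using Q[of k] p by (intro mult_right_mono) (auto intro!: add_nonneg_nonneg mult_nonneg_nonneg)
    finally show ?thesis .
  qed
  define K where "K = A * \<bar>B\<bar> powr p + A * (1 + \<bar>B\<bar> powr p) + E"
  have "AE x in lebesgue_on \<Omega>. \<forall>t. \<bar>t\<bar> \<le> B \<longrightarrow> \<bar>G k x t\<bar> \<le> K" for k
    using Vk_bd[of k] bk_bd[of k]
  proof eventually_elim
    case (elim x)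
    show ?case
    proof (intro allI impI)
      fix t :: real assume t: "\<bar>t\<bar> \<le> B"
      have tp: "\<bar>t\<bar> powr p \<le> \<bar>B\<bar> powr p" using t p by (intro powr_mono2) auto
      have "\<bar>Vk k x * \<bar>t\<bar> powr p\<bar> \<le> A * \<bar>B\<bar> powr p"
        unfolding abs_mult using elim(1) tp A0 by (intro mult_mono) auto
      moreover have "\<bar>bk k x * (\<bar>t\<bar> powr q k / q k)\<bar> \<le> A * (1 + \<bar>B\<bar> powr p)"
        unfolding abs_mult using elim(2) tp A0 powr_q_le[of t k] q(1)[of k] by (intro mult_mono) auto
      moreover note entrB[OF t, of k]
      ultimately show "\<bar>G k x t\<bar> \<le> K" unfolding G_def K_def by linarith
    qed
  qed
  then show ?thesis by blast
qed

text \<open>At distances up to 1 a larger exponent gives a larger kernel. Hence the fractional form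
  of any positive order controls the near logarithmic form with constant 1.\<close>

lemma ker_mono_exponent:
  assumes "0 \<le> \<beta>" "\<beta> \<le> \<beta>'"
  shows "ker {} \<beta> z \<le> ker \<Omega> \<beta>' (z :: 'a \<times> 'a)"
proof -
  have "nkern \<beta> w \<le> nkern \<beta>' w" for w :: 'a
  proof (cases "w = 0 \<or> 1 < norm w")
    case False
    then have "norm w powr \<beta>' \<le> norm w powr \<beta>" using assms by (intro powr_mono') auto
    then show ?thesis using False by (auto simp: nkern_def intro!: divide_left_mono)
  qed (auto simp: nkern_def)
  then show ?thesis unfolding ker_def by (intro add_mono) (auto simp: indicator_def)
qed

lemma ker_tendsto:
  assumes "\<beta> \<longlonglongrightarrow> \<beta>0"
  shows "(\<lambda>k. ker \<Omega> (\<beta> k) z) \<longlonglongrightarrow> ker \<Omega> \<beta>0 z"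
proof (cases "norm (fst z - snd z) = 0")
  case True
  then show ?thesis by (simp add: ker_def nkern_def)
next
  case False
  then show ?thesis unfolding ker_def nkern_def by (intro tendsto_intros assms) auto
qed

section \<open>Lipschitz test functions\<close>

lemma exponent_tendsto: "(\<lambda>k. DIM('a) + s k * p) \<longlonglongrightarrow> DIM('a)"
proof -
  have "(\<lambda>k. DIM('a) + s k * p) \<longlonglongrightarrow> DIM('a) + 0 * p" by (intro tendsto_intros s)
  then show ?thesis by simp
qed

text \<open>Dominates the difference quotients of a Lipschitz function for all orders with \<open>s p \<le> p / 2\<close>.\<close>

definition lip_dom :: "real \<Rightarrow> ('a \<Rightarrow> real) \<Rightarrow> 'a \<times> 'a \<Rightarrow> real" where
  "lip_dom L \<phi> z = L powr p * ((indicator \<Omega> (fst z) + indicator \<Omega> (snd z)) * nkern (DIM('a) - p / 2) (fst z - snd z)) +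
     2 powr p * (indicator \<Omega> (fst z) * indicator \<Omega> (snd z) * (\<bar>\<phi> (fst z)\<bar> powr p + \<bar>\<phi> (snd z)\<bar> powr p))"

text \<open>The exponent \<open>N - p / 2\<close> is below the dimension, so the near kernel is
  integrable in the increment, while one end of each near pair is confined to \<Omega>.\<close>

lemma lip_dom_integrable:
  assumes \<phi>: "\<phi> \<in> logsp \<Omega> p"
  shows "integrable (lborel \<Otimes>\<^sub>M lborel) (lip_dom L \<phi>)"
proof -
  note [measurable] = logspD(1)[OF \<phi>]
  let ?n = "nkern (real DIM('a) - p / 2) :: 'a \<Rightarrow> real"
  have fin_n: "(\<integral>\<^sup>+z. ennreal (?n z) \<partial>lborel) < \<infinity>"
  proof -
    have "(\<integral>\<^sup>+z. ennreal (?n z) \<partial>lborel) = (\<integral>\<^sup>+z. ennreal (norm (z::'a) powr (p / 2 - DIM('a))) * indicator {..1} (norm z) \<partial>lborel)"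
    proof (rule nn_integral_cong)
      fix z :: 'a
      have "1 / norm z powr (real DIM('a) - p / 2) = norm z powr (p / 2 - DIM('a))"
        using powr_minus_divide[of "norm z" "real DIM('a) - p / 2"] by simp
      then show "ennreal (?n z) = ennreal (norm z powr (p / 2 - DIM('a))) * indicator {..1} (norm z)"
        by (simp add: nkern_def indicator_def)
    qed
    also have "\<dots> < \<infinity>" using p by (subst nn_integral_radial_powr_from_0) auto
    finally show ?thesis .
  qed
  have int: "(\<integral>\<^sup>+y. ennreal (?n (x - y)) \<partial>lborel) = (\<integral>\<^sup>+z. ennreal (?n z) \<partial>lborel)" for x
    by (subst nn_integral_lborel_translate[of _ x, symmetric]) (auto simp: nkern_minus)
  have int': "(\<integral>\<^sup>+x. ennreal (?n (x - y)) \<partial>lborel) = (\<integral>\<^sup>+z. ennreal (?n z) \<partial>lborel)" for y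
    using int[of y] by (simp add: nkern_minus[of _ "_ - _", simplified, symmetric])
  have "integrable (lborel \<Otimes>\<^sub>M lborel) (\<lambda>z. indicator \<Omega> (fst z) * ?n (fst z - snd z))"
  proof (rule integrableI_nonneg)
    have "(\<integral>\<^sup>+z. ennreal (indicator \<Omega> (fst z) * ?n (fst z - snd z)) \<partial>(lborel \<Otimes>\<^sub>M lborel)) =
      (\<integral>\<^sup>+x. indicator \<Omega> x * (\<integral>\<^sup>+z. ennreal (?n z) \<partial>lborel) \<partial>lborel)"
      by (subst lborel.nn_integral_fst[symmetric])
        (auto simp: ennreal_mult ennreal_indicator nn_integral_cmult int intro!: nn_integral_cong)
    also have "\<dots> < \<infinity>" using fin fin_n by (simp add: nn_integral_multc ennreal_mult_less_top)
    finally show "(\<integral>\<^sup>+z. ennreal (indicator \<Omega> (fst z) * ?n (fst z - snd z)) \<partial>(lborel \<Otimes>\<^sub>M lborel)) < \<infinity>" .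
  qed auto
  moreover have "integrable (lborel \<Otimes>\<^sub>M lborel) (\<lambda>z. indicator \<Omega> (snd z) * ?n (fst z - snd z))"
  proof (rule integrableI_nonneg)
    have "(\<integral>\<^sup>+z. ennreal (indicator \<Omega> (snd z) * ?n (fst z - snd z)) \<partial>(lborel \<Otimes>\<^sub>M lborel)) =
      (\<integral>\<^sup>+y. indicator \<Omega> y * (\<integral>\<^sup>+z. ennreal (?n z) \<partial>lborel) \<partial>lborel)"
      by (subst lborel_pair.nn_integral_snd[symmetric])
        (auto simp: ennreal_mult ennreal_indicator nn_integral_cmult int' intro!: nn_integral_cong)
    also have "\<dots> < \<infinity>" using fin fin_n by (simp add: nn_integral_multc ennreal_mult_less_top)
    finally show "(\<integral>\<^sup>+z. ennreal (indicator \<Omega> (snd z) * ?n (fst z - snd z)) \<partial>(lborel \<Otimes>\<^sub>M lborel)) < \<infinity>" .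
  qed auto
  ultimately show ?thesis
    unfolding lip_dom_def distrib_right
    using indicator_square_integrable[OF logsp_powr_integrable[OF \<phi>]]
    by (intro Bochner_Integration.integrable_add integrable_mult_right) (auto simp: distrib_left)
qed

text \<open>The Lipschitz bound supplies a factor \<open>norm (x - y) powr p\<close>, of which an
  order at most \<open>1 / 2\<close> uses up at most half. A near pair with both points outside
  \<Omega> contributes nothing.\<close>

lemma lip_dom_bound:
  assumes \<phi>: "\<phi> \<in> logsp \<Omega> p" and L: "L-lipschitz_on UNIV \<phi>" and sk: "0 < \<sigma>" "\<sigma> \<le> 1 / 2"
  shows "ker \<Omega> (DIM('a) + \<sigma> * p) z * \<bar>\<phi> (fst z) - \<phi> (snd z)\<bar> powr p \<le> lip_dom L \<phi> z"
proof -
  define x y where "x = fst z" and "y = snd z"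
  let ?N = "real DIM('a)"
  have near: "nkern (?N + \<sigma> * p) (x - y) * \<bar>\<phi> x - \<phi> y\<bar> powr p \<le>
    L powr p * ((indicator \<Omega> x + indicator \<Omega> y) * nkern (?N - p / 2) (x - y))"
  proof (cases "(x \<in> \<Omega> \<or> y \<in> \<Omega>) \<and> norm (x - y) \<le> 1 \<and> x \<noteq> y")
    case True
    define d where "d = norm (x - y)"
    have d: "0 < d" "d \<le> 1" using True by (auto simp: d_def)
    have L0: "0 \<le> L" using L by (rule lipschitz_on_nonneg)
    have "\<bar>\<phi> x - \<phi> y\<bar> \<le> L * d" using lipschitz_onD[OF L, of x y] by (simp add: dist_real_def dist_norm d_def)
    then have "\<bar>\<phi> x - \<phi> y\<bar> powr p \<le> (L * d) powr p" using p by (intro powr_mono2) auto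
    also have "\<dots> = L powr p * d powr p" using L0 d by (simp add: powr_mult)
    finally have le: "\<bar>\<phi> x - \<phi> y\<bar> powr p \<le> L powr p * d powr p" .
    have nk: "nkern (?N + \<sigma> * p) (x - y) = d powr (- (?N + \<sigma> * p))"
      using True powr_minus_divide[of d "?N + \<sigma> * p"] by (simp add: nkern_def d_def[symmetric])
    have "nkern (?N + \<sigma> * p) (x - y) * \<bar>\<phi> x - \<phi> y\<bar> powr p \<le> d powr (- (?N + \<sigma> * p)) * (L powr p * d powr p)"
      unfolding nk using le by (rule mult_left_mono) simp
    also have "\<dots> = L powr p * (d powr (- (?N + \<sigma> * p)) * d powr p)" by (simp only: mult_ac)
    also have "\<dots> = L powr p * d powr (p - (?N + \<sigma> * p))"
      unfolding powr_add[symmetric] by (rule arg_cong[where f = "\<lambda>a. L powr p * d powr a"]) simp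
    also have "\<dots> \<le> L powr p * d powr (- (?N - p / 2))"
    proof (intro mult_left_mono powr_mono')
      have "\<sigma> * p \<le> 1 / 2 * p" using sk p by (intro mult_right_mono) auto
      then show "- (?N - p / 2) \<le> p - (?N + \<sigma> * p)" by simp
    qed (use d in auto)
    also have "\<dots> = L powr p * (1 * nkern (?N - p / 2) (x - y))"
      using True powr_minus_divide[of d "?N - p / 2"] by (simp add: nkern_def d_def[symmetric])
    also have "\<dots> \<le> L powr p * ((indicator \<Omega> x + indicator \<Omega> y) * nkern (?N - p / 2) (x - y))"
      using True by (intro mult_left_mono mult_right_mono) (auto simp: indicator_def)
    finally show ?thesis .
  next
    case False
    have "nkern (?N + \<sigma> * p) (x - y) = 0 \<or> \<phi> x = \<phi> y"
      using False logspD(2)[OF \<phi>] by (cases "x = y") (auto simp: nkern_def)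
    moreover have "0 \<le> L powr p * ((indicator \<Omega> x + indicator \<Omega> y) * nkern (?N - p / 2) (x - y))"
      by (intro mult_nonneg_nonneg add_nonneg_nonneg) auto
    ultimately show ?thesis by auto
  qed
  have exp: "0 \<le> ?N + \<sigma> * p" using sk p by (intro add_nonneg_nonneg mult_nonneg_nonneg) auto
  have "indicator {1..} (norm (x - y)) / norm (x - y) powr (?N + \<sigma> * p) \<le> (1::real)"
    using exp by (auto simp: indicator_def divide_le_eq ge_one_powr_ge_zero)
  then have far: "indicator \<Omega> x * indicator \<Omega> y * (indicator {1..} (norm (x - y)) / norm (x - y) powr (?N + \<sigma> * p)) * \<bar>\<phi> x - \<phi> y\<bar> powr p
    \<le> (indicator \<Omega> x * indicator \<Omega> y * 1) * (2 powr p * (\<bar>\<phi> x\<bar> powr p + \<bar>\<phi> y\<bar> powr p))"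
    by (intro mult_mono mult_left_mono abs_diff_powr_le p0) (auto simp: indicator_def)
  show ?thesis
    using add_mono[OF near far] unfolding ker_def lip_dom_def x_def y_def by (simp add: algebra_simps)
qed

lemma lipschitz_dform_finite:
  assumes \<phi>: "\<phi> \<in> logsp \<Omega> p" and L: "L-lipschitz_on UNIV \<phi>" and sk: "0 < \<sigma>" "\<sigma> \<le> 1 / 2"
  shows "integrable (lborel \<Otimes>\<^sub>M lborel) (\<lambda>z. ker \<Omega> (DIM('a) + \<sigma> * p) z * \<bar>\<phi> (fst z) - \<phi> (snd z)\<bar> powr p)"
    and "dform \<Omega> (DIM('a) + \<sigma> * p) p \<phi> < \<infinity>"
proof -
  note [measurable] = logspD(1)[OF \<phi>]
  show *: "integrable (lborel \<Otimes>\<^sub>M lborel) (\<lambda>z. ker \<Omega> (DIM('a) + \<sigma> * p) z * \<bar>\<phi> (fst z) - \<phi> (snd z)\<bar> powr p)"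
  proof (rule Bochner_Integration.integrable_bound[OF lip_dom_integrable[OF \<phi>]])
    show "AE z in (lborel \<Otimes>\<^sub>M lborel). norm (ker \<Omega> (DIM('a) + \<sigma> * p) z * \<bar>\<phi> (fst z) - \<phi> (snd z)\<bar> powr p) \<le> norm (lip_dom L \<phi> z)"
      using lip_dom_bound[OF \<phi> L sk] by (intro AE_I2) (simp add: abs_mult order_trans[OF _ abs_ge_self])
  qed measurable
  show "dform \<Omega> (DIM('a) + \<sigma> * p) p \<phi> < \<infinity>"
    unfolding dform_def using * by (subst nn_integral_eq_integral) auto
qed

lemma lipschitz_bounded:
  assumes \<phi>: "\<phi> \<in> logsp \<Omega> p" and L: "L-lipschitz_on UNIV \<phi>"
  obtains B where "\<And>x. \<bar>\<phi> x\<bar> \<le> B"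
proof -
  obtain R where R: "\<And>x. x \<in> \<Omega> \<Longrightarrow> norm x \<le> R" using bdd by (auto simp: bounded_iff)
  have "\<bar>\<phi> x\<bar> \<le> \<bar>\<phi> 0\<bar> + L * \<bar>R\<bar>" for x
  proof (cases "x \<in> \<Omega>")
    case True
    have "\<bar>\<phi> x - \<phi> 0\<bar> \<le> L * norm x" using lipschitz_onD[OF L, of x 0] by (simp add: dist_real_def)
    also have "\<dots> \<le> L * \<bar>R\<bar>" using R[OF True] lipschitz_on_nonneg[OF L] by (intro mult_left_mono) auto
    finally show ?thesis by linarith
  next
    case False
    have "0 \<le> L * \<bar>R\<bar>" using lipschitz_on_nonneg[OF L] by simp
    then show ?thesis using logspD(2)[OF \<phi> False] by simp
  qed
  then show thesis by (rule that)
qed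

text \<open>A Lipschitz function is its own recovery sequence: the kernels are dominated uniformly
  in \<open>k\<close> once \<open>s k\<close> is below \<open>1 / 2\<close>, and the lower order
  integrand is bounded because the function is.\<close>

lemma efun_tendsto:
  assumes \<phi>: "\<phi> \<in> logsp \<Omega> p" and L: "L-lipschitz_on UNIV \<phi>"
  shows "(\<lambda>k. efun k \<phi>) \<longlonglongrightarrow> func \<phi>"
proof -
  note [measurable] = logspD(1)[OF \<phi>]
  let ?P = "lborel \<Otimes>\<^sub>M (lborel :: 'a measure)"
  let ?f = "\<lambda>\<beta> z. ker \<Omega> \<beta> z * \<bar>\<phi> (fst z) - \<phi> (snd z)\<bar> powr p"
  have "\<forall>\<^sub>F k in sequentially. s k < 1 / 2" using s(2) by (intro order_tendstoD(2)) auto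
  then obtain k0 where k0: "\<And>k. k0 \<le> k \<Longrightarrow> s k < 1 / 2" unfolding eventually_sequentially by blast
  have "(\<lambda>k. LINT z|?P. ?f (DIM('a) + s (k + k0) * p) z) \<longlonglongrightarrow> (LINT z|?P. ?f DIM('a) z)"
  proof (rule integral_dominated_convergence[where w = "lip_dom L \<phi>"])
    show "AE z in ?P. norm (?f (DIM('a) + s (k + k0) * p) z) \<le> lip_dom L \<phi> z" for k
      using lip_dom_bound[OF \<phi> L s(1)[of "k + k0"]] k0[of "k + k0"] by (intro AE_I2) (simp add: abs_mult less_imp_le)
    show "AE z in ?P. (\<lambda>k. ?f (DIM('a) + s (k + k0) * p) z) \<longlonglongrightarrow> ?f DIM('a) z"
      by (intro AE_I2 tendsto_intros ker_tendsto LIMSEQ_ignore_initial_segment[OF exponent_tendsto])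
  qed (use lip_dom_integrable[OF \<phi>] in auto)
  moreover have "(LINT z|?P. ?f (DIM('a) + s (k + k0) * p) z) = enn2real (dform \<Omega> (DIM('a) + s (k + k0) * p) p \<phi>)" for k
    unfolding dform_def by (subst integral_eq_nn_integral) auto
  ultimately have "(\<lambda>k. enn2real (dform \<Omega> (DIM('a) + s (k + k0) * p) p \<phi>)) \<longlonglongrightarrow> dint \<phi>"
    unfolding dint_def by (simp only:)
  then have 1: "(\<lambda>k. enn2real (dform \<Omega> (DIM('a) + s k * p) p \<phi>)) \<longlonglongrightarrow> dint \<phi>"
    by (rule LIMSEQ_offset)
  obtain B where B: "\<And>x. \<bar>\<phi> x\<bar> \<le> B" using lipschitz_bounded[OF \<phi> L] by blast
  obtain K where K: "\<And>k. AE x in lebesgue_on \<Omega>. \<forall>t. \<bar>t\<bar> \<le> B \<longrightarrow> \<bar>G k x t\<bar> \<le> K" using G_bounded by blast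
  have 2: "(\<lambda>k. LINT x|lebesgue_on \<Omega>. G k x (\<phi> x)) \<longlonglongrightarrow> low \<phi>"
    unfolding low_def
  proof (rule integral_dominated_convergence[where w = "\<lambda>_. K"])
    show "integrable (lebesgue_on \<Omega>) (\<lambda>_. K)"
      using finite_measure.integrable_const[OF finite_measure_\<Omega>] .
    show "AE x in lebesgue_on \<Omega>. norm (G k x (\<phi> x)) \<le> K" for k
      using K[of k] by eventually_elim (use B in auto)
    show "AE x in lebesgue_on \<Omega>. (\<lambda>k. G k x (\<phi> x)) \<longlonglongrightarrow> V x * \<bar>\<phi> x\<bar> powr p + m * psi p (\<phi> x)"
      using G_tendsto[OF strict_mono_id] by eventually_elim (auto simp: id_def)
  qed (auto intro: G_measurable)
  show ?thesis unfolding efun_def func_def by (intro tendsto_intros ck 1 2)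
qed

text \<open>Comparison with 0 and coercivity bound the L^p norms and the forms, hence the near
  logarithmic forms, and \<open>log_compactness\<close> yields a limit. Fatou's lemma bounds its
  energy from above by that of every Lipschitz function, and density extends this to all
  competitors.\<close>

theorem minimizers_converge:
  fixes u :: "nat \<Rightarrow> 'a \<Rightarrow> real"
  assumes lip: "lipschitz_boundary \<Omega>"
    and u[measurable]: "\<And>k. u k \<in> borel_measurable borel" and supp: "\<And>k x. x \<notin> \<Omega> \<Longrightarrow> u k x = 0"
    and u0: "\<And>k x. 0 \<le> u k x" and uG: "\<And>k. integrable (lebesgue_on \<Omega>) (\<lambda>x. G k x (u k x))"
    and ud: "\<And>k. dform \<Omega> (DIM('a) + s k * p) p (u k) < \<infinity>"
    and min: "\<And>\<phi> L. \<phi> \<in> logsp \<Omega> p \<Longrightarrow> L-lipschitz_on UNIV \<phi> \<Longrightarrow> \<forall>\<^sub>F k in sequentially. efun k (u k) \<le> efun k \<phi>"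
  obtains r U where "strict_mono r" "minimizer U" "\<And>x. 0 \<le> U x"
    "(\<lambda>k. \<integral>\<^sup>+x. ennreal (\<bar>u (r k) x - U x\<bar> powr p) \<partial>lborel) \<longlonglongrightarrow> 0"
proof -
  let ?N = "real DIM('a)"
  let ?M = "lebesgue_on \<Omega>"
  let ?P = "lborel \<Otimes>\<^sub>M (lborel :: 'a measure)"
  obtain C where C: "0 \<le> C" and coerc: "\<forall>\<^sub>F k in sequentially. AE x in ?M. \<forall>t. \<bar>t\<bar> powr p - C \<le> G k x t"
    using G_coercive by blast
  \<comment> \<open>The zero function has energy 0, so the energies of the minimisers are eventually
    non-positive; coercivity then bounds both of their parts.\<close>
  have zero: "efun k (\<lambda>x. 0) = 0" for k
    by (simp add: efun_def dform_def G_def entr_def)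
  have "\<forall>\<^sub>F k in sequentially. efun k (u k) \<le> efun k (\<lambda>x. 0)"
    by (rule min[OF logsp_zero]) (rule lipschitz_on_constant)
  moreover have "\<forall>\<^sub>F k in sequentially. c / 2 < ck k"
    using ck(2) c by (intro order_tendstoD(1)) auto
  ultimately have "\<forall>\<^sub>F k in sequentially. efun k (u k) \<le> 0 \<and> c / 2 < ck k \<and> (AE x in ?M. \<forall>t. \<bar>t\<bar> powr p - C \<le> G k x t)"
    using coerc by eventually_elim (simp add: zero)
  then obtain k0 where k0: "\<And>k. k0 \<le> k \<Longrightarrow> efun k (u k) \<le> 0" "\<And>k. k0 \<le> k \<Longrightarrow> c / 2 < ck k"
    "\<And>k. k0 \<le> k \<Longrightarrow> AE x in ?M. \<forall>t. \<bar>t\<bar> powr p - C \<le> G k x t"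
    unfolding eventually_sequentially by blast
  define mu where "mu = measure ?M \<Omega>"
  interpret fm: finite_measure ?M by (rule finite_measure_\<Omega>)
  have sp: "space ?M = \<Omega>" by (simp add: space_restrict_space)
  have LINT_C: "(LINT x|?M. C) = C * mu" by (simp add: sp mu_def mult.commute)
  have Gge: "AE x in ?M. \<bar>u k x\<bar> powr p - C \<le> G k x (u k x)" if "k0 \<le> k" for k
    using k0(3)[OF that] by eventually_elim blast
  have powr_int: "integrable ?M (\<lambda>x. \<bar>u k x\<bar> powr p)" if k: "k0 \<le> k" for k
  proof (rule Bochner_Integration.integrable_bound)
    show "integrable ?M (\<lambda>x. G k x (u k x) + C)" using uG[of k] by simp
    show "AE x in ?M. norm (\<bar>u k x\<bar> powr p) \<le> norm (G k x (u k x) + C)"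
      using Gge[OF k] by eventually_elim simp
  qed (intro borel_measurable_lebesgue_on, measurable)
  have dge: "0 \<le> enn2real (dform \<Omega> (?N + s k * p) p (u k))" for k by simp
  have low_le: "(LINT x|?M. \<bar>u k x\<bar> powr p) - C * mu \<le> (LINT x|?M. G k x (u k x))" if k: "k0 \<le> k" for k
  proof -
    have "(LINT x|?M. \<bar>u k x\<bar> powr p) - C * mu = (LINT x|?M. \<bar>u k x\<bar> powr p - C)"
      using powr_int[OF k] by (simp add: LINT_C[symmetric] del: LINT_C)
    also have "\<dots> \<le> (LINT x|?M. G k x (u k x))"
      using powr_int[OF k] uG Gge[OF k] by (intro integral_mono_AE) auto
    finally show ?thesis .
  qed
  have mu0: "0 \<le> mu" by (simp add: mu_def)
  have pw_le: "(LINT x|?M. \<bar>u k x\<bar> powr p) \<le> C * mu" if k: "k0 \<le> k" for k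
  proof -
    have "0 \<le> ck k * enn2real (dform \<Omega> (?N + s k * p) p (u k))" using ck(1)[of k] by simp
    then show ?thesis using low_le[OF k] k0(1)[OF k] unfolding efun_def by linarith
  qed
  define D where "D = C * mu / (c / 2)"
  have d_le: "enn2real (dform \<Omega> (?N + s k * p) p (u k)) \<le> D" if k: "k0 \<le> k" for k
  proof -
    have "0 \<le> (LINT x|?M. \<bar>u k x\<bar> powr p)" by (intro integral_nonneg_AE) auto
    then have "ck k * enn2real (dform \<Omega> (?N + s k * p) p (u k)) \<le> C * mu"
      using low_le[OF k] k0(1)[OF k] unfolding efun_def by linarith
    moreover have "c / 2 * enn2real (dform \<Omega> (?N + s k * p) p (u k)) \<le> ck k * enn2real (dform \<Omega> (?N + s k * p) p (u k))"
      using k0(2)[OF k] by (intro mult_right_mono) auto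
    ultimately have "c / 2 * enn2real (dform \<Omega> (?N + s k * p) p (u k)) \<le> C * mu" by linarith
    then show ?thesis using c unfolding D_def by (simp add: le_divide_eq mult.commute)
  qed
  have D0: "0 \<le> D" using C mu0 c by (simp add: D_def)
  \<comment> \<open>Fractional bounds become logarithmic bounds, uniformly in \<open>k\<close>, by
    monotonicity of the near kernel in the exponent.\<close>
  have near_le: "dform {} ?N p (u k) \<le> ennreal (C * mu + D)" if k: "k0 \<le> k" for k
  proof -
    have "dform {} ?N p (u k) \<le> dform \<Omega> (?N + s k * p) p (u k)"
      unfolding dform_def using s(1)[of k] p
      by (intro nn_integral_mono ennreal_leI mult_right_mono ker_mono_exponent) auto
    also have "\<dots> = ennreal (enn2real (dform \<Omega> (?N + s k * p) p (u k)))" using ud[of k] by (simp add: less_top)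
    also have "\<dots> \<le> ennreal (C * mu + D)" using d_le[OF k] C mu0 by (intro ennreal_leI) (simp add: add_increasing)
    finally show ?thesis .
  qed
  have Lp_le: "(\<integral>\<^sup>+x. ennreal (\<bar>u k x\<bar> powr p) \<partial>lborel) \<le> ennreal (C * mu + D)" if k: "k0 \<le> k" for k
  proof -
    have "(\<integral>\<^sup>+x. ennreal (\<bar>u k x\<bar> powr p) \<partial>lborel) = (\<integral>\<^sup>+x. ennreal (\<bar>u k x\<bar> powr p) \<partial>lebesgue)"
      by (simp add: nn_integral_completion)
    also have "\<dots> = (\<integral>\<^sup>+x. ennreal (\<bar>u k x\<bar> powr p) * indicator \<Omega> x \<partial>lebesgue)"
      by (intro nn_integral_cong) (use supp p in \<open>auto simp: indicator_def\<close>)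
    also have "\<dots> = (\<integral>\<^sup>+x. ennreal (\<bar>u k x\<bar> powr p) \<partial>?M)"
      by (subst nn_integral_restrict_space) auto
    also have "\<dots> = ennreal (LINT x|?M. \<bar>u k x\<bar> powr p)"
      using powr_int[OF k] by (subst nn_integral_eq_integral) auto
    also have "\<dots> \<le> ennreal (C * mu + D)" using pw_le[OF k] D0 by (intro ennreal_leI) simp
    finally show ?thesis .
  qed
  obtain r0 U where r0: "strict_mono r0" and U[measurable]: "U \<in> borel_measurable borel" and U0: "\<And>x. x \<notin> \<Omega> \<Longrightarrow> U x = 0"
    and AE0: "AE x in lborel. (\<lambda>n. u (r0 n + k0) x) \<longlonglongrightarrow> U x"
    and conv0: "(\<lambda>n. \<integral>\<^sup>+x. ennreal (\<bar>u (r0 n + k0) x - U x\<bar> powr p) \<partial>lborel) \<longlonglongrightarrow> 0"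
    using log_compactness[OF p \<Omega>_borel bdd, of "C * mu + D" "\<lambda>n. u (n + k0)"] C mu0 D0 supp Lp_le near_le u by auto
  define r where "r n = r0 n + k0" for n
  have r: "strict_mono r" using r0 by (auto simp: r_def strict_mono_def)
  have rk: "k0 \<le> r n" for n by (simp add: r_def)
  have AE: "AE x in lborel. (\<lambda>n. u (r n) x) \<longlonglongrightarrow> U x" using AE0 by (simp add: r_def)
  let ?K = "\<lambda>n. ker \<Omega> (?N + s (r n) * p)"
  have exp_r: "(\<lambda>n. ?N + s (r n) * p) \<longlonglongrightarrow> ?N" using LIMSEQ_subseq_LIMSEQ[OF exponent_tendsto r] by (simp add: o_def)
  have ck_r: "(\<lambda>n. ck (r n)) \<longlonglongrightarrow> c" using LIMSEQ_subseq_LIMSEQ[OF ck(2) r] by (simp add: o_def)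
  define X where "X n = ck (r n) * enn2real (dform \<Omega> (?N + s (r n) * p) p (u (r n)))" for n
  have X: "ennreal (X n) = (\<integral>\<^sup>+z. ennreal (ck (r n) * (?K n z * \<bar>u (r n) (fst z) - u (r n) (snd z)\<bar> powr p)) \<partial>?P)" for n
  proof -
    have "ennreal (X n) = ennreal (ck (r n)) * dform \<Omega> (?N + s (r n) * p) p (u (r n))"
      unfolding X_def using ck(1)[of "r n"] ud[of "r n"] by (simp add: ennreal_mult less_top)
    also have "\<dots> = (\<integral>\<^sup>+z. ennreal (ck (r n)) * ennreal (?K n z * \<bar>u (r n) (fst z) - u (r n) (snd z)\<bar> powr p) \<partial>?P)"
      unfolding dform_def by (subst nn_integral_cmult) auto
    also have "\<dots> = (\<integral>\<^sup>+z. ennreal (ck (r n) * (?K n z * \<bar>u (r n) (fst z) - u (r n) (snd z)\<bar> powr p)) \<partial>?P)"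
      using ck(1)[of "r n"] by (intro nn_integral_cong) (simp add: ennreal_mult)
    finally show ?thesis .
  qed
  have X_lim: "ennreal c * dform \<Omega> ?N p U \<le> liminf (\<lambda>n. ennreal (X n))"
  proof -
    have "ennreal c * dform \<Omega> ?N p U = (\<integral>\<^sup>+z. ennreal (c * (ker \<Omega> ?N z * \<bar>U (fst z) - U (snd z)\<bar> powr p)) \<partial>?P)"
      unfolding dform_def using c by (subst nn_integral_cmult[symmetric]) (auto simp: ennreal_mult)
    also have "\<dots> = (\<integral>\<^sup>+z. liminf (\<lambda>n. ennreal (ck (r n) * (?K n z * \<bar>u (r n) (fst z) - u (r n) (snd z)\<bar> powr p))) \<partial>?P)"
    proof (rule nn_integral_cong_AE, use AE_lborel_pair[OF AE] in eventually_elim)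
      case (elim z)
      have "(\<lambda>n. \<bar>u (r n) (fst z) - u (r n) (snd z)\<bar> powr p) \<longlonglongrightarrow> \<bar>U (fst z) - U (snd z)\<bar> powr p"
        using elim p by (intro tendsto_powr' tendsto_intros) auto
      then have "(\<lambda>n. ennreal (ck (r n) * (?K n z * \<bar>u (r n) (fst z) - u (r n) (snd z)\<bar> powr p))) \<longlonglongrightarrow>
        ennreal (c * (ker \<Omega> ?N z * \<bar>U (fst z) - U (snd z)\<bar> powr p))"
        by (intro tendsto_ennrealI tendsto_mult ck_r ker_tendsto exp_r)
      then show ?case by (intro lim_imp_Liminf[symmetric]) auto
    qed
    also have "\<dots> \<le> liminf (\<lambda>n. \<integral>\<^sup>+z. ennreal (ck (r n) * (?K n z * \<bar>u (r n) (fst z) - u (r n) (snd z)\<bar> powr p)) \<partial>?P)"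
      by (intro nn_integral_liminf) measurable
    finally show ?thesis unfolding X .
  qed
  have X_bd: "X n \<le> C * mu" for n
  proof -
    have "0 \<le> (LINT x|?M. \<bar>u (r n) x\<bar> powr p)" by (intro integral_nonneg_AE) auto
    then show ?thesis using low_le[OF rk[of n]] k0(1)[OF rk[of n]] unfolding efun_def X_def by linarith
  qed
  have "liminf (\<lambda>n. ennreal (X n)) \<le> ennreal (C * mu)"
    by (rule Liminf_le) (auto intro!: always_eventually ennreal_leI X_bd)
  from order_trans[OF X_lim this] have "ennreal c * dform \<Omega> ?N p U < top"
    by (rule le_less_trans) (rule ennreal_less_top)
  then have dU: "dform \<Omega> ?N p U < \<infinity>" using c by (auto simp: ennreal_mult_less_top less_top)
  have Lp_U: "(\<integral>\<^sup>+x. ennreal (\<bar>U x\<bar> powr p) \<partial>lborel) \<le> ennreal (C * mu + D)"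
  proof -
    have "(\<integral>\<^sup>+x. ennreal (\<bar>U x\<bar> powr p) \<partial>lborel) = (\<integral>\<^sup>+x. liminf (\<lambda>n. ennreal (\<bar>u (r n) x\<bar> powr p)) \<partial>lborel)"
    proof (rule nn_integral_cong_AE, use AE in eventually_elim)
      case (elim x)
      then have "(\<lambda>n. ennreal (\<bar>u (r n) x\<bar> powr p)) \<longlonglongrightarrow> ennreal (\<bar>U x\<bar> powr p)"
        using p by (intro tendsto_ennrealI tendsto_powr' tendsto_intros) auto
      then show ?case by (intro lim_imp_Liminf[symmetric]) auto
    qed
    also have "\<dots> \<le> liminf (\<lambda>n. \<integral>\<^sup>+x. ennreal (\<bar>u (r n) x\<bar> powr p) \<partial>lborel)"
      by (intro nn_integral_liminf) measurable
    also have "\<dots> \<le> ennreal (C * mu + D)"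
      by (rule Liminf_le) (auto intro!: always_eventually Lp_le rk)
    finally show ?thesis .
  qed
  have U_in: "U \<in> logsp \<Omega> p"
  proof -
    have "dform {} ?N p U \<le> dform \<Omega> ?N p U"
      unfolding dform_def by (intro nn_integral_mono ennreal_leI mult_right_mono) (auto simp: ker_eq)
    then show ?thesis using dU Lp_U U0 by (auto simp: logsp_def intro: order.strict_trans1)
  qed
  have dintU: "ennreal (c * dint U) = ennreal c * dform \<Omega> ?N p U"
  proof -
    have "dform \<Omega> ?N p U = ennreal (dint U)"
      unfolding dform_def dint_def using dint_integrable[OF U_in] by (subst nn_integral_eq_integral) auto
    then show ?thesis using c by (simp add: ennreal_mult')
  qed
  \<comment> \<open>Shifted by the integral of the coercivity constant, so that the integrand is
    non-negative and Fatou's lemma applies.\<close>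
  define Y where "Y n = (LINT x|?M. G (r n) x (u (r n) x)) + C * mu" for n
  define lowG where "lowG x = V x * \<bar>U x\<bar> powr p + m * psi p (U x)" for x
  have AEM: "AE x in ?M. (\<lambda>n. u (r n) x) \<longlonglongrightarrow> U x" by (rule AE_lebesgue_on_of_lborel[OF \<Omega>_borel AE])
  have GC: "AE x in ?M. (\<forall>n. 0 \<le> G (r n) x (u (r n) x) + C)"
  proof (subst AE_all_countable, intro allI)
    fix n
    show "AE x in ?M. 0 \<le> G (r n) x (u (r n) x) + C"
      using Gge[OF rk[of n]]
    proof eventually_elim
      case (elim x)
      then show ?case using powr_ge_zero[of "\<bar>u (r n) x\<bar>" p] by linarith
    qed
  qed
  have Y: "ennreal (Y n) = (\<integral>\<^sup>+x. ennreal (G (r n) x (u (r n) x) + C) \<partial>?M)" for n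
  proof -
    have "(\<integral>\<^sup>+x. ennreal (G (r n) x (u (r n) x) + C) \<partial>?M) = ennreal (LINT x|?M. G (r n) x (u (r n) x) + C)"
      using uG[of "r n"] GC by (intro nn_integral_eq_integral) (auto elim: eventually_mono)
    also have "(LINT x|?M. G (r n) x (u (r n) x) + C) = Y n"
      unfolding Y_def LINT_C[symmetric] using uG[of "r n"] by simp
    finally show ?thesis by simp
  qed
  have lowG_lim: "AE x in ?M. (\<lambda>n. G (r n) x (u (r n) x) + C) \<longlonglongrightarrow> lowG x + C"
    using G_tendsto[OF r] AEM
  proof eventually_elim
    case (elim x)
    then have "(\<lambda>n. G (r n) x (u (r n) x)) \<longlonglongrightarrow> lowG x" unfolding lowG_def by blast
    then show ?case by (intro tendsto_add tendsto_const)
  qed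
  have lowG_nn: "AE x in ?M. 0 \<le> lowG x + C"
    using lowG_lim GC by eventually_elim (rule tendsto_lowerbound[of _ _ sequentially], auto)
  have lowG_int: "integrable ?M lowG" unfolding lowG_def by (rule low_integrable(4)[OF U_in])
  have Y_lim: "ennreal (low U + C * mu) \<le> liminf (\<lambda>n. ennreal (Y n))"
  proof -
    have "ennreal (low U + C * mu) = ennreal (LINT x|?M. lowG x + C)"
      unfolding low_def lowG_def[symmetric] LINT_C[symmetric] using lowG_int by simp
    also have "\<dots> = (\<integral>\<^sup>+x. ennreal (lowG x + C) \<partial>?M)"
      using lowG_int lowG_nn by (intro nn_integral_eq_integral[symmetric]) auto
    also have "\<dots> = (\<integral>\<^sup>+x. liminf (\<lambda>n. ennreal (G (r n) x (u (r n) x) + C)) \<partial>?M)"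
      by (rule nn_integral_cong_AE, use lowG_lim in eventually_elim)
        (intro lim_imp_Liminf[symmetric] tendsto_ennrealI, auto)
    also have "\<dots> \<le> liminf (\<lambda>n. \<integral>\<^sup>+x. ennreal (G (r n) x (u (r n) x) + C) \<partial>?M)"
      by (intro nn_integral_liminf) (use G_measurable in auto)
    finally show ?thesis unfolding Y .
  qed
  have main: "func U \<le> func \<phi>" if \<phi>: "\<phi> \<in> logsp \<Omega> p" and L: "L-lipschitz_on UNIV \<phi>" for \<phi> L
  proof (rule field_le_epsilon)
    fix e :: real assume e: "0 < e"
    \<comment> \<open>The lower limits are inequalities in \<open>ennreal\<close>; each becomes an
      eventual inequality of reals with error \<open>e / 2\<close>, one for the form and one for the
      lower order part.\<close>
    have gen: "\<forall>\<^sub>F n in sequentially. x - e / 2 \<le> f n"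
      if "ennreal x \<le> liminf (\<lambda>n. ennreal (f n))" "\<And>n. 0 \<le> f n" for x and f :: "nat \<Rightarrow> real"
    proof (cases "x - e / 2 < 0")
      case True
      then show ?thesis using that(2) by (intro always_eventually allI) (rule order_trans[OF less_imp_le])
    next
      case False
      then have "ennreal (x - e / 2) < ennreal x" using e by (intro ennreal_lessI) auto
      then have "ennreal (x - e / 2) < liminf (\<lambda>n. ennreal (f n))" using that(1) by (rule order.strict_trans2)
      then have "\<forall>\<^sub>F n in sequentially. ennreal (x - e / 2) < ennreal (f n)" by (rule less_LiminfD)
      then show ?thesis by eventually_elim (use False in \<open>auto simp: ennreal_less_iff\<close>)
    qed
    have Yn: "0 \<le> Y n" for n
    proof -
      have "0 \<le> (LINT x|?M. \<bar>u (r n) x\<bar> powr p)" by (intro integral_nonneg_AE) auto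
      then show ?thesis using low_le[OF rk[of n]] unfolding Y_def by linarith
    qed
    have "\<forall>\<^sub>F n in sequentially. c * dint U - e / 2 \<le> X n"
      by (rule gen) (use X_lim dintU ck in \<open>auto simp: X_def less_imp_le\<close>)
    moreover have "\<forall>\<^sub>F n in sequentially. (low U + C * mu) - e / 2 \<le> Y n"
      by (rule gen[OF Y_lim Yn])
    moreover have "\<forall>\<^sub>F n in sequentially. efun (r n) (u (r n)) \<le> efun (r n) \<phi>"
      using eventually_subseq[OF r min[OF \<phi> L]] by simp
    ultimately have "\<forall>\<^sub>F n in sequentially. func U - e \<le> efun (r n) \<phi>"
      by eventually_elim (simp add: func_def efun_def X_def Y_def)
    moreover have "(\<lambda>n. efun (r n) \<phi>) \<longlonglongrightarrow> func \<phi>"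
      using LIMSEQ_subseq_LIMSEQ[OF efun_tendsto[OF \<phi> L] r] by (simp add: o_def)
    ultimately have "func U - e \<le> func \<phi>" by (intro tendsto_lowerbound[of _ _ sequentially]) auto
    then show "func U \<le> func \<phi> + e" by simp
  qed
  have "func U \<le> func v" if "v \<in> logsp \<Omega> p" for v
    by (rule minimum_over_Lipschitz[OF lip main that])
  then have "minimizer U" unfolding minimizer_def using U_in by blast
  \<comment> \<open>The limit is replaced by its absolute value to be non-negative everywhere; since
    the approximating functions are non-negative, this does not increase the distance to
    them.\<close>
  then have Umin: "minimizer (\<lambda>x. \<bar>U x\<bar>)" by (rule minimizer_abs(1))
  have "(\<lambda>n. \<integral>\<^sup>+x. ennreal (\<bar>u (r n) x - \<bar>U x\<bar>\<bar> powr p) \<partial>lborel) \<longlonglongrightarrow> 0"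
  proof (rule tendsto_sandwich[of "\<lambda>_. 0" _ _ "\<lambda>n. \<integral>\<^sup>+x. ennreal (\<bar>u (r n) x - U x\<bar> powr p) \<partial>lborel"])
    show "\<forall>\<^sub>F n in sequentially. (\<integral>\<^sup>+x. ennreal (\<bar>u (r n) x - \<bar>U x\<bar>\<bar> powr p) \<partial>lborel) \<le> (\<integral>\<^sup>+x. ennreal (\<bar>u (r n) x - U x\<bar> powr p) \<partial>lborel)"
    proof (intro always_eventually allI nn_integral_mono ennreal_leI powr_mono2)
      fix n x
      show "\<bar>u (r n) x - \<bar>U x\<bar>\<bar> \<le> \<bar>u (r n) x - U x\<bar>" using u0[of "r n" x] by linarith
    qed (use p in auto)
  qed (use conv0 in \<open>auto simp: r_def\<close>)
  with r Umin show thesis by (intro that[of r "\<lambda>x. \<bar>U x\<bar>"]) auto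
qed

end

section \<open>The fractional seminorm and the constants\<close>

definition fk :: "real \<Rightarrow> 'a::euclidean_space \<Rightarrow> real" where
  "fk \<beta> z = indicator {1..} (norm z) / norm z powr \<beta>"

text \<open>The mass of the far kernel on \<Omega> as seen from \<open>x\<close>. Unlike the mass on
  the complement, it stays bounded as the exponent tends to the dimension.\<close>

definition kfar :: "'a::euclidean_space set \<Rightarrow> real \<Rightarrow> 'a \<Rightarrow> real" where
  "kfar \<Omega> \<beta> x = (LINT y|lborel. indicator \<Omega> y * fk \<beta> (x - y))"

lemma fk_nonneg [simp]: "0 \<le> fk \<beta> z" by (simp add: fk_def)

lemma fk_measurable [measurable]: "fk \<beta> \<in> borel_measurable borel"
  unfolding fk_def[abs_def] by measurable

lemma fk_le_1: "0 \<le> \<beta> \<Longrightarrow> fk \<beta> z \<le> 1"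
  by (auto simp: fk_def indicator_def divide_le_eq ge_one_powr_ge_zero)

lemma fk_minus: "fk \<beta> (- z) = fk \<beta> z" by (simp add: fk_def)

lemma fk_commute: "fk \<beta> (x - y) = fk \<beta> (y - x)"
  using fk_minus[of \<beta> "x - y"] by simp

context
  fixes \<Omega> :: "'a::euclidean_space set"
  assumes \<Omega>m[measurable]: "\<Omega> \<in> sets borel" and \<Omega>fin: "emeasure lborel \<Omega> < \<infinity>"
begin

lemma kfar_measurable [measurable]: "kfar \<Omega> \<beta> \<in> borel_measurable borel"
  unfolding kfar_def[abs_def] by measurable

lemma kfar_integrable: "0 \<le> \<beta> \<Longrightarrow> integrable lborel (\<lambda>y. indicator \<Omega> y * fk \<beta> (x - y))"
proof (rule Bochner_Integration.integrable_bound)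
  show "integrable lborel (indicator \<Omega> :: 'a \<Rightarrow> real)" using \<Omega>fin by (simp add: less_top[symmetric])
  show "AE y in lborel. norm (indicator \<Omega> y * fk \<beta> (x - y)) \<le> norm (indicator \<Omega> y :: real)" if "0 \<le> \<beta>"
    using fk_le_1[OF that] by (intro AE_I2) (auto simp: indicator_def)
qed auto

lemma kfar_nonneg: "0 \<le> kfar \<Omega> \<beta> x"
  unfolding kfar_def by (intro integral_nonneg_AE) auto

lemma kfar_le: "0 \<le> \<beta> \<Longrightarrow> kfar \<Omega> \<beta> x \<le> measure lborel \<Omega>"
proof -
  assume \<beta>: "0 \<le> \<beta>"
  have i: "integrable lborel (indicator \<Omega> :: 'a \<Rightarrow> real)" using \<Omega>fin by (simp add: less_top[symmetric])
  have "kfar \<Omega> \<beta> x \<le> (LINT y|lborel. indicator \<Omega> y)"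
    unfolding kfar_def using fk_le_1[OF \<beta>]
    by (intro integral_mono[OF kfar_integrable[OF \<beta>] i]) (auto simp: indicator_def)
  then show ?thesis by simp
qed

lemma kfar_tendsto:
  assumes \<beta>: "\<beta> \<longlonglongrightarrow> \<beta>0" "\<And>k. 0 \<le> \<beta> k"
  shows "(\<lambda>k. kfar \<Omega> (\<beta> k) x) \<longlonglongrightarrow> kfar \<Omega> \<beta>0 x"
  unfolding kfar_def
proof (rule integral_dominated_convergence[where w = "indicator \<Omega>"])
  show "AE y in lborel. (\<lambda>k. indicator \<Omega> y * fk (\<beta> k) (x - y)) \<longlonglongrightarrow> indicator \<Omega> y * fk \<beta>0 (x - y)"
  proof (rule AE_I2)
    fix y
    show "(\<lambda>k. indicator \<Omega> y * fk (\<beta> k) (x - y)) \<longlonglongrightarrow> indicator \<Omega> y * fk \<beta>0 (x - y)"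
    proof (cases "x = y")
      case False
      then show ?thesis unfolding fk_def by (intro tendsto_intros \<beta>) auto
    qed (simp add: fk_def)
  qed
  show "AE y in lborel. norm (indicator \<Omega> y * fk (\<beta> k) (x - y)) \<le> indicator \<Omega> y" for k
    using fk_le_1[OF \<beta>(2)] by (intro AE_I2) (auto simp: indicator_def)
qed (use \<Omega>fin in \<open>auto simp: less_top[symmetric]\<close>)

lemma nn_integral_fk:
  fixes \<alpha> :: real and x :: 'a
  assumes \<alpha>: "0 < \<alpha>"
  shows "(\<integral>\<^sup>+y. ennreal (fk (DIM('a) + \<alpha>) (x - y)) \<partial>lborel) = ennreal (DIM('a) * unit_ball_vol DIM('a) / \<alpha>)"
proof -
  have "(\<integral>\<^sup>+y. ennreal (fk (DIM('a) + \<alpha>) (x - y)) \<partial>lborel) = (\<integral>\<^sup>+z. ennreal (fk (DIM('a) + \<alpha>) (z :: 'a)) \<partial>lborel)"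
    by (subst nn_integral_lborel_translate[of _ x, symmetric]) (auto simp: fk_minus)
  also have "\<dots> = (\<integral>\<^sup>+z. ennreal (norm (z::'a) powr (- (DIM('a) + \<alpha>))) * indicator {1..} (norm z) \<partial>lborel)"
  proof (rule nn_integral_cong)
    fix z :: 'a
    show "ennreal (fk (DIM('a) + \<alpha>) z) = ennreal (norm z powr (- (DIM('a) + \<alpha>))) * indicator {1..} (norm z)"
      unfolding fk_def powr_minus_divide by (simp add: indicator_def)
  qed
  also have "\<dots> = ennreal (DIM('a) * unit_ball_vol DIM('a) / \<alpha>)" by (rule nn_integral_radial_far[OF \<alpha>])
  finally show ?thesis .
qed

text \<open>The whole far kernel has mass \<open>N * unit_ball_vol N / \<alpha>\<close>, and the
  part on \<Omega> is \<open>kfar\<close>. The factor \<open>1 / \<alpha>\<close> will be cancelled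
  by the factor \<open>s\<close> in \<open>frac_c\<close>.\<close>

lemma frac_tail:
  fixes \<alpha> :: real
  assumes \<alpha>: "0 < \<alpha>"
  shows "(\<integral>\<^sup>+y. ennreal (indicator (- \<Omega>) y * fk (DIM('a) + \<alpha>) (x - y)) \<partial>lborel) =
      ennreal (DIM('a) * unit_ball_vol DIM('a) / \<alpha> - kfar \<Omega> (DIM('a) + \<alpha>) x)"
    and "kfar \<Omega> (DIM('a) + \<alpha>) x \<le> DIM('a) * unit_ball_vol DIM('a) / \<alpha>"
proof -
  let ?\<beta> = "DIM('a) + \<alpha>" and ?c = "DIM('a) * unit_ball_vol DIM('a) / \<alpha>"
  let ?t = "\<integral>\<^sup>+y. ennreal (indicator (- \<Omega>) y * fk ?\<beta> (x - y)) \<partial>lborel"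
  have \<beta>: "0 \<le> ?\<beta>" using \<alpha> by simp
  have k: "(\<integral>\<^sup>+y. ennreal (indicator \<Omega> y * fk ?\<beta> (x - y)) \<partial>lborel) = ennreal (kfar \<Omega> ?\<beta> x)"
    unfolding kfar_def using kfar_integrable[OF \<beta>] by (subst nn_integral_eq_integral) auto
  have "?t + ennreal (kfar \<Omega> ?\<beta> x) = (\<integral>\<^sup>+y. ennreal (indicator (- \<Omega>) y * fk ?\<beta> (x - y)) + ennreal (indicator \<Omega> y * fk ?\<beta> (x - y)) \<partial>lborel)"
    unfolding k[symmetric] by (subst nn_integral_add) auto
  also have "\<dots> = (\<integral>\<^sup>+y. ennreal (fk ?\<beta> (x - y)) \<partial>lborel)"
    by (intro nn_integral_cong) (auto simp: indicator_def)
  also have "\<dots> = ennreal ?c" by (rule nn_integral_fk[OF \<alpha>])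
  finally have eq: "?t + ennreal (kfar \<Omega> ?\<beta> x) = ennreal ?c" .
  have "ennreal (kfar \<Omega> ?\<beta> x) \<le> ennreal ?c" unfolding eq[symmetric] by simp
  then show le: "kfar \<Omega> ?\<beta> x \<le> ?c" using \<alpha> by (subst (asm) ennreal_le_iff) auto
  have "?t = ?t + ennreal (kfar \<Omega> ?\<beta> x) - ennreal (kfar \<Omega> ?\<beta> x)" by simp
  also have "\<dots> = ennreal (?c - kfar \<Omega> ?\<beta> x)" unfolding eq using kfar_nonneg by (simp add: ennreal_minus)
  finally show "?t = ennreal (?c - kfar \<Omega> ?\<beta> x)" .
qed

text \<open>\<open>ker\<close> counts pairs at distance 1 twice; they form a null set because
  spheres do.\<close>

lemma AE_norm_diff_neq_1: "AE z in (lborel \<Otimes>\<^sub>M lborel). norm (fst z - snd z :: 'a) \<noteq> 1"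
proof (rule lborel_pair.AE_pair_measure)
  show "{z \<in> space (lborel \<Otimes>\<^sub>M lborel). norm (fst z - snd z :: 'a) \<noteq> 1} \<in> sets (lborel \<Otimes>\<^sub>M lborel)"
    by measurable
  show "AE x in lborel. AE y in lborel. norm (fst (x, y) - snd (x, y) :: 'a) \<noteq> 1"
  proof (rule AE_I2)
    fix x :: 'a
    have "negligible (sphere x 1)" by (rule negligible_sphere)
    then have "sphere x 1 \<in> null_sets lebesgue" by (simp add: negligible_iff_null_sets)
    then have "sphere x 1 \<in> null_sets lborel" by (simp add: null_sets_completion_iff)
    then show "AE y in lborel. norm (fst (x, y) - snd (x, y) :: 'a) \<noteq> 1"
      by (rule AE_I') (auto simp: dist_norm)
  qed
qed

text \<open>Far pairs with exactly one point in \<Omega> see only the value at that point, so they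
  integrate to a potential; the factor 2 comes from the two positions of that point. All other
  contributing pairs are in \<open>ker\<close>.\<close>

lemma frac_split:
  fixes u :: "'a \<Rightarrow> real" and p \<alpha> :: real
  assumes p: "0 < p" and \<alpha>: "0 < \<alpha>" and [measurable]: "u \<in> borel_measurable borel" and supp: "\<And>x. x \<notin> \<Omega> \<Longrightarrow> u x = 0"
  shows "(\<integral>\<^sup>+z. ennreal (\<bar>u (fst z) - u (snd z)\<bar> powr p / norm (fst z - snd z) powr (DIM('a) + \<alpha>)) \<partial>(lborel \<Otimes>\<^sub>M lborel)) =
    dform \<Omega> (DIM('a) + \<alpha>) p u +
    2 * (\<integral>\<^sup>+x. ennreal ((DIM('a) * unit_ball_vol DIM('a) / \<alpha> - kfar \<Omega> (DIM('a) + \<alpha>) x) * \<bar>u x\<bar> powr p) \<partial>lborel)"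
proof -
  let ?\<beta> = "DIM('a) + \<alpha>" and ?c = "DIM('a) * unit_ball_vol DIM('a) / \<alpha>"
  let ?P = "lborel \<Otimes>\<^sub>M (lborel :: 'a measure)"
  define A where "A z = ennreal (\<bar>u (fst z)\<bar> powr p) * ennreal (indicator (- \<Omega>) (snd z) * fk ?\<beta> (fst z - snd z))" for z
  define B where "B z = ennreal (\<bar>u (snd z)\<bar> powr p) * ennreal (indicator (- \<Omega>) (fst z) * fk ?\<beta> (snd z - fst z))" for z
  have [measurable]: "A \<in> borel_measurable ?P" "B \<in> borel_measurable ?P"
    unfolding A_def[abs_def] B_def[abs_def] by measurable
  have "(\<integral>\<^sup>+z. ennreal (\<bar>u (fst z) - u (snd z)\<bar> powr p / norm (fst z - snd z) powr ?\<beta>) \<partial>?P) =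
    (\<integral>\<^sup>+z. ennreal (ker \<Omega> ?\<beta> z * \<bar>u (fst z) - u (snd z)\<bar> powr p) + (A z + B z) \<partial>?P)"
  proof (rule nn_integral_cong_AE, use AE_norm_diff_neq_1 in eventually_elim)
    case (elim z)
    obtain x y where z: "z = (x, y)" by (cases z)
    show ?case
    proof (cases "norm (x - y) \<le> 1")
      case True
      then have "norm (x - y) < 1" using elim z by simp
      then show ?thesis by (simp add: z A_def B_def ker_def nkern_def fk_def norm_minus_commute)
    next
      case False
      then have n: "nkern ?\<beta> (x - y) = 0" "fk ?\<beta> (x - y) = 1 / norm (x - y) powr ?\<beta>" "fk ?\<beta> (y - x) = 1 / norm (x - y) powr ?\<beta>"
        by (auto simp: nkern_def fk_def norm_minus_commute)
      have i: "indicator {1..} (norm (x - y)) = (1::real)" using False by simp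
      show ?thesis
        unfolding z A_def B_def ker_def fst_conv snd_conv n i
        using supp[of x] supp[of y] p by (cases "x \<in> \<Omega>"; cases "y \<in> \<Omega>") (simp_all add: ennreal_mult[symmetric])
    qed
  qed
  also have "\<dots> = dform \<Omega> ?\<beta> p u + ((\<integral>\<^sup>+z. A z \<partial>?P) + (\<integral>\<^sup>+z. B z \<partial>?P))"
    unfolding dform_def by (subst nn_integral_add, measurable)+
  also have "(\<integral>\<^sup>+z. A z \<partial>?P) = (\<integral>\<^sup>+x. ennreal (\<bar>u x\<bar> powr p) * ennreal (?c - kfar \<Omega> ?\<beta> x) \<partial>lborel)"
    by (subst lborel.nn_integral_fst[symmetric]) (auto simp: A_def nn_integral_cmult frac_tail(1)[OF \<alpha>])
  also have "(\<integral>\<^sup>+z. B z \<partial>?P) = (\<integral>\<^sup>+x. ennreal (\<bar>u x\<bar> powr p) * ennreal (?c - kfar \<Omega> ?\<beta> x) \<partial>lborel)"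
    by (subst lborel_pair.nn_integral_snd[symmetric]) (auto simp: B_def nn_integral_cmult frac_tail(1)[OF \<alpha>])
  also have "(\<integral>\<^sup>+x. ennreal (\<bar>u x\<bar> powr p) * ennreal (?c - kfar \<Omega> ?\<beta> x) \<partial>lborel) =
    (\<integral>\<^sup>+x. ennreal ((?c - kfar \<Omega> ?\<beta> x) * \<bar>u x\<bar> powr p) \<partial>lborel)"
    using frac_tail(2)[OF \<alpha>] by (intro nn_integral_cong) (simp add: ennreal_mult mult.commute)
  finally show ?thesis by (simp add: mult_2)
qed

end

section \<open>The normalising constants as the order tends to 0\<close>

definition frac_c :: "real \<Rightarrow> real \<Rightarrow> real \<Rightarrow> real" where
  "frac_c N p s = s * p * 2 powr (2 * s - 1) * Gamma ((N + s * p) / 2) / (pi powr (N / 2) * Gamma (1 - s))"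

text \<open>The product of \<open>frac_c\<close> with the total far mass
  \<open>N * unit_ball_vol N / (s * p)\<close>. It equals 1 at \<open>s = 0\<close>, which expresses
  that the fractional seminorm degenerates to the L^p norm.\<close>

definition frac_kappa :: "real \<Rightarrow> real \<Rightarrow> real \<Rightarrow> real" where
  "frac_kappa N p s = 2 powr (2 * s) * Gamma ((N + s * p) / 2) / (Gamma (N / 2) * Gamma (1 - s))"

lemma frac_c_pos:
  assumes "0 < N" "0 < p" "0 < s" "s < 1"
  shows "0 < frac_c N p s"
  unfolding frac_c_def using assms
  by (intro divide_pos_pos mult_pos_pos Gamma_real_pos) (auto intro: add_pos_pos)

lemma frac_c_kappa:
  assumes "0 < N" "0 < p" "0 < s" "s < 1"
  shows "frac_c N p s * (N * unit_ball_vol N / (s * p)) = frac_kappa N p s"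
proof -
  have G: "0 < Gamma (N / 2)" "0 < Gamma (1 - s)" using assms by (auto intro: Gamma_real_pos)
  have G1: "Gamma (N / 2 + 1) = N / 2 * Gamma (N / 2)"
    using assms by (intro Gamma_plus1) (auto dest: nonpos_Ints_nonpos)
  have v: "unit_ball_vol N = 2 * pi powr (N / 2) / (N * Gamma (N / 2))"
    unfolding unit_ball_vol_def G1 by simp
  have "2 powr (2 * s - 1) = 2 powr (2 * s) / (2::real)" by (simp add: powr_diff)
  then show ?thesis
    using assms G unfolding frac_c_def frac_kappa_def v by (simp add: field_simps)
qed

lemma frac_c_lim:
  assumes N: "0 < N" and s: "\<And>k::nat. 0 < s k" "s \<longlonglongrightarrow> 0"
  shows "(\<lambda>k. frac_c N p (s k) / s k) \<longlonglongrightarrow> p * Gamma (N / 2) / (2 * pi powr (N / 2))"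
proof -
  have nz: "N / 2 \<notin> \<int>\<^sub>\<le>\<^sub>0" "(1::real) \<notin> \<int>\<^sub>\<le>\<^sub>0" using N by (auto dest: nonpos_Ints_nonpos)
  have "(\<lambda>k. p * 2 powr (2 * s k - 1) * Gamma ((N + s k * p) / 2) / (pi powr (N / 2) * Gamma (1 - s k)))
    \<longlonglongrightarrow> p * 2 powr (2 * 0 - 1) * Gamma ((N + 0 * p) / 2) / (pi powr (N / 2) * Gamma (1 - 0))"
    using nz by (intro tendsto_intros tendsto_Gamma s) auto
  then have "(\<lambda>k. p * 2 powr (2 * s k - 1) * Gamma ((N + s k * p) / 2) / (pi powr (N / 2) * Gamma (1 - s k)))
    \<longlonglongrightarrow> p * Gamma (N / 2) / (2 * pi powr (N / 2))"
    by (simp add: powr_minus field_simps)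
  moreover have "frac_c N p (s k) / s k = p * 2 powr (2 * s k - 1) * Gamma ((N + s k * p) / 2) / (pi powr (N / 2) * Gamma (1 - s k))" for k
    using s(1)[of k] by (simp add: frac_c_def)
  ultimately show ?thesis by simp
qed

text \<open>This is the derivative of \<open>frac_kappa\<close> at 0. The power of 2 gives
  \<open>2 * ln 2\<close>, the Gamma factor in the numerator gives the digamma term, and the Gamma
  factor of \<open>1 - s\<close> gives the digamma value at 1, which is minus Euler's constant.
  Their sum is \<open>rho\<close>.\<close>

lemma frac_kappa_lim:
  assumes N: "0 < N" and s: "\<And>k::nat. 0 < s k" "s \<longlonglongrightarrow> 0"
  shows "(\<lambda>k. (frac_kappa N p (s k) - 1) / s k) \<longlonglongrightarrow> 2 * ln 2 - euler_mascheroni + p / 2 * Digamma (N / 2)"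
proof -
  have nz: "N / 2 \<notin> \<int>\<^sub>\<le>\<^sub>0" "(1::real) \<notin> \<int>\<^sub>\<le>\<^sub>0" using N by (auto dest: nonpos_Ints_nonpos)
  have G: "Gamma (N / 2) \<noteq> 0" by (rule less_imp_neq[OF Gamma_real_pos, symmetric]) (use N in simp)
  let ?g = "Gamma (N / 2)"
  have d1: "((\<lambda>s. Gamma ((N + s * p) / 2)) has_real_derivative ?g * Digamma (N / 2) * (p / 2)) (at 0)"
    by (rule DERIV_cong, rule DERIV_chain2[where g = "\<lambda>s. (N + s * p) / 2", OF has_field_derivative_Gamma])
      (use nz in \<open>auto intro!: derivative_eq_intros\<close>)
  have d2: "((\<lambda>s::real. Gamma (1 - s)) has_real_derivative Gamma 1 * Digamma 1 * (- 1)) (at 0)"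
    by (rule DERIV_cong, rule DERIV_chain2[where g = "\<lambda>s. 1 - s", OF has_field_derivative_Gamma])
      (use nz in \<open>auto intro!: derivative_eq_intros\<close>)
  have d3: "((\<lambda>s::real. 2 powr (2 * s)) has_real_derivative 2 * ln 2) (at 0)"
    by (auto intro!: derivative_eq_intros)
  have "((\<lambda>s. frac_kappa N p s) has_real_derivative 2 * ln 2 - euler_mascheroni + p / 2 * Digamma (N / 2)) (at 0)"
    unfolding frac_kappa_def
    by (rule DERIV_cong[OF DERIV_divide[OF DERIV_mult[OF d3 d1] DERIV_cmult[OF d2]]])
      (use G in \<open>auto simp: Digamma_1 field_simps\<close>)
  then have "((\<lambda>t. (frac_kappa N p (0 + t) - frac_kappa N p 0) / t) \<longlongrightarrow> 2 * ln 2 - euler_mascheroni + p / 2 * Digamma (N / 2)) (at 0)"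
    by (simp add: DERIV_def)
  moreover have "frac_kappa N p 0 = 1" using G by (simp add: frac_kappa_def)
  moreover have "filterlim s (at 0) sequentially"
    unfolding filterlim_at using s by (auto simp: less_imp_neq[symmetric])
  ultimately show ?thesis by (auto dest: filterlim_compose)
qed

section \<open>The logarithmic form\<close>

lemma LINT_lebesgue_on:
  fixes f :: "'a::euclidean_space \<Rightarrow> real"
  assumes "\<Omega> \<in> sets borel" "f \<in> borel_measurable borel" "\<And>x. x \<notin> \<Omega> \<Longrightarrow> f x = 0"
  shows "(LINT x|lebesgue_on \<Omega>. f x) = (LINT x|lborel. f x)"
proof -
  have "(LINT x|lebesgue_on \<Omega>. f x) = (LINT x|lebesgue. indicator \<Omega> x *\<^sub>R f x)"
    using assms(1) by (subst integral_restrict_space) auto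
  also have "\<dots> = (LINT x|lebesgue. f x)"
    by (intro Bochner_Integration.integral_cong) (use assms(3) in \<open>auto simp: indicator_def\<close>)
  also have "\<dots> = (LINT x|lborel. f x)" using assms(2) by (simp add: integral_completion)
  finally show ?thesis .
qed

context log_functional
begin

lemma farker_fk: "farker z = indicator \<Omega> (fst z) * indicator \<Omega> (snd z) * fk DIM('a) (fst z - snd z)"
  by (simp add: farker_def fk_def)

text \<open>If the integrand depends on one point of the pair only, integrating out the other leaves
  \<open>kfar\<close>.\<close>

lemma farker_mult_fst:
  fixes g :: "'a \<Rightarrow> real"
  assumes g: "integrable lborel g" and g0: "\<And>x. x \<notin> \<Omega> \<Longrightarrow> g x = 0"
  shows "integrable (lborel \<Otimes>\<^sub>M lborel) (\<lambda>z. farker z * g (fst z))"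
    and "(LINT z|(lborel \<Otimes>\<^sub>M lborel). farker z * g (fst z)) = (LINT x|lborel. kfar \<Omega> DIM('a) x * g x)"
    and "integrable (lborel \<Otimes>\<^sub>M lborel) (\<lambda>z. farker z * g (snd z))"
    and "(LINT z|(lborel \<Otimes>\<^sub>M lborel). farker z * g (snd z)) = (LINT x|lborel. kfar \<Omega> DIM('a) x * g x)"
proof -
  let ?P = "lborel \<Otimes>\<^sub>M (lborel :: 'a measure)"
  have [measurable]: "g \<in> borel_measurable borel" using g by simp
  have dom: "integrable ?P (\<lambda>z. indicator \<Omega> (fst z) * indicator \<Omega> (snd z) * (\<bar>g (fst z)\<bar> + \<bar>g (snd z)\<bar>))"
    using g by (intro indicator_square_integrable) auto
  show 1: "integrable ?P (\<lambda>z. farker z * g (fst z))"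
  proof (rule Bochner_Integration.integrable_bound[OF dom])
    show "AE z in ?P. norm (farker z * g (fst z)) \<le> norm (indicator \<Omega> (fst z) * indicator \<Omega> (snd z) * (\<bar>g (fst z)\<bar> + \<bar>g (snd z)\<bar>))"
    proof (rule AE_I2)
      fix z :: "'a \<times> 'a"
      have "farker z * \<bar>g (fst z)\<bar> \<le> indicator \<Omega> (fst z) * indicator \<Omega> (snd z) * (\<bar>g (fst z)\<bar> + \<bar>g (snd z)\<bar>)"
        by (intro mult_mono farker_le) auto
      then show "norm (farker z * g (fst z)) \<le> norm (indicator \<Omega> (fst z) * indicator \<Omega> (snd z) * (\<bar>g (fst z)\<bar> + \<bar>g (snd z)\<bar>))"
        by (simp add: abs_mult)
    qed
  qed measurable
  show 2: "integrable ?P (\<lambda>z. farker z * g (snd z))"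
  proof (rule Bochner_Integration.integrable_bound[OF dom])
    show "AE z in ?P. norm (farker z * g (snd z)) \<le> norm (indicator \<Omega> (fst z) * indicator \<Omega> (snd z) * (\<bar>g (fst z)\<bar> + \<bar>g (snd z)\<bar>))"
    proof (rule AE_I2)
      fix z :: "'a \<times> 'a"
      have "farker z * \<bar>g (snd z)\<bar> \<le> indicator \<Omega> (fst z) * indicator \<Omega> (snd z) * (\<bar>g (fst z)\<bar> + \<bar>g (snd z)\<bar>)"
        by (intro mult_mono farker_le) auto
      then show "norm (farker z * g (snd z)) \<le> norm (indicator \<Omega> (fst z) * indicator \<Omega> (snd z) * (\<bar>g (fst z)\<bar> + \<bar>g (snd z)\<bar>))"
        by (simp add: abs_mult)
    qed
  qed measurable
  have e1: "farker (x, y) * g x = g x * (indicator \<Omega> y * fk DIM('a) (x - y))" for x y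
    using g0[of x] by (cases "x \<in> \<Omega>") (simp_all add: farker_fk indicator_def)
  have e2: "farker (x, y) * g y = g y * (indicator \<Omega> x * fk DIM('a) (y - x))" for x y
    using g0[of y] fk_commute[of _ x y] by (cases "y \<in> \<Omega>") (simp_all add: farker_fk indicator_def)
  have r1: "(LINT y|lborel. farker (x, y) * g x) = kfar \<Omega> DIM('a) x * g x" for x
    unfolding e1 kfar_def by simp
  have r2: "(LINT x|lborel. farker (x, y) * g y) = kfar \<Omega> DIM('a) y * g y" for y
    unfolding e2 kfar_def by simp
  show "(LINT z|?P. farker z * g (fst z)) = (LINT x|lborel. kfar \<Omega> DIM('a) x * g x)"
    unfolding lborel_pair.integral_fst'[OF 1, symmetric] fst_conv r1 ..
  have snd_int: "integrable ?P (\<lambda>(x, y). farker (x, y) * g y)" using 2 by (simp add: case_prod_unfold)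
  have "(LINT z|?P. farker z * g (snd z)) = (LINT z|?P. (\<lambda>(x, y). farker (x, y) * g y) z)" by (simp add: case_prod_unfold)
  also have "\<dots> = (LINT y|lborel. LINT x|lborel. farker (x, y) * g y)"
    by (rule lborel_pair.integral_snd[OF snd_int, symmetric])
  also have "\<dots> = (LINT x|lborel. kfar \<Omega> DIM('a) x * g x)" unfolding r2 ..
  finally show "(LINT z|?P. farker z * g (snd z)) = (LINT x|lborel. kfar \<Omega> DIM('a) x * g x)" .
qed

text \<open>If one of the two points is outside \<Omega>, the subtracted diagonal terms in
  \<open>Upsilon\<close> cancel the product, so the far integral lives on pairs inside \<Omega>.
  There it splits into the far part of \<open>ddint\<close> and the two diagonal terms, each of
  which yields the potential \<open>kfar\<close>.\<close>

lemma log_form_eq: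
  assumes u: "u \<in> logsp \<Omega> p" and v: "v \<in> logsp \<Omega> p"
  shows "(LINT z|(lborel \<Otimes>\<^sub>M lborel). indicator {z. norm z \<le> 1} (fst z - snd z) *
        (h p (u (fst z) - u (snd z)) * (v (fst z) - v (snd z)) / norm (fst z - snd z) ^ DIM('a))) +
      (LINT z|(lborel \<Otimes>\<^sub>M lborel). indicator {z. 1 \<le> norm z} (fst z - snd z) *
        (Upsilon p (u (fst z)) (u (snd z)) (v (fst z)) (v (snd z)) / norm (fst z - snd z) ^ DIM('a)))
    = ddint u v - 2 * (LINT x|lborel. kfar \<Omega> DIM('a) x * (h p (u x) * v x))"
proof -
  note [measurable] = logspD(1)[OF u] logspD(1)[OF v]
  let ?P = "lborel \<Otimes>\<^sub>M (lborel :: 'a measure)"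
  let ?D = "\<lambda>z. h p (u (fst z) - u (snd z)) * (v (fst z) - v (snd z))"
  let ?g = "\<lambda>x. h p (u x) * v x"
  have pw: "norm (x - y) ^ DIM('a) = norm (x - y) powr DIM('a)" for x y :: 'a
    by (cases "x = y") (simp_all add: powr_realpow)
  have near: "indicator {z. norm z \<le> 1} (fst z - snd z) * (?D z / norm (fst z - snd z) ^ DIM('a)) = ker {} DIM('a) z * ?D z" for z
    by (simp add: pw ker_empty nkern_def indicator_def)
  have far: "indicator {z. 1 \<le> norm z} (fst z - snd z) * (Upsilon p (u (fst z)) (u (snd z)) (v (fst z)) (v (snd z)) / norm (fst z - snd z) ^ DIM('a))
    = farker z * ?D z - farker z * ?g (fst z) - farker z * ?g (snd z)" for z
    using logspD(2)[OF u, of "fst z"] logspD(2)[OF u, of "snd z"] logspD(2)[OF v, of "fst z"] logspD(2)[OF v, of "snd z"]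
    by (cases "fst z \<in> \<Omega>"; cases "snd z \<in> \<Omega>")
      (simp_all add: pw farker_def Upsilon_def indicator_def h_def diff_divide_distrib right_diff_distrib)
  have int_near: "integrable ?P (\<lambda>z. ker {} DIM('a) z * ?D z)"
  proof (rule Bochner_Integration.integrable_bound[OF ddint_integrable[OF u v]])
    show "AE z in ?P. norm (ker {} DIM('a) z * ?D z) \<le> norm (ker \<Omega> DIM('a) z * ?D z)"
      by (intro AE_I2) (auto simp: abs_mult ker_eq intro!: mult_right_mono)
  qed measurable
  have int_far: "integrable ?P (\<lambda>z. farker z * ?D z)"
    using Bochner_Integration.integrable_diff[OF ddint_integrable[OF u v] int_near] by (simp add: ker_eq distrib_right)
  have dd: "ddint u v = (LINT z|?P. ker {} DIM('a) z * ?D z) + (LINT z|?P. farker z * ?D z)"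
    unfolding ddint_def ker_eq distrib_right by (rule Bochner_Integration.integral_add[OF int_near int_far])
  have g: "integrable lborel ?g" by (rule h_mult_integrable[OF u v])
  have g0: "?g x = 0" if "x \<notin> \<Omega>" for x using logspD(2)[OF v that] by simp
  have F: "integrable ?P (\<lambda>z. farker z * ?g (fst z))" "integrable ?P (\<lambda>z. farker z * ?g (snd z))"
    "(LINT z|?P. farker z * ?g (fst z)) = (LINT x|lborel. kfar \<Omega> DIM('a) x * ?g x)"
    "(LINT z|?P. farker z * ?g (snd z)) = (LINT x|lborel. kfar \<Omega> DIM('a) x * ?g x)"
    by (rule farker_mult_fst(1)[OF g g0] farker_mult_fst(2)[OF g g0] farker_mult_fst(3)[OF g g0] farker_mult_fst(4)[OF g g0]; assumption)+
  have "(LINT z|?P. farker z * ?D z - farker z * ?g (fst z) - farker z * ?g (snd z)) =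
    (LINT z|?P. farker z * ?D z - farker z * ?g (fst z)) - (LINT z|?P. farker z * ?g (snd z))"
    by (rule Bochner_Integration.integral_diff[OF Bochner_Integration.integrable_diff[OF int_far F(1)] F(2)])
  also have "(LINT z|?P. farker z * ?D z - farker z * ?g (fst z)) = (LINT z|?P. farker z * ?D z) - (LINT z|?P. farker z * ?g (fst z))"
    by (rule Bochner_Integration.integral_diff[OF int_far F(1)])
  finally have "(LINT z|?P. farker z * ?D z - farker z * ?g (fst z) - farker z * ?g (snd z)) =
    (LINT z|?P. farker z * ?D z) - (LINT x|lborel. kfar \<Omega> DIM('a) x * ?g x) - (LINT x|lborel. kfar \<Omega> DIM('a) x * ?g x)"
    unfolding F(3,4) .
  then show ?thesis unfolding near far dd by simp
qed

end

section \<open>From Lebesgue to Borel representatives\<close>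

lemma sigma_finite_lebesgue: "sigma_finite_measure (lebesgue :: 'a::euclidean_space measure)"
proof -
  obtain A :: "'a set set" where A: "countable A" "A \<subseteq> sets lborel" "\<Union>A = space lborel" "\<forall>a\<in>A. emeasure lborel a \<noteq> \<infinity>"
    using lborel.sigma_finite_countable by metis
  show ?thesis
  proof (rule sigma_finite_measure.intro, intro exI[of _ A] conjI)
    show "\<forall>a\<in>A. emeasure lebesgue a \<noteq> \<infinity>"
    proof
      fix a assume "a \<in> A"
      then have "a \<in> sets lborel" "emeasure lborel a \<noteq> \<infinity>" using A by auto
      then show "emeasure lebesgue a \<noteq> \<infinity>" by simp
    qed
  qed (use A in auto)
qed

interpretation leb: sigma_finite_measure "lebesgue :: 'a::euclidean_space measure"
  by (rule sigma_finite_lebesgue)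

interpretation leb_pair: pair_sigma_finite "lebesgue :: 'a::euclidean_space measure" "lebesgue :: 'b::euclidean_space measure" ..

lemma borel_to_lebesgue [measurable (raw)]: "f \<in> borel_measurable borel \<Longrightarrow> f \<in> borel_measurable lebesgue"
  by (intro measurable_completion) auto

text \<open>The product of two completed measures has more measurable sets than the product of the
  Borel measures. The identity map is measurable in the direction stated and pushes one product
  measure to the other, which carries over all double integrals of Borel functions.\<close>

lemma measurable_lebesgue_pair:
  "(\<lambda>z. z) \<in> (lebesgue :: 'a::euclidean_space measure) \<Otimes>\<^sub>M lebesgue \<rightarrow>\<^sub>M (lborel :: 'a measure) \<Otimes>\<^sub>M (lborel :: 'a measure)"
proof -
  have id: "(\<lambda>x. x) \<in> (lebesgue :: 'a measure) \<rightarrow>\<^sub>M lborel" by (intro measurable_completion) auto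
  have "(\<lambda>z. fst z) \<in> (lebesgue :: 'a measure) \<Otimes>\<^sub>M (lebesgue :: 'a measure) \<rightarrow>\<^sub>M (lborel :: 'a measure)"
    by (rule measurable_compose[OF measurable_fst id])
  moreover have "(\<lambda>z. snd z) \<in> (lebesgue :: 'a measure) \<Otimes>\<^sub>M (lebesgue :: 'a measure) \<rightarrow>\<^sub>M (lborel :: 'a measure)"
    by (rule measurable_compose[OF measurable_snd id])
  ultimately have "(\<lambda>z. (fst z, snd z)) \<in> (lebesgue :: 'a measure) \<Otimes>\<^sub>M lebesgue \<rightarrow>\<^sub>M (lborel :: 'a measure) \<Otimes>\<^sub>M (lborel :: 'a measure)"
    by (rule measurable_Pair)
  then show ?thesis by simp
qed

lemma borel_to_lebesgue_pair:
  "f \<in> (lborel :: 'a::euclidean_space measure) \<Otimes>\<^sub>M (lborel :: 'a measure) \<rightarrow>\<^sub>M N \<Longrightarrow> f \<in> lebesgue \<Otimes>\<^sub>M lebesgue \<rightarrow>\<^sub>M N"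
  by (rule measurable_compose[OF measurable_lebesgue_pair])

lemma nn_integral_lebesgue_pair:
  fixes f :: "'a::euclidean_space \<times> 'a \<Rightarrow> ennreal"
  assumes [measurable]: "f \<in> borel_measurable (lborel \<Otimes>\<^sub>M lborel)"
  shows "(\<integral>\<^sup>+z. f z \<partial>(lebesgue \<Otimes>\<^sub>M lebesgue)) = (\<integral>\<^sup>+z. f z \<partial>(lborel \<Otimes>\<^sub>M lborel))"
proof -
  have "(\<integral>\<^sup>+z. f z \<partial>(lebesgue \<Otimes>\<^sub>M lebesgue)) = (\<integral>\<^sup>+x. \<integral>\<^sup>+y. f (x, y) \<partial>lebesgue \<partial>lebesgue)"
    by (rule leb.nn_integral_fst[symmetric]) (rule borel_to_lebesgue_pair, measurable)
  also have "\<dots> = (\<integral>\<^sup>+x. \<integral>\<^sup>+y. f (x, y) \<partial>lborel \<partial>lebesgue)"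
    by (intro nn_integral_cong nn_integral_completion)
  also have "\<dots> = (\<integral>\<^sup>+x. \<integral>\<^sup>+y. f (x, y) \<partial>lborel \<partial>lborel)"
    by (rule nn_integral_completion)
  also have "\<dots> = (\<integral>\<^sup>+z. f z \<partial>(lborel \<Otimes>\<^sub>M lborel))"
    by (rule lborel.nn_integral_fst) measurable
  finally show ?thesis .
qed

lemma distr_lebesgue_pair:
  "distr ((lebesgue :: 'a::euclidean_space measure) \<Otimes>\<^sub>M lebesgue) ((lborel :: 'a measure) \<Otimes>\<^sub>M (lborel :: 'a measure)) (\<lambda>z. z) = lborel \<Otimes>\<^sub>M lborel"
proof (rule measure_eqI)
  fix A assume "A \<in> sets (distr ((lebesgue :: 'a measure) \<Otimes>\<^sub>M lebesgue) ((lborel :: 'a measure) \<Otimes>\<^sub>M (lborel :: 'a measure)) (\<lambda>z. z))"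
  then have A: "A \<in> sets ((lborel :: 'a measure) \<Otimes>\<^sub>M (lborel :: 'a measure))" by simp
  have "emeasure (distr ((lebesgue :: 'a measure) \<Otimes>\<^sub>M lebesgue) ((lborel :: 'a measure) \<Otimes>\<^sub>M (lborel :: 'a measure)) (\<lambda>z. z)) A
    = (\<integral>\<^sup>+z. indicator A z \<partial>distr ((lebesgue :: 'a measure) \<Otimes>\<^sub>M lebesgue) ((lborel :: 'a measure) \<Otimes>\<^sub>M (lborel :: 'a measure)) (\<lambda>z. z))"
    using A by simp
  also have "\<dots> = (\<integral>\<^sup>+z. indicator A z \<partial>(lebesgue \<Otimes>\<^sub>M lebesgue))"
    using A by (subst nn_integral_distr[OF measurable_lebesgue_pair]) auto
  also have "\<dots> = (\<integral>\<^sup>+z. indicator A z \<partial>(lborel \<Otimes>\<^sub>M lborel))"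
    by (rule nn_integral_lebesgue_pair[of "indicator A"]) (use A in auto)
  finally show "emeasure (distr ((lebesgue :: 'a measure) \<Otimes>\<^sub>M lebesgue) ((lborel :: 'a measure) \<Otimes>\<^sub>M (lborel :: 'a measure)) (\<lambda>z. z)) A = emeasure (lborel \<Otimes>\<^sub>M lborel) A"
    using A by simp
qed simp

lemma integral_lebesgue_pair:
  fixes f :: "'a::euclidean_space \<times> 'a \<Rightarrow> real"
  assumes "f \<in> borel_measurable (lborel \<Otimes>\<^sub>M lborel)"
  shows "(LINT z|(lebesgue \<Otimes>\<^sub>M lebesgue). f z) = (LINT z|(lborel \<Otimes>\<^sub>M lborel). f z)"
  using integral_distr[OF measurable_lebesgue_pair assms] by (simp add: distr_lebesgue_pair)

lemma AE_lebesgue_pair: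
  assumes "AE x in lebesgue. P (x::'a::euclidean_space)"
  shows "AE z in (lebesgue \<Otimes>\<^sub>M lebesgue). P (fst z) \<and> P (snd z)"
proof -
  obtain N where N: "{x \<in> space lebesgue. \<not> P x} \<subseteq> N" "emeasure lebesgue N = 0" "N \<in> sets lebesgue"
    using assms by (rule AE_E)
  have U: "UNIV \<in> sets (lebesgue :: 'a measure)" by simp
  have "N \<times> UNIV \<in> null_sets (lebesgue \<Otimes>\<^sub>M lebesgue)" "UNIV \<times> N \<in> null_sets (lebesgue \<Otimes>\<^sub>M lebesgue)"
    using N U by (auto simp: null_sets_def leb.emeasure_pair_measure_Times intro!: pair_measureI)
  then have "N \<times> UNIV \<union> UNIV \<times> N \<in> null_sets (lebesgue \<Otimes>\<^sub>M (lebesgue :: 'a measure))" by auto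
  then show ?thesis by (rule AE_I') (use N(1) in auto)
qed

text \<open>Multiplication with the indicator turns vanishing almost everywhere off \<Omega> into
  vanishing everywhere there.\<close>

lemma borel_representative:
  fixes u :: "'a::euclidean_space \<Rightarrow> real"
  assumes \<Omega>: "\<Omega> \<in> sets borel" and u: "u \<in> borel_measurable lebesgue" and u0: "AE x in lebesgue. x \<notin> \<Omega> \<longrightarrow> u x = 0"
  obtains u' where "u' \<in> borel_measurable borel" "\<And>x. x \<notin> \<Omega> \<Longrightarrow> u' x = 0" "AE x in lebesgue. u x = u' x"
proof -
  obtain v where v: "v \<in> borel_measurable lborel" "AE x in lborel. u x = v x"
    using completion_ex_borel_measurable_real[OF u] by blast
  show thesis
  proof (rule that[of "\<lambda>x. indicator \<Omega> x * v x"])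
    show "(\<lambda>x. indicator \<Omega> x * v x) \<in> borel_measurable borel" using v(1) \<Omega> by auto
    show "AE x in lebesgue. u x = indicator \<Omega> x * v x"
      using AE_completion[OF v(2)] u0 by eventually_elim (auto simp: indicator_def)
  qed simp
qed

lemma AE_lebesgue_restrict:
  assumes "\<Omega> \<in> sets borel" "AE x in lebesgue. P x"
  shows "AE x in lebesgue_on \<Omega>. P x"
  using assms by (subst AE_restrict_space_iff) auto

lemma frac_seminorm_pow_cong:
  assumes "AE x in lebesgue. u x = u' x"
  shows "frac_seminorm_pow s p u = frac_seminorm_pow s p u'"
  unfolding frac_seminorm_pow_def
  by (intro arg_cong2[where f = "(*)"] refl nn_integral_cong_AE, use AE_lebesgue_pair[OF assms] in eventually_elim)
    (simp add: case_prod_unfold)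

lemma log_seminorm_pow_cong:
  assumes "AE x in lebesgue. u x = u' x"
  shows "log_seminorm_pow p u = log_seminorm_pow p u'"
  unfolding log_seminorm_pow_def
  by (intro arg_cong2[where f = "(*)"] refl nn_integral_cong_AE, use AE_lebesgue_pair[OF assms] in eventually_elim)
    (simp add: case_prod_unfold)

lemma compose_fst_lebesgue: "f \<in> borel_measurable lebesgue \<Longrightarrow> (\<lambda>z. f (fst z)) \<in> borel_measurable (lebesgue \<Otimes>\<^sub>M lebesgue)"
  by (rule measurable_compose[OF measurable_fst])

lemma compose_snd_lebesgue: "f \<in> borel_measurable lebesgue \<Longrightarrow> (\<lambda>z. f (snd z)) \<in> borel_measurable (lebesgue \<Otimes>\<^sub>M lebesgue)"
  by (rule measurable_compose[OF measurable_snd])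

lemma norm_diff_lebesgue_pair:
  "(\<lambda>z. norm (fst z - snd z :: 'a::euclidean_space)) \<in> borel_measurable (lebesgue \<Otimes>\<^sub>M lebesgue)"
  by (rule borel_to_lebesgue_pair) measurable

lemma log_form_cong:
  fixes u u' v v' :: "real ^ 'n \<Rightarrow> real"
  assumes u: "AE x in lebesgue. u x = u' x" and v: "AE x in lebesgue. v x = v' x"
    and [measurable]: "u \<in> borel_measurable lebesgue" "u' \<in> borel_measurable lebesgue"
      "v \<in> borel_measurable lebesgue" "v' \<in> borel_measurable lebesgue"
  shows "log_form p u v = log_form p u' v'"
proof -
  have [measurable]: "(\<lambda>z. w (fst z)) \<in> borel_measurable (lebesgue \<Otimes>\<^sub>M lebesgue)" "(\<lambda>z. w (snd z)) \<in> borel_measurable (lebesgue \<Otimes>\<^sub>M lebesgue)"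
    if "w \<in> borel_measurable lebesgue" for w :: "real ^ 'n \<Rightarrow> real"
    using that by (auto intro: compose_fst_lebesgue compose_snd_lebesgue)
  note [measurable] = norm_diff_lebesgue_pair
  have ind1: "(indicator {z. norm z \<le> 1} (x - y) :: real) = (if norm (x - y) \<le> 1 then 1 else 0)"
    and ind2: "(indicator {z. 1 \<le> norm z} (x - y) :: real) = (if 1 \<le> norm (x - y) then 1 else 0)" for x y :: "real ^ 'n"
    by (auto simp: indicator_def)
  have AE: "AE z in (lebesgue \<Otimes>\<^sub>M lebesgue). (u (fst z) = u' (fst z) \<and> v (fst z) = v' (fst z)) \<and> (u (snd z) = u' (snd z) \<and> v (snd z) = v' (snd z))"
    by (rule AE_lebesgue_pair) (use u v in eventually_elim, simp)
  have "(\<integral>(x, y). indicator {z. norm z \<le> 1} (x - y) * (h p (u x - u y) * (v x - v y) / norm (x - y) ^ CARD('n)) \<partial>(lebesgue \<Otimes>\<^sub>M lebesgue)) =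
    (\<integral>(x, y). indicator {z. norm z \<le> 1} (x - y) * (h p (u' x - u' y) * (v' x - v' y) / norm (x - y) ^ CARD('n)) \<partial>(lebesgue \<Otimes>\<^sub>M lebesgue))"
    unfolding case_prod_unfold ind1
  proof (rule integral_cong_AE)
    show "AE z in (lebesgue \<Otimes>\<^sub>M lebesgue). (if norm (fst z - snd z) \<le> 1 then 1 else 0) * (h p (u (fst z) - u (snd z)) * (v (fst z) - v (snd z)) / norm (fst z - snd z) ^ CARD('n)) = (if norm (fst z - snd z) \<le> 1 then 1 else 0) * (h p (u' (fst z) - u' (snd z)) * (v' (fst z) - v' (snd z)) / norm (fst z - snd z) ^ CARD('n))"
      using AE by eventually_elim simp
  qed measurable
  moreover have "(\<integral>(x, y). indicator {z. 1 \<le> norm z} (x - y) * (Upsilon p (u x) (u y) (v x) (v y) / norm (x - y) ^ CARD('n)) \<partial>(lebesgue \<Otimes>\<^sub>M lebesgue)) =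
    (\<integral>(x, y). indicator {z. 1 \<le> norm z} (x - y) * (Upsilon p (u' x) (u' y) (v' x) (v' y) / norm (x - y) ^ CARD('n)) \<partial>(lebesgue \<Otimes>\<^sub>M lebesgue))"
    unfolding case_prod_unfold ind2 Upsilon_def
  proof (rule integral_cong_AE)
    show "AE z in (lebesgue \<Otimes>\<^sub>M lebesgue). (if 1 \<le> norm (fst z - snd z) then 1 else 0) * ((h p (u (fst z) - u (snd z)) * (v (fst z) - v (snd z)) - h p (u (fst z)) * v (fst z) - h p (u (snd z)) * v (snd z)) / norm (fst z - snd z) ^ CARD('n)) = (if 1 \<le> norm (fst z - snd z) then 1 else 0) * ((h p (u' (fst z) - u' (snd z)) * (v' (fst z) - v' (snd z)) - h p (u' (fst z)) * v' (fst z) - h p (u' (snd z)) * v' (snd z)) / norm (fst z - snd z) ^ CARD('n))"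
      using AE by eventually_elim simp
  qed measurable
  moreover have "(LINT x|lebesgue. h p (u x) * v x) = (LINT x|lebesgue. h p (u' x) * v' x)"
  proof (rule integral_cong_AE)
    show "AE x in lebesgue. h p (u x) * v x = h p (u' x) * v' x" using u v by eventually_elim simp
  qed measurable
  ultimately show ?thesis unfolding log_form_def by simp
qed

lemma frac_const_eq: "frac_const TYPE('n::finite) s p = frac_c (real CARD('n)) p s"
  by (simp add: frac_const_def frac_c_def)

lemma frac_seminorm_pow_borel:
  fixes u :: "real ^ 'n \<Rightarrow> real" and s p :: real
  assumes [measurable]: "u \<in> borel_measurable borel"
  shows "frac_seminorm_pow s p u = ennreal (frac_c CARD('n) p s / 2) *
    (\<integral>\<^sup>+z. ennreal (\<bar>u (fst z) - u (snd z)\<bar> powr p / norm (fst z - snd z) powr (CARD('n) + s * p)) \<partial>(lborel \<Otimes>\<^sub>M lborel))"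
  unfolding frac_seminorm_pow_def frac_const_eq case_prod_unfold
  by (subst nn_integral_lebesgue_pair) auto

lemma log_seminorm_pow_borel:
  fixes u :: "real ^ 'n \<Rightarrow> real"
  assumes [measurable]: "u \<in> borel_measurable borel"
  shows "log_seminorm_pow p u = ennreal (log_const TYPE('n) p) * dform {} DIM(real ^ 'n) p u"
proof -
  have eq: "indicator {z. norm z \<le> 1} (fst z - snd z) * (\<bar>u (fst z) - u (snd z)\<bar> powr p / norm (fst z - snd z) ^ CARD('n)) =
    ker {} DIM(real ^ 'n) z * \<bar>u (fst z) - u (snd z)\<bar> powr p" for z :: "(real ^ 'n) \<times> (real ^ 'n)"
  proof (cases "fst z = snd z")
    case False
    then show ?thesis by (simp add: ker_empty nkern_def indicator_def powr_realpow)
  qed (simp add: ker_empty nkern_def)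
  show ?thesis
    unfolding log_seminorm_pow_def case_prod_unfold eq dform_def by (subst nn_integral_lebesgue_pair) auto
qed

lemma log_const_pos: "0 < p \<Longrightarrow> 0 < log_const TYPE('n::finite) p"
  unfolding log_const_def by (intro divide_pos_pos mult_pos_pos Gamma_real_pos) auto

lemma X_log_representative:
  fixes u :: "real ^ 'n \<Rightarrow> real"
  assumes p: "1 < p" and \<Omega>: "\<Omega> \<in> sets borel" and u: "u \<in> X_log p \<Omega>"
  obtains u' where "u' \<in> logsp \<Omega> p" "AE x in lebesgue. u x = u' x"
proof -
  have um: "u \<in> borel_measurable lebesgue" and ui: "integrable lebesgue (\<lambda>x. \<bar>u x\<bar> powr p)"
    and us: "log_seminorm_pow p u < \<infinity>" and u0: "AE x in lebesgue. x \<notin> \<Omega> \<longrightarrow> u x = 0"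
    using u by (auto simp: X_log_def Lp_def)
  obtain u' where u'[measurable]: "u' \<in> borel_measurable borel" and z: "\<And>x. x \<notin> \<Omega> \<Longrightarrow> u' x = 0" and AE: "AE x in lebesgue. u x = u' x"
    using borel_representative[OF \<Omega> um u0] by blast
  have "(\<integral>\<^sup>+x. ennreal (\<bar>u' x\<bar> powr p) \<partial>lborel) = (\<integral>\<^sup>+x. ennreal (\<bar>u' x\<bar> powr p) \<partial>lebesgue)"
    by (simp add: nn_integral_completion)
  also have "\<dots> = (\<integral>\<^sup>+x. ennreal (\<bar>u x\<bar> powr p) \<partial>lebesgue)"
    by (rule nn_integral_cong_AE, use AE in eventually_elim) simp
  also have "\<dots> < \<infinity>" using ui by (subst nn_integral_eq_integral) auto
  finally have 1: "(\<integral>\<^sup>+x. ennreal (\<bar>u' x\<bar> powr p) \<partial>lborel) < \<infinity>" .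
  have "ennreal (log_const TYPE('n) p) * dform {} DIM(real ^ 'n) p u' < \<infinity>"
    using us unfolding log_seminorm_pow_cong[OF AE] log_seminorm_pow_borel[OF u'] .
  then have "dform {} DIM(real ^ 'n) p u' < \<infinity>"
    using log_const_pos[of p, where 'n = 'n] p by (auto simp: ennreal_mult_less_top)
  then show thesis using 1 z AE by (intro that[of u']) (auto simp: logsp_def)
qed

lemma logsp_X_log:
  fixes u :: "real ^ 'n \<Rightarrow> real"
  assumes u: "u \<in> logsp \<Omega> p"
  shows "u \<in> X_log p \<Omega>"
proof -
  have um[measurable]: "u \<in> borel_measurable borel" and z: "\<And>x. x \<notin> \<Omega> \<Longrightarrow> u x = 0"
    and 1: "(\<integral>\<^sup>+x. ennreal (\<bar>u x\<bar> powr p) \<partial>lborel) < \<infinity>" and 2: "dform {} DIM(real ^ 'n) p u < \<infinity>"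
    using u by (auto simp: logsp_def)
  have "integrable lborel (\<lambda>x. \<bar>u x\<bar> powr p)" using 1 by (intro integrableI_nonneg) auto
  then have "integrable lebesgue (\<lambda>x. \<bar>u x\<bar> powr p)" by (simp add: integrable_completion)
  moreover have "log_seminorm_pow p u < \<infinity>"
    unfolding log_seminorm_pow_borel[OF um] using 2 by (simp add: ennreal_mult_less_top)
  ultimately show ?thesis using z borel_to_lebesgue[OF um] by (auto simp: X_log_def Lp_def)
qed

section \<open>Least energy solutions of the fractional problem\<close>

lemma frac_energy_cong:
  assumes \<Omega>: "\<Omega> \<in> sets borel" and AE: "AE x in lebesgue. u x = u' x"
    and [measurable]: "u \<in> borel_measurable lebesgue" "u' \<in> borel_measurable lebesgue" "b \<in> borel_measurable (lebesgue_on \<Omega>)"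
  shows "frac_energy s p r b \<Omega> u = frac_energy s p r b \<Omega> u'"
proof -
  have [measurable]: "u \<in> borel_measurable (lebesgue_on \<Omega>)" "u' \<in> borel_measurable (lebesgue_on \<Omega>)"
    by (auto intro: measurable_restrict_space1)
  have "(LINT x|lebesgue_on \<Omega>. b x * \<bar>u x\<bar> powr r) = (LINT x|lebesgue_on \<Omega>. b x * \<bar>u' x\<bar> powr r)"
  proof (rule integral_cong_AE)
    show "AE x in lebesgue_on \<Omega>. b x * \<bar>u x\<bar> powr r = b x * \<bar>u' x\<bar> powr r"
      using AE_lebesgue_restrict[OF \<Omega> AE] by eventually_elim simp
  qed measurable
  then show ?thesis unfolding frac_energy_def frac_seminorm_pow_cong[OF AE] by simp
qed

text \<open>A function of zero seminorm is constant almost everywhere. A non-zero constant is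
  impossible, since the function vanishes off a bounded set, whose complement has infinite
  measure.\<close>

lemma frac_seminorm_zero_trivial:
  fixes u :: "real ^ 'n \<Rightarrow> real"
  assumes p: "1 < p" and s: "0 < s" "s < 1" and bdd: "bounded \<Omega>" and \<Omega>: "\<Omega> \<in> sets borel"
    and u: "u \<in> W0 s p \<Omega>" and 0: "frac_seminorm_pow s p u = 0"
  shows "\<not> nontrivial u"
proof -
  have um: "u \<in> borel_measurable lebesgue" and u0: "AE x in lebesgue. x \<notin> \<Omega> \<longrightarrow> u x = 0"
    using u by (auto simp: W0_def Lp_def)
  obtain v where v[measurable]: "v \<in> borel_measurable borel" and z: "\<And>x. x \<notin> \<Omega> \<Longrightarrow> v x = 0" and AE: "AE x in lebesgue. u x = v x"
    using borel_representative[OF \<Omega> um u0] by blast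
  have c: "0 < frac_c CARD('n) p s" using p s by (intro frac_c_pos) auto
  have "frac_seminorm_pow s p v = 0" using 0 frac_seminorm_pow_cong[OF AE] by metis
  then have "ennreal (frac_c CARD('n) p s / 2) *
    (\<integral>\<^sup>+z. ennreal (\<bar>v (fst z) - v (snd z)\<bar> powr p / norm (fst z - snd z) powr (CARD('n) + s * p)) \<partial>(lborel \<Otimes>\<^sub>M lborel)) = 0"
    by (rule trans[OF frac_seminorm_pow_borel[OF v, symmetric]])
  then have "ennreal (frac_c CARD('n) p s / 2) = 0 \<or>
    (\<integral>\<^sup>+z. ennreal (\<bar>v (fst z) - v (snd z)\<bar> powr p / norm (fst z - snd z) powr (CARD('n) + s * p)) \<partial>(lborel \<Otimes>\<^sub>M lborel)) = 0"
    by (simp only: mult_eq_0_iff)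
  moreover have "ennreal (frac_c CARD('n) p s / 2) \<noteq> 0" using c by simp
  ultimately have "(\<integral>\<^sup>+z. ennreal (\<bar>v (fst z) - v (snd z)\<bar> powr p / norm (fst z - snd z) powr (CARD('n) + s * p)) \<partial>(lborel \<Otimes>\<^sub>M lborel)) = 0"
    by blast
  then have "AE z in (lborel \<Otimes>\<^sub>M lborel). ennreal (\<bar>v (fst z) - v (snd z)\<bar> powr p / norm (fst z - snd z) powr (CARD('n) + s * p)) = 0"
    by (subst (asm) nn_integral_0_iff_AE) auto
  then have "AE z in (lborel \<Otimes>\<^sub>M lborel). v (fst z) = v (snd z)"
  proof eventually_elim
    case (elim z)
    have "\<bar>v (fst z) - v (snd z)\<bar> powr p / norm (fst z - snd z) powr (CARD('n) + s * p) = 0"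
      using elim by (intro antisym) (simp_all add: ennreal_eq_0_iff del: divide_le_0_iff divide_eq_0_iff)
    then show ?case by (cases "fst z = snd z") auto
  qed
  then have "AE x in lborel. AE y in lborel. v (fst (x, y)) = v (snd (x, y))" by (rule lborel_pair.AE_pair)
  then have "AE x in lborel. v x = 0"
  proof eventually_elim
    case (elim x)
    show ?case
    proof (rule ccontr)
      assume vx: "v x \<noteq> 0"
      have "AE y in lborel. y \<in> \<Omega>" using elim by eventually_elim (use vx z in force)
      then have "- \<Omega> \<in> null_sets lborel"
        using \<Omega> by (subst AE_iff_null_sets) (auto simp: Compl_eq)
      then have "emeasure lborel (\<Omega> \<union> - \<Omega>) \<le> emeasure lborel \<Omega> + 0"
        using \<Omega> by (intro order_trans[OF emeasure_subadditive] add_left_mono) auto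
      then have "emeasure lborel (UNIV :: (real ^ 'n) set) < \<infinity>"
        using emeasure_bounded_finite[OF bdd] by (auto simp: Compl_partition intro: order.strict_trans1)
      then show False by simp
    qed
  qed
  then have "AE x in lebesgue. u x = 0"
    using AE AE_completion by (fastforce elim: eventually_elim2)
  then show ?thesis by (simp add: nontrivial_def)
qed

lemma frac_seminorm_pow_scale:
  fixes u :: "real ^ 'n \<Rightarrow> real" and s p t :: real
  assumes t: "0 < t" and um: "u \<in> borel_measurable lebesgue"
  shows "frac_seminorm_pow s p (\<lambda>x. t * u x) = ennreal (t powr p) * frac_seminorm_pow s p u"
proof -
  have [measurable]: "(\<lambda>z. u (fst z)) \<in> borel_measurable (lebesgue \<Otimes>\<^sub>M lebesgue)" "(\<lambda>z. u (snd z)) \<in> borel_measurable (lebesgue \<Otimes>\<^sub>M lebesgue)"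
    using um by (auto intro: compose_fst_lebesgue compose_snd_lebesgue)
  note [measurable] = norm_diff_lebesgue_pair
  have eq: "ennreal (\<bar>t * u x - t * u y\<bar> powr p / norm (x - y) powr (CARD('n) + s * p)) =
    ennreal (t powr p) * ennreal (\<bar>u x - u y\<bar> powr p / norm (x - y) powr (CARD('n) + s * p))" for x y
  proof -
    have "\<bar>t * u x - t * u y\<bar> powr p / norm (x - y) powr (CARD('n) + s * p) =
      t powr p * (\<bar>u x - u y\<bar> powr p / norm (x - y) powr (CARD('n) + s * p))"
      using t by (simp add: right_diff_distrib[symmetric] abs_mult powr_mult)
    then show ?thesis by (simp only: ennreal_mult' powr_ge_zero)
  qed
  have "frac_seminorm_pow s p (\<lambda>x. t * u x) = ennreal (frac_const TYPE('n) s p / 2) *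
    (\<integral>\<^sup>+z. ennreal (t powr p) * ennreal (\<bar>u (fst z) - u (snd z)\<bar> powr p / norm (fst z - snd z) powr (CARD('n) + s * p)) \<partial>(lebesgue \<Otimes>\<^sub>M lebesgue))"
    unfolding frac_seminorm_pow_def case_prod_unfold eq ..
  also have "\<dots> = ennreal (frac_const TYPE('n) s p / 2) * (ennreal (t powr p) *
    (\<integral>\<^sup>+z. ennreal (\<bar>u (fst z) - u (snd z)\<bar> powr p / norm (fst z - snd z) powr (CARD('n) + s * p)) \<partial>(lebesgue \<Otimes>\<^sub>M lebesgue)))"
    by (subst nn_integral_cmult) auto
  finally show ?thesis unfolding frac_seminorm_pow_def case_prod_unfold by (simp add: mult_ac)
qed

text \<open>Along a ray the energy is \<open>\<tau> powr p * A / p - \<tau> powr r * B / r\<close>,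
  with its minimum at the critical scaling \<open>t\<close>. The claim compares this minimum with
  the value at 1; it follows from the tangent at 1 of the power with exponent
  \<open>p / (p - r)\<close>.\<close>

lemma young_scaling:
  fixes A B p r t :: real
  assumes r: "1 < r" "r < p" and A: "0 < A" and t: "0 < t" and eq: "t powr p * A = t powr r * B"
  shows "(1 / p - 1 / r) * (t powr p * A) \<le> A / p - B / r"
proof -
  define T where "T = t powr p"
  have T: "0 < T" using t by (simp add: T_def)
  have B: "B = t powr (p - r) * A" using eq t by (simp add: powr_diff field_simps)
  have tT: "t powr (p - r) = T powr ((p - r) / p)" using r by (simp add: T_def powr_powr)
  have "T powr ((p - r) / p) \<le> (p - r) / p * T + r / p"
  proof -
    have P: "1 < p / (p - r)" using r by simp
    have "1 + p / (p - r) * (T powr ((p - r) / p) - 1) \<le> T"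
      using abs_powr_tangent[OF P, of 1 "T powr ((p - r) / p)"] r T by (simp add: h_def powr_powr)
    then have "(p - r) / p * (1 + p / (p - r) * (T powr ((p - r) / p) - 1)) \<le> (p - r) / p * T"
      using r by (intro mult_left_mono) auto
    moreover have "(p - r) / p * (1 + p / (p - r) * (T powr ((p - r) / p) - 1)) = (p - r) / p + T powr ((p - r) / p) - 1"
      using r by (simp add: distrib_left)
    moreover have "(p - r) / p = 1 - r / p" using r by (simp add: diff_divide_distrib)
    ultimately show ?thesis by linarith
  qed
  then have "T powr ((p - r) / p) / r \<le> ((p - r) / p * T + r / p) / r" using r by (intro divide_right_mono) auto
  also have "\<dots> = (1 / r - 1 / p) * T + 1 / p" using r by (simp add: field_simps)
  finally have "(1 / p - 1 / r) * T \<le> 1 / p - T powr ((p - r) / p) / r" by (simp add: algebra_simps)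
  then have "(1 / p - 1 / r) * T * A \<le> (1 / p - T powr ((p - r) / p) / r) * A" using A by (intro mult_right_mono) auto
  then show ?thesis unfolding B tT T_def[symmetric] by (simp add: algebra_simps)
qed

text \<open>Every non-trivial function can be scaled onto the Nehari set, and by sublinearity this
  scaling is the minimum along its ray. Minimality on the Nehari set is thus global minimality. The
  lower bound on \<open>b\<close> makes the source integral positive, so that the scaling
  exists.\<close>

lemma frac_least_energy_le:
  fixes u \<phi> :: "real ^ 'n \<Rightarrow> real"
  assumes p: "1 < p" and s: "0 < s" "s < 1" and r: "1 < r" "r < p"
    and bdd: "bounded \<Omega>" and \<Omega>[measurable]: "\<Omega> \<in> sets borel"
    and b[measurable]: "b \<in> borel_measurable (lebesgue_on \<Omega>)" and b_ge: "AE x in lebesgue_on \<Omega>. 1 / 2 \<le> b x"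
    and b_le: "AE x in lebesgue_on \<Omega>. b x \<le> K"
    and u: "frac_least_energy_solution s p r b \<Omega> u" and nt: "nontrivial u" and \<phi>: "\<phi> \<in> W0 s p \<Omega>"
  shows "frac_energy s p r b \<Omega> u \<le> frac_energy s p r b \<Omega> \<phi>"
proof -
  have uW: "u \<in> W0 s p \<Omega>" using u by (auto simp: frac_least_energy_solution_def frac_weak_solution_def)
  have inf: "ereal (frac_energy s p r b \<Omega> u) = (INF w\<in>frac_Nehari s p r b \<Omega>. ereal (frac_energy s p r b \<Omega> w))"
    using u by (simp add: frac_least_energy_solution_def)
  have fin: "emeasure lebesgue \<Omega> < \<infinity>" using emeasure_bounded_finite[OF bdd] \<Omega> by simp
  interpret fm: finite_measure "lebesgue_on \<Omega>"
    by (rule finite_measureI) (use fin in \<open>simp add: emeasure_restrict_space space_restrict_space\<close>)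
  have key: "frac_energy s p r b \<Omega> u \<le> frac_energy s p r b \<Omega> \<phi> \<and> frac_energy s p r b \<Omega> u \<le> 0"
    if \<phi>: "\<phi> \<in> W0 s p \<Omega>" and nt: "nontrivial \<phi>" for \<phi>
  proof -
    have \<phi>m[measurable]: "\<phi> \<in> borel_measurable lebesgue" and \<phi>i: "integrable lebesgue (\<lambda>x. \<bar>\<phi> x\<bar> powr p)"
      and \<phi>s: "frac_seminorm_pow s p \<phi> < \<infinity>" and \<phi>0: "AE x in lebesgue. x \<notin> \<Omega> \<longrightarrow> \<phi> x = 0"
      using \<phi> by (auto simp: W0_def Lp_def)
    have [measurable]: "\<phi> \<in> borel_measurable (lebesgue_on \<Omega>)" by (rule measurable_restrict_space1) measurable
    define A where "A = enn2real (frac_seminorm_pow s p \<phi>)"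
    have As: "frac_seminorm_pow s p \<phi> = ennreal A" using \<phi>s by (simp add: A_def less_top)
    have "A \<noteq> 0" using frac_seminorm_zero_trivial[OF p s bdd \<Omega> \<phi>] nt As by auto
    then have A: "0 < A" by (simp add: A_def order_less_le)
    have \<phi>i': "integrable (lebesgue_on \<Omega>) (\<lambda>x. \<bar>\<phi> x\<bar> powr p)"
      using \<phi>i integrable_mult_indicator[of \<Omega> lebesgue "\<lambda>x. \<bar>\<phi> x\<bar> powr p"] \<Omega> by (subst integrable_restrict_space) auto
    have bi: "integrable (lebesgue_on \<Omega>) (\<lambda>x. b x * \<bar>\<phi> x\<bar> powr r)"
    proof (rule Bochner_Integration.integrable_bound)
      show "integrable (lebesgue_on \<Omega>) (\<lambda>x. \<bar>K\<bar> * (1 + \<bar>\<phi> x\<bar> powr p))" using \<phi>i' by auto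
      show "AE x in lebesgue_on \<Omega>. norm (b x * \<bar>\<phi> x\<bar> powr r) \<le> norm (\<bar>K\<bar> * (1 + \<bar>\<phi> x\<bar> powr p))"
        using b_ge b_le
      proof eventually_elim
        case (elim x)
        have "\<bar>\<phi> x\<bar> powr r \<le> 1 + \<bar>\<phi> x\<bar> powr p"
        proof (cases "\<bar>\<phi> x\<bar> \<le> 1")
          case True
          then have "\<bar>\<phi> x\<bar> powr r \<le> 1" using r by (intro powr_le1) auto
          then show ?thesis using powr_ge_zero[of "\<bar>\<phi> x\<bar>" p] by linarith
        next
          case False
          then have "\<bar>\<phi> x\<bar> powr r \<le> \<bar>\<phi> x\<bar> powr p" using r by (intro powr_mono) auto
          then show ?thesis by simp
        qed
        then have "b x * \<bar>\<phi> x\<bar> powr r \<le> \<bar>K\<bar> * (1 + \<bar>\<phi> x\<bar> powr p)" using elim by (intro mult_mono) auto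
        then show ?case using elim by (simp add: abs_mult)
      qed
    qed measurable
    define B where "B = (LINT x|lebesgue_on \<Omega>. b x * \<bar>\<phi> x\<bar> powr r)"
    have nn: "AE x in lebesgue_on \<Omega>. 0 \<le> b x * \<bar>\<phi> x\<bar> powr r" using b_ge by eventually_elim auto
    have "B \<noteq> 0"
    proof
      assume "B = 0"
      then have "AE x in lebesgue_on \<Omega>. b x * \<bar>\<phi> x\<bar> powr r = 0"
        unfolding B_def using nn by (subst (asm) integral_nonneg_eq_0_iff_AE[OF bi]) auto
      then have "AE x in lebesgue_on \<Omega>. \<phi> x = 0" using b_ge by eventually_elim auto
      then have "AE x in lebesgue. x \<in> \<Omega> \<longrightarrow> \<phi> x = 0" by (subst (asm) AE_restrict_space_iff) auto
      then have "AE x in lebesgue. \<phi> x = 0" using \<phi>0 by eventually_elim auto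
      then show False using nt by (simp add: nontrivial_def)
    qed
    moreover have "0 \<le> B" unfolding B_def by (rule integral_nonneg_AE[OF nn])
    ultimately have B: "0 < B" by simp
    \<comment> \<open>The positive solution of \<open>t powr p * A = t powr r * B\<close>, which
      puts \<open>t * \<phi>\<close> on the Nehari set.\<close>
    define t where "t = (B / A) powr (1 / (p - r))"
    have t: "0 < t" using A B by (simp add: t_def)
    have "t powr (p - r) = B / A" using A B r by (simp add: t_def powr_powr)
    then have teq: "t powr p * A = t powr r * B" using A t by (simp add: powr_diff field_simps)
    define w where "w x = t * \<phi> x" for x
    have sw: "frac_seminorm_pow s p w = ennreal (t powr p * A)"
      unfolding w_def frac_seminorm_pow_scale[OF t \<phi>m] As by (simp add: ennreal_mult')
    have Bw: "(LINT x|lebesgue_on \<Omega>. b x * \<bar>w x\<bar> powr r) = t powr r * B"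
    proof -
      have "b x * \<bar>w x\<bar> powr r = t powr r * (b x * \<bar>\<phi> x\<bar> powr r)" for x
        unfolding w_def using t by (simp add: abs_mult powr_mult)
      then show ?thesis unfolding B_def by (simp only: integral_mult_right_zero)
    qed
    have wpi: "integrable lebesgue (\<lambda>x. \<bar>w x\<bar> powr p)"
      unfolding w_def using \<phi>i t by (simp add: abs_mult powr_mult)
    have wm: "w \<in> borel_measurable lebesgue" unfolding w_def[abs_def] using \<phi>m by (rule borel_measurable_times[OF borel_measurable_const])
    have "w \<in> W0 s p \<Omega>"
      using wm wpi sw \<phi>0 by (auto simp: W0_def Lp_def w_def elim: eventually_mono)
    moreover have "nontrivial w" using nt t by (simp add: nontrivial_def w_def)
    moreover have ew: "enn2real (frac_seminorm_pow s p w) = t powr p * A" unfolding sw using A by simp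
    ultimately have "w \<in> frac_Nehari s p r b \<Omega>" using teq by (simp add: frac_Nehari_def Bw)
    then have "ereal (frac_energy s p r b \<Omega> u) \<le> ereal (frac_energy s p r b \<Omega> w)"
      unfolding inf by (rule INF_lower)
    moreover have E: "frac_energy s p r b \<Omega> w = (1 / p - 1 / r) * (t powr p * A)"
      unfolding frac_energy_def ew Bw teq[symmetric] by (simp add: left_diff_distrib)
    moreover have "\<dots> \<le> A / p - B / r" by (rule young_scaling[OF r A t teq])
    moreover have "A / p - B / r = frac_energy s p r b \<Omega> \<phi>" by (simp add: frac_energy_def A_def B_def)
    moreover have "(1 / p - 1 / r) * (t powr p * A) \<le> 0"
      using r A by (intro mult_nonpos_nonneg) (auto simp: frac_le)
    ultimately show ?thesis by auto
  qed
  show ?thesis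
  proof (cases "nontrivial \<phi>")
    case True
    then show ?thesis using key[OF \<phi>] by blast
  next
    \<comment> \<open>Here the competitor has energy 0, and the energy of \<open>u\<close> is at
      most 0 by \<open>key\<close> applied to \<open>u\<close> itself.\<close>
    case False
    then have AE0: "AE x in lebesgue. \<phi> x = (\<lambda>x. 0) x" by (simp add: nontrivial_def)
    have "\<phi> \<in> borel_measurable lebesgue" using \<phi> by (auto simp: W0_def Lp_def)
    then have "frac_energy s p r b \<Omega> \<phi> = frac_energy s p r b \<Omega> (\<lambda>x. 0)"
      by (intro frac_energy_cong[OF \<Omega> AE0]) auto
    also have "\<dots> = 0" by (simp add: frac_energy_def frac_seminorm_pow_def case_prod_unfold)
    finally show ?thesis using key[OF uW nt] by simp
  qed
qed

section \<open>The limit problem as a minimisation problem\<close>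

text \<open>The coefficients for which \<open>func\<close> is the energy of the limit problem. The
  term with \<open>kfar\<close> in the potential stems from the diagonal terms of
  \<open>Upsilon\<close>.\<close>

locale log_problem = log_functional \<Omega> p c m VB V
  for \<Omega> :: "(real ^ 'n) set" and p c m VB :: real and V :: "real ^ 'n \<Rightarrow> real" +
  fixes \<mu> B :: real and b :: "real ^ 'n \<Rightarrow> real"
  assumes c_eq: "c = log_const TYPE('n) p / (2 * p)" and m_eq: "m = - \<mu> / p\<^sup>2"
    and V_eq: "\<And>x. V x = (rho TYPE('n) p - log_const TYPE('n) p * kfar \<Omega> DIM(real ^ 'n) x) / p - b x / p"
    and b[measurable]: "b \<in> borel_measurable (lebesgue_on \<Omega>)" and b_bd: "AE x in lebesgue_on \<Omega>. \<bar>b x\<bar> \<le> B"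
begin

lemma kfar_mult_integrable:
  assumes f: "integrable lborel f"
  shows "integrable lborel (\<lambda>x. kfar \<Omega> DIM(real ^ 'n) x * f x)"
proof (rule Bochner_Integration.integrable_bound)
  show "integrable lborel (\<lambda>x. measure lborel \<Omega> * f x)" using f by simp
  have [measurable]: "f \<in> borel_measurable borel" using borel_measurable_integrable[OF f] by simp
  note [measurable] = kfar_measurable[OF \<Omega>_borel fin]
  show "(\<lambda>x. kfar \<Omega> DIM(real ^ 'n) x * f x) \<in> borel_measurable lborel" by measurable
  show "AE x in lborel. norm (kfar \<Omega> DIM(real ^ 'n) x * f x) \<le> norm (measure lborel \<Omega> * f x)"
    using kfar_nonneg[OF \<Omega>_borel fin] kfar_le[OF \<Omega>_borel fin]
    by (intro AE_I2) (auto simp: abs_mult intro!: mult_right_mono)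
qed

lemma b_mult_integrable:
  assumes f: "integrable (lebesgue_on \<Omega>) f"
  shows "integrable (lebesgue_on \<Omega>) (\<lambda>x. b x * f x)"
proof (rule Bochner_Integration.integrable_bound)
  show "integrable (lebesgue_on \<Omega>) (\<lambda>x. B * f x)" using f by simp
  have [measurable]: "f \<in> borel_measurable (lebesgue_on \<Omega>)" using f by simp
  show "(\<lambda>x. b x * f x) \<in> borel_measurable (lebesgue_on \<Omega>)" by measurable
  show "AE x in lebesgue_on \<Omega>. norm (b x * f x) \<le> norm (B * f x)"
    using b_bd by eventually_elim (auto simp: abs_mult intro!: mult_right_mono)
qed

lemma V_integral:
  assumes f: "integrable lborel f" and f0: "\<And>x. x \<notin> \<Omega> \<Longrightarrow> f x = 0"
  shows "p * (LINT x|lebesgue_on \<Omega>. V x * f x) = rho TYPE('n) p * (LINT x|lborel. f x)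
    - log_const TYPE('n) p * (LINT x|lborel. kfar \<Omega> DIM(real ^ 'n) x * f x) - (LINT x|lebesgue_on \<Omega>. b x * f x)"
proof -
  define C R k where "C = log_const TYPE('n) p" and "R = rho TYPE('n) p" and "k = kfar \<Omega> DIM(real ^ 'n)"
  have [measurable]: "f \<in> borel_measurable borel" using borel_measurable_integrable[OF f] by simp
  have [measurable]: "k \<in> borel_measurable borel" unfolding k_def by (rule kfar_measurable[OF \<Omega>_borel fin])
  have kf: "integrable lborel (\<lambda>x. k x * f x)" unfolding k_def by (rule kfar_mult_integrable[OF f])
  note 1 = integrable_lebesgue_on_of_lborel[OF \<Omega>_borel f]
  note 2 = integrable_lebesgue_on_of_lborel[OF \<Omega>_borel kf]
  note 3 = b_mult_integrable[OF 1]
  have "p * (LINT x|lebesgue_on \<Omega>. V x * f x) = (LINT x|lebesgue_on \<Omega>. (R * f x - C * (k x * f x)) - b x * f x)"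
    unfolding integral_mult_right_zero[symmetric]
    by (intro Bochner_Integration.integral_cong refl) (use p in \<open>simp add: V_eq C_def R_def k_def field_simps\<close>)
  also have "\<dots> = (LINT x|lebesgue_on \<Omega>. R * f x - C * (k x * f x)) - (LINT x|lebesgue_on \<Omega>. b x * f x)"
    using 1 2 3 by (intro Bochner_Integration.integral_diff Bochner_Integration.integrable_diff integrable_mult_right)
  also have "(LINT x|lebesgue_on \<Omega>. R * f x - C * (k x * f x)) = (LINT x|lebesgue_on \<Omega>. R * f x) - (LINT x|lebesgue_on \<Omega>. C * (k x * f x))"
    using 1 2 by (intro Bochner_Integration.integral_diff integrable_mult_right)
  also have "(LINT x|lebesgue_on \<Omega>. R * f x) = R * (LINT x|lborel. f x)"
    by (simp add: LINT_lebesgue_on[OF \<Omega>_borel _ f0])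
  also have "(LINT x|lebesgue_on \<Omega>. C * (k x * f x)) = C * (LINT x|lborel. k x * f x)"
    by (simp add: LINT_lebesgue_on[OF \<Omega>_borel] f0)
  finally show ?thesis by (simp add: C_def R_def k_def)
qed

lemma ddint_self: "ddint u u = dint u"
  by (simp add: ddint_def dint_def h_mult_self)

lemma log_form_logsp:
  assumes u: "u \<in> logsp \<Omega> p" and v: "v \<in> logsp \<Omega> p"
  shows "log_form p u v = log_const TYPE('n) p / 2 * (ddint u v - 2 * (LINT x|lborel. kfar \<Omega> DIM(real ^ 'n) x * (h p (u x) * v x)))
    + rho TYPE('n) p * (LINT x|lborel. h p (u x) * v x)"
proof -
  note [measurable] = logspD(1)[OF u] logspD(1)[OF v]
  have "(LINT x|lebesgue. h p (u x) * v x) = (LINT x|lborel. h p (u x) * v x)"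
    by (rule integral_completion) measurable
  moreover have "(LINT z|(lebesgue \<Otimes>\<^sub>M lebesgue). indicator {z. norm z \<le> 1} (fst z - snd z) *
      (h p (u (fst z) - u (snd z)) * (v (fst z) - v (snd z)) / norm (fst z - snd z) ^ DIM(real ^ 'n))) =
    (LINT z|(lborel \<Otimes>\<^sub>M lborel). indicator {z. norm z \<le> 1} (fst z - snd z) *
      (h p (u (fst z) - u (snd z)) * (v (fst z) - v (snd z)) / norm (fst z - snd z) ^ DIM(real ^ 'n)))"
    by (rule integral_lebesgue_pair) measurable
  moreover have "(LINT z|(lebesgue \<Otimes>\<^sub>M lebesgue). indicator {z. 1 \<le> norm z} (fst z - snd z) *
        (Upsilon p (u (fst z)) (u (snd z)) (v (fst z)) (v (snd z)) / norm (fst z - snd z) ^ DIM(real ^ 'n))) =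
    (LINT z|(lborel \<Otimes>\<^sub>M lborel). indicator {z. 1 \<le> norm z} (fst z - snd z) *
        (Upsilon p (u (fst z)) (u (snd z)) (v (fst z)) (v (snd z)) / norm (fst z - snd z) ^ DIM(real ^ 'n)))"
    unfolding Upsilon_def by (rule integral_lebesgue_pair) measurable
  ultimately show ?thesis
    unfolding log_form_def case_prod_unfold log_form_eq[OF u v, symmetric] by (simp add: distrib_left)
qed

text \<open>The defect in the weak equation is \<open>p\<close> times the Euler-Lagrange expression
  of \<open>func\<close>, since the potential and the entropy coefficient were chosen
  accordingly.\<close>

lemma log_form_minus_source:
  assumes u: "u \<in> logsp \<Omega> p" and v: "v \<in> logsp \<Omega> p"
  shows "log_form p u v - (LINT x|lebesgue_on \<Omega>. (b x + \<mu> * ln \<bar>u x\<bar>) * h p (u x) * v x)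
    = p * (c * ddint u v + (LINT x|lebesgue_on \<Omega>. (V x + m * p * ln \<bar>u x\<bar>) * h p (u x) * v x))"
proof -
  let ?f = "\<lambda>x. h p (u x) * v x" and ?l = "\<lambda>x. h p (u x) * ln \<bar>u x\<bar> * v x"
  note 1 = integrable_lebesgue_on_of_lborel[OF \<Omega>_borel h_mult_integrable[OF u v]]
  note 2 = integrable_lebesgue_on_of_lborel[OF \<Omega>_borel h_ln_integrable[OF u v]]
  have "(LINT x|lebesgue_on \<Omega>. (b x + \<mu> * ln \<bar>u x\<bar>) * h p (u x) * v x) = (LINT x|lebesgue_on \<Omega>. b x * ?f x + \<mu> * ?l x)"
    by (intro Bochner_Integration.integral_cong refl) (simp add: algebra_simps)
  also have "\<dots> = (LINT x|lebesgue_on \<Omega>. b x * ?f x) + (LINT x|lebesgue_on \<Omega>. \<mu> * ?l x)"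
    by (intro Bochner_Integration.integral_add b_mult_integrable[OF 1] integrable_mult_right 2)
  finally have A: "(LINT x|lebesgue_on \<Omega>. (b x + \<mu> * ln \<bar>u x\<bar>) * h p (u x) * v x) =
    (LINT x|lebesgue_on \<Omega>. b x * ?f x) + \<mu> * (LINT x|lebesgue_on \<Omega>. ?l x)" by simp
  have "(LINT x|lebesgue_on \<Omega>. (V x + m * p * ln \<bar>u x\<bar>) * h p (u x) * v x) = (LINT x|lebesgue_on \<Omega>. V x * ?f x + m * p * ?l x)"
    by (intro Bochner_Integration.integral_cong refl) (simp add: algebra_simps)
  also have "\<dots> = (LINT x|lebesgue_on \<Omega>. V x * ?f x) + (LINT x|lebesgue_on \<Omega>. m * p * ?l x)"
    by (intro Bochner_Integration.integral_add V_mult_integrable[OF 1] integrable_mult_right 2)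
  finally have "(LINT x|lebesgue_on \<Omega>. (V x + m * p * ln \<bar>u x\<bar>) * h p (u x) * v x) =
    (LINT x|lebesgue_on \<Omega>. V x * ?f x) + m * p * (LINT x|lebesgue_on \<Omega>. ?l x)" by simp
  moreover have "p * (LINT x|lebesgue_on \<Omega>. V x * ?f x) = rho TYPE('n) p * (LINT x|lborel. ?f x)
    - log_const TYPE('n) p * (LINT x|lborel. kfar \<Omega> DIM(real ^ 'n) x * ?f x) - (LINT x|lebesgue_on \<Omega>. b x * ?f x)"
    by (rule V_integral[OF h_mult_integrable[OF u v]]) (simp add: logspD(2)[OF u] h_def)
  moreover have "p * (m * p * L) = - \<mu> * L" "p * (c * D) = log_const TYPE('n) p / 2 * D" for L D
    using p by (auto simp: m_eq c_eq power2_eq_square)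
  ultimately show ?thesis
    unfolding A log_form_logsp[OF u v] by (simp only: distrib_left right_diff_distrib)
qed

lemma log_energy_logsp:
  assumes u: "u \<in> logsp \<Omega> p"
  shows "log_energy p \<mu> b \<Omega> u = func u"
proof -
  note 1 = logsp_powr_integrable[OF u]
  have "low u = (LINT x|lebesgue_on \<Omega>. V x * \<bar>u x\<bar> powr p) + (LINT x|lebesgue_on \<Omega>. m * psi p (u x))"
    unfolding low_def by (intro Bochner_Integration.integral_add integrable_mult_right low_integrable[OF u])
  then have low: "p * low u = p * (LINT x|lebesgue_on \<Omega>. V x * \<bar>u x\<bar> powr p) + p * (m * (LINT x|lebesgue_on \<Omega>. psi p (u x)))"
    by (simp add: distrib_left)
  have "p * (LINT x|lebesgue_on \<Omega>. V x * \<bar>u x\<bar> powr p) = rho TYPE('n) p * (LINT x|lborel. \<bar>u x\<bar> powr p)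
    - log_const TYPE('n) p * (LINT x|lborel. kfar \<Omega> DIM(real ^ 'n) x * \<bar>u x\<bar> powr p) - (LINT x|lebesgue_on \<Omega>. b x * \<bar>u x\<bar> powr p)"
    by (rule V_integral[OF 1]) (use p logspD(2)[OF u] in simp)
  moreover have "p * (c * dint u) = log_const TYPE('n) p / 2 * dint u" using p by (simp add: c_eq)
  moreover have "p * (m * L) = - (p * (\<mu> / p\<^sup>2 * L))" for L by (simp add: m_eq)
  moreover have "log_energy p \<mu> b \<Omega> u = 1 / p * (log_const TYPE('n) p / 2 * (dint u - 2 * (LINT x|lborel. kfar \<Omega> DIM(real ^ 'n) x * \<bar>u x\<bar> powr p))
      + rho TYPE('n) p * (LINT x|lborel. \<bar>u x\<bar> powr p)) - 1 / p * (LINT x|lebesgue_on \<Omega>. b x * \<bar>u x\<bar> powr p)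
      - \<mu> / p\<^sup>2 * (LINT x|lebesgue_on \<Omega>. psi p (u x))"
    by (simp only: log_energy_def log_form_logsp[OF u u] ddint_self h_mult_self psi_eq[symmetric])
  then have "p * log_energy p \<mu> b \<Omega> u = log_const TYPE('n) p / 2 * dint u - log_const TYPE('n) p * (LINT x|lborel. kfar \<Omega> DIM(real ^ 'n) x * \<bar>u x\<bar> powr p)
      + rho TYPE('n) p * (LINT x|lborel. \<bar>u x\<bar> powr p) - (LINT x|lebesgue_on \<Omega>. b x * \<bar>u x\<bar> powr p)
      - p * (\<mu> / p\<^sup>2 * (LINT x|lebesgue_on \<Omega>. psi p (u x)))"
    using p by (simp only: right_diff_distrib distrib_left) simp
  ultimately have "p * func u = p * log_energy p \<mu> b \<Omega> u"
    unfolding func_def distrib_left low by (simp only:)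
  then show ?thesis using p by simp
qed

lemma log_energy_cong:
  assumes AE: "AE x in lebesgue. u x = u' x"
    and u: "u \<in> borel_measurable lebesgue" "u' \<in> borel_measurable lebesgue"
  shows "log_energy p \<mu> b \<Omega> u = log_energy p \<mu> b \<Omega> u'"
proof -
  have [measurable]: "u \<in> borel_measurable (lebesgue_on \<Omega>)" "u' \<in> borel_measurable (lebesgue_on \<Omega>)"
    using u by (auto intro: measurable_restrict_space1)
  note AE' = AE_lebesgue_restrict[OF \<Omega>_borel AE]
  have "(LINT x|lebesgue_on \<Omega>. b x * \<bar>u x\<bar> powr p) = (LINT x|lebesgue_on \<Omega>. b x * \<bar>u' x\<bar> powr p)"
  proof (rule integral_cong_AE)
    show "AE x in lebesgue_on \<Omega>. b x * \<bar>u x\<bar> powr p = b x * \<bar>u' x\<bar> powr p"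
      using AE' by eventually_elim simp
  qed measurable
  moreover have "(LINT x|lebesgue_on \<Omega>. \<bar>u x\<bar> powr p * (ln (\<bar>u x\<bar> powr p) - 1)) = (LINT x|lebesgue_on \<Omega>. \<bar>u' x\<bar> powr p * (ln (\<bar>u' x\<bar> powr p) - 1))"
  proof (rule integral_cong_AE)
    show "AE x in lebesgue_on \<Omega>. \<bar>u x\<bar> powr p * (ln (\<bar>u x\<bar> powr p) - 1) = \<bar>u' x\<bar> powr p * (ln (\<bar>u' x\<bar> powr p) - 1)"
      using AE' by eventually_elim simp
  qed measurable
  ultimately show ?thesis unfolding log_energy_def log_form_cong[OF AE AE u u] by simp
qed

lemma X_log_func:
  assumes w: "w \<in> X_log p \<Omega>"
  obtains w' where "w' \<in> logsp \<Omega> p" "AE x in lebesgue. w x = w' x" "log_energy p \<mu> b \<Omega> w = func w'"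
proof -
  obtain w' where w': "w' \<in> logsp \<Omega> p" and AE: "AE x in lebesgue. w x = w' x"
    using X_log_representative[OF p \<Omega>_borel w] by blast
  have "w \<in> borel_measurable lebesgue" using w by (auto simp: X_log_def Lp_def)
  then have "log_energy p \<mu> b \<Omega> w = func w'"
    using log_energy_cong[OF AE _ borel_to_lebesgue[OF logspD(1)[OF w']]] log_energy_logsp[OF w'] by simp
  then show thesis using that w' AE by blast
qed

lemma minimizer_weak_solution:
  assumes min: "minimizer u"
  shows "log_weak_solution p \<mu> b \<Omega> u"
  unfolding log_weak_solution_def
proof (intro conjI ballI)
  have u: "u \<in> logsp \<Omega> p" using min by (simp add: minimizer_def)
  show "u \<in> X_log p \<Omega>" by (rule logsp_X_log[OF u])
  fix v assume v: "v \<in> X_log p \<Omega>"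
  obtain v' where v': "v' \<in> logsp \<Omega> p" and AE: "AE x in lebesgue. v x = v' x"
    using X_log_representative[OF p \<Omega>_borel v] by blast
  have vm: "v \<in> borel_measurable lebesgue" using v by (auto simp: X_log_def Lp_def)
  note um' = borel_to_lebesgue[OF logspD(1)[OF u]] and vm' = borel_to_lebesgue[OF logspD(1)[OF v']]
  have [measurable]: "u \<in> borel_measurable (lebesgue_on \<Omega>)" "v \<in> borel_measurable (lebesgue_on \<Omega>)" "v' \<in> borel_measurable (lebesgue_on \<Omega>)"
    using vm um' vm' by (auto intro: measurable_restrict_space1)
  note AE' = AE_lebesgue_restrict[OF \<Omega>_borel AE]
  have "(LINT x|lebesgue_on \<Omega>. (b x + \<mu> * ln \<bar>u x\<bar>) * h p (u x) * v x) = (LINT x|lebesgue_on \<Omega>. (b x + \<mu> * ln \<bar>u x\<bar>) * h p (u x) * v' x)"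
  proof (rule integral_cong_AE)
    show "AE x in lebesgue_on \<Omega>. (b x + \<mu> * ln \<bar>u x\<bar>) * h p (u x) * v x = (b x + \<mu> * ln \<bar>u x\<bar>) * h p (u x) * v' x"
      using AE' by eventually_elim simp
  qed measurable
  moreover have "log_form p u v = log_form p u v'"
    by (rule log_form_cong[OF _ AE um' um' vm vm']) simp
  ultimately show "log_form p u v = (LINT x|lebesgue_on \<Omega>. (b x + \<mu> * ln \<bar>u x\<bar>) * h p (u x) * v x)"
    using log_form_minus_source[OF u v'] Euler_Lagrange[OF min v'] by simp
qed

text \<open>Everything but the logarithm is homogeneous of degree \<open>p\<close>. The additional
  term is proportional to \<open>ln t\<close> and therefore prevails for small
  \<open>t\<close>.\<close>

lemma func_scale:
  assumes u: "u \<in> logsp \<Omega> p" and t: "0 < t"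
  shows "func (\<lambda>x. t * u x) = t powr p * (func u + m * p * ln t * (LINT x|lborel. \<bar>u x\<bar> powr p))"
proof -
  have *: "\<bar>t * a\<bar> powr p = t powr p * \<bar>a\<bar> powr p" for a using t by (simp add: abs_mult powr_mult)
  have **: "psi p (t * a) = t powr p * (psi p a + p * ln t * \<bar>a\<bar> powr p)" for a
  proof (cases "a = 0")
    case False
    then have "ln \<bar>t * a\<bar> = ln t + ln \<bar>a\<bar>" using t by (simp add: abs_mult ln_mult)
    then show ?thesis unfolding psi_def * by (simp add: algebra_simps)
  qed simp
  have "dint (\<lambda>x. t * u x) = t powr p * dint u"
    unfolding dint_def right_diff_distrib[symmetric] * mult.left_commute[of _ "t powr p"] by simp
  moreover have "low (\<lambda>x. t * u x) = t powr p * (low u + m * p * ln t * (LINT x|lborel. \<bar>u x\<bar> powr p))"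
  proof -
    have "low (\<lambda>x. t * u x) = (LINT x|lebesgue_on \<Omega>. t powr p * ((V x * \<bar>u x\<bar> powr p + m * psi p (u x)) + m * p * ln t * \<bar>u x\<bar> powr p))"
      unfolding low_def * ** by (intro Bochner_Integration.integral_cong refl) (simp add: algebra_simps)
    also have "\<dots> = t powr p * (low u + (LINT x|lebesgue_on \<Omega>. m * p * ln t * \<bar>u x\<bar> powr p))"
      unfolding integral_mult_right_zero low_def
      by (subst Bochner_Integration.integral_add) (auto intro!: low_integrable[OF u] integrable_mult_right)
    also have "(LINT x|lebesgue_on \<Omega>. m * p * ln t * \<bar>u x\<bar> powr p) = m * p * ln t * (LINT x|lborel. \<bar>u x\<bar> powr p)"
      using logspD(1)[OF u] logspD(2)[OF u] p by (simp add: LINT_lebesgue_on[OF \<Omega>_borel])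
    finally show ?thesis .
  qed
  ultimately show ?thesis by (simp add: func_def algebra_simps)
qed

text \<open>The entropy makes the functional negative on small multiples of any non-zero function.\<close>

lemma minimizer_nontrivial:
  assumes min: "minimizer u" and \<phi>: "\<phi> \<in> logsp \<Omega> p" and nt: "\<not> (AE x in lborel. \<phi> x = 0)"
  shows "nontrivial u"
  unfolding nontrivial_def
proof
  assume AE: "AE x in lebesgue. u x = 0"
  have u: "u \<in> logsp \<Omega> p" using min by (simp add: minimizer_def)
  define I where "I = (LINT x|lborel. \<bar>\<phi> x\<bar> powr p)"
  have "I \<noteq> 0"
  proof
    assume "I = 0"
    then have "AE x in lborel. \<bar>\<phi> x\<bar> powr p = 0"
      unfolding I_def using integral_nonneg_eq_0_iff_AE[OF logsp_powr_integrable[OF \<phi>]] by simp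
    then have "AE x in lborel. \<phi> x = 0" by eventually_elim simp
    then show False using nt by simp
  qed
  moreover have "0 \<le> I" unfolding I_def by (intro integral_nonneg_AE) simp
  ultimately have I: "0 < I" by simp
  \<comment> \<open>Makes the bracket in \<open>func_scale\<close> equal to
    \<open>func \<phi> - |func \<phi>| - 1\<close>, which is negative.\<close>
  define t where "t = exp (- (\<bar>func \<phi>\<bar> + 1) / (m * p * I))"
  have mpI: "0 < m * p * I" using m p I by simp
  have "m * p * ln t * I = m * p * I * ln t" by simp
  also have "\<dots> = - (\<bar>func \<phi>\<bar> + 1)" unfolding t_def ln_exp using m p I by simp
  finally have "func \<phi> + m * p * ln t * I < 0" by linarith
  then have "func (\<lambda>x. t * \<phi> x) < 0"
    using func_scale[OF \<phi>, of t] by (simp add: t_def I_def mult_pos_neg)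
  moreover have "func u \<le> func (\<lambda>x. t * \<phi> x)"
    using min logsp_cmult[OF \<phi>] by (simp add: minimizer_def)
  moreover have "0 \<le> func u"
  proof -
    have "low u = (LINT x|lebesgue_on \<Omega>. 0)"
      unfolding low_def
    proof (rule integral_cong_AE)
      show "(\<lambda>x. V x * \<bar>u x\<bar> powr p + m * psi p (u x)) \<in> borel_measurable (lebesgue_on \<Omega>)"
        using low_integrable(4)[OF u] by (rule borel_measurable_integrable)
      show "AE x in lebesgue_on \<Omega>. V x * \<bar>u x\<bar> powr p + m * psi p (u x) = 0"
        using AE_lebesgue_restrict[OF \<Omega>_borel AE] by eventually_elim (use p in simp)
    qed simp
    moreover have "0 \<le> dint u" unfolding dint_def by (intro integral_nonneg_AE AE_I2 mult_nonneg_nonneg) auto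
    ultimately show ?thesis using c by (simp add: func_def)
  qed
  ultimately show False by simp
qed

lemma minimizer_energy_le:
  assumes "minimizer u" "w \<in> X_log p \<Omega>"
  shows "log_energy p \<mu> b \<Omega> u \<le> log_energy p \<mu> b \<Omega> w"
proof -
  obtain w' where "w' \<in> logsp \<Omega> p" "log_energy p \<mu> b \<Omega> w = func w'" by (rule X_log_func[OF assms(2)])
  then show ?thesis using assms(1) log_energy_logsp[of u] by (simp add: minimizer_def)
qed

text \<open>Testing the weak equation with \<open>u\<close> itself puts \<open>u\<close> on the
  Nehari set, and as a global minimiser it attains the infimum there.\<close>

lemma minimizer_least_energy:
  assumes min: "minimizer u" and nt: "nontrivial u"
  shows "log_least_energy_solution p \<mu> b \<Omega> u"
    and "log_energy p \<mu> b \<Omega> u = (INF w\<in>log_Nehari p \<mu> b \<Omega>. ereal (log_energy p \<mu> b \<Omega> w))"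
proof -
  note weak = minimizer_weak_solution[OF min]
  have uX: "u \<in> X_log p \<Omega>" using weak by (simp add: log_weak_solution_def)
  have "log_form p u u = (LINT x|lebesgue_on \<Omega>. (b x + \<mu> * ln \<bar>u x\<bar>) * h p (u x) * u x)"
    using weak uX unfolding log_weak_solution_def by blast
  then have N: "u \<in> log_Nehari p \<mu> b \<Omega>"
    using uX nt by (simp add: log_Nehari_def mult.assoc h_mult_self)
  show 2: "log_energy p \<mu> b \<Omega> u = (INF w\<in>log_Nehari p \<mu> b \<Omega>. ereal (log_energy p \<mu> b \<Omega> w))"
    by (intro antisym INF_greatest INF_lower[OF N]) (auto simp: log_Nehari_def intro!: minimizer_energy_le[OF min])
  show "log_least_energy_solution p \<mu> b \<Omega> u"
    unfolding log_least_energy_solution_def using weak 2 by simp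
qed

text \<open>The Nehari infimum is attained by the global minimiser \<open>u\<close>, so another
  least energy solution has the same energy and is a global minimiser too.\<close>

lemma least_energy_unique:
  assumes min: "minimizer u" and nt: "nontrivial u" and pos: "\<And>x. 0 \<le> u x"
    and w: "log_least_energy_solution p \<mu> b \<Omega> w"
  shows "(AE x in lebesgue. w x = u x) \<or> (AE x in lebesgue. w x = - u x)"
proof -
  have wX: "w \<in> X_log p \<Omega>" and "ereal (log_energy p \<mu> b \<Omega> w) = ereal (log_energy p \<mu> b \<Omega> u)"
    using w minimizer_least_energy(2)[OF min nt] by (auto simp: log_least_energy_solution_def log_weak_solution_def)
  then have eq: "log_energy p \<mu> b \<Omega> w = log_energy p \<mu> b \<Omega> u" by simp
  obtain w' where w': "w' \<in> logsp \<Omega> p" and AE: "AE x in lebesgue. w x = w' x" and e: "log_energy p \<mu> b \<Omega> w = func w'"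
    by (rule X_log_func[OF wX])
  have "func w' = func u" using e eq log_energy_logsp min by (simp add: minimizer_def)
  then have "minimizer w'" using min w' by (simp add: minimizer_def)
  from minimizer_unique[OF min pos this] show ?thesis
  proof
    assume "AE x in lborel. w' x = u x"
    then have "AE x in lebesgue. w' x = u x" by (rule AE_completion)
    with AE have "AE x in lebesgue. w x = u x" by eventually_elim simp
    then show ?thesis ..
  next
    assume "AE x in lborel. w' x = - u x"
    then have "AE x in lebesgue. w' x = - u x" by (rule AE_completion)
    with AE have "AE x in lebesgue. w x = - u x" by eventually_elim simp
    then show ?thesis ..
  qed
qed

lemma minimizer_Linf:
  assumes min: "minimizer u"
  shows "u \<in> Linf (lebesgue_on \<Omega>)"
proof -
  obtain k where k: "AE x in lborel. \<bar>u x\<bar> \<le> k" using minimizer_bounded[OF min] by blast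
  have um[measurable]: "u \<in> borel_measurable (lebesgue_on \<Omega>)"
    using min logspD(1) by (intro borel_measurable_lebesgue_on) (auto simp: minimizer_def)
  have "esssup (lebesgue_on \<Omega>) (\<lambda>x. ereal \<bar>u x\<bar>) \<le> ereal k"
    using AE_lebesgue_on_of_lborel[OF \<Omega>_borel k] by (intro esssup_I) auto
  then have "Linf_norm (lebesgue_on \<Omega>) u < \<infinity>" unfolding Linf_norm_def by (rule order.strict_trans1) simp
  then show ?thesis using um by (simp add: Linf_def)
qed

end

section \<open>First order expansions in the order\<close>

text \<open>The hypothesis concerns the limit at 0, not the value; differentiability at the endpoint
  identifies the two.\<close>

lemma C1_on_expansion:
  fixes f :: "real \<Rightarrow> real" and e L :: real
  assumes C1: "C1_on {0..e} f" and e: "0 < e" and lim: "(f \<longlongrightarrow> L) (at_right 0)"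
  shows "f 0 = L" and "((\<lambda>t. (f t - L) / t) \<longlongrightarrow> vector_derivative f (at 0 within {0..e})) (at_right 0)"
proof -
  have w: "at 0 within {0..e} = at_right 0" using e by (rule at_within_Icc_at_right)
  have d: "f differentiable (at 0 within {0..e})" using C1 e unfolding C1_on_def by simp
  then have "(f \<longlongrightarrow> f 0) (at_right 0)"
    using differentiable_imp_continuous_within[OF d] unfolding continuous_within w by simp
  then show L: "f 0 = L" using lim by (rule tendsto_unique[OF trivial_limit_at_right_real])
  have "(f has_real_derivative vector_derivative f (at 0 within {0..e})) (at 0 within {0..e})"
    using d unfolding has_real_derivative_iff_has_vector_derivative vector_derivative_works .
  then show "((\<lambda>t. (f t - L) / t) \<longlongrightarrow> vector_derivative f (at 0 within {0..e})) (at_right 0)"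
    unfolding has_field_derivative_iff w L by simp
qed

text \<open>The bound is assumed at rational times only, because it comes from an almost everywhere
  statement for each time and only countably many null sets can be collected. Continuity of the
  derivative extends it to all times.\<close>

lemma C1_on_bound:
  fixes f :: "real \<Rightarrow> real" and e A t :: real
  assumes C1: "C1_on {0..e} f" and e: "0 < e"
    and bd: "\<And>t. t \<in> \<rat> \<inter> {0..e} \<Longrightarrow> \<bar>vector_derivative f (at t within {0..e})\<bar> \<le> A" and t: "t \<in> {0..e}"
  shows "\<bar>vector_derivative f (at t within {0..e})\<bar> \<le> A" and "\<bar>f t - f 0\<bar> \<le> A * t"
proof -
  define f' where "f' t = vector_derivative f (at t within {0..e})" for t
  have cont: "continuous_on {0..e} f'" and der: "\<And>t. t \<in> {0..e} \<Longrightarrow> (f has_real_derivative f' t) (at t within {0..e})"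
    using C1 unfolding C1_on_def f'_def has_real_derivative_iff_has_vector_derivative vector_derivative_works by auto
  have le: "\<bar>f' t\<bar> \<le> A" if t: "t \<in> {0..e}" for t
  proof (rule ccontr)
    assume "\<not> \<bar>f' t\<bar> \<le> A"
    then obtain d where d: "0 < d" and close: "\<And>y. y \<in> {0..e} \<Longrightarrow> dist y t < d \<Longrightarrow> dist (f' y) (f' t) < \<bar>f' t\<bar> - A"
      using cont t unfolding continuous_on_iff by (metis diff_gt_0_iff_gt not_le)
    have "max 0 (t - d) < min e (t + d)" using d t e by auto
    then obtain y where y: "y \<in> \<rat>" "max 0 (t - d) < y" "y < min e (t + d)" using Rats_dense_in_real by blast
    then have ye: "y \<in> {0..e}" and "dist y t < d" by (auto simp: dist_real_def abs_if)
    from close[OF this] have "\<bar>f' y - f' t\<bar> < \<bar>f' t\<bar> - A" by (simp add: dist_real_def)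
    moreover have "\<bar>f' y\<bar> \<le> A" using bd[of y] y(1) ye by (simp add: f'_def)
    ultimately show False by linarith
  qed
  show "\<bar>vector_derivative f (at t within {0..e})\<bar> \<le> A" using le[OF t] by (simp add: f'_def)
  have "norm (f t - f 0) \<le> A * norm (t - 0)"
    by (rule field_differentiable_bound[of "{0..e}" f f']) (use der le t e in auto)
  then show "\<bar>f t - f 0\<bar> \<le> A * t" using t by simp
qed

text \<open>The supremum of essential suprema gives, for each time, an exceptional set of its own.
  Restricting to rational times gives a common one, off which the derivative is bounded on the whole
  interval.\<close>

lemma weight_expansion:
  fixes a :: "real \<Rightarrow> 'a \<Rightarrow> real" and e :: real
  assumes e: "e = 1 / 2"
    and a0: "AE x in M. C1_on {0..e} (\<lambda>t. a t x) \<and> ((\<lambda>t. a t x) \<longlongrightarrow> 1) (at_right 0)"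
    and bd: "(SUP t\<in>{0..e}. Linf_norm M (d_order a t)) < \<infinity>"
  obtains A where "0 \<le> A" "AE x in M. \<bar>d_order a 0 x\<bar> \<le> A \<and> (\<forall>t\<in>{0..e}. \<bar>a t x - 1\<bar> \<le> A * t) \<and>
    ((\<lambda>t. (a t x - 1) / t) \<longlongrightarrow> d_order a 0 x) (at_right 0)"
proof -
  define S where "S = (SUP t\<in>{0..e}. Linf_norm M (d_order a t))"
  define A where "A = max 0 (real_of_ereal S)"
  have "S < \<infinity>" using bd by (simp add: S_def)
  then have SA: "S \<le> ereal A" unfolding A_def by (cases S) auto
  have "AE x in M. \<bar>d_order a t x\<bar> \<le> A" if t: "t \<in> {0..e}" for t
  proof -
    have "AE x in M. ereal \<bar>d_order a t x\<bar> \<le> Linf_norm M (d_order a t)" unfolding Linf_norm_def by (rule esssup_AE)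
    then show ?thesis
    proof eventually_elim
      case (elim x)
      also have "Linf_norm M (d_order a t) \<le> S" unfolding S_def by (rule SUP_upper[OF t])
      also note SA
      finally show ?case by simp
    qed
  qed
  moreover have "countable (\<rat> \<inter> {0..e})" by (rule countable_subset[OF _ countable_rat]) auto
  ultimately have "AE x in M. \<forall>t\<in>\<rat> \<inter> {0..e}. \<bar>d_order a t x\<bar> \<le> A"
    by (subst AE_ball_countable) auto
  with a0 have "AE x in M. \<bar>d_order a 0 x\<bar> \<le> A \<and> (\<forall>t\<in>{0..e}. \<bar>a t x - 1\<bar> \<le> A * t) \<and>
    ((\<lambda>t. (a t x - 1) / t) \<longlongrightarrow> d_order a 0 x) (at_right 0)"
  proof eventually_elim
    case (elim x)
    then have C1: "C1_on {0..e} (\<lambda>t. a t x)" and lim: "((\<lambda>t. a t x) \<longlongrightarrow> 1) (at_right 0)" by auto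
    have e0: "0 < e" using e by simp
    have bd: "\<bar>vector_derivative (\<lambda>t. a t x) (at t within {0..e})\<bar> \<le> A" if "t \<in> \<rat> \<inter> {0..e}" for t
      using elim that unfolding d_order_def e by blast
    note exp = C1_on_expansion[OF C1 e0 lim] and bound = C1_on_bound[OF C1 e0 bd]
    show ?case
      using bound(1)[of 0] bound(2) exp e0 unfolding d_order_def e by simp
  qed
  moreover have "0 \<le> A" by (simp add: A_def)
  ultimately show thesis by (rule that[rotated])
qed

section \<open>Passage to the limit in the fractional problems\<close>

text \<open>\<open>frac_split\<close> multiplied by half the normalising constant; the total far
  mass times that constant is \<open>frac_kappa\<close>. The potential is bounded, so finiteness of
  the seminorm is that of \<open>dform\<close>.\<close>

lemma frac_seminorm_pow_split:
  fixes u :: "real ^ 'n \<Rightarrow> real" and s p :: real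
  assumes p: "1 < p" and s: "0 < s" "s < 1" and \<Omega>: "\<Omega> \<in> sets borel" and bdd: "bounded \<Omega>"
    and u[measurable]: "u \<in> borel_measurable borel" and supp: "\<And>x. x \<notin> \<Omega> \<Longrightarrow> u x = 0"
    and ui: "integrable lborel (\<lambda>x. \<bar>u x\<bar> powr p)"
  shows "frac_seminorm_pow s p u < \<infinity> \<longleftrightarrow> dform \<Omega> (DIM(real ^ 'n) + s * p) p u < \<infinity>"
    and "frac_seminorm_pow s p u < \<infinity> \<Longrightarrow> enn2real (frac_seminorm_pow s p u) =
      frac_c CARD('n) p s / 2 * enn2real (dform \<Omega> (DIM(real ^ 'n) + s * p) p u) +
      (LINT x|lborel. (frac_kappa CARD('n) p s - frac_c CARD('n) p s * kfar \<Omega> (DIM(real ^ 'n) + s * p) x) * \<bar>u x\<bar> powr p)"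
    and "integrable lborel (\<lambda>x. (frac_kappa CARD('n) p s - frac_c CARD('n) p s * kfar \<Omega> (DIM(real ^ 'n) + s * p) x) * \<bar>u x\<bar> powr p)"
proof -
  have fin: "emeasure lborel \<Omega> < \<infinity>" by (rule emeasure_bounded_finite[OF bdd])
  define D where "D = dform \<Omega> (DIM(real ^ 'n) + s * p) p u"
  define F where "F = frac_c CARD('n) p s"
  define k where "k = kfar \<Omega> (DIM(real ^ 'n) + s * p)"
  define C where "C = DIM(real ^ 'n) * unit_ball_vol DIM(real ^ 'n) / (s * p)"
  have sp: "0 < s * p" using p s by simp
  have F: "0 < F" unfolding F_def using p s by (intro frac_c_pos) auto
  have FC: "F * C = frac_kappa CARD('n) p s" unfolding F_def C_def using frac_c_kappa[of "CARD('n)" p s] p s by simp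
  have [measurable]: "k \<in> borel_measurable borel" unfolding k_def by (rule kfar_measurable[OF \<Omega> fin])
  have k: "0 \<le> k x" "k x \<le> C" for x
    unfolding k_def C_def using kfar_nonneg[OF \<Omega> fin] frac_tail(2)[OF \<Omega> fin sp, of x] by auto
  have gi: "integrable lborel (\<lambda>x. (C - k x) * \<bar>u x\<bar> powr p)"
  proof (rule Bochner_Integration.integrable_bound)
    show "integrable lborel (\<lambda>x. C * \<bar>u x\<bar> powr p)" using ui by simp
    have "\<bar>(C - k x) * \<bar>u x\<bar> powr p\<bar> \<le> \<bar>C * \<bar>u x\<bar> powr p\<bar>" for x
      using k[of x] by (auto simp: abs_mult intro!: mult_right_mono)
    then show "AE x in lborel. norm ((C - k x) * \<bar>u x\<bar> powr p) \<le> norm (C * \<bar>u x\<bar> powr p)" by (intro AE_I2) simp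
  qed measurable
  define g where "g = (LINT x|lborel. (C - k x) * \<bar>u x\<bar> powr p)"
  have g0: "0 \<le> g" unfolding g_def using k by (intro integral_nonneg_AE AE_I2 mult_nonneg_nonneg) auto
  have "(\<integral>\<^sup>+x. ennreal ((C - k x) * \<bar>u x\<bar> powr p) \<partial>lborel) = ennreal g"
    unfolding g_def using k by (intro nn_integral_eq_integral[OF gi] AE_I2 mult_nonneg_nonneg) auto
  then have eq: "frac_seminorm_pow s p u = ennreal (F / 2) * (D + 2 * ennreal g)"
    unfolding frac_seminorm_pow_borel[OF u] D_def F_def
    using frac_split[OF \<Omega> fin _ sp u supp, of p] p unfolding k_def C_def by simp
  have F2: "ennreal (F / 2) \<noteq> 0" using F by simp
  show *: "frac_seminorm_pow s p u < \<infinity> \<longleftrightarrow> dform \<Omega> (DIM(real ^ 'n) + s * p) p u < \<infinity>"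
    unfolding eq D_def[symmetric] using F2 by (auto simp: ennreal_mult_less_top ennreal_add_less_top)
  have Fg: "(LINT x|lborel. (frac_kappa CARD('n) p s - F * k x) * \<bar>u x\<bar> powr p) = F * g"
    unfolding g_def FC[symmetric] integral_mult_right_zero[symmetric] by (intro Bochner_Integration.integral_cong refl) (simp add: algebra_simps)
  show "enn2real (frac_seminorm_pow s p u) =
      frac_c CARD('n) p s / 2 * enn2real (dform \<Omega> (DIM(real ^ 'n) + s * p) p u) +
      (LINT x|lborel. (frac_kappa CARD('n) p s - frac_c CARD('n) p s * kfar \<Omega> (DIM(real ^ 'n) + s * p) x) * \<bar>u x\<bar> powr p)"
    if "frac_seminorm_pow s p u < \<infinity>"
  proof -
    have "D < \<infinity>" using that * by (simp add: D_def)
    then obtain d where d: "D = ennreal d" "0 \<le> d" by (cases D) auto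
    have "ennreal (2 * g) = ennreal 2 * ennreal g" by (rule ennreal_mult) (use g0 in auto)
    then have "ennreal (2 * g) = 2 * ennreal g" by simp
    moreover have "ennreal (d + 2 * g) = ennreal d + ennreal (2 * g)" by (rule ennreal_plus) (use d g0 in auto)
    moreover have "ennreal (F / 2 * (d + 2 * g)) = ennreal (F / 2) * ennreal (d + 2 * g)"
      by (rule ennreal_mult) (use F d g0 in auto)
    ultimately have "ennreal (F / 2) * (D + 2 * ennreal g) = ennreal (F / 2 * (d + 2 * g))" by (simp only: d(1))
    then have "enn2real (frac_seminorm_pow s p u) = F / 2 * (d + 2 * g)"
      unfolding eq using d(2) g0 F by simp
    also have "\<dots> = F / 2 * d + F * g" by (simp add: algebra_simps)
    finally show ?thesis using Fg[unfolded F_def k_def] d by (simp add: D_def F_def)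
  qed
  have "integrable lborel (\<lambda>x. F * ((C - k x) * \<bar>u x\<bar> powr p))" using gi by (rule integrable_mult_right)
  then show "integrable lborel (\<lambda>x. (frac_kappa CARD('n) p s - frac_c CARD('n) p s * kfar \<Omega> (DIM(real ^ 'n) + s * p) x) * \<bar>u x\<bar> powr p)"
    unfolding FC[symmetric] F_def k_def by (simp add: algebra_simps)
qed

lemma LINT_tendsto_of_Lp_norm:
  fixes f :: "nat \<Rightarrow> 'a \<Rightarrow> real" and p :: real
  assumes p: "0 < p"
  shows "(\<lambda>k. Lp_norm M p (f k)) \<longlonglongrightarrow> 0 \<longleftrightarrow> (\<lambda>k. LINT x|M. \<bar>f k x\<bar> powr p) \<longlonglongrightarrow> 0"
proof
  have 0: "0 \<le> (LINT x|M. \<bar>f k x\<bar> powr p)" for k by (intro integral_nonneg_AE) simp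
  show "(\<lambda>k. Lp_norm M p (f k)) \<longlonglongrightarrow> 0" if "(\<lambda>k. LINT x|M. \<bar>f k x\<bar> powr p) \<longlonglongrightarrow> 0"
  proof -
    have "(\<lambda>k. (LINT x|M. \<bar>f k x\<bar> powr p) powr (1 / p)) \<longlonglongrightarrow> 0 powr (1 / p)"
      using p 0 that by (intro tendsto_powr' tendsto_const) auto
    then show ?thesis by (simp add: Lp_norm_def)
  qed
  show "(\<lambda>k. LINT x|M. \<bar>f k x\<bar> powr p) \<longlonglongrightarrow> 0" if "(\<lambda>k. Lp_norm M p (f k)) \<longlonglongrightarrow> 0"
  proof -
    have "(\<lambda>k. Lp_norm M p (f k) powr p) \<longlonglongrightarrow> 0 powr p"
      using p that by (intro tendsto_powr' tendsto_const) (auto simp: Lp_norm_def)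
    then show ?thesis using p 0 by (simp add: Lp_norm_def powr_powr)
  qed
qed

text \<open>If \<open>w = - U\<close>, then \<open>|u - w|\<close> is \<open>u + U\<close> and so at
  least \<open>U\<close>; convergence to \<open>w\<close> forces \<open>U = 0\<close>. This excludes
  the solution of the opposite sign as a limit.\<close>

lemma nonneg_limit_not_negative:
  fixes u :: "nat \<Rightarrow> 'a \<Rightarrow> real" and p :: real
  assumes p: "0 < p" and u: "\<And>k. u k \<in> Lp M p" "\<And>k. AE x in M. 0 \<le> u k x"
    and U: "U \<in> Lp M p" "AE x in M. 0 \<le> U x" and w: "AE x in M. w x = - U x" "w \<in> borel_measurable M"
    and lim: "subseq_limit_Lp M p u w"
  shows "AE x in M. U x = 0"
proof -
  have [measurable]: "u k \<in> borel_measurable M" "U \<in> borel_measurable M" "w \<in> borel_measurable M"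
    and ui: "integrable M (\<lambda>x. \<bar>u k x\<bar> powr p)" and Ui: "integrable M (\<lambda>x. \<bar>U x\<bar> powr p)" for k
    using u(1) U(1) w(2) by (auto simp: Lp_def)
  obtain r where "(\<lambda>k. Lp_norm M p (\<lambda>x. u (r k) x - w x)) \<longlonglongrightarrow> 0" using lim by (auto simp: subseq_limit_Lp_def)
  then have 1: "(\<lambda>k. LINT x|M. \<bar>u (r k) x - w x\<bar> powr p) \<longlonglongrightarrow> 0" using LINT_tendsto_of_Lp_norm[OF p, of M "\<lambda>k x. u (r k) x - w x"] by blast
  have "(LINT x|M. \<bar>U x\<bar> powr p) \<le> (LINT x|M. \<bar>u (r k) x - w x\<bar> powr p)" for k
  proof (rule integral_mono_AE[OF Ui])
    show "integrable M (\<lambda>x. \<bar>u (r k) x - w x\<bar> powr p)"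
    proof (rule Bochner_Integration.integrable_bound)
      show "integrable M (\<lambda>x. 2 powr p * (\<bar>u (r k) x\<bar> powr p + \<bar>U x\<bar> powr p))" using ui Ui by simp
      show "AE x in M. norm (\<bar>u (r k) x - w x\<bar> powr p) \<le> norm (2 powr p * (\<bar>u (r k) x\<bar> powr p + \<bar>U x\<bar> powr p))"
        using w(1)
      proof eventually_elim
        case (elim x)
        show ?case using abs_diff_powr_le[OF p, of "u (r k) x" "w x"] elim by simp
      qed
    qed measurable
    show "AE x in M. \<bar>U x\<bar> powr p \<le> \<bar>u (r k) x - w x\<bar> powr p"
      using w(1) u(2)[of "r k"] U(2) by eventually_elim (use p in \<open>auto intro!: powr_mono2\<close>)
  qed
  then have "(LINT x|M. \<bar>U x\<bar> powr p) \<le> 0" by (intro LIMSEQ_le_const[OF 1]) auto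
  moreover have "0 \<le> (LINT x|M. \<bar>U x\<bar> powr p)" by (intro integral_nonneg_AE) simp
  ultimately have "AE x in M. \<bar>U x\<bar> powr p = 0" using integral_nonneg_eq_0_iff_AE[OF Ui] by simp
  then show ?thesis by eventually_elim simp
qed

text \<open>Ties the abstract coefficients of \<open>log_approx\<close> to the fractional problems
  and those of \<open>log_functional\<close> to the limit problem.\<close>

locale frac_limit = log_problem \<Omega> p c m VB V \<mu> B b + log_approx \<Omega> p c m VB V s q ck Vk bk V1 b A
  for \<Omega> :: "(real ^ 'n) set" and p c m VB :: real and V :: "real ^ 'n \<Rightarrow> real" and \<mu> B :: real and b :: "real ^ 'n \<Rightarrow> real"
    and s q ck :: "nat \<Rightarrow> real" and Vk bk :: "nat \<Rightarrow> real ^ 'n \<Rightarrow> real" and V1 :: "real ^ 'n \<Rightarrow> real" and A :: real +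
  fixes a :: "nat \<Rightarrow> real ^ 'n \<Rightarrow> real"
  assumes s_half: "\<And>k. s k \<le> 1 / 2"
    and ck_eq: "\<And>k. ck k = frac_c CARD('n) p (s k) / (2 * s k * p)"
    and Vk_eq: "\<And>k x. Vk k x = ((frac_kappa CARD('n) p (s k) - 1) / s k
        - frac_c CARD('n) p (s k) / s k * kfar \<Omega> (DIM(real ^ 'n) + s k * p) x) / p"
    and bk_eq: "\<And>k x. bk k x = (a k x - 1) / s k"
begin

lemma a_eq: "a k x = 1 + s k * bk k x"
  using s(1)[of k] by (simp add: bk_eq)

lemma a_measurable: "a k \<in> borel_measurable (lebesgue_on \<Omega>)"
proof -
  have "(\<lambda>x. 1 + s k * bk k x) \<in> borel_measurable (lebesgue_on \<Omega>)" by measurable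
  then show ?thesis unfolding a_eq[symmetric] .
qed

lemma a_bound: "AE x in lebesgue_on \<Omega>. \<bar>a k x - 1\<bar> \<le> s k * A"
  using bk_bd[of k] by eventually_elim (use s(1)[of k] in \<open>simp add: a_eq abs_mult mult_left_mono\<close>)

lemma a_le: "AE x in lebesgue_on \<Omega>. \<bar>a k x\<bar> \<le> 1 + A"
  using a_bound[of k]
proof eventually_elim
  case (elim x)
  have "s k * A \<le> 1 * A" using s_half[of k] A0 by (intro mult_right_mono) auto
  then show ?case using elim by linarith
qed

text \<open>The term \<open>|w| powr p / (p * s k)\<close> is added in \<open>entr\<close> and
  removed by the \<open>- 1\<close> in \<open>Vk\<close>; in the source, the weight is split as
  \<open>1 + s k * bk k\<close>. With these cancellations the two energies agree term by
  term.\<close>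

lemma frac_energy_efun:
  assumes w[measurable]: "w \<in> borel_measurable borel" and supp: "\<And>x. x \<notin> \<Omega> \<Longrightarrow> w x = 0"
    and wi: "integrable lborel (\<lambda>x. \<bar>w x\<bar> powr p)" and fin: "frac_seminorm_pow (s k) p w < \<infinity>"
  shows "frac_energy (s k) p (q k) (a k) \<Omega> w = s k * efun k w" and "integrable (lebesgue_on \<Omega>) (\<lambda>x. G k x (w x))"
proof -
  define F where "F = frac_c CARD('n) p (s k)"
  define K where "K x = frac_kappa CARD('n) p (s k) - F * kfar \<Omega> (DIM(real ^ 'n) + s k * p) x" for x
  have sk: "0 < s k" "s k < 1" using s(1)[of k] s_half[of k] by auto
  note split = frac_seminorm_pow_split[OF p sk \<Omega>_borel bdd w supp wi]
  have Ki: "integrable lborel (\<lambda>x. K x * \<bar>w x\<bar> powr p)" using split(3) by (simp add: K_def F_def)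
  note wm = borel_measurable_lebesgue_on[OF w, of \<Omega>]
  note [measurable] = wm a_measurable
  interpret finite_measure "lebesgue_on \<Omega>" by (rule finite_measure_\<Omega>)
  have wi': "integrable (lebesgue_on \<Omega>) (\<lambda>x. 1 + \<bar>w x\<bar> powr p)"
    using integrable_lebesgue_on_of_lborel[OF \<Omega>_borel wi] by simp
  have ai: "integrable (lebesgue_on \<Omega>) (\<lambda>x. a k x * (\<bar>w x\<bar> powr q k / q k))"
  proof (rule Bochner_Integration.integrable_bound)
    show "integrable (lebesgue_on \<Omega>) (\<lambda>x. (1 + A) * (1 + \<bar>w x\<bar> powr p))" using wi' by (rule integrable_mult_right)
    show "(\<lambda>x. a k x * (\<bar>w x\<bar> powr q k / q k)) \<in> borel_measurable (lebesgue_on \<Omega>)" by measurable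
    show "AE x in lebesgue_on \<Omega>. norm (a k x * (\<bar>w x\<bar> powr q k / q k)) \<le> norm ((1 + A) * (1 + \<bar>w x\<bar> powr p))"
      using a_le[of k]
    proof eventually_elim
      case (elim x)
      have "0 \<le> \<bar>w x\<bar> powr q k / q k" using q(1)[of k] by simp
      then have "\<bar>a k x * (\<bar>w x\<bar> powr q k / q k)\<bar> \<le> (1 + A) * (1 + \<bar>w x\<bar> powr p)"
        unfolding abs_mult using elim powr_q_le[of "w x" k] A0 by (intro mult_mono) auto
      then show ?case unfolding real_norm_def by (rule order_trans[OF _ abs_ge_self])
    qed
  qed
  have sG: "s k * G k x (w x) = 1 / p * (K x * \<bar>w x\<bar> powr p) - a k x * (\<bar>w x\<bar> powr q k / q k)" for x
  proof -
    define X Y where "X = \<bar>w x\<bar> powr p" and "Y = \<bar>w x\<bar> powr q k / q k"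
    define v where "v = kfar \<Omega> (DIM(real ^ 'n) + s k * p) x"
    have "s k * Vk k x = (frac_kappa CARD('n) p (s k) - 1 - F * v) / p"
      unfolding Vk_eq v_def[symmetric] F_def[symmetric] times_divide_eq_left diff_divide_distrib[symmetric] using sk by simp
    moreover have "s k * entr k (w x) = X / p - Y" unfolding entr_def X_def Y_def using sk by simp
    moreover have "s k * bk k x = a k x - 1" by (simp add: a_eq)
    moreover have "s k * G k x (w x) = s k * Vk k x * X - s k * bk k x * Y + s k * entr k (w x)"
      unfolding G_def X_def Y_def by (simp add: algebra_simps)
    ultimately have "s k * G k x (w x) = (frac_kappa CARD('n) p (s k) - 1 - F * v) / p * X - (a k x - 1) * Y + (X / p - Y)" by simp
    also have "\<dots> = 1 / p * (K x * X) - a k x * Y"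
      unfolding K_def v_def[symmetric] using p by (simp add: field_simps)
    finally show ?thesis by (simp add: X_def Y_def)
  qed
  note Ki' = integrable_mult_right[OF integrable_lebesgue_on_of_lborel[OF \<Omega>_borel Ki], of "1 / p"]
  have "integrable (lebesgue_on \<Omega>) (\<lambda>x. s k * G k x (w x))"
    unfolding sG by (intro Bochner_Integration.integrable_diff Ki' ai)
  then show "integrable (lebesgue_on \<Omega>) (\<lambda>x. G k x (w x))" using sk by simp
  have "s k * (LINT x|lebesgue_on \<Omega>. G k x (w x)) = (LINT x|lebesgue_on \<Omega>. 1 / p * (K x * \<bar>w x\<bar> powr p) - a k x * (\<bar>w x\<bar> powr q k / q k))"
    unfolding integral_mult_right_zero[symmetric] sG ..
  also have "\<dots> = (LINT x|lebesgue_on \<Omega>. 1 / p * (K x * \<bar>w x\<bar> powr p)) - (LINT x|lebesgue_on \<Omega>. a k x * (\<bar>w x\<bar> powr q k / q k))"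
    by (intro Bochner_Integration.integral_diff Ki' ai)
  also have "(LINT x|lebesgue_on \<Omega>. 1 / p * (K x * \<bar>w x\<bar> powr p)) = 1 / p * (LINT x|lebesgue_on \<Omega>. K x * \<bar>w x\<bar> powr p)" by (rule integral_mult_right_zero)
  also have "(LINT x|lebesgue_on \<Omega>. K x * \<bar>w x\<bar> powr p) = (LINT x|lborel. K x * \<bar>w x\<bar> powr p)"
    by (rule LINT_lebesgue_on[OF \<Omega>_borel]) (use borel_measurable_integrable[OF Ki] supp p in auto)
  also have "(LINT x|lebesgue_on \<Omega>. a k x * (\<bar>w x\<bar> powr q k / q k)) = 1 / q k * (LINT x|lebesgue_on \<Omega>. a k x * \<bar>w x\<bar> powr q k)"
    unfolding integral_mult_right_zero[symmetric] by (intro Bochner_Integration.integral_cong refl) simp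
  finally have 1: "s k * (LINT x|lebesgue_on \<Omega>. G k x (w x)) = 1 / p * (LINT x|lborel. K x * \<bar>w x\<bar> powr p)
    - 1 / q k * (LINT x|lebesgue_on \<Omega>. a k x * \<bar>w x\<bar> powr q k)" .
  define D where "D = enn2real (dform \<Omega> (DIM(real ^ 'n) + s k * p) p w)"
  have 2: "enn2real (frac_seminorm_pow (s k) p w) = F / 2 * D + (LINT x|lborel. K x * \<bar>w x\<bar> powr p)"
    using split(2)[OF _ fin] by (simp add: F_def D_def K_def)
  have 3: "s k * (ck k * D) = 1 / p * (F / 2 * D)" using sk p by (simp add: ck_eq F_def)
  show "frac_energy (s k) p (q k) (a k) \<Omega> w = s k * efun k w"
    unfolding frac_energy_def efun_def 2 D_def[symmetric] distrib_left 3 1 by simp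
qed

text \<open>The absolute value of a Borel representative is used: it is non-negative everywhere and,
  by positivity on \<Omega>, still agrees with \<open>u\<close> almost everywhere.\<close>

lemma W0_borel_representative:
  assumes u: "u \<in> W0 \<sigma> p \<Omega>" and pos: "AE x in lebesgue_on \<Omega>. 0 < u x"
  obtains u' where "u' \<in> borel_measurable borel" "\<And>x. x \<notin> \<Omega> \<Longrightarrow> u' x = 0" "\<And>x. 0 \<le> u' x"
    "AE x in lebesgue. u x = u' x" "integrable lborel (\<lambda>x. \<bar>u' x\<bar> powr p)" "frac_seminorm_pow \<sigma> p u' < \<infinity>"
proof -
  have um: "u \<in> borel_measurable lebesgue" and ui: "integrable lebesgue (\<lambda>x. \<bar>u x\<bar> powr p)"
    and us: "frac_seminorm_pow \<sigma> p u < \<infinity>" and u0: "AE x in lebesgue. x \<notin> \<Omega> \<longrightarrow> u x = 0"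
    using u by (auto simp: W0_def Lp_def)
  obtain v where v[measurable]: "v \<in> borel_measurable borel" and z: "\<And>x. x \<notin> \<Omega> \<Longrightarrow> v x = 0" and AE: "AE x in lebesgue. u x = v x"
    using borel_representative[OF \<Omega>_borel um u0] by blast
  have "AE x in lebesgue. x \<in> \<Omega> \<longrightarrow> 0 < u x" using pos by (subst (asm) AE_restrict_space_iff) auto
  with AE u0 have AE': "AE x in lebesgue. u x = \<bar>v x\<bar>" by eventually_elim fastforce
  have vm: "(\<lambda>x. \<bar>v x\<bar>) \<in> borel_measurable borel" by measurable
  show thesis
  proof (rule that[of "\<lambda>x. \<bar>v x\<bar>"])
    have "integrable lebesgue (\<lambda>x. \<bar>\<bar>v x\<bar>\<bar> powr p)"
    proof (rule iffD1[OF integrable_cong_AE ui])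
      show "AE x in lebesgue. \<bar>u x\<bar> powr p = \<bar>\<bar>v x\<bar>\<bar> powr p" using AE by eventually_elim simp
      show "(\<lambda>x. \<bar>u x\<bar> powr p) \<in> borel_measurable lebesgue" using ui by simp
      show "(\<lambda>x. \<bar>\<bar>v x\<bar>\<bar> powr p) \<in> borel_measurable lebesgue" by (rule borel_to_lebesgue) measurable
    qed
    then show "integrable lborel (\<lambda>x. \<bar>\<bar>v x\<bar>\<bar> powr p)" by (subst (asm) integrable_completion) auto
    show "frac_seminorm_pow \<sigma> p (\<lambda>x. \<bar>v x\<bar>) < \<infinity>" using us frac_seminorm_pow_cong[OF AE', of \<sigma> p] by simp
  qed (use z AE' vm in auto)
qed

text \<open>Global minimality of the fractional solutions is divided by \<open>s k\<close> and read
  for Borel representatives, which is the hypothesis of \<open>minimizers_converge\<close>.\<close>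

theorem least_energy_solutions_converge:
  fixes u :: "nat \<Rightarrow> real ^ 'n \<Rightarrow> real"
  assumes lip: "lipschitz_boundary \<Omega>"
    and sol: "\<And>k. frac_least_energy_solution (s k) p (q k) (a k) \<Omega> (u k)"
    and nt: "\<And>k. nontrivial (u k)" and pos: "\<And>k. AE x in lebesgue_on \<Omega>. 0 < u k x"
  obtains U where "minimizer U" "\<And>x. 0 \<le> U x" "nontrivial U" "subseq_limit_Lp (lebesgue_on \<Omega>) p u U"
proof -
  have W: "u k \<in> W0 (s k) p \<Omega>" for k
    using sol[of k] by (simp add: frac_least_energy_solution_def frac_weak_solution_def)
  define P where "P k u' \<longleftrightarrow> u' \<in> borel_measurable borel \<and> (\<forall>x. x \<notin> \<Omega> \<longrightarrow> u' x = 0) \<and> (\<forall>x. 0 \<le> u' x) \<and>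
    (AE x in lebesgue. u k x = u' x) \<and> integrable lborel (\<lambda>x. \<bar>u' x\<bar> powr p) \<and> frac_seminorm_pow (s k) p u' < \<infinity>" for k u'
  have ex: "\<exists>u'. P k u'" for k
    unfolding P_def by (rule W0_borel_representative[OF W pos, of k]) blast
  obtain u' where "P k (u' k)" for k using choice[of P] ex by blast
  then have u'm[measurable]: "u' k \<in> borel_measurable borel" and supp: "x \<notin> \<Omega> \<Longrightarrow> u' k x = 0" and u'0: "0 \<le> u' k x"
    and AE: "AE x in lebesgue. u k x = u' k x" and u'i: "integrable lborel (\<lambda>x. \<bar>u' k x\<bar> powr p)"
    and u's: "frac_seminorm_pow (s k) p (u' k) < \<infinity>" for k x
    unfolding P_def by blast+
  have sk: "0 < s k" "s k < 1" for k using s(1)[of k] s_half[of k] by auto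
  have ud: "dform \<Omega> (DIM(real ^ 'n) + s k * p) p (u' k) < \<infinity>" for k
    using u's[of k] frac_seminorm_pow_split(1)[OF p sk \<Omega>_borel bdd u'm supp u'i] by simp
  have min: "\<forall>\<^sub>F k in sequentially. efun k (u' k) \<le> efun k \<phi>"
    if \<phi>: "\<phi> \<in> logsp \<Omega> p" and L: "L-lipschitz_on UNIV \<phi>" for \<phi> L
  proof -
    \<comment> \<open>The weight is within \<open>s k * A\<close> of 1, so for large
      \<open>k\<close> it is at least \<open>1 / 2\<close>, as the reduction to global minimality
      requires.\<close>
    have "(\<lambda>k. s k * A) \<longlonglongrightarrow> 0 * A" by (intro tendsto_mult tendsto_const s)
    then have "\<forall>\<^sub>F k in sequentially. s k * A < 1 / 2" by (rule order_tendstoD) simp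
    then show ?thesis
    proof eventually_elim
      case (elim k)
      note \<phi>m = logspD(1)[OF \<phi>] and \<phi>0 = logspD(2)[OF \<phi>] and \<phi>i = logsp_powr_integrable[OF \<phi>]
      have \<phi>s: "frac_seminorm_pow (s k) p \<phi> < \<infinity>"
        using lipschitz_dform_finite(2)[OF \<phi> L sk(1) s_half, of k] frac_seminorm_pow_split(1)[OF p sk \<Omega>_borel bdd \<phi>m \<phi>0 \<phi>i] by simp
      then have \<phi>W: "\<phi> \<in> W0 (s k) p \<Omega>" using logsp_X_log[OF \<phi>] by (simp add: W0_def X_log_def)
      have ge: "AE x in lebesgue_on \<Omega>. 1 / 2 \<le> a k x"
        using a_bound[of k]
      proof eventually_elim
        case (elim x)
        then show ?case using \<open>s k * A < 1 / 2\<close> by (simp add: abs_le_iff)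
      qed
      have le: "AE x in lebesgue_on \<Omega>. a k x \<le> 1 + A" using a_le[of k] by eventually_elim simp
      have um: "u k \<in> borel_measurable lebesgue" using W[of k] by (simp add: W0_def Lp_def)
      have "frac_energy (s k) p (q k) (a k) \<Omega> (u k) \<le> frac_energy (s k) p (q k) (a k) \<Omega> \<phi>"
        by (rule frac_least_energy_le[OF p sk q(1,2) bdd \<Omega>_borel a_measurable ge le sol nt \<phi>W])
      also have "frac_energy (s k) p (q k) (a k) \<Omega> (u k) = frac_energy (s k) p (q k) (a k) \<Omega> (u' k)"
        by (rule frac_energy_cong[OF \<Omega>_borel AE um borel_to_lebesgue[OF u'm] a_measurable])
      also have "\<dots> = s k * efun k (u' k)" by (rule frac_energy_efun(1)[OF u'm supp u'i u's])
      also have "frac_energy (s k) p (q k) (a k) \<Omega> \<phi> = s k * efun k \<phi>" by (rule frac_energy_efun(1)[OF \<phi>m \<phi>0 \<phi>i \<phi>s])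
      finally have "s k * efun k (u' k) \<le> s k * efun k \<phi>" .
      then show ?case using sk(1)[of k] by simp
    qed
  qed
  have uG: "integrable (lebesgue_on \<Omega>) (\<lambda>x. G k x (u' k x))" for k
    by (rule frac_energy_efun(2)[OF u'm supp u'i u's])
  obtain r U where r: "strict_mono r" and U: "minimizer U" "\<And>x. 0 \<le> U x"
    and lim: "(\<lambda>k. \<integral>\<^sup>+x. ennreal (\<bar>u' (r k) x - U x\<bar> powr p) \<partial>lborel) \<longlonglongrightarrow> 0"
    by (rule minimizers_converge[OF lip u'm supp u'0 uG ud min]) blast+
  have Ul: "U \<in> logsp \<Omega> p" using U by (simp add: minimizer_def)
  note Um[measurable] = logspD(1)[OF Ul]
  have eq: "(LINT x|lebesgue_on \<Omega>. \<bar>u k x - U x\<bar> powr p) = enn2real (\<integral>\<^sup>+x. ennreal (\<bar>u' k x - U x\<bar> powr p) \<partial>lborel)" for k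
  proof -
    have um: "u k \<in> borel_measurable (lebesgue_on \<Omega>)" using W[of k] by (auto simp: W0_def Lp_def intro: measurable_restrict_space1)
    note [measurable] = um borel_measurable_lebesgue_on[OF Um, of \<Omega>] borel_measurable_lebesgue_on[OF u'm[of k], of \<Omega>]
    have "(LINT x|lebesgue_on \<Omega>. \<bar>u k x - U x\<bar> powr p) = (LINT x|lebesgue_on \<Omega>. \<bar>u' k x - U x\<bar> powr p)"
    proof (rule integral_cong_AE)
      show "AE x in lebesgue_on \<Omega>. \<bar>u k x - U x\<bar> powr p = \<bar>u' k x - U x\<bar> powr p"
        using AE_lebesgue_restrict[OF \<Omega>_borel AE[of k]] by eventually_elim simp
    qed measurable
    also have "\<dots> = (LINT x|lborel. \<bar>u' k x - U x\<bar> powr p)"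
      by (rule LINT_lebesgue_on[OF \<Omega>_borel]) (use supp logspD(2)[OF Ul] p in auto)
    also have "\<dots> = enn2real (\<integral>\<^sup>+x. ennreal (\<bar>u' k x - U x\<bar> powr p) \<partial>lborel)"
      by (rule integral_eq_nn_integral) auto
    finally show ?thesis .
  qed
  have "(\<lambda>k. enn2real (\<integral>\<^sup>+x. ennreal (\<bar>u' (r k) x - U x\<bar> powr p) \<partial>lborel)) \<longlonglongrightarrow> 0"
    by (rule tendsto_enn2real) (use lim in simp_all)
  then have lim': "subseq_limit_Lp (lebesgue_on \<Omega>) p u U"
    unfolding subseq_limit_Lp_def using r LINT_tendsto_of_Lp_norm[OF p0, of "lebesgue_on \<Omega>" "\<lambda>k x. u (r k) x - U x"]
    unfolding eq by blast
  \<comment> \<open>Excluding a trivial limit needs a non-zero function of finite logarithmic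
    energy; the first fractional solution is one, because its near form only decreases with the
    exponent.\<close>
  have "u' 0 \<in> logsp \<Omega> p"
  proof -
    have "dform {} DIM(real ^ 'n) p (u' 0) \<le> dform \<Omega> (DIM(real ^ 'n) + s 0 * p) p (u' 0)"
      unfolding dform_def using sk(1)[of 0] p
      by (intro nn_integral_mono ennreal_leI mult_right_mono ker_mono_exponent) auto
    then have "dform {} DIM(real ^ 'n) p (u' 0) < \<infinity>" using ud[of 0] by (rule order.strict_trans1)
    moreover have "(\<integral>\<^sup>+x. ennreal (\<bar>u' 0 x\<bar> powr p) \<partial>lborel) < \<infinity>"
      using nn_integral_eq_integral[OF u'i[of 0]] by simp
    ultimately show ?thesis using supp u'm by (simp add: logsp_def)
  qed
  moreover have "\<not> (AE x in lborel. u' 0 x = 0)"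
  proof
    assume "AE x in lborel. u' 0 x = 0"
    then have "AE x in lebesgue. u' 0 x = 0" by (rule AE_completion)
    with AE[of 0] have "AE x in lebesgue. u 0 x = 0" by eventually_elim simp
    then show False using nt[of 0] by (simp add: nontrivial_def)
  qed
  ultimately have "nontrivial U" by (rule minimizer_nontrivial[OF U(1)])
  then show thesis using that U lim' by blast
qed

end

text \<open>The passage to the limit is stated for an arbitrary sequence of orders tending to 0. As
  the equation is odd, a least energy solution is determined only up to sign; the last clause
  removes this freedom for limits of subsequences of the given positive solutions.\<close>

theorem theorem2p15:
  fixes \<Omega> :: "(real ^ 'n) set"
    and p \<mu> \<delta> c\<^sub>1 c\<^sub>2 :: real
    and q \<nu> :: "real \<Rightarrow> real"
    and a :: "real \<Rightarrow> real ^ 'n \<Rightarrow> real"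
    and s :: "nat \<Rightarrow> real"
    and u :: "nat \<Rightarrow> real ^ 'n \<Rightarrow> real"
  assumes p: "1 < p"
    and \<Omega>: "open \<Omega>" "bounded \<Omega>" "lipschitz_boundary \<Omega>"
    and q_C1: "C1_on {0..1/2} q"
    and q_lim: "(q \<longlongrightarrow> p) (at_right 0)"
    and \<mu>_def: "\<mu> = vector_derivative q (at 0 within {0..1/2})"
    and \<mu>_neg: "\<mu> < 0"
    and q_range: "\<forall>t\<in>{0<..1/2}. 1 < q t \<and> q t < p"
    and a0: "AE x in lebesgue_on \<Omega>.
        C1_on {0..1/2} (\<lambda>t. a t x) \<and> ((\<lambda>t. a t x) \<longlongrightarrow> 1) (at_right 0)"
    and \<delta>: "0 < \<delta>" "\<delta> < 1"
    and a1: "\<forall>t\<in>{0<..1/2}. a t \<in> Lp (lebesgue_on \<Omega>) (\<nu> t) \<and> 1 < \<nu> t \<and>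
        (t * p < real CARD('n) \<longrightarrow>
          max (crit_exp TYPE('n) t p / (crit_exp TYPE('n) t p - q t))
              (1 + (real CARD('n) - t * p) * p /
                   (t * (p\<^sup>2 - real CARD('n) * \<mu> - \<delta> * p\<^sup>2))) < \<nu> t)"
    and a2: "\<forall>t\<in>{0..1/2}. d_order a t \<in> Linf (lebesgue_on \<Omega>)"
        "(SUP t\<in>{0..1/2}. Linf_norm (lebesgue_on \<Omega>) (d_order a t)) < \<infinity>"
    and a3: "\<forall>t\<in>{0<..1/2}.
        c\<^sub>1 \<le> Lp_norm (lebesgue_on \<Omega>) (\<nu> t) (a t) powr (1 / (p - q t)) \<and>
        Lp_norm (lebesgue_on \<Omega>) (\<nu> t) (a t) powr (1 / (p - q t)) \<le> c\<^sub>2"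
    and s: "\<forall>k. s k \<in> {0<..1/2}" "s \<longlonglongrightarrow> 0"
    and u_sol: "\<forall>k. frac_least_energy_solution (s k) p (q (s k)) (a (s k)) \<Omega> (u k)"
    and u_nontrivial: "\<forall>k. nontrivial (u k)"
    and u_pos: "\<forall>k. AE x in lebesgue_on \<Omega>. 0 < u k x"
  shows "\<exists>u\<^sub>1. u\<^sub>1 \<in> X_log p \<Omega> \<and> u\<^sub>1 \<in> Linf (lebesgue_on \<Omega>) \<and>
      nontrivial u\<^sub>1 \<and> log_least_energy_solution p \<mu> (d_order a 0) \<Omega> u\<^sub>1 \<and>
      subseq_limit_Lp (lebesgue_on \<Omega>) p u u\<^sub>1 \<and>
      (\<forall>w. nontrivial w \<and> log_least_energy_solution p \<mu> (d_order a 0) \<Omega> w \<longrightarrow>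
           (AE x in lebesgue. w x = u\<^sub>1 x) \<or> (AE x in lebesgue. w x = - u\<^sub>1 x)) \<and>
      (\<forall>w. nontrivial w \<and> log_least_energy_solution p \<mu> (d_order a 0) \<Omega> w \<and>
           subseq_limit_Lp (lebesgue_on \<Omega>) p u w \<longrightarrow> (AE x in lebesgue. w x = u\<^sub>1 x))"
proof -
  define C R where "C = log_const TYPE('n) p" and "R = rho TYPE('n) p"
  have \<Omega>b: "\<Omega> \<in> sets borel" using \<Omega>(1) by simp
  have fin: "emeasure lborel \<Omega> < \<infinity>" by (rule emeasure_bounded_finite[OF \<Omega>(2)])
  have p0: "0 < p" using p by simp
  have C0: "0 < C" unfolding C_def by (rule log_const_pos[OF p0])
  have s_pos: "\<And>k. 0 < s k" and s_half: "\<And>k. s k \<le> 1 / 2" using s(1) by auto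
  have s_right: "filterlim s (at_right 0) sequentially"
    by (rule tendsto_imp_filterlim_at_right[OF s(2)]) (use s_pos in simp)
  obtain A0 where A0: "0 \<le> A0" and exp: "AE x in lebesgue_on \<Omega>. \<bar>d_order a 0 x\<bar> \<le> A0 \<and>
      (\<forall>t\<in>{0..1/2}. \<bar>a t x - 1\<bar> \<le> A0 * t) \<and> ((\<lambda>t. (a t x - 1) / t) \<longlongrightarrow> d_order a 0 x) (at_right 0)"
    by (rule weight_expansion[OF refl a0 a2(2)])
  define b where "b = d_order a 0"
  define k0 where "k0 = kfar \<Omega> DIM(real ^ 'n)"
  define M where "M = measure lborel \<Omega>"
  \<comment> \<open>\<open>V1\<close> is the limit of the potentials \<open>Vk\<close>; the further
    \<open>- b / p\<close> is the limit of the source correction, written as a multiple of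
    \<open>|u| powr p\<close>.\<close>
  define V1 V where "V1 x = (R - C * k0 x) / p" and "V x = (R - C * k0 x) / p - b x / p" for x
  define X Y where "X k = (frac_kappa CARD('n) p (s k) - 1) / s k" and "Y k = frac_c CARD('n) p (s k) / s k" for k
  define kk where "kk k = kfar \<Omega> (DIM(real ^ 'n) + s k * p)" for k
  define Vk bk where "Vk k x = (X k - Y k * kk k x) / p" and "bk k x = (a (s k) x - 1) / s k" for k x
  define ck where "ck k = frac_c CARD('n) p (s k) / (2 * s k * p)" for k
  have card: "0 < real CARD('n)" by simp
  have X_lim: "X \<longlonglongrightarrow> R"
    using frac_kappa_lim[OF card s_pos s(2), of p] by (simp add: X_def[abs_def] R_def rho_def)
  have Y_lim: "Y \<longlonglongrightarrow> C"
    using frac_c_lim[OF card s_pos s(2), of p] by (simp add: Y_def[abs_def] C_def log_const_def)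
  obtain KX where KX: "\<And>k. \<bar>X k\<bar> \<le> KX"
    using convergent_imp_Bseq[OF convergentI[OF X_lim]] unfolding Bseq_def by auto
  obtain KY where KY: "\<And>k. \<bar>Y k\<bar> \<le> KY"
    using convergent_imp_Bseq[OF convergentI[OF Y_lim]] unfolding Bseq_def by auto
  have KX0: "0 \<le> KX" and KY0: "0 \<le> KY" using order_trans[OF abs_ge_zero KX[of 0]] order_trans[OF abs_ge_zero KY[of 0]] .
  have M0: "0 \<le> M" by (simp add: M_def)
  \<comment> \<open>One bound for both \<open>Vk\<close> and \<open>bk\<close>: \<open>KX\<close>
    and \<open>KY\<close> bound the convergent constants, \<open>M\<close> bounds every
    \<open>kfar\<close> because the far kernel is at most 1, and \<open>A0\<close> comes from the
    expansion of the weight.\<close>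
  define A where "A = (KX + KY * M) / p + A0"
  define VB where "VB = (\<bar>R\<bar> + C * M + A0) / p"
  have k0m[measurable]: "k0 \<in> borel_measurable (lebesgue_on \<Omega>)"
    unfolding k0_def by (rule borel_measurable_lebesgue_on[OF kfar_measurable[OF \<Omega>b fin]])
  have kkm[measurable]: "kk k \<in> borel_measurable (lebesgue_on \<Omega>)" for k
    unfolding kk_def by (rule borel_measurable_lebesgue_on[OF kfar_measurable[OF \<Omega>b fin]])
  have k0_bd: "0 \<le> k0 x" "k0 x \<le> M" for x
    unfolding k0_def M_def by (rule kfar_nonneg[OF \<Omega>b fin], rule kfar_le[OF \<Omega>b fin]) simp
  have kk_bd: "0 \<le> kk k x" "kk k x \<le> M" for k x
    unfolding kk_def M_def using s_pos[of k] p0 by (intro kfar_nonneg[OF \<Omega>b fin] kfar_le[OF \<Omega>b fin]; simp)+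
  have b_m: "b \<in> borel_measurable (lebesgue_on \<Omega>)" using a2(1) by (auto simp: b_def Linf_def)
  have b_bd: "AE x in lebesgue_on \<Omega>. \<bar>b x\<bar> \<le> A0" using exp unfolding b_def by eventually_elim blast
  note [measurable] = b_m
  have V_m: "V \<in> borel_measurable (lebesgue_on \<Omega>)" unfolding V_def[abs_def] by measurable
  have V_bd: "AE x in lebesgue_on \<Omega>. \<bar>V x\<bar> \<le> VB"
    using b_bd
  proof eventually_elim
    case (elim x)
    have "C * k0 x \<le> C * M" "0 \<le> C * k0 x" using C0 k0_bd[of x] by (auto intro: mult_left_mono)
    then have "\<bar>R - C * k0 x - b x\<bar> \<le> \<bar>R\<bar> + C * M + A0" using elim by linarith
    then have "\<bar>R - C * k0 x - b x\<bar> / p \<le> VB" unfolding VB_def using p0 by (intro divide_right_mono) auto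
    moreover have "\<bar>V x\<bar> = \<bar>R - C * k0 x - b x\<bar> / p" unfolding V_def diff_divide_distrib[symmetric] abs_divide using p0 by simp
    ultimately show ?case by simp
  qed
  have c: "0 < C / (2 * p)" using C0 p0 by simp
  have m: "0 < - \<mu> / p\<^sup>2" using \<mu>_neg p0 by (intro divide_pos_pos) auto
  have q1: "\<And>k. 1 < q (s k)" and q2: "\<And>k. q (s k) < p" using q_range s(1) by auto
  have q3: "(\<lambda>k. q (s k)) \<longlonglongrightarrow> p" by (rule filterlim_compose[OF q_lim s_right])
  have "(\<lambda>k. (q (s k) - p) / s k) \<longlonglongrightarrow> \<mu>"
    using filterlim_compose[OF C1_on_expansion(2)[OF q_C1 _ q_lim] s_right] unfolding \<mu>_def by simp
  then have "(\<lambda>k. - ((q (s k) - p) / s k)) \<longlonglongrightarrow> - \<mu>" by (rule tendsto_minus)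
  then have qs: "(\<lambda>k. (p - q (s k)) / s k) \<longlonglongrightarrow> - \<mu> / p\<^sup>2 * p\<^sup>2"
    using p0 unfolding minus_divide_left minus_diff_eq by simp
  have ck1: "\<And>k. 0 < ck k"
  proof -
    fix k
    have "s k < 1" using s_half[of k] by simp
    then show "0 < ck k" unfolding ck_def using s_pos[of k] p0 by (intro divide_pos_pos frac_c_pos mult_pos_pos) auto
  qed
  have ck2: "ck \<longlonglongrightarrow> C / (2 * p)"
  proof -
    have "(\<lambda>k. Y k / (2 * p)) \<longlonglongrightarrow> C / (2 * p)" using p0 by (intro tendsto_divide Y_lim tendsto_const) auto
    then show ?thesis by (simp add: ck_def[abs_def] Y_def mult.commute mult.left_commute)
  qed
  have Vk_m: "\<And>k. Vk k \<in> borel_measurable (lebesgue_on \<Omega>)" unfolding Vk_def[abs_def] by measurable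
  have Vk_bd: "\<And>k. AE x in lebesgue_on \<Omega>. \<bar>Vk k x\<bar> \<le> A"
  proof (rule AE_I2)
    fix k x
    have "\<bar>Y k * kk k x\<bar> \<le> KY * M" unfolding abs_mult using KY[of k] kk_bd[of k x] KY0 by (intro mult_mono) auto
    then have "\<bar>X k - Y k * kk k x\<bar> \<le> KX + KY * M" using KX[of k] by linarith
    then have "\<bar>X k - Y k * kk k x\<bar> / p \<le> (KX + KY * M) / p" using p0 by (intro divide_right_mono) auto
    moreover have "\<bar>Vk k x\<bar> = \<bar>X k - Y k * kk k x\<bar> / p" unfolding Vk_def abs_divide using p0 by simp
    ultimately show "\<bar>Vk k x\<bar> \<le> A" unfolding A_def using A0 by linarith
  qed
  have Vk_lim: "AE x in lebesgue_on \<Omega>. (\<lambda>k. Vk k x) \<longlonglongrightarrow> V1 x"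
  proof (rule AE_I2)
    fix x
    have e: "(\<lambda>k. DIM(real ^ 'n) + s k * p) \<longlonglongrightarrow> DIM(real ^ 'n) + 0 * p" by (intro tendsto_intros s)
    have "(\<lambda>k. kk k x) \<longlonglongrightarrow> kfar \<Omega> (DIM(real ^ 'n) + 0 * p) x"
      unfolding kk_def using s_pos p0 by (intro kfar_tendsto[OF \<Omega>b fin e]) (simp add: less_imp_le)
    then have "(\<lambda>k. kk k x) \<longlonglongrightarrow> k0 x" by (simp add: k0_def)
    then show "(\<lambda>k. Vk k x) \<longlonglongrightarrow> V1 x" unfolding Vk_def V1_def
      using p0 by (intro tendsto_divide tendsto_diff tendsto_mult X_lim Y_lim tendsto_const) auto
  qed
  have bk_m: "\<And>k. bk k \<in> borel_measurable (lebesgue_on \<Omega>)"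
  proof -
    fix k
    have [measurable]: "a (s k) \<in> borel_measurable (lebesgue_on \<Omega>)" using a1 s(1) by (auto simp: Lp_def)
    show "bk k \<in> borel_measurable (lebesgue_on \<Omega>)" unfolding bk_def[abs_def] by measurable
  qed
  have A0A: "A0 \<le> A" unfolding A_def using KX0 KY0 M0 p0 by simp
  have bk_bd: "\<And>k. AE x in lebesgue_on \<Omega>. \<bar>bk k x\<bar> \<le> A"
  proof -
    fix k
    show "AE x in lebesgue_on \<Omega>. \<bar>bk k x\<bar> \<le> A"
      using exp
    proof eventually_elim
      case (elim x)
      then have "\<bar>a (s k) x - 1\<bar> \<le> A0 * s k" using s_pos[of k] s_half[of k] by auto
      then have "\<bar>a (s k) x - 1\<bar> / s k \<le> A0" using s_pos[of k] by (simp add: divide_le_eq)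
      then have "\<bar>bk k x\<bar> \<le> A0" unfolding bk_def abs_divide using s_pos[of k] by simp
      then show ?case using A0A by linarith
    qed
  qed
  have bk_lim: "AE x in lebesgue_on \<Omega>. (\<lambda>k. bk k x) \<longlonglongrightarrow> b x"
    using exp
  proof eventually_elim
    case (elim x)
    then show ?case unfolding bk_def b_def using filterlim_compose[OF _ s_right] by blast
  qed
  have V_V1: "AE x in lebesgue_on \<Omega>. V x = V1 x - b x / p" by (simp add: V_def V1_def)
  have A_nonneg: "0 \<le> A" using A0 A0A by linarith
  have c_eq: "C / (2 * p) = log_const TYPE('n) p / (2 * p)" by (simp add: C_def)
  have m_eq: "- \<mu> / p\<^sup>2 = - \<mu> / p\<^sup>2" by simp
  have V_eq: "\<And>x. V x = (rho TYPE('n) p - log_const TYPE('n) p * kfar \<Omega> DIM(real ^ 'n) x) / p - b x / p"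
    by (simp add: V_def R_def C_def k0_def)
  have Vk_eq: "\<And>k x. Vk k x = ((frac_kappa CARD('n) p (s k) - 1) / s k
      - frac_c CARD('n) p (s k) / s k * kfar \<Omega> (DIM(real ^ 'n) + s k * p) x) / p"
    by (simp add: Vk_def X_def Y_def kk_def)
  interpret frac_limit \<Omega> p "C / (2 * p)" "- \<mu> / p\<^sup>2" VB V \<mu> A0 b s "\<lambda>k. q (s k)" ck Vk bk V1 A "\<lambda>k. a (s k)"
    by unfold_locales (fact p \<Omega>(1,2) c m V_m V_bd c_eq m_eq V_eq b_m b_bd s_pos s(2) q1 q2 q3 qs ck1 ck2 Vk_m Vk_bd Vk_lim
      bk_m bk_bd bk_lim V_V1 A_nonneg s_half ck_def Vk_eq bk_def)+
  have sol: "\<And>k. frac_least_energy_solution (s k) p (q (s k)) (a (s k)) \<Omega> (u k)"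
    and nt: "\<And>k. nontrivial (u k)" and pos: "\<And>k. AE x in lebesgue_on \<Omega>. 0 < u k x"
    using u_sol u_nontrivial u_pos by auto
  obtain U where U: "minimizer U" "\<And>x. 0 \<le> U x" "nontrivial U" "subseq_limit_Lp (lebesgue_on \<Omega>) p u U"
    by (rule least_energy_solutions_converge[OF \<Omega>(3) sol nt pos]) blast
  have Ul: "U \<in> logsp \<Omega> p" using U(1) unfolding minimizer_def by blast
  have Lp_on: "f \<in> Lp (lebesgue_on \<Omega>) p" if f: "f \<in> Lp lebesgue p" for f
  proof -
    have "integrable lebesgue (\<lambda>x. indicator \<Omega> x *\<^sub>R (\<bar>f x\<bar> powr p))"
      using f \<Omega>b by (intro integrable_mult_indicator) (auto simp: Lp_def)
    then have "integrable (lebesgue_on \<Omega>) (\<lambda>x. \<bar>f x\<bar> powr p)" using \<Omega>b by (subst integrable_restrict_space) auto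
    then show ?thesis using f by (auto simp: Lp_def intro: measurable_restrict_space1)
  qed
  have unique: "(AE x in lebesgue. w x = U x) \<or> (AE x in lebesgue. w x = - U x)"
    if "log_least_energy_solution p \<mu> b \<Omega> w" for w
    by (rule least_energy_unique[OF U(1) U(3) U(2) that])
  have limit: "AE x in lebesgue. w x = U x"
    if w: "log_least_energy_solution p \<mu> b \<Omega> w" and lim: "subseq_limit_Lp (lebesgue_on \<Omega>) p u w" for w
  proof (rule ccontr)
    assume "\<not> (AE x in lebesgue. w x = U x)"
    \<comment> \<open>The remaining alternative has the wrong sign for a limit of positive
      functions.\<close>
    then have AE: "AE x in lebesgue. w x = - U x" using unique[OF w] by blast
    have w_m: "w \<in> borel_measurable (lebesgue_on \<Omega>)"
      using w Lp_on[of w] by (auto simp: log_least_energy_solution_def log_weak_solution_def X_log_def Lp_def)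
    have "AE x in lebesgue_on \<Omega>. U x = 0"
    proof (rule nonneg_limit_not_negative[OF p0 _ _ _ _ AE_lebesgue_restrict[OF \<Omega>b AE] w_m lim])
      show "u k \<in> Lp (lebesgue_on \<Omega>) p" for k
        using sol[of k] by (intro Lp_on) (simp add: frac_least_energy_solution_def frac_weak_solution_def W0_def)
      show "AE x in lebesgue_on \<Omega>. 0 \<le> u k x" for k using pos[of k] by eventually_elim simp
      show "U \<in> Lp (lebesgue_on \<Omega>) p" using logsp_X_log[OF Ul] by (intro Lp_on) (simp add: X_log_def)
    qed (use U(2) in simp)
    then have "AE x in lborel. U x = 0" by (rule AE_lborel_of_lebesgue_on[OF \<Omega>b]) (rule logspD(2)[OF Ul])
    then have "AE x in lebesgue. U x = 0" by (rule AE_completion)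
    then show False using U(3) by (simp add: nontrivial_def)
  qed
  show ?thesis
    unfolding b_def[symmetric]
    using logsp_X_log[OF Ul] minimizer_Linf[OF U(1)] U(3,4) minimizer_least_energy(1)[OF U(1,3)] unique limit
    by (intro exI[of _ U]) blast
qed

end
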